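(* Let $w\in\mathbb{C}$, and for $x>0$ define \[ \lambda_w(x):=\psi_w(x+1)-\frac{1}{2x}\mathcal{C}(w)-\mathcal{C}(iw)\log(x)-\frac{1}{2}\mathcal{B}(iw). \] Then for any positive real numbers $\alpha,\beta$ with $\alpha\beta=1$, \begin{align*} &\sqrt{\alpha}\left\{\frac{\gamma-\log(2\pi\alpha)}{2\alpha}\mathcal{C}(w)+\frac{1}{2\alpha} \mathcal{B}(w)+\sum_{m=1}^\infty \lambda_w(m\alpha)\right\}\\ &=\sqrt{\beta}\left\{\frac{\gamma-\log(2\pi\beta)}{2\beta}\mathcal{C}(iw)+\frac{1}{2\beta} \mathcal{B}(iw)+\sum_{m=1}^\infty \lambda_{iw} (m\beta)\right\}\\ &=-\frac{e^{\frac{w^2}{4}}}{2\pi^{\frac{3}{2}}}\int_0^\infty\left|\Gamma\left(\frac{-1+it}{4}\right)\right|^2\frac{\Xi^{2}\left(\frac{t}{2}\right)}{1+t^2}\left(\alpha^{\frac{it}{2}}\left({}_1F_{1}\left(\tfrac{3+it}{4};\tfrac{3}{2};-\tfrac{w^2}{4}\right)\right)^{2}+\alpha^{-\frac{it}{2}}\left({}_1F_{1}\left(\tfrac{3-it}{4};\tfrac{3}{2};-\tfrac{w^2}{4}\right)\right)^{2}\right) dt. \end{align*}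
   Context: $\gamma$ is Euler's constant, $\psi(x)=\Gamma'(x)/\Gamma(x)$ the digamma function, $\zeta(s)$ the Riemann zeta function. $\xi(s)=\frac12 s(s-1)\pi^{-s/2}\Gamma(s/2)\zeta(s)$ and $\Xi(t)=\xi(\tfrac12+it)$. ${}_1F_1(a;c;z)=\sum_{n\ge0}\frac{(a)_n}{(c)_n}\frac{z^n}{n!}$ with $(a)_n=\Gamma(a+n)/\Gamma(a)$. $\mathrm{erf}(w)=\frac{2}{\sqrt\pi}\int_0^w e^{-t^2}dt$. Define \[ \mathcal{C}(w):=\frac{\pi}{w^2} e^{\frac{w^2}{4}}\mathrm{erf}^2\left(\frac{w}{2}\right),\qquad \mathcal{B}(w):=\frac{\sqrt{\pi}}{w}\mathrm{erf}\left(\frac{w}{2}\right)\sum_{n=0}^\infty\frac{(w^2/4)^n}{(3/2)_n}(\psi(n+1)+\gamma). \] The generalized digamma function is \[ \psi_w(a):=\frac{4}{w^2\sqrt{\pi}}\int_0^\infty\int_0^\infty\int_0^\infty \frac{e^{-(u^2+v^2+x)}}{u}\sin(wv)\sinh(wu)\left(\frac{1}{x}-\frac{J_{0}\left((a-1)\frac{vx}{u}\right)}{1-e^{-x}}\right)dx\,du\,dv, \] where $J_0$ is the Bessel function of the first kind of order $0$. At $w=0$ all these $w$-dependent quantities are understood via their limiting values as $w\to0$.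
   Formalization: In the definition of λ_w(x) the constant term is B(iw) instead of the printed ½B(iw); with ½ the terms λ_w(mα) tend to ½B(iw), which is nonzero e.g. at w=1, so the series diverges. All else is as printed. *)

theory Defs
  imports "HOL-Complex_Analysis.Complex_Analysis"
begin

(* The holomorphic extension of the Dirichlet series to the punctured plane is unique there;
   the arbitrary value 0 at the pole makes it unique as a total function. *)
definition zeta :: "complex \<Rightarrow> complex" where
  "zeta = (THE f. f holomorphic_on (- {1}) \<and>
             (\<forall>s. Re s > 1 \<longrightarrow> (\<lambda>n. 1 / of_nat (Suc n) powr s) sums f s) \<and> f 1 = 0)"

(* remove_sings fills in the removable singularities of the product (at 1 and at the
   nonpositive even integers), so that this is the entire function xi. *)
definition xi :: "complex \<Rightarrow> complex" where
  "xi = remove_sings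
     (\<lambda>s. 1/2 * s * (s - 1) * of_real pi powr (- s / 2) * Gamma (s / 2) * zeta s)"

definition Xi :: "complex \<Rightarrow> complex" where
  "Xi t = xi (1/2 + \<i> * t)"

definition hyp1F1 :: "complex \<Rightarrow> complex \<Rightarrow> complex \<Rightarrow> complex" where
  "hyp1F1 a c z = (\<Sum>n. pochhammer a n / pochhammer c n * (z ^ n / fact n))"

definition erf :: "complex \<Rightarrow> complex" where
  "erf w = 2 / of_real (sqrt pi) * contour_integral (linepath 0 w) (\<lambda>t. exp (- (t\<^sup>2)))"

definition bessel_J0 :: "real \<Rightarrow> real" where
  "bessel_J0 x = (\<Sum>k. (-1) ^ k / (fact k)\<^sup>2 * (x / 2) ^ (2 * k))"

definition limit_at_0 :: "(complex \<Rightarrow> complex) \<Rightarrow> complex \<Rightarrow> complex" where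
  "limit_at_0 f w = (if w = 0 then Lim (at 0) f else f w)"

definition CC :: "complex \<Rightarrow> complex" where
  "CC = limit_at_0 (\<lambda>w. of_real pi / w\<^sup>2 * exp (w\<^sup>2 / 4) * (erf (w / 2))\<^sup>2)"

definition BB :: "complex \<Rightarrow> complex" where
  "BB = limit_at_0 (\<lambda>w. of_real (sqrt pi) / w * erf (w / 2) *
          (\<Sum>n. (w\<^sup>2 / 4) ^ n / pochhammer (3/2) n *
                 (Digamma (of_nat (n + 1)) + euler_mascheroni)))"

(* The parameter a is real, as in all uses: for non-real a the inner integral need not converge. *)
definition psi_gen :: "complex \<Rightarrow> real \<Rightarrow> complex" where
  "psi_gen w a = limit_at_0 (\<lambda>w. 4 / (w\<^sup>2 * of_real (sqrt pi)) *
     (LINT v:{0<..}|lborel. (LINT u:{0<..}|lborel. (LINT x:{0<..}|lborel.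
        of_real (exp (- (u\<^sup>2 + v\<^sup>2 + x)) / u) * sin (w * of_real v) * sinh (w * of_real u) *
        of_real (1 / x - bessel_J0 ((a - 1) * (v * x / u)) / (1 - exp (- x))))))) w"

(* The constant term is BB (i w), not BB (i w) / 2 as printed in the source: as x tends to infinity,
   psi_gen w (x + 1) = CC (i w) * ln x + BB (i w) + CC w / (2 x) + O(1 / x^2), so that
   the printed version tends to BB (i w) / 2, which is nonzero for general w, and the series
   of its values at the multiples of alpha diverges. *)
definition lam :: "complex \<Rightarrow> real \<Rightarrow> complex" where
  "lam w x = psi_gen w (x + 1) - 1 / (2 * of_real x) * CC w - CC (\<i> * w) * of_real (ln x)
               - BB (\<i> * w)"

end

theory Submission
  imports Defs "HOL-Probability.Probability" "HOL-Real_Asymp.Real_Asymp"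
begin

text \<open>
  Let \<open>\<omega>(x) = \<Sum>\<^sub>n\<^sub>\<ge>\<^sub>1 exp(-\<pi> n\<^sup>2 x)\<close> and \<open>\<phi>(q) = exp(q/4) \<omega>(exp q) - exp(-q/4)/2\<close>. The functional equation
  of the theta function says that \<open>\<phi>\<close> is even, and the Fourier transform of \<open>\<phi>\<close> at \<open>t/4\<close> is
  \<open>\<pi>\<close> to the \<open>-s/2\<close> times \<open>\<Gamma>(s/2) \<zeta>(s)\<close> at \<open>s = (1 + i t)/2\<close>.

  The triple integral defining \<open>\<psi>\<^sub>w(x + 1)\<close> is an average over \<open>r = v/u\<close> of an ordinary function of \<open>x r\<close>,
  namely \<open>ln (x r / 2) + 1/(2 x r) - R(x r)\<close> with \<open>R(c) = \<integral> \<omega>(exp(-q)) exp(-\<pi> c\<^sup>2 exp q) dq\<close>. The averages of \<open>1\<close>,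
  \<open>ln r\<close>, \<open>1/r\<close> and \<open>(ln r)/r\<close> are expressed by \<open>C\<close> and \<open>B\<close>, so \<open>\<lambda>\<^sub>w(x)\<close> is the average of \<open>-R(x r)\<close>.
  Summing over the multiples of \<open>\<alpha>\<close> turns \<open>R\<close> into the self-convolution of \<open>\<phi>\<close> at \<open>2 ln (\<alpha> r)\<close> plus
  elementary terms, which are exactly those cancelled by the \<open>C\<close> and \<open>B\<close> terms of the theorem.
  Fourier inversion writes the self-convolution as an integral of the squared transform, that is of \<open>\<Xi>\<^sup>2\<close>,
  against powers of \<open>\<alpha> r\<close>. The average of a power of \<open>r\<close> is a product of two Gaussian moments of the
  hyperbolic sine, each a Gamma value times a confluent hypergeometric value. The symmetry between \<open>(w, \<alpha>)\<close>
  and \<open>(i w, \<beta>)\<close> is then Kummer's transformation.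
\<close>

subsection \<open>Integrals in logarithmic coordinates\<close>

text \<open>In the variable \<open>q = ln x\<close>, Mellin transforms and multiplicative
  convolutions become Fourier transforms and convolutions on the line. The theta function enters
  through the Laplace transform of the Bessel function, \<open>1 / sqrt (k^2 + c^2)\<close>: the
  inner integral of \<open>psi_gen\<close> is the limit of \<open>ln (N + 1)\<close> minus sums of
  such terms, each term is a Gaussian integral, and summing over \<open>k\<close> produces
  \<open>om\<close>. The Gaussian factor that remains, summed over the multiples of \<alpha>,
  produces a second \<open>om\<close>. Euler's constant and the logarithms come from the terms that
  separate \<open>om\<close> from the decaying function \<open>phi\<close>: they tend to a nonzero
  constant at one end of the line, and their regularised integral is \<open>theta_const\<close>. The
  inversion step needs no estimate of zeta on the critical line: \<open>phi\<close> is real and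
  even, so the transform of its self-convolution is the square of a real number, and nonnegativity
  alone makes it integrable.\<close>

lemma distr_exp_lborel:
  "distr (density lborel (\<lambda>q. ennreal (exp q))) borel exp
     = density lborel (indicator {0<..} :: real \<Rightarrow> ennreal)"
proof (rule measure_eqI)
  fix A :: "real set" assume "A \<in> sets (distr (density lborel (\<lambda>q. ennreal (exp q))) borel exp)"
  then have A[measurable]: "A \<in> sets borel" by simp
  have [simp, measurable]: "(exp :: real \<Rightarrow> real) -` A \<in> sets borel"
    using measurable_sets_borel[of exp borel A] by simp
  \<comment> \<open>The two cut-offs correspond under \<open>exp\<close>: the substitution rule on
    the compact interval \<open>[-n, n]\<close> gives equality for each \<open>n\<close>, and
    monotone convergence exhausts both sides.\<close>
  define f :: "nat \<Rightarrow> real \<Rightarrow> ennreal"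
    where "f n x = ennreal (indicator A x * indicator {exp (- real n)..exp (real n)} x)" for n x
  define g :: "nat \<Rightarrow> real \<Rightarrow> ennreal"
    where "g n x = ennreal (indicator A (exp x) * exp x * indicator {- real n..real n} x)" for n x
  have eq: "integral\<^sup>N lborel (f n) = integral\<^sup>N lborel (g n)" for n
    unfolding f_def g_def
    by (rule nn_integral_substitution[where g = exp and g' = exp])
       (auto intro!: derivative_eq_intros continuous_intros simp: set_borel_measurable_def)
  have incf: "incseq f"
  proof (intro incseq_SucI le_funI)
    fix n and x :: real
    have ind: "indicator S x \<le> (indicator T x :: real)" if "S \<subseteq> T" for S T :: "real set"
      using that by (auto split: split_indicator)
    have "exp (- real (Suc n)) \<le> exp (- real n)" "exp (real n) \<le> exp (real (Suc n))" by simp_all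
    then have "{exp (- real n)..exp (real n)} \<subseteq> {exp (- real (Suc n))..exp (real (Suc n))}"
      by (meson atLeastatMost_subset_iff)
    then show "f n x \<le> f (Suc n) x"
      unfolding f_def using ind by (intro ennreal_leI mult_left_mono) auto
  qed
  have incg: "incseq g"
    by (intro incseq_SucI le_funI) (auto simp: g_def split: split_indicator)
  have supf: "(SUP n. f n x) = indicator A x * indicator {0<..} x" for x
  proof (cases "x > 0")
    case True
    obtain n :: nat where n: "\<bar>ln x\<bar> \<le> real n" using real_arch_simple by blast
    have "exp (- real n) \<le> exp (ln x)" "exp (ln x) \<le> exp (real n)" using n by auto
    then have "f n x = indicator A x" using True by (auto simp: f_def split: split_indicator)
    moreover have "f m x \<le> indicator A x" for m by (auto simp: f_def split: split_indicator)
    ultimately have "(SUP n. f n x) = indicator A x"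
      by (intro antisym SUP_least) (metis SUP_upper UNIV_I)+
    then show ?thesis using True by simp
  next
    case False
    then have "\<not> exp (- real n) \<le> x" for n by (meson exp_gt_zero less_le_trans)
    then have "f n x = 0" for n by (simp add: f_def)
    then show ?thesis using False by simp
  qed
  have supg: "(SUP n. g n x) = ennreal (exp x) * indicator A (exp x)" for x
  proof -
    obtain n :: nat where n: "\<bar>x\<bar> \<le> real n" using real_arch_simple by blast
    have "g n x = ennreal (exp x) * indicator A (exp x)" using n
      by (auto simp: g_def split: split_indicator)
    moreover have "g m x \<le> ennreal (exp x) * indicator A (exp x)" for m
      by (auto simp: g_def split: split_indicator)
    ultimately show ?thesis
      by (intro antisym SUP_least) (metis SUP_upper UNIV_I)+
  qed
  have [measurable]: "f n \<in> borel_measurable lborel" "g n \<in> borel_measurable lborel" for n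
    unfolding f_def g_def by measurable
  have "emeasure (distr (density lborel (\<lambda>q. ennreal (exp q))) borel exp) A
      = (\<integral>\<^sup>+q. ennreal (exp q) * indicator A (exp q) \<partial>lborel)"
    by (subst emeasure_distr; simp) (subst emeasure_density; simp add: indicator_def)
  also have "\<dots> = (SUP n. integral\<^sup>N lborel (g n))"
    unfolding supg[symmetric] by (rule nn_integral_monotone_convergence_SUP[OF incg]) simp
  also have "\<dots> = (SUP n. integral\<^sup>N lborel (f n))" by (simp add: eq)
  also have "\<dots> = (\<integral>\<^sup>+x. indicator A x * indicator {0<..} x \<partial>lborel)"
    unfolding supf[symmetric] by (rule nn_integral_monotone_convergence_SUP[OF incf, symmetric]) simp
  also have "\<dots> = emeasure (density lborel (indicator {0<..} :: real \<Rightarrow> ennreal)) A"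
    by (subst emeasure_density) (simp_all add: mult.commute)
  finally show "emeasure (distr (density lborel (\<lambda>q. ennreal (exp q))) borel exp) A
     = emeasure (density lborel (indicator {0<..})) A" .
qed simp

lemma nn_integral_exp_subst:
  assumes [measurable]: "f \<in> borel_measurable borel"
  shows "(\<integral>\<^sup>+x. indicator {0<..} x * f x \<partial>lborel) = (\<integral>\<^sup>+q. ennreal (exp q) * f (exp q) \<partial>lborel)"
proof -
  have "(\<integral>\<^sup>+x. indicator {0<..} x * f x \<partial>lborel) = integral\<^sup>N (density lborel (indicator {0<..} :: real \<Rightarrow> ennreal)) f"
    by (subst nn_integral_density) auto
  also have "\<dots> = (\<integral>\<^sup>+q. ennreal (exp q) * f (exp q) \<partial>lborel)"
    unfolding distr_exp_lborel[symmetric]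
    by (simp add: nn_integral_distr nn_integral_density)
  finally show ?thesis .
qed

text \<open>Transporting the measure, and not only single integrals, yields integrability and value
  together, for integrands in any Banach space.\<close>

lemma
  fixes f :: "real \<Rightarrow> 'a::{banach, second_countable_topology}"
  assumes "set_borel_measurable borel {0<..} f"
  shows set_integrable_exp_subst:
      "set_integrable lborel {0<..} f \<longleftrightarrow> integrable lborel (\<lambda>q. exp q *\<^sub>R f (exp q))" (is ?P)
    and set_integral_exp_subst:
      "(LINT x:{0<..}|lborel. f x) = (LINT q|lborel. exp q *\<^sub>R f (exp q))" (is ?Q)
proof -
  define g where "g x = indicator {0<..} x *\<^sub>R f x" for x :: real
  have g[measurable]: "g \<in> borel_measurable borel"
    using assms unfolding set_borel_measurable_def g_def .
  have gf: "g (exp q) = f (exp q)" for q :: real by (simp add: g_def)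
  have dens: "(indicator {0<..} :: real \<Rightarrow> ennreal) = (\<lambda>x. ennreal (indicator {0<..} x))"
    by (auto simp: indicator_def)
  have "set_integrable lborel {0<..} f \<longleftrightarrow> integrable (density lborel (indicator {0<..} :: real \<Rightarrow> ennreal)) g"
    unfolding dens by (subst integrable_density) (auto simp: set_integrable_def g_def simp flip: indicator_inter_arith)
  also have "\<dots> \<longleftrightarrow> integrable lborel (\<lambda>q. exp q *\<^sub>R g (exp q))"
    unfolding distr_exp_lborel[symmetric]
    by (simp add: integrable_distr_eq integrable_density)
  finally show ?P by (simp add: gf)
  have "(LINT x:{0<..}|lborel. f x) = integral\<^sup>L (density lborel (indicator {0<..} :: real \<Rightarrow> ennreal)) g"
    unfolding dens by (subst integral_density) (auto simp: set_lebesgue_integral_def g_def simp flip: indicator_inter_arith)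
  also have "\<dots> = integral\<^sup>L lborel (\<lambda>q. exp q *\<^sub>R g (exp q))"
    unfolding distr_exp_lborel[symmetric]
    by (simp add: integral_distr integral_density)
  finally show ?Q by (simp add: gf)
qed

lemma has_bochner_integral_lborel_affine:
  fixes f :: "real \<Rightarrow> 'a::{banach, second_countable_topology}"
  assumes "has_bochner_integral lborel f I" "c \<noteq> 0"
  shows "has_bochner_integral lborel (\<lambda>x. f (t + c * x)) (I /\<^sub>R \<bar>c\<bar>)"
proof -
  have "integral\<^sup>L lborel f = \<bar>c\<bar> *\<^sub>R (LBINT x. f (t + c * x))"
    by (rule lborel_integral_real_affine) fact
  then have "I = \<bar>c\<bar> *\<^sub>R (LBINT x. f (t + c * x))"
    using assms by (simp add: has_bochner_integral_iff)
  then show ?thesis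
    using assms by (auto simp: has_bochner_integral_iff intro!: lborel_integrable_real_affine)
qed

lemma Gamma_integral_exp:
  assumes "Re z > 0"
  shows "has_bochner_integral lborel
           (\<lambda>q::real. exp (z * of_real q) * of_real (exp (- exp q))) (Gamma z)"
proof -
  let ?f = "\<lambda>t::real. complex_of_real t powr (z - 1) / of_real (exp t)"
  have m: "set_borel_measurable borel {0<..} ?f"
    by (rule set_measurable_continuous_on) (auto intro!: continuous_intros)
  have "set_integrable lebesgue {0<..} ?f"
    using absolutely_integrable_Gamma_integral'[OF assms] by simp
  then have i: "set_integrable lborel {0<..} ?f"
    using m unfolding set_integrable_def set_borel_measurable_def
    by (subst (asm) integrable_completion) auto
  have "(LINT x:{0<..}|lborel. ?f x) = integral {0<..} ?f"
    using set_borel_integral_eq_integral(2)[OF i] by simp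
  also have "\<dots> = Gamma z" using Gamma_integral_complex'[OF assms] by (rule integral_unique)
  finally have e: "(LINT x:{0<..}|lborel. ?f x) = Gamma z" .
  have eq: "exp q *\<^sub>R ?f (exp q) = exp (z * of_real q) * of_real (exp (- exp q))" for q
  proof -
    have "complex_of_real (exp q) powr (z - 1) = exp ((z - 1) * of_real q)"
      by (simp add: powr_def Ln_of_real flip: exp_of_real)
    then show ?thesis
      by (simp add: scaleR_conv_of_real exp_minus field_simps exp_diff flip: exp_of_real)
  qed
  show ?thesis
    using i e set_integrable_exp_subst[OF m] set_integral_exp_subst[OF m]
    by (simp add: has_bochner_integral_iff eq)
qed

text \<open>Rescaled from the standard normal density, whose characteristic function is known: with
  \<open>c = sqrt (2 * a)\<close> the density at \<open>c * x\<close> is the Gaussian divided by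
  \<open>sqrt (2 * pi)\<close>.\<close>

lemma gaussian_integrable:
  assumes "a > (0::real)"
  shows "integrable lborel (\<lambda>x. exp (- a * x\<^sup>2))"
    and "integrable lborel (\<lambda>x. complex_of_real (exp (- a * x\<^sup>2)) * iexp (b * x))"
    and "(LBINT x. complex_of_real (exp (- a * x\<^sup>2)) * iexp (b * x)) = of_real (sqrt (pi / a) * exp (- b\<^sup>2 / (4 * a)))"
proof -
  define c where "c = sqrt (2 * a)"
  have c: "c > 0" "c\<^sup>2 = 2 * a" using assms by (auto simp: c_def)
  have s: "std_normal_density (c * x) = exp (- a * x\<^sup>2) / sqrt (2 * pi)" for x
    by (simp add: std_normal_density_def power_mult_distrib c)
  have i1: "integrable lborel std_normal_density" by (rule integrable_normal_density) simp
  have "integrable lborel (\<lambda>x. std_normal_density (0 + c * x))"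
    using i1 c by (intro lborel_integrable_real_affine) auto
  then have i2: "integrable lborel (\<lambda>x. exp (- a * x\<^sup>2) / sqrt (2 * pi))" by (simp add: s)
  have "integrable lborel (\<lambda>x. exp (- a * x\<^sup>2) / sqrt (2 * pi) * sqrt (2 * pi))"
    using i2 by (rule integrable_mult_left)
  then show i3: "integrable lborel (\<lambda>x. exp (- a * x\<^sup>2))" by simp
  show "integrable lborel (\<lambda>x. complex_of_real (exp (- a * x\<^sup>2)) * iexp (b * x))"
    by (rule Bochner_Integration.integrable_bound[OF i3]) (auto simp: norm_mult)
  let ?J = "LBINT x. complex_of_real (exp (- a * x\<^sup>2)) * iexp (b * x)"
  have "of_real (exp (- (b / c)\<^sup>2 / 2)) = char std_normal_distribution (b / c)"
    by (simp add: char_std_normal_distribution)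
  also have "\<dots> = (LBINT x. of_real (std_normal_density x) * iexp (b / c * x))"
    unfolding char_def by (subst integral_density) (auto simp: scaleR_conv_of_real)
  also have "\<dots> = c *\<^sub>R (LBINT x. of_real (std_normal_density (0 + c * x)) * iexp (b / c * (0 + c * x)))"
    using c by (subst lborel_integral_real_affine[of c _ 0]) auto
  also have "(LBINT x. of_real (std_normal_density (0 + c * x)) * iexp (b / c * (0 + c * x)))
      = (LBINT x. of_real (1 / sqrt (2 * pi)) * (complex_of_real (exp (- a * x\<^sup>2)) * iexp (b * x)))"
    using c by (intro Bochner_Integration.integral_cong) (auto simp: s)
  also have "\<dots> = of_real (1 / sqrt (2 * pi)) * ?J"
    by (rule integral_mult_right_zero)
  finally have "of_real (exp (- (b / c)\<^sup>2 / 2)) = c *\<^sub>R (of_real (1 / sqrt (2 * pi)) * ?J)" .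
  then have "(LBINT x. complex_of_real (exp (- a * x\<^sup>2)) * iexp (b * x))
      = of_real (sqrt (2 * pi) / c * exp (- (b / c)\<^sup>2 / 2))"
    using c by (simp add: scaleR_conv_of_real field_simps)
  moreover have "sqrt (2 * pi) / c = sqrt (pi / a)"
    using assms by (simp add: c_def real_sqrt_divide real_sqrt_mult)
  moreover have "- (b / c)\<^sup>2 / 2 = - b\<^sup>2 / (4 * a)" by (simp add: power_divide c)
  ultimately show "(LBINT x. complex_of_real (exp (- a * x\<^sup>2)) * iexp (b * x)) = of_real (sqrt (pi / a) * exp (- b\<^sup>2 / (4 * a)))"
    by simp
qed

subsection \<open>The theta function\<close>

text \<open>The functional equation comes from integrating a Gaussian against the Poisson kernel of period 1
  and letting the radius tend to 1, which is Abel summation of the Fourier side of Poisson summation.\<close>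

definition poisson_kernel :: "real \<Rightarrow> real \<Rightarrow> real" where
  "poisson_kernel r x = (1 - r\<^sup>2) / ((1 - r)\<^sup>2 + 4 * r * (sin (pi * x))\<^sup>2)"

text \<open>Real part of the geometric series in \<open>z = r * cis (2 * pi * x)\<close>. The
  denominator of the kernel is the square of the modulus of \<open>1 - z\<close>, rewritten by the
  half-angle formula; this form makes lower bounds visible.\<close>

lemma poisson_kernel_sums:
  assumes "0 \<le> r" "r < 1"
  shows "(\<lambda>k. r ^ Suc k * cos (2 * pi * real (Suc k) * x)) sums ((poisson_kernel r x - 1) / 2)"
proof -
  define z where "z = of_real r * cis (2 * pi * x)"
  have nz: "norm z < 1" using assms by (simp add: z_def norm_mult)
  have "(\<lambda>k. z * z ^ k) sums (z * (1 / (1 - z)))" using nz by (intro sums_mult geometric_sums)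
  then have "(\<lambda>k. Re (z * z ^ k)) sums Re (z * (1 / (1 - z)))" by (rule sums_Re)
  moreover have "Re (z * z ^ k) = r ^ Suc k * cos (2 * pi * real (Suc k) * x)" for k
  proof -
    have "z * z ^ k = z ^ Suc k" by simp
    also have "\<dots> = of_real (r ^ Suc k) * cis (real (Suc k) * (2 * pi * x))"
      by (simp only: z_def power_mult_distrib Complex.DeMoivre of_real_power)
    finally show ?thesis by (simp add: mult_ac del: of_nat_Suc)
  qed
  moreover have "Re (z * (1 / (1 - z))) = (poisson_kernel r x - 1) / 2"
  proof -
    define C where "C = cos (2 * pi * x)"
    have C: "C = 1 - 2 * (sin (pi * x))\<^sup>2" using cos_double_sin[of "pi * x"] by (simp add: C_def mult.assoc)
    have d: "(1 - r)\<^sup>2 + 4 * r * (sin (pi * x))\<^sup>2 = 1 - 2 * r * C + r\<^sup>2"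
      unfolding C by (simp add: power2_eq_square algebra_simps)
    have "(1 - r)\<^sup>2 > 0" "4 * r * (sin (pi * x))\<^sup>2 \<ge> 0" using assms by auto
    then have pos: "1 - 2 * r * C + r\<^sup>2 > 0" unfolding d[symmetric] by linarith
    have z: "Re z = r * C" "Im z = r * sin (2 * pi * x)" by (simp_all add: z_def C_def)
    have n: "(cmod (1 - z))\<^sup>2 = 1 - 2 * r * C + r\<^sup>2"
      unfolding cmod_power2
    proof -
      have "(Re (1 - z))\<^sup>2 + (Im (1 - z))\<^sup>2 = 1 - 2 * r * C + r\<^sup>2 * ((sin (2 * pi * x))\<^sup>2 + C\<^sup>2)"
        by (simp add: z power2_eq_square algebra_simps)
      then show "(Re (1 - z))\<^sup>2 + (Im (1 - z))\<^sup>2 = 1 - 2 * r * C + r\<^sup>2"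
        by (simp add: C_def)
    qed
    have n2: "(1 - Re z)\<^sup>2 + (Im z)\<^sup>2 = 1 - 2 * r * C + r\<^sup>2" using n by (simp add: cmod_power2)
    have "(Re z)\<^sup>2 + (Im z)\<^sup>2 = r\<^sup>2 * ((sin (2 * pi * x))\<^sup>2 + C\<^sup>2)"
      by (simp add: z power2_eq_square algebra_simps)
    then have n3: "(Re z)\<^sup>2 + (Im z)\<^sup>2 = r\<^sup>2" by (simp add: C_def)
    have "z * (1 / (1 - z)) = z / (1 - z)" by simp
    then have "Re (z * (1 / (1 - z))) = (Re z * (1 - Re z) - Im z * Im z) / (1 - 2 * r * C + r\<^sup>2)"
      by (simp add: Re_divide n2)
    also have "Re z * (1 - Re z) - Im z * Im z = r * C - r\<^sup>2"
      using n3 by (simp add: z(1) power2_eq_square algebra_simps)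
    finally show ?thesis
      unfolding poisson_kernel_def d using pos by (simp add: field_simps)
  qed
  ultimately show ?thesis by (simp only:)
qed

lemma poisson_kernel_nonneg: "0 \<le> r \<Longrightarrow> r < 1 \<Longrightarrow> 0 \<le> poisson_kernel r x"
  unfolding poisson_kernel_def by (intro divide_nonneg_nonneg) (auto simp: power_le_one_iff)

lemma poisson_kernel_measurable [measurable]: "poisson_kernel r \<in> borel_measurable borel"
  unfolding poisson_kernel_def by measurable

lemma poisson_kernel_mirror: "poisson_kernel r (1 - x) = poisson_kernel r x"
  by (simp add: poisson_kernel_def right_diff_distrib sin_diff)

lemma poisson_kernel_periodic: "poisson_kernel r (real n + x) = poisson_kernel r x"
  by (simp add: poisson_kernel_def distrib_left sin_add power_mult_distrib) (simp add: mult.commute[of pi] flip: power_mult)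

text \<open>A crude Jordan inequality. The half angle \<open>pi * x / 2\<close> stays below
  \<open>pi / 3\<close>, where the cosine is at least 1/2, and the duplication formula does the
  rest.\<close>

lemma sin_pi_ge:
  assumes "0 \<le> x" "x \<le> 1/2" shows "x / 2 \<le> sin (pi * x)"
proof -
  define y where "y = pi * x / 2"
  have y: "0 \<le> y" "y \<le> pi / 3" using assms by (auto simp: y_def)
  have c: "cos t \<ge> 1/2" if "0 \<le> t" "t \<le> y" for t
    using cos_monotone_0_pi_le[of t "pi/3"] that y by (simp add: cos_60)
  have "sin 0 - 0 / 2 \<le> sin y - y / 2"
    by (rule DERIV_nonneg_imp_nondecreasing[OF y(1)])
       (use c in \<open>fastforce intro!: derivative_eq_intros\<close>)
  then have s: "y / 2 \<le> sin y" by simp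
  have "sin (pi * x) = 2 * sin y * cos y" using sin_double[of y] by (simp add: y_def)
  also have "\<dots> \<ge> 2 * (y / 2) * (1/2)"
    using s c[of y] y by (intro mult_mono) auto
  finally have "sin (pi * x) \<ge> y / 2" by simp
  moreover have "y / 2 \<ge> x / 2" using assms pi_ge_two using mult_right_mono[of 2 pi x] by (simp add: y_def)
  ultimately show ?thesis by linarith
qed

text \<open>Multiplied by the distance to the nearest integer, the kernel stays bounded as the
  radius tends to 1. For \<open>r \<ge> 1/4\<close> the factor \<open>4 * r\<close> is at least 1,
  so the denominator dominates \<open>(1 - r)^2 + m^2 / 4\<close>, which is at least
  \<open>(1 - r) * m\<close> by the inequality of the means.\<close>

lemma poisson_kernel_bound:
  assumes "1/4 \<le> r" "r < 1" "0 \<le> x" "x \<le> 1" "m = min x (1 - x)"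
  shows "m * poisson_kernel r x \<le> 2"
proof -
  have m: "0 \<le> m" "m \<le> 1/2" using assms(3,4) unfolding assms(5) by (auto simp: min_def)
  have "sin (pi * (1 - x)) = sin (pi * x)" by (simp add: right_diff_distrib sin_diff)
  then have s: "m / 2 \<le> sin (pi * x)"
    using sin_pi_ge[of m] m assms(5) by (auto simp: min_def split: if_splits)
  have "m\<^sup>2 / 4 = (m / 2)\<^sup>2" by (simp add: power2_eq_square)
  also have "\<dots> \<le> (sin (pi * x))\<^sup>2" using s m by (intro power_mono) auto
  also have "\<dots> \<le> 4 * r * (sin (pi * x))\<^sup>2" using assms by (simp add: mult_le_cancel_right1)
  finally have a: "(1 - r)\<^sup>2 + m\<^sup>2 / 4 \<le> (1 - r)\<^sup>2 + 4 * r * (sin (pi * x))\<^sup>2" by simp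
  have "0 \<le> ((1 - r) - m / 2)\<^sup>2" by simp
  then have b: "(1 - r) * m \<le> (1 - r)\<^sup>2 + m\<^sup>2 / 4" by (simp add: power2_eq_square algebra_simps)
  have d: "0 < (1 - r)\<^sup>2 + 4 * r * (sin (pi * x))\<^sup>2" using assms by (intro add_pos_nonneg) auto
  have "m * (1 - r\<^sup>2) = ((1 - r) * m) * (1 + r)" by (simp add: power2_eq_square algebra_simps)
  also have "\<dots> \<le> ((1 - r) * m) * 2" using assms m by (intro mult_left_mono) auto
  also have "\<dots> = 2 * ((1 - r) * m)" by simp
  also have "\<dots> \<le> 2 * ((1 - r)\<^sup>2 + 4 * r * (sin (pi * x))\<^sup>2)"
    using order_trans[OF b a] by (rule mult_left_mono) simp
  finally show ?thesis unfolding poisson_kernel_def using d by (simp add: divide_simps)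
qed

text \<open>The shift by 4 keeps the radii in \<open>[3/4, 1)\<close>, inside the range of
  \<open>poisson_kernel_bound\<close>.\<close>

lemma seq_tendsto_at_left_1: "filterlim (\<lambda>j. 1 - 1 / real (j + 4)) (at 1) sequentially"
  unfolding filterlim_at by (auto intro!: eventuallyI) real_asymp

lemma poisson_kernel_tendsto_0:
  assumes "0 < x" "x < 1"
  shows "(\<lambda>j. poisson_kernel (1 - 1 / real (j + 4)) x) \<longlonglongrightarrow> 0"
proof -
  have "sin (pi * x) > 0" using assms by (intro sin_gt_zero) auto
  then have "((\<lambda>r. poisson_kernel r x) \<longlongrightarrow> 0) (at 1)"
    unfolding poisson_kernel_def by (auto intro!: tendsto_eq_intros)
  then show ?thesis by (rule filterlim_compose[OF _ seq_tendsto_at_left_1])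
qed

lemma integrable_poisson_kernel:
  assumes "0 \<le> r" "r < 1" "continuous_on {0..1} h"
  shows "set_integrable lborel {0..1} (\<lambda>x. h x * poisson_kernel r x)"
proof -
  have "0 < (1 - r)\<^sup>2 + 4 * r * (sin (pi * x))\<^sup>2" for x using assms by (intro add_pos_nonneg) auto
  then have "(1 - r)\<^sup>2 + 4 * r * (sin (pi * x))\<^sup>2 \<noteq> 0" for x by (metis less_irrefl)
  then have "continuous_on {0..1} (\<lambda>x. h x * poisson_kernel r x)"
    unfolding poisson_kernel_def using assms by (intro continuous_intros) auto
  then show ?thesis by (rule borel_integrable_atLeastAtMost')
qed

text \<open>Termwise integration of the cosine series: every cosine has mean 0 over a period and
  only the constant term is left.\<close>

lemma integral_poisson_kernel:
  assumes r: "0 \<le> r" "r < 1"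
  shows "(LBINT x:{0..1}. poisson_kernel r x) = 1"
proof -
  let ?f = "\<lambda>k x. r ^ Suc k * cos (2 * pi * real (Suc k) * x)"
  have i: "(LBINT x:{0..1}. ?f k x) = 0" for k
  proof -
    have "(LBINT x:{0..1}. ?f k x) = r ^ Suc k * (sin (2 * pi * real (Suc k) * 1) / (2 * pi * real (Suc k)))
        - r ^ Suc k * (sin (2 * pi * real (Suc k) * 0) / (2 * pi * real (Suc k)))"
      unfolding set_lebesgue_integral_def
      by (rule integral_FTC_atLeastAtMost)
         (auto intro!: derivative_eq_intros continuous_intros 
           simp: has_real_derivative_iff_has_vector_derivative[symmetric] field_simps simp del: of_nat_Suc)
    also have "sin (2 * pi * real (Suc k) * 1) = 0"
    proof -
      have "2 * pi * real (Suc k) * 1 = real (2 * Suc k) * pi" by simp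
      then show ?thesis by (simp only: sin_npi)
    qed
    finally show ?thesis by simp
  qed
  have c: "set_integrable lborel {0..1} (?f k)" for k
    by (intro borel_integrable_atLeastAtMost' continuous_intros)
  have b: "norm (indicator {0..1} x * ?f k x) \<le> r ^ Suc k * indicator {0..1} x" for k and x :: real
    using r by (auto simp: abs_mult split: split_indicator intro!: mult_left_le simp del: power_Suc)
  have sg: "summable (\<lambda>k. r ^ Suc k)" using r by (auto intro!: summable_geometric simp: summable_Suc_iff)
  have "(\<lambda>k. \<integral>x. indicator {0..1} x * ?f k x \<partial>lborel) sums (\<integral>x. (\<Sum>k. indicator {0..1} x * ?f k x) \<partial>lborel)"
  proof (rule sums_integral)
    show "integrable lborel (\<lambda>x. indicator {0..1} x * ?f k x)" for k
      using c[of k] by (simp add: set_integrable_def)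
    show "AE x in lborel. summable (\<lambda>k. norm (indicator {0..1} x * ?f k x))"
    proof (rule AE_I2)
      fix x :: real
      show "summable (\<lambda>k. norm (indicator {0..1} x * ?f k x))"
        by (rule summable_comparison_test[OF _ summable_mult2[OF sg, of "indicator {0..1} x"]])
           (use b[of x] in \<open>auto simp del: power_Suc of_nat_Suc\<close>)
    qed
    have "(\<integral>x. norm (indicator {0..1} x * ?f k x) \<partial>lborel) \<le> (\<integral>x. r ^ Suc k * indicator {0..1::real} x \<partial>lborel)" for k
      using c[of k] b[of _ k] by (intro integral_mono) (auto simp: set_integrable_def simp del: power_Suc of_nat_Suc)
    then have "norm (\<integral>x. norm (indicator {0..1} x * ?f k x) \<partial>lborel) \<le> r ^ Suc k" for k
      by (simp del: power_Suc of_nat_Suc)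
    then show "summable (\<lambda>k. \<integral>x. norm (indicator {0..1} x * ?f k x) \<partial>lborel)"
      by (intro summable_comparison_test[OF _ sg]) auto
  qed
  moreover have "(\<Sum>k. indicator {0..1} x * ?f k x) = indicator {0..1} x * ((poisson_kernel r x - 1) / 2)" for x
    using poisson_kernel_sums[OF r, of x] by (simp add: suminf_mult sums_iff del: power_Suc of_nat_Suc)
  ultimately have "(\<integral>x. indicator {0..1} x * ((poisson_kernel r x - 1) / 2) \<partial>lborel) = 0"
    using i unfolding set_lebesgue_integral_def real_scaleR_def by (simp only: sums_iff) simp
  moreover have "(\<integral>x. indicator {0..1} x * ((poisson_kernel r x - 1) / 2) \<partial>lborel)
     = ((LBINT x:{0..1}. poisson_kernel r x) - 1) / 2"
  proof -
    have "(\<integral>x. indicator {0..1} x * ((poisson_kernel r x - 1) / 2) \<partial>lborel)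
      = (\<integral>x. (indicator {0..1} x * poisson_kernel r x - indicator {0..1} x) / 2 \<partial>lborel)"
      by (simp add: algebra_simps diff_divide_distrib)
    also have "\<dots> = ((LBINT x:{0..1}. poisson_kernel r x) - (LBINT x. indicator {0..1::real} x)) / 2"
      using integrable_poisson_kernel[OF r, of "\<lambda>_. 1"]
      by (simp add: set_lebesgue_integral_def set_integrable_def)
    finally show ?thesis by simp
  qed
  ultimately show ?thesis by simp
qed

text \<open>The kernel is symmetric about 1/2, so the two weights \<open>x\<close> and
  \<open>1 - x\<close>, which add up to 1, share the total mass equally.\<close>

lemma integral_poisson_kernel_mirror:
  assumes r: "0 \<le> r" "r < 1"
  shows "(LBINT x:{0..1}. x * poisson_kernel r x) = 1 / 2"
    and "(LBINT x:{0..1}. (1 - x) * poisson_kernel r x) = 1 / 2"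
proof -
  have "(LBINT x:{0..1}. x * poisson_kernel r x)
      = (LBINT x. indicator {0..1} (1 + (-1) * x) *\<^sub>R ((1 + (-1) * x) * poisson_kernel r (1 + (-1) * x)))"
    unfolding set_lebesgue_integral_def by (subst lborel_integral_real_affine[of "-1" _ 1]) auto
  also have "\<dots> = (LBINT x:{0..1}. (1 - x) * poisson_kernel r x)"
    unfolding set_lebesgue_integral_def
    by (intro Bochner_Integration.integral_cong) (auto simp: poisson_kernel_mirror split: split_indicator)
  finally have a: "(LBINT x:{0..1}. x * poisson_kernel r x) = (LBINT x:{0..1}. (1 - x) * poisson_kernel r x)" .
  have "(LBINT x:{0..1}. x * poisson_kernel r x) + (LBINT x:{0..1}. (1 - x) * poisson_kernel r x)
     = (LBINT x:{0..1}. x * poisson_kernel r x + (1 - x) * poisson_kernel r x)"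
    by (intro set_integral_add(2)[symmetric] integrable_poisson_kernel r continuous_intros)
  also have "\<dots> = 1" using integral_poisson_kernel[OF r] by (simp add: algebra_simps)
  finally show "(LBINT x:{0..1}. x * poisson_kernel r x) = 1 / 2"
    and "(LBINT x:{0..1}. (1 - x) * poisson_kernel r x) = 1 / 2" using a by auto
qed

text \<open>The mass gathers at the two ends of the period, half at each. The linear interpolant of
  \<open>h\<close> is integrated exactly for every radius. The remainder \<open>k\<close> vanishes
  at both ends at a linear rate, so its product with the kernel is bounded, and it tends to 0 in
  between.\<close>

lemma poisson_kernel_concentration:
  assumes h: "continuous_on {0..1} h"
    and L0: "\<And>x. x \<in> {0..1} \<Longrightarrow> \<bar>h x - h 0\<bar> \<le> L * x"
    and L1: "\<And>x. x \<in> {0..1} \<Longrightarrow> \<bar>h 1 - h x\<bar> \<le> L * (1 - x)"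
  shows "(\<lambda>j. LBINT x:{0..1}. h x * poisson_kernel (1 - 1 / real (j + 4)) x) \<longlonglongrightarrow> (h 0 + h 1) / 2"
proof -
  define r where "r j = 1 - 1 / real (j + 4)" for j
  have r: "1/4 \<le> r j" "0 \<le> r j" "r j < 1" for j by (auto simp: r_def field_simps)
  define k where "k x = h x - ((1 - x) * h 0 + x * h 1)" for x
  have ck: "continuous_on {0..1} k" unfolding k_def by (intro continuous_intros h)
  have k: "\<bar>k x\<bar> \<le> 2 * L * min x (1 - x)" if "x \<in> {0..1}" for x
  proof -
    have "\<bar>x * (h 1 - h 0)\<bar> \<le> x * L" "\<bar>(1 - x) * (h 1 - h 0)\<bar> \<le> (1 - x) * L"
      using that L0[of 1] by (auto simp: abs_mult intro!: mult_left_mono)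
    moreover have "k x = (h x - h 0) - x * (h 1 - h 0)" "k x = (1 - x) * (h 1 - h 0) - (h 1 - h x)"
      by (auto simp: k_def algebra_simps)
    ultimately have "\<bar>k x\<bar> \<le> L * x + x * L" "\<bar>k x\<bar> \<le> (1 - x) * L + L * (1 - x)"
      using L0[OF that] L1[OF that] by linarith+
    then show ?thesis by (auto simp: min_def algebra_simps)
  qed
  have L: "L \<ge> 0" using L0[of 1] by (simp add: order_trans[OF abs_ge_zero])
  have bound: "\<bar>k x * poisson_kernel (r j) x\<bar> \<le> 4 * L" if "x \<in> {0..1}" for x j
  proof -
    have "\<bar>k x * poisson_kernel (r j) x\<bar> \<le> (2 * L * min x (1 - x)) * poisson_kernel (r j) x"
      using k[OF that] poisson_kernel_nonneg[OF r(2,3)] by (simp add: abs_mult mult_right_mono)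
    also have "\<dots> = 2 * L * (min x (1 - x) * poisson_kernel (r j) x)" by simp
    also have "\<dots> \<le> 2 * L * 2"
      using poisson_kernel_bound[OF r(1,3), of x] that L by (intro mult_left_mono) auto
    finally show ?thesis by simp
  qed
  have "(\<lambda>j. LBINT x. indicator {0..1} x *\<^sub>R (k x * poisson_kernel (r j) x)) \<longlonglongrightarrow> (LBINT x::real. 0)"
  proof (rule integral_dominated_convergence[where w = "\<lambda>x. 4 * L * indicator {0..1} x"])
    show "(\<lambda>x. indicator {0..1} x *\<^sub>R (k x * poisson_kernel (r j) x)) \<in> borel_measurable lborel" for j
      using integrable_poisson_kernel[OF r(2,3) ck] unfolding set_integrable_def by (rule borel_measurable_integrable)
    have "AE x in lborel. x \<notin> {0, 1::real}" by (intro AE_not_in countable_imp_null_set_lborel) auto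
    then show "AE x in lborel. (\<lambda>j. indicator {0..1} x *\<^sub>R (k x * poisson_kernel (r j) x)) \<longlonglongrightarrow> 0"
    proof eventually_elim
      case (elim x)
      show ?case
      proof (cases "x \<in> {0..1}")
        case True
        then have "(\<lambda>j. k x * poisson_kernel (r j) x) \<longlonglongrightarrow> k x * 0"
          using elim unfolding r_def by (intro tendsto_intros poisson_kernel_tendsto_0) auto
        then show ?thesis using True by simp
      qed simp
    qed
    show "AE x in lborel. norm (indicator {0..1} x *\<^sub>R (k x * poisson_kernel (r j) x)) \<le> 4 * L * indicator {0..1} x" for j
      using bound[of _ j] by (auto split: split_indicator)
  qed auto
  then have lim: "(\<lambda>j. LBINT x:{0..1}. k x * poisson_kernel (r j) x) \<longlonglongrightarrow> 0"
    by (simp add: set_lebesgue_integral_def)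
  have eq: "(LBINT x:{0..1}. h x * poisson_kernel (r j) x)
      = (LBINT x:{0..1}. k x * poisson_kernel (r j) x) + (h 0 + h 1) / 2" for j
  proof -
    let ?p = "poisson_kernel (r j)"
    have i: "set_integrable lborel {0..1} (\<lambda>x. k x * ?p x)"
      "set_integrable lborel {0..1} (\<lambda>x. (1 - x) * ?p x)" "set_integrable lborel {0..1} (\<lambda>x. x * ?p x)"
      by (intro integrable_poisson_kernel r ck continuous_intros)+
    have "(LBINT x:{0..1}. h x * ?p x)
       = (LBINT x:{0..1}. k x * ?p x + (h 0 * ((1 - x) * ?p x) + h 1 * (x * ?p x)))"
      by (simp add: k_def algebra_simps)
    also have "\<dots> = (LBINT x:{0..1}. k x * ?p x) + (h 0 * (LBINT x:{0..1}. (1 - x) * ?p x)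
        + h 1 * (LBINT x:{0..1}. x * ?p x))"
      by (subst set_integral_add set_integral_add(2) set_integral_mult_right, 
          (intro i set_integral_add(1) set_integrable_mult_right)+)+ simp
    finally show ?thesis using integral_poisson_kernel_mirror[OF r(2,3)] by simp
  qed
  show ?thesis
    using tendsto_add[OF lim tendsto_const[of "(h 0 + h 1) / 2"]] unfolding eq[symmetric] by (simp add: r_def)
qed

section \<open>The theta series and its functional equation\<close>

definition om :: "real \<Rightarrow> real" where
  "om x = (\<Sum>n. exp (- (pi * (real (Suc n))\<^sup>2 * x)))"

lemma exp_square_le_power:
  assumes "a > 0" shows "exp (- (a * (real k)\<^sup>2)) \<le> exp (- a) ^ k"
proof -
  have "real k \<le> (real k)\<^sup>2" by (cases k) (auto simp: power2_eq_square)
  then show ?thesis using assms by (simp flip: exp_of_nat_mult)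
qed

lemma summable_exp_square:
  assumes "a > 0"
  shows "summable (\<lambda>k. exp (- (a * (real k)\<^sup>2)))"
  by (rule summable_comparison_test[OF _ summable_geometric[of "exp (- a)"]])
     (use exp_square_le_power[OF assms] assms in auto)

lemma om_sums:
  assumes "x > 0" shows "(\<lambda>n. exp (- (pi * (real (Suc n))\<^sup>2 * x))) sums om x"
proof -
  have "summable (\<lambda>k. exp (- ((pi * x) * (real (Suc k))\<^sup>2)))"
    using assms by (intro summable_Suc_iff[THEN iffD2] summable_exp_square) auto
  then show ?thesis unfolding om_def by (intro summable_sums) (simp add: mult_ac)
qed

text \<open>Cuts the line into unit cells, on each of which a function of period 1 looks the same;
  evenness lets the natural numbers index the cells.\<close>

lemma integral_even_tiling:
  fixes f :: "real \<Rightarrow> real"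
  assumes f: "integrable lborel f" and even: "\<And>x. f (- x) = f x"
  shows "(LBINT x. f x) = 2 * (\<Sum>k. LBINT x:{0..1}. f (real k + x))"
proof -
  have s: "set_integrable lborel A f" if "A \<in> sets borel" for A
    using f that unfolding set_integrable_def by (intro integrable_mult_indicator) auto
  have un: "(\<Union>i. {real i..<real (Suc i)}) = {0..}"
  proof (intro equalityI subsetI)
    fix x :: real assume "x \<in> {0..}"
    then show "x \<in> (\<Union>i. {real i..<real (Suc i)})"
      by (intro UN_I[of "nat \<lfloor>x\<rfloor>"]) (auto simp: le_nat_floor, linarith)
  qed (auto intro: order_trans)
  have disj: "{real i..<real (Suc i)} \<inter> {real j..<real (Suc j)} = {}" if "i \<noteq> j" for i j
  proof -
    have "real (Suc i) \<le> real j \<or> real (Suc j) \<le> real i"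
      unfolding of_nat_le_iff using that by linarith
    then show ?thesis by (auto simp del: of_nat_Suc)
  qed
  have "(LBINT x:{0..}. f x) = (\<Sum>i. LBINT x:{real i..<real (Suc i)}. f x)"
    unfolding un[symmetric]
    by (rule lebesgue_integral_countable_add[OF _ disj s]) auto
  also have "\<dots> = (\<Sum>k. LBINT x:{0..1}. f (real k + x))"
  proof (rule suminf_cong)
    fix i
    have "(LBINT x:{real i..<real (Suc i)}. f x) = (LBINT x:{real i..real (Suc i)}. f x)"
      by (rule set_integral_discrete_difference[where X = "{real (Suc i)}"]) auto
    also have "\<dots> = (LBINT x. indicator {real i..real (Suc i)} (real i + 1 * x) *\<^sub>R f (real i + 1 * x))"
      unfolding set_lebesgue_integral_def by (subst lborel_integral_real_affine[of 1 _ "real i"]) auto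
    also have "\<dots> = (LBINT x:{0..1}. f (real i + x))"
      unfolding set_lebesgue_integral_def
      by (intro Bochner_Integration.integral_cong) (auto split: split_indicator)
    finally show "(LBINT x:{real i..<real (Suc i)}. f x) = (LBINT x:{0..1}. f (real i + x))" .
  qed
  finally have pos: "(LBINT x:{0..}. f x) = (\<Sum>k. LBINT x:{0..1}. f (real k + x))" .
  have "(LBINT x:{..0}. f x) = (LBINT x. indicator {..0} (0 + (-1) * x) *\<^sub>R f (0 + (-1) * x))"
    unfolding set_lebesgue_integral_def by (subst lborel_integral_real_affine[of "-1" _ 0]) auto
  also have "\<dots> = (LBINT x:{0..}. f x)"
    unfolding set_lebesgue_integral_def
    by (intro Bochner_Integration.integral_cong) (auto simp: even split: split_indicator)
  also have "(LBINT x:{..0}. f x) = (LBINT x:{..<0}. f x)"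
    by (rule set_integral_discrete_difference[where X = "{0}"]) auto
  finally have neg: "(LBINT x:{..<0}. f x) = (LBINT x:{0..}. f x)" .
  have "(LBINT x. f x) = (LBINT x:({..<0} \<union> {0..}). f x)"
  proof -
    have "{..<0} \<union> {0..} = (UNIV :: real set)" by auto
    then show ?thesis by (simp add: set_lebesgue_integral_def)
  qed
  also have "\<dots> = (LBINT x:{..<0}. f x) + (LBINT x:{0..}. f x)"
    by (intro set_integral_Un s) auto
  finally show ?thesis using neg pos by simp
qed

text \<open>The Fourier side of Poisson summation with Abel weights \<open>r ^ k\<close>: the kernel
  is expanded into cosines, and the Gaussian of parameter \<open>t\<close> is transformed into one
  of parameter \<open>1 / t\<close>.\<close>

lemma gaussian_poisson_kernel:
  assumes t: "t > 0" and r: "0 \<le> r" "r < 1"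
  shows "(\<lambda>k. r ^ Suc k * exp (- (pi * (real (Suc k))\<^sup>2 * (1 / t)))) sums
           (((LBINT x. exp (- (pi * t) * x\<^sup>2) * poisson_kernel r x) * sqrt t - 1) / 2)"
    and "integrable lborel (\<lambda>x. exp (- (pi * t) * x\<^sup>2) * poisson_kernel r x)"
proof -
  let ?g = "\<lambda>x::real. exp (- (pi * t) * x\<^sup>2)"
  let ?f = "\<lambda>k x. r ^ Suc k * (?g x * cos (2 * pi * real (Suc k) * x))"
  have pt: "pi * t > 0" using t by simp
  note G = gaussian_integrable[OF pt]
  have cosi: "integrable lborel (\<lambda>x. ?g x * cos (b * x))"
    "(LBINT x. ?g x * cos (b * x)) = sqrt (1 / t) * exp (- b\<^sup>2 / (4 * (pi * t)))" for b
  proof -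
    have e: "?g x * cos (b * x) = Re (complex_of_real (?g x) * iexp (b * x))" for x
      by (simp add: Re_exp del: of_real_exp exp_of_real)
    show "integrable lborel (\<lambda>x. ?g x * cos (b * x))" unfolding e by (intro integrable_Re G)
    have "(LBINT x. ?g x * cos (b * x)) = Re (LBINT x. complex_of_real (?g x) * iexp (b * x))"
      unfolding e by (rule integral_Re[OF G(2)])
    also have "\<dots> = sqrt (pi / (pi * t)) * exp (- b\<^sup>2 / (4 * (pi * t)))" unfolding G(3) by (rule Re_complex_of_real)
    finally show "(LBINT x. ?g x * cos (b * x)) = sqrt (1 / t) * exp (- b\<^sup>2 / (4 * (pi * t)))" by simp
  qed
  have sg: "summable (\<lambda>k. r ^ Suc k)" using r by (auto intro!: summable_geometric simp: summable_Suc_iff)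
  have b: "norm (?f k x) \<le> r ^ Suc k * ?g x" for k x
  proof -
    have "norm (?f k x) = r ^ Suc k * ?g x * \<bar>cos (2 * pi * real (Suc k) * x)\<bar>"
      using r by (simp add: abs_mult)
    also have "\<dots> \<le> r ^ Suc k * ?g x * 1" using r by (intro mult_left_mono) auto
    finally show ?thesis by simp
  qed
  have i: "integrable lborel (?f k)" for k by (intro integrable_mult_right cosi)
  have su: "summable (\<lambda>k. norm (?f k x))" for x
    by (rule summable_comparison_test[OF _ summable_mult2[OF sg, of "?g x"]]) (use b[of _ x] in auto)
  have S0: "(\<lambda>k. LBINT x. ?f k x) sums (LBINT x. (\<Sum>k. ?f k x))"
    and int: "integrable lborel (\<lambda>x. (\<Sum>k. ?f k x))"
  proof -
    have A: "AE x in lborel. summable (\<lambda>k. norm (?f k x))" using su by simp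
    have "(LBINT x. norm (?f k x)) \<le> (LBINT x. r ^ Suc k * ?g x)" for k
      using G(1) b[of k] i[of k] by (intro integral_mono) auto
    then have "norm (LBINT x. norm (?f k x)) \<le> r ^ Suc k * (LBINT x. ?g x)" for k
      by (simp del: power_Suc of_nat_Suc)
    then have B: "summable (\<lambda>k. LBINT x. norm (?f k x))"
      by (intro summable_comparison_test[OF _ summable_mult2[OF sg]]) auto
    show "(\<lambda>k. LBINT x. ?f k x) sums (LBINT x. (\<Sum>k. ?f k x))" by (rule sums_integral[OF i A B])
    show "integrable lborel (\<lambda>x. (\<Sum>k. ?f k x))" by (rule integrable_suminf[OF i A B])
  qed
  have sum: "(\<Sum>k. ?f k x) = ?g x * ((poisson_kernel r x - 1) / 2)" for x
    using sums_mult[OF poisson_kernel_sums[OF r, of x], of "?g x"]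
    by (simp add: sums_iff mult_ac del: power_Suc of_nat_Suc)
  have int2: "integrable lborel (\<lambda>x. ?g x * poisson_kernel r x)"
  proof -
    have "integrable lborel (\<lambda>x. 2 * (?g x * ((poisson_kernel r x - 1) / 2)) + ?g x)"
      using int unfolding sum by (intro Bochner_Integration.integrable_add integrable_mult_right G(1))
    moreover have "2 * (?g x * ((poisson_kernel r x - 1) / 2)) + ?g x = ?g x * poisson_kernel r x" for x
      by (simp add: field_simps)
    ultimately show ?thesis by simp
  qed
  have "(\<lambda>k. LBINT x. ?f k x) sums (LBINT x. ?g x * ((poisson_kernel r x - 1) / 2))"
    using S0 unfolding sum .
  also have "(LBINT x. ?g x * ((poisson_kernel r x - 1) / 2))
      = (LBINT x. (?g x * poisson_kernel r x - ?g x) / 2)"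
    by (intro Bochner_Integration.integral_cong) (auto simp: algebra_simps diff_divide_distrib)
  also have "\<dots> = ((LBINT x. ?g x * poisson_kernel r x) - sqrt (1 / t)) / 2"
    using int2 G(1) cosi(2)[of 0] by simp
  also have "(\<lambda>k. LBINT x. ?f k x) = (\<lambda>k. sqrt (1 / t) * (r ^ Suc k * exp (- (pi * (real (Suc k))\<^sup>2 * (1 / t)))))"
  proof
    fix k
    have "(2 * pi * real (Suc k))\<^sup>2 / (4 * (pi * t)) = pi * (real (Suc k))\<^sup>2 * (1 / t)"
      by (simp add: power_mult_distrib power2_eq_square)
    then have e: "- (2 * pi * real (Suc k))\<^sup>2 / (4 * (pi * t)) = - (pi * (real (Suc k))\<^sup>2 * (1 / t))"
      by (simp only: minus_divide_left[symmetric])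
    have "(LBINT x. ?f k x) = r ^ Suc k * (LBINT x. ?g x * cos (2 * pi * real (Suc k) * x))"
      by (rule integral_mult_right_zero)
    also have "\<dots> = r ^ Suc k * (sqrt (1 / t) * exp (- (pi * (real (Suc k))\<^sup>2 * (1 / t))))"
      by (simp only: cosi(2) e)
    finally show "(LBINT x. ?f k x) = sqrt (1 / t) * (r ^ Suc k * exp (- (pi * (real (Suc k))\<^sup>2 * (1 / t))))"
      by (simp only: mult.left_commute)
  qed
  finally have "(\<lambda>k. sqrt t * (sqrt (1 / t) * (r ^ Suc k * exp (- (pi * (real (Suc k))\<^sup>2 * (1 / t))))))
    sums (sqrt t * (((LBINT x. ?g x * poisson_kernel r x) - sqrt (1 / t)) / 2))"
    by (rule sums_mult)
  moreover have "sqrt t * sqrt (1 / t) = 1" using t by (simp add: real_sqrt_divide)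
  ultimately show "(\<lambda>k. r ^ Suc k * exp (- (pi * (real (Suc k))\<^sup>2 * (1 / t)))) sums
           (((LBINT x. ?g x * poisson_kernel r x) * sqrt t - 1) / 2)"
    by (simp add: mult.assoc[symmetric] right_diff_distrib mult.commute[of "sqrt t"] del: power_Suc of_nat_Suc)
  show "integrable lborel (\<lambda>x. ?g x * poisson_kernel r x)" by (fact int2)
qed

text \<open>The integral of Gaussian times kernel is evaluated in two ways, over unit cells and as
  the Abel-weighted dual series. Tannery's theorem takes the limit of the radius under both
  sums.\<close>

theorem om_functional_equation:
  assumes t: "t > 0"
  shows "1 + 2 * om (1 / t) = sqrt t * (1 + 2 * om t)"
proof -
  let ?g = "\<lambda>x::real. exp (- (pi * t) * x\<^sup>2)"
  define r where "r j = 1 - 1 / real (j + 4)" for j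
  have r: "0 \<le> r j" "r j < 1" for j by (auto simp: r_def field_simps)
  define G where "G k = exp (- (pi * t * (real k)\<^sup>2))" for k
  have G: "summable G" unfolding G_def using t by (intro summable_exp_square) auto
  have pd: "((\<lambda>x. ?g x) has_real_derivative - (2 * (pi * t) * x) * ?g x) (at x)" for x
    by (auto intro!: derivative_eq_intros)
  have mono: "?g (real k + x) \<le> G k" if "x \<ge> 0" for k x
    using that t by (auto simp: G_def intro!: mult_left_mono power_mono)
  define a where "a k j = (LBINT x:{0..1}. ?g (real k + x) * poisson_kernel (r j) x)" for k j
  have lim: "(\<lambda>j. a k j) \<longlonglongrightarrow> (G k + G (Suc k)) / 2" for k
  proof -
    \<comment> \<open>Bounds the derivative of the Gaussian on \<open>[k, k + 1]\<close>, where the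
      exponential factor is at most 1.\<close>
    define L where "L = 2 * (pi * t) * (real k + 1)"
    have lip: "\<bar>?g (real k + y) - ?g (real k + x)\<bar> \<le> L * (y - x)" if "0 \<le> x" "x \<le> y" "y \<le> 1" for x y
    proof (cases "x = y")
      case False
      have "\<exists>z>real k + x. z < real k + y \<and> ?g (real k + y) - ?g (real k + x) = (real k + y - (real k + x)) * (- (2 * (pi * t) * z) * ?g z)"
        by (rule MVT2) (use that False pd in auto)
      then obtain z where z: "real k + x < z" "z < real k + y"
        "?g (real k + y) - ?g (real k + x) = (y - x) * (- (2 * (pi * t) * z) * ?g z)" by auto
      have "\<bar>2 * (pi * t) * z * ?g z\<bar> \<le> L * 1"
        unfolding abs_mult L_def using z that t by (intro mult_mono) auto
      then show ?thesis unfolding z(3) abs_mult using that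
        by (simp add: abs_mult mult.commute[of "y - x"] mult_right_mono)
    qed simp
    have "(\<lambda>j. LBINT x:{0..1}. ?g (real k + x) * poisson_kernel (1 - 1 / real (j + 4)) x)
        \<longlonglongrightarrow> (?g (real k + 0) + ?g (real k + 1)) / 2"
      by (rule poisson_kernel_concentration[where L = L])
         (use lip[of 0] lip[of _ 1] in \<open>auto intro!: continuous_intros\<close>)
    then show ?thesis unfolding a_def r_def by (simp add: G_def add.commute)
  qed
  have ab: "norm (a k j) \<le> G k" for k j
  proof -
    have i: "set_integrable lborel {0..1} (\<lambda>x. ?g (real k + x) * poisson_kernel (r j) x)"
       "set_integrable lborel {0..1} (\<lambda>x. G k * poisson_kernel (r j) x)"
      by (intro integrable_poisson_kernel r continuous_intros)+
    have "a k j \<le> (LBINT x:{0..1}. G k * poisson_kernel (r j) x)"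
      unfolding a_def using mono by (intro set_integral_mono i mult_right_mono poisson_kernel_nonneg r) auto
    also have "\<dots> = G k" using integral_poisson_kernel[OF r] by simp
    finally have "a k j \<le> G k" .
    moreover have "a k j \<ge> 0" unfolding a_def set_lebesgue_integral_def
      by (intro integral_nonneg_AE AE_I2) (auto intro!: mult_nonneg_nonneg poisson_kernel_nonneg r)
    ultimately show ?thesis by simp
  qed
  have "(\<lambda>j. \<Sum>k. a k j) \<longlonglongrightarrow> (\<Sum>k. (G k + G (Suc k)) / 2)"
    by (rule tannerys_theorem[THEN conjunct2, THEN conjunct2])
       (use lim ab G in \<open>auto intro!: always_eventually\<close>)
  also have "(\<lambda>j. \<Sum>k. a k j) = (\<lambda>j. (LBINT x. ?g x * poisson_kernel (r j) x) / 2)"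
  proof
    fix j
    have "(LBINT x. ?g x * poisson_kernel (r j) x) = 2 * (\<Sum>k. LBINT x:{0..1}. ?g (real k + x) * poisson_kernel (r j) (real k + x))"
      by (rule integral_even_tiling[OF gaussian_poisson_kernel(2)[OF t r]]) (simp add: poisson_kernel_def)
    then show "(\<Sum>k. a k j) = (LBINT x. ?g x * poisson_kernel (r j) x) / 2"
      by (simp add: a_def poisson_kernel_periodic)
  qed
  \<comment> \<open>Each cell contributes the mean of its two end values, so that 0 receives weight
    1/2 and every positive integer weight 1.\<close>
  also have "(\<Sum>k. (G k + G (Suc k)) / 2) = (1 + 2 * om t) / 2"
  proof -
    have s: "(\<lambda>k. G (Suc k)) sums om t" using om_sums[OF t] by (simp add: G_def mult_ac)
    then have "G sums (om t + G 0)" by (simp add: sums_Suc_iff)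
    from sums_divide[OF sums_add[OF this s], of 2] show ?thesis by (simp add: sums_iff G_def)
  qed
  finally have l1: "(\<lambda>j. (LBINT x. ?g x * poisson_kernel (r j) x) / 2) \<longlonglongrightarrow> (1 + 2 * om t) / 2" .
  have sum2: "(\<Sum>k. r j ^ Suc k * exp (- (pi * (real (Suc k))\<^sup>2 * (1 / t))))
     = ((LBINT x. ?g x * poisson_kernel (r j) x) * sqrt t - 1) / 2" for j
    using gaussian_poisson_kernel(1)[OF t r] by (rule sums_unique[symmetric])
  have "(\<lambda>j. \<Sum>k. r j ^ Suc k * exp (- (pi * (real (Suc k))\<^sup>2 * (1 / t)))) \<longlonglongrightarrow> om (1 / t)"
    unfolding om_def
  proof (rule tannerys_theorem[THEN conjunct2, THEN conjunct2])
    show "summable (\<lambda>k. exp (- (pi * (real (Suc k))\<^sup>2 * (1 / t))))"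
      using om_sums[of "1 / t"] t by (auto simp: sums_iff)
    have r1: "r \<longlonglongrightarrow> 1" using seq_tendsto_at_left_1 unfolding r_def by (rule filterlim_mono) (auto simp: at_within_le_nhds)
    show "(\<lambda>j. r j ^ Suc k * exp (- (pi * (real (Suc k))\<^sup>2 * (1 / t)))) \<longlonglongrightarrow> exp (- (pi * (real (Suc k))\<^sup>2 * (1 / t)))" for k
      using tendsto_mult[OF tendsto_power[OF r1, of "Suc k"] tendsto_const[of "exp (- (pi * (real (Suc k))\<^sup>2 * (1 / t)))"]] by simp
    have "r j ^ Suc k \<le> 1" for j k using r[of j] by (intro power_le_one) auto
    then show "\<forall>\<^sub>F (k, j) in sequentially \<times>\<^sub>F sequentially. norm (r j ^ Suc k * exp (- (pi * (real (Suc k))\<^sup>2 * (1 / t)))) \<le> exp (- (pi * (real (Suc k))\<^sup>2 * (1 / t)))"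
      using r by (auto intro!: always_eventually simp: abs_mult mult_le_cancel_right1 simp del: power_Suc)
  qed auto
  then have l2: "(\<lambda>j. (LBINT x. ?g x * poisson_kernel (r j) x) / 2 * sqrt t - 1 / 2) \<longlonglongrightarrow> om (1 / t)"
    unfolding sum2 by (simp add: diff_divide_distrib)
  have "(\<lambda>j. (LBINT x. ?g x * poisson_kernel (r j) x) / 2 * sqrt t - 1 / 2) \<longlonglongrightarrow> (1 + 2 * om t) / 2 * sqrt t - 1 / 2"
    by (intro tendsto_intros l1)
  from LIMSEQ_unique[OF l2 this] show ?thesis by (simp add: field_simps)
qed

lemma om_nonneg: "om x \<ge> 0" if "x > 0" 
  unfolding om_def using om_sums[OF that] by (intro suminf_nonneg) (auto simp: sums_iff)

lemma om_measurable [measurable]: "om \<in> borel_measurable borel"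
  unfolding om_def by measurable

text \<open>Integral test: the term with index \<open>k + 1\<close> is below the integral of the
  decreasing Gaussian over \<open>[k, k + 1]\<close>. This bound is exactly what makes
  \<open>phi\<close> nonpositive.\<close>

lemma om_le_inverse_sqrt:
  assumes t: "t > 0" shows "om t \<le> 1 / (2 * sqrt t)"
proof -
  let ?g = "\<lambda>x::real. exp (- (pi * t) * x\<^sup>2)"
  have pt: "pi * t > 0" using t by simp
  have "complex_of_real (LBINT x. ?g x) = (LBINT x. complex_of_real (?g x) * iexp (0 * x))"
    by (simp del: of_real_exp)
  also have "\<dots> = of_real (sqrt (pi / (pi * t)) * exp (- 0\<^sup>2 / (4 * (pi * t))))"
    by (rule gaussian_integrable(3)[OF pt])
  finally have "(LBINT x. ?g x) = sqrt (pi / (pi * t)) * exp (- 0\<^sup>2 / (4 * (pi * t)))"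
    by (simp only: of_real_eq_iff)
  then have I: "(LBINT x. ?g x) = 1 / sqrt t" by (simp add: real_sqrt_divide)
  have T: "(LBINT x. ?g x) = 2 * (\<Sum>k. LBINT x:{0..1}. ?g (real k + x))"
    by (rule integral_even_tiling[OF gaussian_integrable(1)[OF pt]]) simp
  have si: "set_integrable lborel {0..1} (\<lambda>x. ?g (real k + x))" for k
    by (intro borel_integrable_atLeastAtMost' continuous_intros)
  have sc: "set_integrable lborel {0..1::real} (\<lambda>x. c)" for c :: real
    by (intro borel_integrable_atLeastAtMost' continuous_intros)
  have c1: "(LBINT x:{0..1::real}. c) = c" for c :: real by (simp add: set_lebesgue_integral_def)
  have lo: "exp (- (pi * (real (Suc k))\<^sup>2 * t)) \<le> (LBINT x:{0..1}. ?g (real k + x))" for k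
  proof -
    have "(LBINT x:{0..1::real}. exp (- (pi * (real (Suc k))\<^sup>2 * t))) \<le> (LBINT x:{0..1}. ?g (real k + x))"
      by (intro set_integral_mono si sc) (use t in \<open>auto simp: mult_ac intro!: mult_left_mono power_mono\<close>)
    then show ?thesis unfolding c1 .
  qed
  have hi: "(LBINT x:{0..1}. ?g (real k + x)) \<le> exp (- (pi * t * (real k)\<^sup>2))" for k
  proof -
    have "(LBINT x:{0..1}. ?g (real k + x)) \<le> (LBINT x:{0..1::real}. exp (- (pi * t * (real k)\<^sup>2)))"
      by (intro set_integral_mono si sc) (use t in \<open>auto simp: mult_ac intro!: mult_left_mono power_mono\<close>)
    then show ?thesis unfolding c1 .
  qed
  have "0 \<le> (LBINT x:{0..1}. ?g (real k + x))" for k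
    using lo[of k] exp_ge_zero order_trans by blast
  then have "summable (\<lambda>k. LBINT x:{0..1}. ?g (real k + x))"
    using hi by (intro summable_comparison_test[OF _ summable_exp_square[OF pt]]) auto
  then have "om t \<le> (\<Sum>k. LBINT x:{0..1}. ?g (real k + x))"
    unfolding om_def using om_sums[OF t] lo by (intro suminf_le) (auto simp: sums_iff)
  also have "\<dots> = 1 / (2 * sqrt t)" using T I by simp
  finally show ?thesis .
qed

text \<open>Squares are at least as large as their roots, which compares the series with a geometric
  one; for \<open>x \<ge> 1\<close> its ratio is at most 1/2, whence the factor 2.\<close>

lemma om_le_exp:
  assumes x: "x \<ge> 1" shows "om x \<le> 2 * exp (- (pi * x))"
proof -
  define q where "q = exp (- (pi * x))"
  have "3 * 1 \<le> pi * x" using x pi_gt3 by (intro mult_mono) auto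
  then have "q \<le> exp (-1)" by (auto simp: q_def)
  also have "exp (-1) \<le> (1/2::real)" using exp_ge_add_one_self[of 1] by (simp add: exp_minus field_simps)
  finally have q: "0 < q" "q \<le> 1/2" by (auto simp: q_def)
  have le: "exp (- (pi * (real (Suc n))\<^sup>2 * x)) \<le> q * q ^ n" for n
    using exp_square_le_power[of "pi * x" "Suc n"] x by (simp add: q_def mult_ac)
  have s: "(\<lambda>n. q * q ^ n) sums (q * (1 / (1 - q)))"
    using q by (intro sums_mult geometric_sums) auto
  have "om x \<le> q * (1 / (1 - q))"
    using sums_le[OF le om_sums s] x by simp
  also have "\<dots> \<le> q * 2" using q by (intro mult_left_mono) (auto simp: field_simps)
  finally show ?thesis by (simp add: q_def)
qed

lemma continuous_on_om: "continuous_on {0<..} om"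
proof -
  have "continuous_on {a<..} om" if a: "a > 0" for a
  proof -
    have "uniform_limit {a<..} (\<lambda>n x. \<Sum>i<n. exp (- (pi * (real (Suc i))\<^sup>2 * x))) om sequentially"
      unfolding om_def
    proof (rule Weierstrass_m_test)
      show "summable (\<lambda>i. exp (- (pi * (real (Suc i))\<^sup>2 * a)))"
        using om_sums[OF a] by (simp add: sums_iff)
      show "norm (exp (- (pi * (real (Suc i))\<^sup>2 * x))) \<le> exp (- (pi * (real (Suc i))\<^sup>2 * a))"
        if "x \<in> {a<..}" for i x using that by (auto intro!: mult_left_mono)
    qed
    then show ?thesis
      by (rule uniform_limit_theorem[rotated]) (auto intro!: always_eventually continuous_intros)
  qed
  then have "continuous_on {x/2<..} om" if "x > 0" for x using that by auto
  then have "isCont om x" if "x > 0" for x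
    using that continuous_on_eq_continuous_at[OF open_greaterThan, of "x / 2" om] by simp
  then show ?thesis by (auto intro!: continuous_at_imp_continuous_on)
qed

section \<open>The even function \<open>phi\<close> and its unsymmetric companion
  \<open>chi\<close>\<close>

text \<open>The weight \<open>exp (q / 4)\<close> makes the functional equation symmetric; the
  subtracted term removes the growth of \<open>om\<close> near 0 and leaves decay at both
  ends.\<close>

definition phi :: "real \<Rightarrow> real" where
  "phi q = exp (q / 4) * om (exp q) - exp (- q / 4) / 2"

lemma phi_measurable [measurable]: "phi \<in> borel_measurable borel"
  unfolding phi_def by measurable

lemma continuous_phi: "continuous_on UNIV phi"
  unfolding phi_def
  by (intro continuous_intros continuous_on_compose2[OF continuous_on_om]) auto

lemma phi_even: "phi (- q) = phi q"
proof -
  define E where "E = exp (q / 4)"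
  have E0: "E > 0" by (simp add: E_def)
  have E: "exp q = E ^ 4" "exp (- q) = 1 / E ^ 4" "exp (- q / 4) = 1 / E"
    by (simp_all add: E_def exp_minus field_simps flip: exp_of_nat_mult)
  have s: "sqrt (E ^ 4) = E\<^sup>2" by (rule real_sqrt_unique) (simp_all flip: power_mult)
  define W where "W = om (E ^ 4)"
  have "1 + 2 * om (1 / E ^ 4) = E\<^sup>2 * (1 + 2 * W)"
    using om_functional_equation[of "E ^ 4"] E0 s by (simp add: W_def)
  then have a: "om (1 / E ^ 4) = (E\<^sup>2 * (1 + 2 * W) - 1) / 2" by simp
  have "phi (- q) = 1 / E * ((E\<^sup>2 * (1 + 2 * W) - 1) / 2) - E / 2"
    unfolding phi_def E a by (simp add: E_def)
  also have "\<dots> = E * W - (1 / E) / 2" using E0 by (simp add: field_simps power2_eq_square)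
  also have "\<dots> = phi q" unfolding phi_def E W_def by (simp add: E_def)
  finally show ?thesis .
qed

text \<open>The integral test for \<open>om\<close> gives the sign. Dropping the nonnegative
  \<open>om\<close> gives the decay for positive \<open>q\<close>, and evenness carries it over to
  negative \<open>q\<close>.\<close>

lemma phi_bounds: "phi q \<le> 0" "\<bar>phi q\<bar> \<le> exp (- \<bar>q\<bar> / 4) / 2"
proof -
  have s: "sqrt (exp q) = exp (q / 2)" for q :: real
    by (rule real_sqrt_unique) (auto simp flip: exp_of_nat_mult)
  have "exp (q / 4) * om (exp q) \<le> exp (q / 4) * (1 / (2 * exp (q / 2)))" for q
    using om_le_inverse_sqrt[of "exp q"] by (intro mult_left_mono) (auto simp: s)
  also have "exp (q / 4) * (1 / (2 * exp (q / 2))) = exp (- q / 4) / 2" for q :: real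
    by (simp add: field_simps flip: exp_add)
  finally have le: "phi q \<le> 0" for q by (simp add: phi_def)
  have lo: "- (exp (- q / 4) / 2) \<le> phi q" for q using om_nonneg[of "exp q"] by (simp add: phi_def)
  have "\<bar>phi q\<bar> \<le> exp (- q / 4) / 2" for q using le[of q] lo[of q] by linarith
  from this[of q] this[of "-q"] show "\<bar>phi q\<bar> \<le> exp (- \<bar>q\<bar> / 4) / 2"
    by (auto simp: phi_even abs_if)
  show "phi q \<le> 0" by (rule le)
qed

lemma integrable_exp_abs:
  assumes "a > 0" shows "integrable lborel (\<lambda>q::real. exp (- a * \<bar>q\<bar>))"
proof -
  define f where "f q = indicator {0<..} q * exp (- (q * a))" for q :: real
  have f: "integrable lborel f"
    using integrable_I0i_exp_mscale[OF assms] by (simp add: f_def[abs_def] set_integrable_def)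
  have "integrable lborel (\<lambda>q. f (0 + (-1) * q))"
    by (rule lborel_integrable_real_affine[OF f]) simp
  then have i: "integrable lborel (\<lambda>q. f q + f (- q))" using f by simp
  have "AE q in lborel. f q + f (- q) = exp (- a * \<bar>q\<bar>)"
    using AE_lborel_singleton[of 0]
    by eventually_elim (auto simp: f_def mult.commute split: split_indicator)
  from integrable_cong_AE[THEN iffD1, OF _ _ this i] show ?thesis by (simp add: f_def)
qed

lemma integrable_phi: "integrable lborel phi"
  by (rule Bochner_Integration.integrable_bound[OF integrable_mult_left[OF integrable_exp_abs[of "1/4"], of "1/2"]])
     (use phi_bounds(2) in auto)

text \<open>Tends to 1/2 at minus infinity and to 0 at plus infinity, hence integrable only after a
  step is removed. It appears when a product of two values of \<open>phi\<close> is multiplied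
  out.\<close>

definition chi :: "real \<Rightarrow> real" where "chi q = exp (q / 2) * om (exp q)"

lemma chi_measurable [measurable]: "chi \<in> borel_measurable borel"
  unfolding chi_def by measurable

lemma chi_phi: "chi q = exp (q / 4) * phi q + 1 / 2"
  by (simp add: chi_def phi_def algebra_simps flip: exp_add)

lemma chi_pos_bound:
  assumes "q \<ge> 0" shows "0 \<le> chi q" "chi q \<le> 2 * exp (- q / 2)"
proof -
  show "0 \<le> chi q" using om_nonneg[of "exp q"] by (simp add: chi_def)
  have "q \<le> exp q" using exp_ge_add_one_self[of q] by linarith
  also have "exp q \<le> pi * exp q" using mult_right_mono[of 1 pi "exp q"] pi_gt3 by simp
  finally have "exp (- (pi * exp q)) \<le> exp (- q)" by (simp only: exp_le_cancel_iff neg_le_iff_le)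
  then have "om (exp q) \<le> 2 * exp (- q)" using om_le_exp[of "exp q"] assms
    by (meson mult_left_mono one_le_exp_iff order_trans zero_le_numeral)
  then have "chi q \<le> exp (q / 2) * (2 * exp (- q))" unfolding chi_def by (rule mult_left_mono) simp
  also have "\<dots> = 2 * exp (- q / 2)" by (simp flip: exp_add)
  finally show "chi q \<le> 2 * exp (- q / 2)" .
qed

text \<open>For negative \<open>q\<close> the difference is \<open>exp (q / 4) * phi q\<close>, so
  the decay of \<open>phi\<close> carries over; for other \<open>q\<close> the exponential decay of
  \<open>om\<close> suffices.\<close>

lemma chi_cut_bound: "\<bar>chi q - indicator {..<0} q / 2\<bar> \<le> 2 * exp (- \<bar>q\<bar> / 2)"
proof (cases "q < 0")
  case True
  have "\<bar>chi q - indicator {..<0} q / 2\<bar> = exp (q / 4) * \<bar>phi q\<bar>" using True by (simp add: chi_phi abs_mult)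
  also have "\<dots> \<le> exp (q / 4) * (exp (- \<bar>q\<bar> / 4) / 2)" by (intro mult_left_mono phi_bounds) auto
  also have "\<dots> = exp (- \<bar>q\<bar> / 2) / 2" using True by (simp flip: exp_add)
  also have "\<dots> \<le> 2 * exp (- \<bar>q\<bar> / 2)" by simp
  finally show ?thesis .
next
  case False
  then have "\<bar>chi q - indicator {..<0} q / 2\<bar> = chi q" "\<bar>q\<bar> = q" using chi_pos_bound(1)[of q] by auto
  then show ?thesis using chi_pos_bound(2)[of q] False by (simp only:)
qed

lemma integrable_chi_cut: "integrable lborel (\<lambda>q. chi q - indicator {..<0} q / 2)"
proof (rule Bochner_Integration.integrable_bound)
  show "integrable lborel (\<lambda>q. 2 * exp (- (1/2) * \<bar>q::real\<bar>))"
    by (intro integrable_mult_right integrable_exp_abs) simp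
  show "AE q in lborel. norm (chi q - indicator {..<0} q / 2) \<le> norm (2 * exp (- (1/2) * \<bar>q\<bar>))"
  proof (rule AE_I2)
    fix q
    have "norm (2 * exp (- (1/2) * \<bar>q\<bar>)) = 2 * exp (- \<bar>q\<bar> / 2)" by simp
    then show "norm (chi q - indicator {..<0} q / 2) \<le> norm (2 * exp (- (1/2) * \<bar>q\<bar>))"
      unfolding real_norm_def[of "chi q - _"] by (metis chi_cut_bound)
  qed
  show "(\<lambda>q. chi q - indicator {..<0} q / 2) \<in> borel_measurable lborel" by measurable
qed

subsection \<open>Fourier inversion for nonnegative transforms\<close>

lemma integrable_pair_mult:
  fixes f g :: "real \<Rightarrow> 'a::{real_normed_algebra, banach, second_countable_topology}"
  assumes f: "integrable lborel f" and g: "integrable lborel g"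
  shows "integrable (lborel \<Otimes>\<^sub>M lborel) (\<lambda>p. f (fst p) * g (snd p))"
proof (rule lborel_pair.Fubini_integrable)
  have [measurable]: "f \<in> borel_measurable borel" "g \<in> borel_measurable borel"
    using f g by (auto dest: borel_measurable_integrable)
  show m: "(\<lambda>p. f (fst p) * g (snd p)) \<in> borel_measurable (lborel \<Otimes>\<^sub>M lborel)" by measurable
  have m2: "(\<lambda>p. norm (f (fst p) * g (snd p))) \<in> borel_measurable (lborel \<Otimes>\<^sub>M lborel)" by measurable
  have gi: "integrable lborel (\<lambda>y. f x * g y)" for x using g by (rule integrable_mult_right)
  then show "AE x in lborel. integrable lborel (\<lambda>y. f (fst (x, y)) * g (snd (x, y)))" by simp
  have "norm (LBINT y. norm (f x * g y)) \<le> norm (norm (f x) * (LBINT y. norm (g y)))" for x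
  proof -
    have "(LBINT y. norm (f x * g y)) \<le> (LBINT y. norm (f x) * norm (g y))"
      using gi g by (intro integral_mono integrable_norm integrable_mult_right norm_mult_ineq) auto
    also have "\<dots> = norm (f x) * (LBINT y. norm (g y))" by simp
    finally show ?thesis by simp
  qed
  moreover have "(\<lambda>x. LBINT y. norm (f x * g y)) \<in> borel_measurable lborel"
    using lborel.borel_measurable_lebesgue_integral[of "\<lambda>x y. norm (f x * g y)" lborel] by measurable
  ultimately show "integrable lborel (\<lambda>x. LBINT y. norm (f (fst (x, y)) * g (snd (x, y))))"
    using f by (intro Bochner_Integration.integrable_bound[OF integrable_mult_left[OF integrable_norm[OF f], of "LBINT y. norm (g y)"]]) auto
qed

lemma gaussian_fourier:
  assumes "e > 0"
  shows "(LBINT k. complex_of_real (exp (- e * k\<^sup>2)) * iexp (k * b)) = of_real (sqrt (pi / e) * exp (- b\<^sup>2 / (4 * e)))"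
  using gaussian_integrable(3)[OF assms, of b] by (simp only: mult.commute[of b])

text \<open>Nonnegativity of the transform makes it integrable, by monotone convergence in the
  Gaussian-regularised inversion formula.\<close>

theorem fourier_inversion_nonneg:
  fixes f F :: "real \<Rightarrow> real"
  assumes fi: "integrable lborel f" and fc: "continuous_on UNIV f" and fb: "\<And>x. \<bar>f x\<bar> \<le> B"
    and F: "\<And>k. (LBINT x. complex_of_real (f x) * iexp (k * x)) = of_real (F k)"
    and F0: "\<And>k. 0 \<le> F k"
  shows "integrable lborel F"
    and "(LBINT k. complex_of_real (F k) * iexp (- (k * z))) = of_real (2 * pi * f z)"
proof -
  have [measurable]: "f \<in> borel_measurable borel" using fi by (auto dest: borel_measurable_integrable)
  have B: "0 \<le> B" using fb[of 0] by linarith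
  have Fm[measurable]: "F \<in> borel_measurable borel"
  proof -
    have "F k = Re (LBINT x. complex_of_real (f x) * iexp (k * x))" for k using F[of k] by simp
    moreover have "(\<lambda>k. LBINT x. complex_of_real (f x) * iexp (k * x)) \<in> borel_measurable borel"
      using lborel.borel_measurable_lebesgue_integral[of "\<lambda>k x. complex_of_real (f x) * iexp (k * x)" borel]
      by measurable
    ultimately show ?thesis by (simp add: borel_measurable_Re cong: measurable_cong)
  qed
  \<comment> \<open>Fubini and the transform of the Gaussian turn the regularised inverse into an
    average of \<open>f\<close> over a Gaussian of width proportional to \<open>sqrt e\<close>
    around \<open>z\<close>.\<close>
  have key: "(LBINT k. complex_of_real (F k * exp (- e * k\<^sup>2)) * iexp (- (k * z)))
     = of_real (2 * sqrt pi * (LBINT y. f (z + 2 * sqrt e * y) * exp (- y\<^sup>2)))" if e: "e > 0" for e z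
  proof -
    have gi: "integrable lborel (\<lambda>k. complex_of_real (exp (- e * k\<^sup>2)) * iexp (- (k * z)))"
      using gaussian_integrable(2)[OF e, of "- z"] by (simp add: mult.commute[of z])
    have fi': "integrable lborel (\<lambda>x. complex_of_real (f x))" using fi by simp
    have P: "integrable (lborel \<Otimes>\<^sub>M lborel) (\<lambda>(x, k). complex_of_real (f x) * iexp (k * x) * (complex_of_real (exp (- e * k\<^sup>2)) * iexp (- (k * z))))"
      by (rule Bochner_Integration.integrable_bound[OF integrable_pair_mult[OF fi' gi]])
         (auto simp: norm_mult)
    have "(LBINT k. complex_of_real (F k * exp (- e * k\<^sup>2)) * iexp (- (k * z)))
      = (LBINT k. LBINT x. complex_of_real (f x) * iexp (k * x) * (complex_of_real (exp (- e * k\<^sup>2)) * iexp (- (k * z))))"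
      unfolding integral_mult_left_zero F by (simp add: mult.assoc)
    also have "\<dots> = (LBINT x. LBINT k. complex_of_real (f x) * iexp (k * x) * (complex_of_real (exp (- e * k\<^sup>2)) * iexp (- (k * z))))"
      by (rule lborel_pair.Fubini_integral[OF P])
    also have "\<dots> = (LBINT x. complex_of_real (f x) * (LBINT k. complex_of_real (exp (- e * k\<^sup>2)) * iexp (k * (x - z))))"
      by (subst integral_mult_right_zero[symmetric])
         (simp add: right_diff_distrib exp_diff exp_minus field_simps)
    also have "\<dots> = (LBINT x. complex_of_real (f x * (sqrt (pi / e) * exp (- (x - z)\<^sup>2 / (4 * e)))))"
      unfolding gaussian_fourier[OF e] by simp
    also have "\<dots> = of_real (LBINT x. f x * (sqrt (pi / e) * exp (- (x - z)\<^sup>2 / (4 * e))))"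
      by (rule integral_complex_of_real)
    also have "(LBINT x. f x * (sqrt (pi / e) * exp (- (x - z)\<^sup>2 / (4 * e))))
       = 2 * sqrt e * (LBINT y. f (z + 2 * sqrt e * y) * (sqrt (pi / e) * exp (- (z + 2 * sqrt e * y - z)\<^sup>2 / (4 * e))))"
      using e by (subst lborel_integral_real_affine[of "2 * sqrt e" _ z]) auto
    also have "\<dots> = 2 * sqrt pi * (LBINT y. f (z + 2 * sqrt e * y) * exp (- y\<^sup>2))"
      using e by (simp add: power_mult_distrib real_sqrt_divide flip: integral_mult_right_zero) (simp add: mult_ac)
    finally show ?thesis .
  qed
  define E where "E n = 1 / real (Suc n)" for n
  have E: "E n > 0" for n by (simp add: E_def)
  have E0: "E \<longlonglongrightarrow> 0" unfolding E_def by real_asymp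
  have G1: "integrable lborel (\<lambda>y::real. exp (- y\<^sup>2))" using gaussian_integrable(1)[of 1] by simp
  have G2: "(LBINT y::real. exp (- y\<^sup>2)) = sqrt pi"
  proof -
    have "complex_of_real (LBINT y::real. exp (- y\<^sup>2)) = of_real (sqrt pi)"
      using gaussian_fourier[of 1 0] by (simp del: of_real_exp)
    then show ?thesis by (simp only: of_real_eq_iff)
  qed
  have lim: "(\<lambda>n. LBINT y. f (z + 2 * sqrt (E n) * y) * exp (- y\<^sup>2)) \<longlonglongrightarrow> (LBINT y. f z * exp (- y\<^sup>2))" for z
  proof (rule integral_dominated_convergence[where w = "\<lambda>y. B * exp (- y\<^sup>2)"])
    show "AE y in lborel. (\<lambda>n. f (z + 2 * sqrt (E n) * y) * exp (- y\<^sup>2)) \<longlonglongrightarrow> f z * exp (- y\<^sup>2)"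
    proof (rule AE_I2)
      fix y
      have "(\<lambda>n. z + 2 * sqrt (E n) * y) \<longlonglongrightarrow> z + 2 * sqrt 0 * y" by (intro tendsto_intros E0)
      then have "(\<lambda>n. f (z + 2 * sqrt (E n) * y)) \<longlonglongrightarrow> f z"
        using continuous_on_tendsto_compose[OF fc] by simp
      then show "(\<lambda>n. f (z + 2 * sqrt (E n) * y) * exp (- y\<^sup>2)) \<longlonglongrightarrow> f z * exp (- y\<^sup>2)" by (intro tendsto_intros)
    qed
  qed (use G1 fb in \<open>auto simp: abs_mult intro!: mult_right_mono\<close>)
  have Fe: "integrable lborel (\<lambda>k. F k * exp (- e * k\<^sup>2))" "(LBINT k. F k * exp (- e * k\<^sup>2)) \<le> 2 * pi * B" if e: "e > 0" for e
  proof -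
    have bF: "\<bar>F k\<bar> \<le> (LBINT x. \<bar>f x\<bar>)" for k
    proof -
      have "\<bar>F k\<bar> = norm (LBINT x. complex_of_real (f x) * iexp (k * x))" unfolding F by simp
      also have "\<dots> \<le> (LBINT x. norm (complex_of_real (f x) * iexp (k * x)))" by (rule integral_norm_bound)
      finally show ?thesis by (simp add: norm_mult)
    qed
    show i: "integrable lborel (\<lambda>k. F k * exp (- e * k\<^sup>2))"
      by (rule Bochner_Integration.integrable_bound[OF integrable_mult_right[OF gaussian_integrable(1)[OF e], of "LBINT x. \<bar>f x\<bar>"]])
         (use bF in \<open>auto simp: abs_mult intro!: mult_right_mono order_trans[OF bF]\<close>)
    have "complex_of_real (LBINT k. F k * exp (- e * k\<^sup>2)) = of_real (2 * sqrt pi * (LBINT y. f (2 * sqrt e * y) * exp (- y\<^sup>2)))"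
      using key[OF e, of 0] by (simp del: of_real_mult)
    then have "(LBINT k. F k * exp (- e * k\<^sup>2)) = 2 * sqrt pi * (LBINT y. f (2 * sqrt e * y) * exp (- y\<^sup>2))"
      by (simp only: of_real_eq_iff)
    also have "\<dots> \<le> 2 * sqrt pi * (LBINT y. B * exp (- y\<^sup>2))"
    proof (intro mult_left_mono integral_mono integrable_mult_right G1)
      show "integrable lborel (\<lambda>y. f (2 * sqrt e * y) * exp (- y\<^sup>2))"
        by (rule Bochner_Integration.integrable_bound[OF integrable_mult_right[OF G1, of B]])
           (use fb B in \<open>auto simp: abs_mult intro!: mult_right_mono\<close>)
      show "f (2 * sqrt e * y) * exp (- y\<^sup>2) \<le> B * exp (- y\<^sup>2)" for y
        using fb[of "2 * sqrt e * y"] by (intro mult_right_mono) auto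
    qed auto
    also have "\<dots> = 2 * pi * B" by (simp add: G2)
    finally show "(LBINT k. F k * exp (- e * k\<^sup>2)) \<le> 2 * pi * B" .
  qed
  have limF: "(\<lambda>n. F k * exp (- E n * k\<^sup>2)) \<longlonglongrightarrow> F k" for k
  proof -
    have "(\<lambda>n. F k * exp (- E n * k\<^sup>2)) \<longlonglongrightarrow> F k * exp (- 0 * k\<^sup>2)" by (intro tendsto_intros E0)
    then show ?thesis by simp
  qed
  \<comment> \<open>At \<open>z = 0\<close> the regularised integrals are at most
    \<open>2 * pi * B\<close> for every \<open>e\<close>; Fatou's lemma passes this bound on to
    \<open>F\<close>.\<close>
  show FI: "integrable lborel F"
  proof (rule integrableI_nonneg)
    have "(\<integral>\<^sup>+k. ennreal (F k) \<partial>lborel) = (\<integral>\<^sup>+k. liminf (\<lambda>n. ennreal (F k * exp (- E n * k\<^sup>2))) \<partial>lborel)"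
      using limF by (intro nn_integral_cong lim_imp_Liminf[symmetric] tendsto_ennrealI) auto
    also have "\<dots> \<le> liminf (\<lambda>n. \<integral>\<^sup>+k. ennreal (F k * exp (- E n * k\<^sup>2)) \<partial>lborel)"
      by (rule nn_integral_liminf) measurable
    also have "\<dots> \<le> ennreal (2 * pi * B)"
    proof (rule Liminf_le)
      show "\<forall>\<^sub>F n in sequentially. (\<integral>\<^sup>+k. ennreal (F k * exp (- E n * k\<^sup>2)) \<partial>lborel) \<le> ennreal (2 * pi * B)"
        using Fe[OF E] F0 by (intro always_eventually allI) (simp add: nn_integral_eq_integral ennreal_leI)
    qed simp
    also have "\<dots> < \<infinity>" by simp
    finally show "(\<integral>\<^sup>+k. ennreal (F k) \<partial>lborel) < \<infinity>" .
  qed (use F0 in auto)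
  have "(\<lambda>n. LBINT k. complex_of_real (F k * exp (- E n * k\<^sup>2)) * iexp (- (k * z)))
     \<longlonglongrightarrow> (LBINT k. complex_of_real (F k) * iexp (- (k * z)))"
  proof (rule integral_dominated_convergence[where w = F])
    show "AE k in lborel. (\<lambda>n. complex_of_real (F k * exp (- E n * k\<^sup>2)) * iexp (- (k * z))) \<longlonglongrightarrow> complex_of_real (F k) * iexp (- (k * z))"
      by (intro AE_I2 tendsto_mult_right tendsto_of_real limF)
    show "AE k in lborel. norm (complex_of_real (F k * exp (- E n * k\<^sup>2)) * iexp (- (k * z))) \<le> F k" for n
      using F0 less_imp_le[OF E] by (intro AE_I2) (auto simp: norm_mult intro!: mult_left_le)
  qed (use FI in auto)
  moreover have "(\<lambda>n. complex_of_real (2 * sqrt pi * (LBINT y. f (z + 2 * sqrt (E n) * y) * exp (- y\<^sup>2))))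
     \<longlonglongrightarrow> of_real (2 * sqrt pi * (f z * sqrt pi))"
    using lim[of z] by (intro tendsto_of_real tendsto_mult_left) (simp add: G2)
  ultimately have "(LBINT k. complex_of_real (F k) * iexp (- (k * z))) = of_real (2 * sqrt pi * (f z * sqrt pi))"
    unfolding key[OF E] by (rule LIMSEQ_unique)
  then show "(LBINT k. complex_of_real (F k) * iexp (- (k * z))) = of_real (2 * pi * f z)"
    by (simp add: mult.left_commute flip: of_real_mult)
qed

section \<open>The self-convolution of \<open>phi\<close> and its transform\<close>

lemma convolution_fourier:
  fixes f g :: "real \<Rightarrow> real"
  assumes f: "integrable lborel f" and g: "integrable lborel g"
  shows "integrable lborel (\<lambda>z. LBINT r. f r * g (z - r))"
    and "(LBINT z. complex_of_real (LBINT r. f r * g (z - r)) * iexp (k * z))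
      = (LBINT x. complex_of_real (f x) * iexp (k * x)) * (LBINT x. complex_of_real (g x) * iexp (k * x))"
proof -
  have [measurable]: "f \<in> borel_measurable borel" "g \<in> borel_measurable borel"
    using f g by (auto dest: borel_measurable_integrable)
  have gs: "integrable lborel (\<lambda>z. g (z - r))" "(LBINT z. \<bar>g (z - r)\<bar>) = (LBINT z. \<bar>g z\<bar>)" for r
    using lborel_integrable_real_affine[OF g, of 1 "- r"] lborel_integral_real_affine[of 1 "\<lambda>z. \<bar>g z\<bar>" "- r"]
    by simp_all
  have P: "integrable (lborel \<Otimes>\<^sub>M lborel) (\<lambda>p. f (fst p) * g (snd p - fst p))"
  proof (rule lborel_pair.Fubini_integrable)
    show "(\<lambda>p. f (fst p) * g (snd p - fst p)) \<in> borel_measurable (lborel \<Otimes>\<^sub>M lborel)" by measurable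
    show "integrable lborel (\<lambda>x. LBINT y. norm (f (fst (x, y)) * g (snd (x, y) - fst (x, y))))"
      using f by (simp add: abs_mult gs(2))
    show "AE x in lborel. integrable lborel (\<lambda>y. f (fst (x, y)) * g (snd (x, y) - fst (x, y)))"
      using gs(1) by simp
  qed
  show "integrable lborel (\<lambda>z. LBINT r. f r * g (z - r))"
    using lborel_pair.integrable_fst'[OF lborel_pair.integrable_product_swap[OF P]]
    by (simp add: case_prod_unfold)
  have Pc: "integrable (lborel \<Otimes>\<^sub>M lborel) (\<lambda>(r, z). complex_of_real (f r * g (z - r)) * iexp (k * z))"
    by (rule Bochner_Integration.integrable_bound[OF P]) (auto simp: norm_mult abs_mult)
  have "(LBINT z. complex_of_real (LBINT r. f r * g (z - r)) * iexp (k * z))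
     = (LBINT z. LBINT r. complex_of_real (f r * g (z - r)) * iexp (k * z))"
    by (simp del: of_real_mult)
  also have "\<dots> = (LBINT r. LBINT z. complex_of_real (f r * g (z - r)) * iexp (k * z))"
    by (rule lborel_pair.Fubini_integral[OF Pc])
  also have "\<dots> = (LBINT r. complex_of_real (f r) * iexp (k * r) * (LBINT x. complex_of_real (g x) * iexp (k * x)))"
  proof (rule Bochner_Integration.integral_cong[OF refl])
    fix r
    have "(LBINT x. complex_of_real (g x) * iexp (k * x)) = (LBINT z. complex_of_real (g (- r + 1 * z)) * iexp (k * (- r + 1 * z)))"
      by (subst lborel_integral_real_affine[of 1 _ "- r"]) auto
    then show "(LBINT z. complex_of_real (f r * g (z - r)) * iexp (k * z)) =
        complex_of_real (f r) * iexp (k * r) * (LBINT x. complex_of_real (g x) * iexp (k * x))"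
      by (simp flip: integral_mult_right_zero) (simp add: algebra_simps flip: exp_add)
  qed
  also have "\<dots> = (LBINT x. complex_of_real (f x) * iexp (k * x)) * (LBINT x. complex_of_real (g x) * iexp (k * x))"
    by (rule integral_mult_left_zero)
  finally show "(LBINT z. complex_of_real (LBINT r. f r * g (z - r)) * iexp (k * z))
      = (LBINT x. complex_of_real (f x) * iexp (k * x)) * (LBINT x. complex_of_real (g x) * iexp (k * x))" .
qed

definition phi_conv :: "real \<Rightarrow> real" where
  "phi_conv z = (LBINT r. phi r * phi (z - r))"

text \<open>The real part loses nothing: \<open>phi\<close> is real and even, so its transform
  equals its own conjugate, as \<open>phi_hat_eq\<close> records.\<close>

definition phi_hat :: "real \<Rightarrow> real" where
  "phi_hat k = Re (LBINT q. complex_of_real (phi q) * iexp (k * q))"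

lemma phi_hat_eq: "(LBINT q. complex_of_real (phi q) * iexp (k * q)) = of_real (phi_hat k)"
proof -
  let ?I = "LBINT q. complex_of_real (phi q) * iexp (k * q)"
  have "?I = (LBINT q. complex_of_real (phi (0 + (-1) * q)) * iexp (k * (0 + (-1) * q)))"
    by (subst lborel_integral_real_affine[of "-1" _ 0]) auto
  also have "\<dots> = (LBINT q. cnj (complex_of_real (phi q) * iexp (k * q)))"
    by (simp add: phi_even exp_cnj)
  also have "\<dots> = cnj ?I" by (rule Bochner_Integration.integral_cnj)
  finally have "Im ?I = Im (cnj ?I)" by metis
  then have "Im ?I = 0" by simp
  then show ?thesis unfolding phi_hat_def by (simp add: complex_eq_iff)
qed

lemma phi_hat_even: "phi_hat (- k) = phi_hat k"
proof -
  have "complex_of_real (phi_hat (- k)) = (LBINT q. complex_of_real (phi (0 + (-1) * q)) * iexp (- k * (0 + (-1) * q)))"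
    unfolding phi_hat_eq[symmetric] by (subst lborel_integral_real_affine[of "-1" _ 0]) auto
  also have "\<dots> = of_real (phi_hat k)" unfolding phi_hat_eq[symmetric] by (simp add: phi_even)
  finally show ?thesis by (simp only: of_real_eq_iff)
qed

lemma phi_le_half: "\<bar>phi q\<bar> \<le> 1 / 2"
  using phi_bounds(2)[of q] by (rule order_trans) simp

lemma phi_conv_bounds: "0 \<le> phi_conv z" "\<bar>phi_conv z\<bar> \<le> (LBINT r. \<bar>phi r\<bar>) / 2"
  and integrable_phi_mult: "integrable lborel (\<lambda>r. phi r * phi (z - r))"
proof -
  have le: "\<bar>phi r * phi (z - r)\<bar> \<le> \<bar>phi r\<bar> * (1 / 2)" for r
    unfolding abs_mult by (intro mult_left_mono phi_le_half) auto
  show i: "integrable lborel (\<lambda>r. phi r * phi (z - r))"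
    by (rule Bochner_Integration.integrable_bound[OF integrable_mult_left[OF integrable_abs[OF integrable_phi], of "1/2"]])
       (use le in auto)
  show nn: "0 \<le> phi_conv z"
  proof -
    have "0 \<le> phi r * phi (z - r)" for r
      by (rule mult_nonpos_nonpos[OF phi_bounds(1) phi_bounds(1)])
    then show ?thesis unfolding phi_conv_def by (intro integral_nonneg_AE AE_I2)
  qed
  have j: "integrable lborel (\<lambda>r. \<bar>phi r\<bar> * (1 / 2))"
    by (intro integrable_mult_left integrable_abs integrable_phi)
  have "phi r * phi (z - r) \<le> \<bar>phi r\<bar> * (1 / 2)" for r
    using le[of r] by linarith
  then have "phi_conv z \<le> (LBINT r. \<bar>phi r\<bar> * (1 / 2))"
    unfolding phi_conv_def by (rule integral_mono[OF i j])
  then show "\<bar>phi_conv z\<bar> \<le> (LBINT r. \<bar>phi r\<bar>) / 2" using nn by simp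
qed

lemma continuous_phi_conv: "continuous_on UNIV phi_conv"
  unfolding continuous_on_sequentially
proof (intro ballI allI impI)
  fix x :: real and z :: "nat \<Rightarrow> real" assume "x \<in> UNIV" and "(\<forall>n. z n \<in> UNIV) \<and> z \<longlonglongrightarrow> x"
  then have z: "z \<longlonglongrightarrow> x" by simp
  have "(\<lambda>n. LBINT r. phi r * phi (z n - r)) \<longlonglongrightarrow> (LBINT r. phi r * phi (x - r))"
  proof (rule integral_dominated_convergence[where w = "\<lambda>r. \<bar>phi r\<bar> * (1 / 2)"])
    show "AE r in lborel. (\<lambda>n. phi r * phi (z n - r)) \<longlonglongrightarrow> phi r * phi (x - r)"
      by (intro AE_I2 tendsto_mult_left continuous_on_tendsto_compose[OF continuous_phi] tendsto_diff z) auto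
    show "AE r in lborel. norm (phi r * phi (z n - r)) \<le> \<bar>phi r\<bar> * (1 / 2)" for n
      unfolding real_norm_def abs_mult by (intro AE_I2 mult_left_mono phi_le_half) auto
  qed (use integrable_phi in auto)
  then show "(phi_conv \<circ> z) \<longlonglongrightarrow> phi_conv x" by (simp add: phi_conv_def o_def)
qed

text \<open>The transform of the self-convolution is the square of the real number
  \<open>phi_hat k\<close>, so \<open>fourier_inversion_nonneg\<close> applies, and integrability of
  the square is part of its conclusion.\<close>

lemma
  shows integrable_phi_hat_square: "integrable lborel (\<lambda>k. (phi_hat k)\<^sup>2)"
    and phi_conv_inversion:
      "(LBINT k. complex_of_real ((phi_hat k)\<^sup>2) * iexp (- (k * z))) = of_real (2 * pi * phi_conv z)"
proof -
  have i: "integrable lborel phi_conv"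
    unfolding phi_conv_def[abs_def] by (rule convolution_fourier(1)[OF integrable_phi integrable_phi])
  have F: "(LBINT x. complex_of_real (phi_conv x) * iexp (k * x)) = of_real ((phi_hat k)\<^sup>2)" for k
    using convolution_fourier(2)[OF integrable_phi integrable_phi, of k]
    unfolding phi_hat_eq phi_conv_def by (simp add: power2_eq_square)
  note * = fourier_inversion_nonneg[OF i continuous_phi_conv phi_conv_bounds(2) F zero_le_power2]
  show "integrable lborel (\<lambda>k. (phi_hat k)\<^sup>2)" by (rule *(1))
  show "(LBINT k. complex_of_real ((phi_hat k)\<^sup>2) * iexp (- (k * z))) = of_real (2 * pi * phi_conv z)" by (rule *(2))
qed

subsection \<open>Logarithmic moments of the Gamma integral\<close>

lemma Gamma_integral_exp_real:
  assumes "s > 0"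
  shows "has_bochner_integral lborel (\<lambda>q::real. exp (s * q - exp q)) (Gamma s)"
proof -
  have "has_bochner_integral lborel (\<lambda>q::real. exp (complex_of_real s * of_real q) * of_real (exp (- exp q))) (Gamma (complex_of_real s))"
    by (rule Gamma_integral_exp) (use assms in simp)
  then have "has_bochner_integral lborel (\<lambda>q::real. Re (exp (complex_of_real s * of_real q) * of_real (exp (- exp q)))) (Re (Gamma (complex_of_real s)))"
    by (rule has_bochner_integral_bounded_linear[OF bounded_linear_Re])
  moreover have "Re (exp (complex_of_real s * of_real q) * of_real (exp (- exp q))) = exp (s * q - exp q)" for q
    by (simp add: exp_diff exp_minus field_simps Re_exp del: of_real_exp exp_of_real)
  ultimately show ?thesis by (simp add: Gamma_complex_of_real)
qed

text \<open>A majorant, uniform in \<open>h\<close>, of the difference quotient of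
  \<open>exp (h * q)\<close> at 0. One \<open>d\<close> in the exponent pays for the factor
  \<open>q\<close>, the other for the exponential of \<open>h * q\<close>; it allows differentiation
  under the Gamma integral.\<close>

lemma exp_quotient_bound:
  fixes q h d :: real
  assumes "0 < h" "h \<le> d"
  shows "\<bar>(exp (h * q) - 1) / h\<bar> \<le> (exp (2 * d * q) + exp (- (2 * d * q))) / d"
proof -
  have d: "d > 0" using assms by simp
  have A: "\<bar>exp x - 1\<bar> \<le> \<bar>x\<bar> * exp \<bar>x\<bar>" for x :: real
  proof (cases "x \<ge> 0")
    case True
    have "1 - x \<le> exp (- x)" using exp_ge_add_one_self[of "- x"] by simp
    then have "(1 - x) * exp x \<le> exp (- x) * exp x" by (rule mult_right_mono) simp
    then have "exp x - 1 \<le> x * exp x" by (simp add: algebra_simps flip: exp_add)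
    then show ?thesis using True by simp
  next
    case False
    have "1 - exp x \<le> - x" using exp_ge_add_one_self[of x] by linarith
    also have "\<dots> \<le> - x * exp (- x)" using False by (simp add: mult_le_cancel_left1)
    finally show ?thesis using False by simp
  qed
  have "\<bar>(exp (h * q) - 1) / h\<bar> \<le> (\<bar>h * q\<bar> * exp \<bar>h * q\<bar>) / h"
    using A[of "h * q"] assms by (simp add: divide_right_mono)
  also have "\<dots> = \<bar>q\<bar> * exp (h * \<bar>q\<bar>)" using assms by (simp add: abs_mult)
  also have "\<dots> \<le> (exp (d * \<bar>q\<bar>) / d) * exp (d * \<bar>q\<bar>)"
  proof (intro mult_mono)
    have "d * \<bar>q\<bar> \<le> exp (d * \<bar>q\<bar>)" using exp_ge_add_one_self[of "d * \<bar>q\<bar>"] by linarith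
    then show "\<bar>q\<bar> \<le> exp (d * \<bar>q\<bar>) / d" using d by (simp add: field_simps)
    show "exp (h * \<bar>q\<bar>) \<le> exp (d * \<bar>q\<bar>)" using assms by (simp add: mult_right_mono)
  qed (use d in auto)
  also have "\<dots> = exp (2 * d * \<bar>q\<bar>) / d" by (simp flip: exp_add)
  also have "\<dots> \<le> (exp (2 * d * q) + exp (- (2 * d * q))) / d"
    using d by (intro divide_right_mono) (auto simp: abs_if)
  finally show ?thesis .
qed

text \<open>Derivative of the Gamma integral with respect to its parameter. With
  \<open>d = s / 4\<close> the exponents \<open>s - 2 * d\<close> and \<open>s + 2 * d\<close> of
  the majorant are positive, so the majorant is a sum of Gamma integrals.\<close>

lemma log_Gamma_integral:
  assumes s: "s > 0"
  shows "has_bochner_integral lborel (\<lambda>q::real. q * exp (s * q - exp q)) (Gamma s * Digamma s)"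
proof -
  define d where "d = s / 4"
  define h where "h n = d / real (Suc n)" for n
  have d: "d > 0" using s by (simp add: d_def)
  have h: "0 < h n" "h n \<le> d" for n using d by (auto simp: h_def field_simps)
  have h0: "h \<longlonglongrightarrow> 0" unfolding h_def using d by real_asymp
  have hat: "filterlim h (at 0) sequentially"
    using h0 h(1) by (auto simp: filterlim_at intro!: always_eventually) (metis less_irrefl)
  define W where "W q = (exp ((s + 2 * d) * q - exp q) + exp ((s - 2 * d) * q - exp q)) / d" for q :: real
  have Wi: "integrable lborel W" unfolding W_def
    using Gamma_integral_exp_real[of "s + 2 * d"] Gamma_integral_exp_real[of "s - 2 * d"] s d
    by (intro integrable_divide_zero impI Bochner_Integration.integrable_add) (auto simp: d_def has_bochner_integral_iff)
  define f where "f n q = exp (s * q - exp q) * ((exp (h n * q) - 1) / h n)" for n and q :: real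
  have [measurable]: "f n \<in> borel_measurable borel" for n unfolding f_def by measurable
  have fb: "\<bar>f n q\<bar> \<le> W q" for n q
  proof -
    have "\<bar>f n q\<bar> \<le> exp (s * q - exp q) * ((exp (2 * d * q) + exp (- (2 * d * q))) / d)"
      unfolding f_def abs_mult using exp_quotient_bound[OF h(1)[of n] h(2), of q] by (intro mult_mono) auto
    also have "\<dots> = W q" by (simp add: W_def field_simps flip: exp_add)
    finally show ?thesis .
  qed
  have fl: "(\<lambda>n. f n q) \<longlonglongrightarrow> q * exp (s * q - exp q)" for q
  proof -
    have "((\<lambda>x. exp (x * q)) has_real_derivative q * exp (0 * q)) (at 0)" by (auto intro!: derivative_eq_intros)
    then have "((\<lambda>x. (exp (x * q) - 1) / x) \<longlongrightarrow> q) (at 0)" by (simp add: has_field_derivative_iff)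
    then have "(\<lambda>n. (exp (h n * q) - 1) / h n) \<longlonglongrightarrow> q" by (rule filterlim_compose[OF _ hat])
    then show ?thesis unfolding f_def mult.commute[of q] by (rule tendsto_mult_left)
  qed
  have lim1: "(\<lambda>n. LBINT q. f n q) \<longlonglongrightarrow> (LBINT q. q * exp (s * q - exp q))"
    by (rule integral_dominated_convergence[where w = W]) (use Wi fb fl in auto)
  have i: "integrable lborel (\<lambda>q. q * exp (s * q - exp q))"
    by (rule integrable_dominated_convergence[where w = W and s = f]) (use Wi fb fl in auto)
  have fI: "(LBINT q. f n q) = (Gamma (s + h n) - Gamma s) / h n" for n
  proof -
    have e: "f n q = (exp ((s + h n) * q - exp q) - exp (s * q - exp q)) / h n" for q
      unfolding f_def by (simp add: right_diff_distrib distrib_right flip: exp_add)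
    show ?thesis unfolding e
      using Gamma_integral_exp_real[of "s + h n"] Gamma_integral_exp_real[of s] s h(1)[of n]
      by (auto simp: has_bochner_integral_iff)
  qed
  have "(Gamma has_real_derivative Gamma s * Digamma s) (at s)"
    using s by (auto intro!: derivative_eq_intros elim!: nonpos_Ints_cases)
  then have "((\<lambda>x. (Gamma (s + x) - Gamma s) / x) \<longlongrightarrow> Gamma s * Digamma s) (at 0)" unfolding DERIV_def .
  then have "(\<lambda>n. (Gamma (s + h n) - Gamma s) / h n) \<longlonglongrightarrow> Gamma s * Digamma s" by (rule filterlim_compose[OF _ hat])
  then have "(LBINT q. q * exp (s * q - exp q)) = Gamma s * Digamma s"
    using lim1 unfolding fI by (metis LIMSEQ_unique)
  with i show ?thesis by (simp add: has_bochner_integral_iff)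
qed

section \<open>The regularised integral of \<open>chi\<close>\<close>

text \<open>A complementary error function. \<open>gauss_tail (exp (q / 2))\<close> has the same
  limits 1/2 and 0 at the two ends as \<open>chi q\<close>, and serves as its comparison function:
  an integral of the Gaussian against a sum of its values.\<close>

definition gauss_tail :: "real \<Rightarrow> real" where
  "gauss_tail x = (LBINT r:{x<..}. exp (- pi * r\<^sup>2))"

lemma gauss_pi_set_integrable:
  assumes "A \<in> sets borel" shows "set_integrable lborel A (\<lambda>r. exp (- pi * r\<^sup>2))"
  using assms unfolding set_integrable_def
  by (intro integrable_mult_indicator gaussian_integrable(1)) auto

lemma gauss_tail_diff:
  assumes "0 \<le> x" "x \<le> y"
  shows "0 \<le> gauss_tail x - gauss_tail y" "gauss_tail x - gauss_tail y \<le> (y - x) * exp (- pi * x\<^sup>2)"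
proof -
  have "{x<..} = {x<..y} \<union> {y<..}" using assms by auto
  then have "gauss_tail x = (LBINT r:({x<..y} \<union> {y<..}). exp (- pi * r\<^sup>2))" by (simp add: gauss_tail_def)
  also have "\<dots> = (LBINT r:{x<..y}. exp (- pi * r\<^sup>2)) + gauss_tail y"
    unfolding gauss_tail_def by (intro set_integral_Un gauss_pi_set_integrable) auto
  finally have e: "gauss_tail x - gauss_tail y = (LBINT r:{x<..y}. exp (- pi * r\<^sup>2))" by simp
  show "0 \<le> gauss_tail x - gauss_tail y" unfolding e set_lebesgue_integral_def
    by (intro integral_nonneg_AE AE_I2) simp
  have c: "set_integrable lborel {x<..y} (\<lambda>_. exp (- pi * x\<^sup>2))"
    using assms unfolding set_integrable_def by (auto intro!: integrable_mult_left integrable_real_indicator)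
  have "(LBINT r:{x<..y}. exp (- pi * r\<^sup>2)) \<le> (LBINT r:{x<..y}. exp (- pi * x\<^sup>2))"
    using assms by (intro set_integral_mono gauss_pi_set_integrable c) (auto intro!: mult_left_mono power_mono)
  also have "\<dots> = (y - x) * exp (- pi * x\<^sup>2)" using assms by (simp add: set_lebesgue_integral_def)
  finally show "gauss_tail x - gauss_tail y \<le> (y - x) * exp (- pi * x\<^sup>2)" unfolding e .
qed

lemma gauss_tail_tendsto_0:
  assumes "filterlim X at_top sequentially" shows "(\<lambda>n. gauss_tail (X n)) \<longlonglongrightarrow> 0"
proof -
  have "(\<lambda>n. LBINT r. indicator {X n<..} r *\<^sub>R exp (- pi * r\<^sup>2)) \<longlonglongrightarrow> (LBINT r::real. 0)"
  proof (rule integral_dominated_convergence[where w = "\<lambda>r. exp (- pi * r\<^sup>2)"])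
    show "AE r in lborel. (\<lambda>n. indicator {X n<..} r *\<^sub>R exp (- pi * r\<^sup>2)) \<longlonglongrightarrow> 0"
    proof (intro AE_I2 tendsto_eventually)
      fix r
      have "\<forall>\<^sub>F n in sequentially. r \<le> X n" using assms by (simp add: filterlim_at_top)
      then show "\<forall>\<^sub>F n in sequentially. indicator {X n<..} r *\<^sub>R exp (- pi * r\<^sup>2) = 0"
        by eventually_elim (simp add: indicator_def)
    qed
  qed (auto simp: gaussian_integrable(1)[OF pi_gt_zero, simplified] split: split_indicator)
  then show ?thesis by (simp add: gauss_tail_def set_lebesgue_integral_def)
qed

text \<open>The cost of moving the cut-off of a half-line from 0 to \<open>a\<close>, with the right
  sign for either sign of \<open>a\<close>. Cut-offs are shifted by logarithms, and logarithms
  thereby enter the values of regularised integrals.\<close>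

lemma half_line_difference:
  fixes a :: real
  defines "f \<equiv> (\<lambda>q. (if q < a then 1 else 0) - (if q < 0 then 1 else 0 :: real))"
  shows "has_bochner_integral lborel f a" "(LBINT q. \<bar>f q\<bar>) = \<bar>a\<bar>"
proof -
  have "has_bochner_integral lborel f a \<and> (LBINT q. \<bar>f q\<bar>) = \<bar>a\<bar>"
  proof (cases "a \<ge> 0")
    case True
    then have "f = indicator {0..<a}" by (auto simp: f_def fun_eq_iff split: split_indicator)
    then show ?thesis using True by (simp add: has_bochner_integral_iff)
  next
    case False
    then have "f = (\<lambda>q. - indicator {a..<0} q)" by (auto simp: f_def fun_eq_iff split: split_indicator)
    then show ?thesis using False by (simp add: has_bochner_integral_iff)
  qed
  then show "has_bochner_integral lborel f a" "(LBINT q. \<bar>f q\<bar>) = \<bar>a\<bar>" by auto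
qed

text \<open>The affine change of variable \<open>ln pi + 2 * p\<close> turns the weight into that of
  the Gamma integral at 1/2, taken with and without the logarithmic factor.\<close>

lemma gaussian_log_integral:
  "has_bochner_integral lborel (\<lambda>p. exp p * (exp (- pi * (exp p)\<^sup>2) * p)) ((Digamma (1/2) - ln pi) / 4)"
proof -
  define K where "K p = exp p * exp (- pi * (exp p)\<^sup>2)" for p :: real
  have e: "exp (1 / 2 * (ln pi + 2 * p) - exp (ln pi + 2 * p)) = sqrt pi * K p" for p
  proof -
    have "exp (1 / 2 * (ln pi + 2 * p)) = sqrt pi * exp p"
      by (simp add: distrib_left exp_add ln_sqrt[symmetric])
    moreover have "exp (ln pi + 2 * p) = pi * (exp p)\<^sup>2" by (simp add: exp_add flip: exp_of_nat_mult)
    ultimately show ?thesis unfolding exp_diff K_def by (simp add: exp_minus field_simps)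
  qed
  have "has_bochner_integral lborel (\<lambda>p. exp (1/2 * (ln pi + 2 * p) - exp (ln pi + 2 * p))) (Gamma (1/2) /\<^sub>R \<bar>2\<bar>)"
    by (rule has_bochner_integral_lborel_affine[OF Gamma_integral_exp_real]) auto
  then have 1: "has_bochner_integral lborel (\<lambda>p. sqrt pi * K p) (sqrt pi / 2)"
    unfolding e by (simp add: Gamma_one_half_real)
  have "has_bochner_integral lborel (\<lambda>p. (ln pi + 2 * p) * exp (1/2 * (ln pi + 2 * p) - exp (ln pi + 2 * p))) ((Gamma (1/2) * Digamma (1/2)) /\<^sub>R \<bar>2\<bar>)"
    by (rule has_bochner_integral_lborel_affine[OF log_Gamma_integral]) auto
  then have 2: "has_bochner_integral lborel (\<lambda>p. (ln pi + 2 * p) * (sqrt pi * K p)) (sqrt pi * Digamma (1/2) / 2)"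
    unfolding e by (simp add: Gamma_one_half_real)
  have "has_bochner_integral lborel (\<lambda>p. (1 / (2 * sqrt pi)) * ((ln pi + 2 * p) * (sqrt pi * K p) - ln pi * (sqrt pi * K p)))
     ((1 / (2 * sqrt pi)) * (sqrt pi * Digamma (1/2) / 2 - ln pi * (sqrt pi / 2)))"
    by (intro has_bochner_integral_mult_right has_bochner_integral_diff 1 2)
  moreover have "(1 / (2 * sqrt pi)) * ((ln pi + 2 * p) * (sqrt pi * K p) - ln pi * (sqrt pi * K p)) = exp p * (exp (- pi * (exp p)\<^sup>2) * p)" for p
    by (simp add: K_def field_simps)
  moreover have "(1 / (2 * sqrt pi)) * (sqrt pi * Digamma (1/2) / 2 - ln pi * (sqrt pi / 2)) = (Digamma (1/2) - ln pi) / 4"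
    by (simp add: field_simps)
  ultimately show ?thesis by (simp only:)
qed

text \<open>The tail is written as an integral over \<open>r\<close> and the order of integration
  exchanged. For fixed \<open>r\<close> the point \<open>q\<close> lies below the cut-off
  \<open>2 * ln r\<close>, whose distance to the cut-off at 0 is its contribution; what is left is
  twice the logarithmic integral of the Gaussian.\<close>

lemma gauss_tail_cut_integral:
  "has_bochner_integral lborel (\<lambda>q. gauss_tail (exp (q / 2)) - indicator {..<0} q / 2) ((Digamma (1/2) - ln pi) / 2)"
proof -
  let ?g = "\<lambda>r. exp (- pi * r\<^sup>2) * ln r :: real"
  have m: "set_borel_measurable borel {0<..} ?g" unfolding set_borel_measurable_def by measurable
  have gi: "set_integrable lborel {0<..} ?g" and gI: "(LBINT r:{0<..}. ?g r) = (Digamma (1/2) - ln pi) / 4"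
    using gaussian_log_integral set_integrable_exp_subst[OF m] set_integral_exp_subst[OF m]
    by (auto simp: has_bochner_integral_iff)
  define h where "h a q = (if q < a then 1 else 0) - (if q < 0 then 1 else 0 :: real)" for a q :: real
  define f where "f p = indicator {0<..} (fst p) * exp (- pi * (fst p)\<^sup>2) * h (2 * ln (fst p)) (snd p)" for p :: "real \<times> real"
  have fm[measurable]: "f \<in> borel_measurable (lborel \<Otimes>\<^sub>M lborel)" unfolding f_def h_def by measurable
  have h: "has_bochner_integral lborel (h a) a" "(LBINT q. \<bar>h a q\<bar>) = \<bar>a\<bar>" for a
    unfolding h_def[abs_def] by (rule half_line_difference)+
  have P: "integrable (lborel \<Otimes>\<^sub>M lborel) f"
  proof (rule lborel_pair.Fubini_integrable[OF fm])
    have "(LBINT y. norm (f (x, y))) = 2 * (indicator {0<..} x * \<bar>?g x\<bar>)" for x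
      by (simp add: f_def abs_mult h(2))
    then show "integrable lborel (\<lambda>x. LBINT y. norm (f (x, y)))"
      using integrable_abs[OF gi[unfolded set_integrable_def]] by (simp add: abs_mult)
    show "AE x in lborel. integrable lborel (\<lambda>y. f (x, y))"
      using h(1) by (auto simp: f_def has_bochner_integral_iff)
  qed
  have in2: "(LBINT r. f (r, q)) = gauss_tail (exp (q / 2)) - indicator {..<0} q / 2" for q
  proof -
    have gt0: "gauss_tail 0 = 1 / 2"
    proof -
      have "complex_of_real (LBINT x. exp (- pi * x\<^sup>2)) = 1"
        using gaussian_fourier[OF pi_gt_zero, of 0] by (simp del: of_real_exp)
      then have "(LBINT x. exp (- pi * x\<^sup>2)) = 1" by (simp only: of_real_eq_1_iff)
      moreover have "(LBINT x. exp (- pi * x\<^sup>2)) = (LBINT x:{..<0}. exp (- pi * x\<^sup>2)) + (LBINT x:{0..}. exp (- pi * x\<^sup>2))"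
      proof -
        have "{..<0} \<union> {0..} = (UNIV :: real set)" by auto
        then have "(LBINT x. exp (- pi * x\<^sup>2)) = (LBINT x:{..<0} \<union> {0..}. exp (- pi * x\<^sup>2))"
          by (simp add: set_lebesgue_integral_def)
        also have "\<dots> = (LBINT x:{..<0}. exp (- pi * x\<^sup>2)) + (LBINT x:{0..}. exp (- pi * x\<^sup>2))"
          by (intro set_integral_Un gauss_pi_set_integrable) auto
        finally show ?thesis .
      qed
      moreover have "(LBINT x:{0..}. exp (- pi * x\<^sup>2)) = (LBINT x:{0<..}. exp (- pi * x\<^sup>2))"
        by (rule set_integral_discrete_difference[where X = "{0}"]) auto
      moreover have "(LBINT x:{..<0}. exp (- pi * x\<^sup>2)) = (LBINT x:{0<..}. exp (- pi * x\<^sup>2))"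
      proof -
        have "(LBINT x:{..<0}. exp (- pi * x\<^sup>2)) = (LBINT x. indicator {..<0} (0 + (-1) * x) *\<^sub>R exp (- pi * (0 + (-1) * x)\<^sup>2))"
          unfolding set_lebesgue_integral_def by (subst lborel_integral_real_affine[of "-1" _ 0]) auto
        also have "\<dots> = (LBINT x:{0<..}. exp (- pi * x\<^sup>2))"
          unfolding set_lebesgue_integral_def
          by (intro Bochner_Integration.integral_cong) (auto split: split_indicator)
        finally show ?thesis .
      qed
      ultimately show ?thesis by (simp add: gauss_tail_def)
    qed
    have iff: "exp (q / 2) < r \<longleftrightarrow> 0 < r \<and> q < 2 * ln r" for r
    proof (cases "r > 0")
      case True
      then have "exp (q / 2) < r \<longleftrightarrow> exp (q / 2) < exp (ln r)" by simp
      then show ?thesis using True by (simp only: exp_less_cancel_iff) auto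
    qed (use exp_gt_zero[of "q / 2"] in \<open>auto simp del: exp_gt_zero\<close>)
    have "f (r, q) = indicator {exp (q / 2)<..} r *\<^sub>R exp (- pi * r\<^sup>2) - indicator {..<0} q * (indicator {0<..} r *\<^sub>R exp (- pi * r\<^sup>2))" for r
      using iff[of r] by (auto simp: f_def h_def split: split_indicator)
    then have "(LBINT r. f (r, q)) = gauss_tail (exp (q / 2)) - indicator {..<0} q * gauss_tail 0"
      using gauss_pi_set_integrable unfolding gauss_tail_def set_lebesgue_integral_def set_integrable_def by simp
    then show ?thesis by (simp add: gt0)
  qed
  have "integrable lborel (\<lambda>q. LBINT r. f (r, q))"
    using lborel_pair.integrable_fst'[OF lborel_pair.integrable_product_swap[OF P]] by (simp add: case_prod_unfold)
  moreover have "(LBINT q. LBINT r. f (r, q)) = (LBINT r. LBINT q. f (r, q))"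
    using P by (intro lborel_pair.Fubini_integral) (simp add: case_prod_unfold)
  moreover have "(LBINT r. LBINT q. f (r, q)) = (LBINT r. 2 * (indicator {0<..} r *\<^sub>R ?g r))"
    using h(1) by (intro Bochner_Integration.integral_cong) (auto simp: f_def has_bochner_integral_iff)
  moreover have "\<dots> = (Digamma (1/2) - ln pi) / 2"
    using gI by (simp add: set_lebesgue_integral_def)
  ultimately show ?thesis unfolding in2 by (simp add: has_bochner_integral_iff)
qed

text \<open>Represents \<open>1 / a\<close> as an integral of Gaussians in \<open>a\<close>, so that
  sums over \<open>a\<close> can be taken under the integral and become theta series.\<close>

lemma exp_gauss_integral:
  assumes a: "a > 0"
  shows "has_bochner_integral lborel (\<lambda>q. exp (q / 2) * exp (- pi * a\<^sup>2 * exp q)) (1 / a)"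
proof -
  define L where "L = ln (pi * a\<^sup>2)"
  have pa: "pi * a\<^sup>2 > 0" using a by simp
  have "has_bochner_integral lborel (\<lambda>q. exp (1/2 * (L + 1 * q) - exp (L + 1 * q))) (Gamma (1/2) /\<^sub>R \<bar>1\<bar>)"
    by (rule has_bochner_integral_lborel_affine[OF Gamma_integral_exp_real]) auto
  moreover have "exp (1/2 * (L + 1 * q) - exp (L + 1 * q)) = (sqrt pi * a) * (exp (q / 2) * exp (- pi * a\<^sup>2 * exp q))" for q
  proof -
    have "exp (L + 1 * q) = pi * a\<^sup>2 * exp q" using pa by (simp add: exp_add L_def)
    moreover have "exp (1/2 * (L + 1 * q)) = (sqrt pi * a) * exp (q / 2)"
    proof -
      have "exp (1/2 * L) = exp (ln (sqrt (pi * a\<^sup>2)))" using pa by (simp add: ln_sqrt L_def)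
      also have "\<dots> = sqrt pi * a" using a by (simp add: real_sqrt_mult)
      finally show ?thesis by (simp add: distrib_left exp_add)
    qed
    ultimately show ?thesis unfolding exp_diff by (simp add: exp_minus field_simps)
  qed
  ultimately have "has_bochner_integral lborel (\<lambda>q. (sqrt pi * a) * (exp (q / 2) * exp (- pi * a\<^sup>2 * exp q))) (sqrt pi)"
    by (simp add: Gamma_one_half_real)
  from has_bochner_integral_mult_right[OF this, of "1 / (sqrt pi * a)"] show ?thesis
    using a by (simp add: field_simps)
qed

text \<open>Frullani's integral in logarithmic coordinates, for \<open>T\<close> with limits
  \<open>L\<close> and 0 at the two ends. The integrable parts of the two translates cancel; the
  distance between their steps gives the value.\<close>

lemma frullani_log:
  fixes T :: "real \<Rightarrow> real"
  assumes "integrable lborel (\<lambda>q. T q - L * indicator {..<0} q)"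
  shows "has_bochner_integral lborel (\<lambda>q. T (A + q) - T (B + q)) (L * (B - A))"
proof -
  define c where "c q = T q - L * indicator {..<0} q" for q
  define j where "j = integral\<^sup>L lborel c"
  have cI: "has_bochner_integral lborel c j" using assms by (simp add: c_def[abs_def] has_bochner_integral_iff j_def)
  have 1: "has_bochner_integral lborel (\<lambda>q. c (t + 1 * q)) j" for t
    using has_bochner_integral_lborel_affine[OF cI, of 1 t] by simp
  have 2: "has_bochner_integral lborel (\<lambda>q. ((if q < - A then 1 else 0) - (if q < 0 then 1 else 0)) - ((if q < - B then 1 else 0) - (if q < 0 then 1 else 0 :: real))) (- A - - B)"
    by (intro has_bochner_integral_diff half_line_difference)
  have "has_bochner_integral lborel (\<lambda>q. (c (A + 1 * q) - c (B + 1 * q)) + L * (((if q < - A then 1 else 0) - (if q < 0 then 1 else 0)) - ((if q < - B then 1 else 0) - (if q < 0 then 1 else 0 :: real)))) ((j - j) + L * (- A - - B))"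
    by (intro has_bochner_integral_diff has_bochner_integral_add has_bochner_integral_mult_right 1 2)
  moreover have "(c (A + 1 * q) - c (B + 1 * q)) + L * (((if q < - A then 1 else 0) - (if q < 0 then 1 else 0)) - ((if q < - B then 1 else 0) - (if q < 0 then 1 else 0 :: real))) = T (A + q) - T (B + q)" for q
    by (auto simp: c_def algebra_simps split: split_indicator)
  ultimately show ?thesis by simp
qed

text \<open>Sum against integral: the Gaussian at \<open>n \<ge> 1\<close> minus its integral over
  \<open>[n, n + 1]\<close> is nonnegative and, integrated over \<open>q\<close>, gives
  \<open>1 / n - ln ((n + 1) / n)\<close>, terms which add up to Euler's constant. The tail that
  remains contributes the digamma value at 1/2.\<close>

theorem chi_cut_integral:
  "(LBINT q. chi q - indicator {..<0} q / 2) = (euler_mascheroni - ln (4 * pi)) / 2"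
proof -
  define T where "T q = gauss_tail (exp (q / 2))" for q
  define c where "c q = T q - indicator {..<0} q / 2" for q
  have cI: "has_bochner_integral lborel c ((Digamma (1/2) - ln pi) / 2)"
    unfolding c_def T_def by (rule gauss_tail_cut_integral)
  have Tdiff: "has_bochner_integral lborel (\<lambda>q. T (A + q) - T (B + q)) ((B - A) / 2)" for A B
    using frullani_log[of T "1 / 2" A B] cI by (simp add: c_def[abs_def] has_bochner_integral_iff)
  define d where "d n q = exp (q / 2) * exp (- pi * (real (Suc n))\<^sup>2 * exp q) - (T (2 * ln (real (Suc n)) + q) - T (2 * ln (real (Suc n) + 1) + q))" for n q
  have dI: "has_bochner_integral lborel (d n) (inverse (real (Suc n)) - (ln (real (Suc n) + 1) - ln (real (Suc n))))" for n
  proof -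
    have "has_bochner_integral lborel (d n) (1 / real (Suc n) - (2 * ln (real (Suc n) + 1) - 2 * ln (real (Suc n))) / 2)"
      unfolding d_def by (intro has_bochner_integral_diff exp_gauss_integral Tdiff) simp
    then show ?thesis by (simp add: inverse_eq_divide diff_divide_distrib)
  qed
  have Tln: "T (2 * ln a + q) = gauss_tail (a * exp (q / 2))" if "a > 0" for a q
    using that by (simp add: T_def add_divide_distrib exp_add)
  have d0: "0 \<le> d n q" for n q
  proof -
    have "gauss_tail (real (Suc n) * exp (q / 2)) - gauss_tail ((real (Suc n) + 1) * exp (q / 2))
       \<le> ((real (Suc n) + 1) * exp (q / 2) - real (Suc n) * exp (q / 2)) * exp (- pi * (real (Suc n) * exp (q / 2))\<^sup>2)"
      by (rule gauss_tail_diff) (auto intro!: mult_right_mono)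
    also have "\<dots> = exp (q / 2) * exp (- pi * (real (Suc n))\<^sup>2 * exp q)"
    proof -
      have "(exp (q / 2))\<^sup>2 = exp q" by (simp flip: exp_of_nat_mult)
      then show ?thesis by (simp add: power_mult_distrib left_diff_distrib[symmetric] mult.assoc del: of_nat_Suc)
    qed
    finally show ?thesis unfolding d_def by (simp add: Tln del: of_nat_Suc)
  qed
  have dsum: "(\<lambda>n. d n q) sums (chi q - T q)" for q
  proof -
    have "(\<lambda>n. exp (q / 2) * exp (- (pi * (real (Suc n))\<^sup>2 * exp q))) sums (exp (q / 2) * om (exp q))"
      by (intro sums_mult om_sums) simp
    then have 1: "(\<lambda>n. exp (q / 2) * exp (- pi * (real (Suc n))\<^sup>2 * exp q)) sums chi q" by (simp add: chi_def)
    have lim: "(\<lambda>n. T (2 * ln (real (Suc n)) + q)) \<longlonglongrightarrow> 0"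
    proof -
      have "filterlim (\<lambda>n. real (Suc n) * exp (q / 2)) at_top sequentially"
        by (rule filterlim_at_top_mult_tendsto_pos[OF tendsto_const])
           (rule exp_gt_zero, rule filterlim_compose[OF filterlim_real_sequentially filterlim_Suc])
      from gauss_tail_tendsto_0[OF this] show ?thesis by (simp add: Tln del: of_nat_Suc)
    qed
    have "(\<lambda>n. T (2 * ln (real (Suc n)) + q) - T (2 * ln (real (Suc (Suc n))) + q)) sums (T (2 * ln (real (Suc 0)) + q) - 0)"
      by (rule telescope_sums'[OF lim])
    then have 2: "(\<lambda>n. T (2 * ln (real (Suc n)) + q) - T (2 * ln (real (Suc n) + 1) + q)) sums T q"
      by (simp add: add.commute)
    show ?thesis unfolding d_def by (rule sums_diff[OF 1 2])
  qed
  have es: "(\<lambda>n. inverse (real (Suc n)) - (ln (real (Suc n) + 1) - ln (real (Suc n)))) sums euler_mascheroni"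
    using euler_mascheroni_sum_real by (simp add: add_ac algebra_simps)
  have nd: "norm (d n q) = d n q" for n q using d0[of n q] by simp
  have "(\<lambda>n. LBINT q. d n q) sums (LBINT q. (\<Sum>n. d n q))" and ii: "integrable lborel (\<lambda>q. (\<Sum>n. d n q))"
  proof -
    have 1: "integrable lborel (d n)" for n using dI by (simp add: has_bochner_integral_iff)
    have 2: "AE q in lborel. summable (\<lambda>n. norm (d n q))" unfolding nd using dsum by (simp add: sums_iff)
    have 3: "summable (\<lambda>n. LBINT q. norm (d n q))" unfolding nd using es dI by (simp add: has_bochner_integral_iff sums_iff)
    show "(\<lambda>n. LBINT q. d n q) sums (LBINT q. (\<Sum>n. d n q))" by (rule sums_integral[OF 1 2 3])
    show "integrable lborel (\<lambda>q. (\<Sum>n. d n q))" by (rule integrable_suminf[OF 1 2 3])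
  qed
  moreover have "(\<Sum>n. d n q) = chi q - T q" for q using dsum by (simp add: sums_iff)
  moreover have "(\<lambda>n. LBINT q. d n q) sums euler_mascheroni" using es dI by (simp add: has_bochner_integral_iff)
  ultimately have g: "(LBINT q. chi q - T q) = euler_mascheroni" "integrable lborel (\<lambda>q. chi q - T q)"
    using sums_unique2 by auto
  have "(LBINT q. chi q - indicator {..<0} q / 2) = (LBINT q. (chi q - T q) + c q)" by (simp add: c_def)
  also have "\<dots> = euler_mascheroni + (Digamma (1/2) - ln pi) / 2"
    using g cI by (simp add: has_bochner_integral_iff)
  also have "Digamma (1/2 :: real) = - 2 * ln 2 - euler_mascheroni" using Digamma_half_integer[of 0, where 'a = real] by simp
  also have "euler_mascheroni + (- 2 * ln 2 - euler_mascheroni - ln pi) / 2 = (euler_mascheroni - ln (4 * pi)) / 2"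
  proof -
    have "ln (4 * pi) = ln (2 ^ 2 * pi)" by simp
    also have "\<dots> = 2 * ln 2 + ln pi" using ln_realpow[of 2 2] by (subst ln_mult) auto
    finally show ?thesis by (simp add: field_simps)
  qed
  finally show ?thesis .
qed

subsection \<open>The Bessel function\<close>

lemma einterval_0_half_pi: "einterval 0 (ereal (pi / 2)) = {0<..<pi / 2}"
  by (auto simp: einterval_def zero_ereal_def)

lemma set_integrable_half_pi:
  fixes f :: "real \<Rightarrow> real"
  assumes "continuous_on {0..pi/2} f" shows "set_integrable lborel {0<..<pi/2} f"
  by (rule set_integrable_subset[OF borel_integrable_atLeastAtMost'[OF assms]]) auto

lemma set_integral_half_pi_FTC:
  fixes f F :: "real \<Rightarrow> real"
  assumes "continuous_on {0..pi/2} f" "\<And>x. (F has_real_derivative f x) (at x)"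
  shows "(LBINT x:{0<..<pi/2}. f x) = F (pi / 2) - F 0"
proof -
  have "(LBINT x:{0<..<pi/2}. f x) = (LBINT x:{0..pi/2}. f x)"
    by (rule set_integral_discrete_difference[where X = "{0, pi/2}"]) auto
  also have "\<dots> = F (pi / 2) - F 0"
    unfolding set_lebesgue_integral_def using assms
    by (intro integral_FTC_atLeastAtMost)
       (auto simp: has_real_derivative_iff_has_vector_derivative[symmetric] intro: DERIV_subset)
  finally show ?thesis .
qed

text \<open>The function \<open>cos t ^ (2 * k + 1) * sin t\<close> vanishes at both ends, and
  integrating its derivative gives the Wallis recursion.\<close>

lemma wallis_cos_integral:
  "(LBINT t:{0<..<pi/2}. cos t ^ (2 * k)) = pi / 2 * (fact (2 * k) / (4 ^ k * (fact k)\<^sup>2))"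
proof (induction k)
  case 0
  show ?case by (simp add: set_lebesgue_integral_def)
next
  case (Suc k)
  have i: "set_integrable lborel {0<..<pi/2} (\<lambda>t. cos t ^ n)" for n
    by (intro set_integrable_half_pi continuous_intros)
  have "(LBINT t:{0<..<pi/2}. real (2 * k + 2) * cos t ^ (2 * Suc k) - real (2 * k + 1) * cos t ^ (2 * k))
     = cos (pi / 2) ^ (2 * k + 1) * sin (pi / 2) - cos 0 ^ (2 * k + 1) * sin 0"
  proof (rule set_integral_half_pi_FTC)
    fix t :: real
    have "((\<lambda>t. cos t ^ (2 * k + 1) * sin t) has_real_derivative
        (real (2 * k + 1) * cos t ^ (2 * k) * (- sin t)) * sin t + cos t ^ (2 * k + 1) * cos t) (at t)"
      by (rule derivative_eq_intros refl | simp)+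
    moreover have "(real (2 * k + 1) * cos t ^ (2 * k) * (- sin t)) * sin t + cos t ^ (2 * k + 1) * cos t
       = real (2 * k + 2) * cos t ^ (2 * Suc k) - real (2 * k + 1) * cos t ^ (2 * k)"
    proof -
      have "sin t * sin t = 1 - cos t * cos t" using sin_cos_squared_add[of t] by (simp add: power2_eq_square)
      have "(real (2 * k + 1) * cos t ^ (2 * k) * (- sin t)) * sin t = - real (2 * k + 1) * cos t ^ (2 * k) * (sin t * sin t)"
        by (simp add: algebra_simps)
      also have "\<dots> = - real (2 * k + 1) * cos t ^ (2 * k) * (1 - cos t * cos t)"
        by (simp only: \<open>sin t * sin t = 1 - cos t * cos t\<close>)
      finally have e: "(real (2 * k + 1) * cos t ^ (2 * k) * (- sin t)) * sin t = - real (2 * k + 1) * cos t ^ (2 * k) * (1 - cos t * cos t)" .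
      show ?thesis unfolding e by (simp add: algebra_simps)
    qed
    ultimately show "((\<lambda>t. cos t ^ (2 * k + 1) * sin t) has_real_derivative real (2 * k + 2) * cos t ^ (2 * Suc k) - real (2 * k + 1) * cos t ^ (2 * k)) (at t)"
      by simp
  qed (intro continuous_intros)
  moreover have "(LBINT t:{0<..<pi/2}. real (2 * k + 2) * cos t ^ (2 * Suc k) - real (2 * k + 1) * cos t ^ (2 * k))
     = real (2 * k + 2) * (LBINT t:{0<..<pi/2}. cos t ^ (2 * Suc k)) - real (2 * k + 1) * (LBINT t:{0<..<pi/2}. cos t ^ (2 * k))"
    by (simp only: set_integral_diff(2)[OF set_integrable_mult_right[OF i] set_integrable_mult_right[OF i]] set_integral_mult_right)
  ultimately have "real (2 * k + 2) * (LBINT t:{0<..<pi/2}. cos t ^ (2 * Suc k)) = real (2 * k + 1) * (LBINT t:{0<..<pi/2}. cos t ^ (2 * k))"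
    by (simp only: cos_pi_half sin_zero) simp
  then have "(LBINT t:{0<..<pi/2}. cos t ^ (2 * Suc k)) = real (2 * k + 1) / real (2 * k + 2) * (LBINT t:{0<..<pi/2}. cos t ^ (2 * k))"
    by (simp add: field_simps del: mult_Suc_right)
  also have "\<dots> = pi / 2 * (fact (2 * Suc k) / (4 ^ Suc k * (fact (Suc k))\<^sup>2))"
    unfolding Suc.IH by (simp add: fact_reduce divide_simps power2_eq_square) (simp add: algebra_simps)?
  finally show ?case .
qed

text \<open>Bessel's integral: the cosine series is integrated termwise, and the Wallis integrals
  supply the squared factorials.\<close>

lemma bessel_J0_integral: "bessel_J0 x = 2 / pi * (LBINT t:{0<..<pi/2}. cos (x * cos t))"
proof -
  let ?f = "\<lambda>k t. (- 1) ^ k / fact (2 * k) * (x * cos t) ^ (2 * k) :: real"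
  have i: "set_integrable lborel {0<..<pi/2} (?f k)" for k
    by (intro set_integrable_half_pi continuous_intros)
  have fk: "(LBINT t:{0<..<pi/2}. ?f k t) = pi / 2 * ((-1) ^ k / (fact k)\<^sup>2 * (x / 2) ^ (2 * k))" for k
  proof -
    have "(LBINT t:{0<..<pi/2}. ?f k t) = (LBINT t:{0<..<pi/2}. ((- 1) ^ k / fact (2 * k) * x ^ (2 * k)) * cos t ^ (2 * k))"
      by (simp add: power_mult_distrib mult.assoc)
    also have "\<dots> = ((- 1) ^ k / fact (2 * k) * x ^ (2 * k)) * (pi / 2 * (fact (2 * k) / (4 ^ k * (fact k)\<^sup>2)))"
      by (simp only: set_integral_mult_right wallis_cos_integral)
    also have "\<dots> = pi / 2 * ((-1) ^ k / (fact k)\<^sup>2 * (x / 2) ^ (2 * k))"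
      proof -
      have "(4 :: real) ^ k = 2 ^ (2 * k)" by (simp add: power_mult)
      then show ?thesis by (simp add: power_divide mult_ac)
    qed
    finally show ?thesis .
  qed
  have nb: "norm (indicator {0<..<pi/2} t *\<^sub>R ?f k t) \<le> indicator {0<..<pi/2} t * (\<bar>x\<bar> ^ (2 * k) /\<^sub>R fact (2 * k))" for k t
  proof -
    have "\<bar>x * cos t\<bar> ^ (2 * k) \<le> \<bar>x\<bar> ^ (2 * k)"
      by (intro power_mono) (auto simp: abs_mult mult_left_le)
    then show ?thesis
      by (auto simp: abs_mult power_abs divide_simps split: split_indicator)
  qed
  have sn: "summable (\<lambda>k. \<bar>x\<bar> ^ (2 * k) /\<^sub>R fact (2 * k))"
  proof (rule summable_comparison_test[OF _ summable_exp_generic[of "x\<^sup>2"]], intro exI allI impI)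
    fix k
    have "fact k \<le> (fact (2 * k) :: real)" by (intro fact_mono) auto
    then show "norm (\<bar>x\<bar> ^ (2 * k) /\<^sub>R fact (2 * k)) \<le> (x\<^sup>2) ^ k /\<^sub>R fact k"
      by (simp add: power_mult frac_le divide_inverse[symmetric] mult.commute[of "inverse _"])
  qed
  have se: "summable (\<lambda>k. norm (indicator {0<..<pi/2} t *\<^sub>R ?f k t))" for t
    by (rule summable_comparison_test[OF _ summable_mult[OF sn, of "indicator {0<..<pi/2} t"]]) (use nb[of t] in auto)
  have "(\<lambda>k. \<integral>t. indicator {0<..<pi/2} t *\<^sub>R ?f k t \<partial>lborel) sums (\<integral>t. (\<Sum>k. indicator {0<..<pi/2} t *\<^sub>R ?f k t) \<partial>lborel)"
  proof (rule sums_integral)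
    show "integrable lborel (\<lambda>t. indicator {0<..<pi/2} t *\<^sub>R ?f k t)" for k
      using i[of k] unfolding set_integrable_def .
    show "AE t in lborel. summable (\<lambda>k. norm (indicator {0<..<pi/2} t *\<^sub>R ?f k t))" using se by simp
    have "(\<integral>t. norm (indicator {0<..<pi/2} t *\<^sub>R ?f k t) \<partial>lborel) \<le> (\<integral>t. indicator {0<..<pi/2} t * (\<bar>x\<bar> ^ (2 * k) /\<^sub>R fact (2 * k)) \<partial>lborel)" for k
      using i[of k] nb[of _ k] unfolding set_integrable_def
      by (intro integral_mono integrable_norm) (auto intro!: integrable_mult_left integrable_real_indicator)
    then have "(\<integral>t. norm (indicator {0<..<pi/2} t *\<^sub>R ?f k t) \<partial>lborel) \<le> pi / 2 * (\<bar>x\<bar> ^ (2 * k) /\<^sub>R fact (2 * k))" for k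
      by simp
    then show "summable (\<lambda>k. \<integral>t. norm (indicator {0<..<pi/2} t *\<^sub>R ?f k t) \<partial>lborel)"
      by (intro summable_comparison_test[OF _ summable_mult[OF sn, of "pi / 2"]]) auto
  qed
  also have "(\<lambda>t. \<Sum>k. indicator {0<..<pi/2} t *\<^sub>R ?f k t) = (\<lambda>t. indicator {0<..<pi/2} t *\<^sub>R cos (x * cos t))"
  proof
    fix t
    show "(\<Sum>k. indicator {0<..<pi/2} t *\<^sub>R ?f k t) = indicator {0<..<pi/2} t *\<^sub>R cos (x * cos t)"
      using sums_unique[OF sums_mult[OF cos_paired[of "x * cos t"], of "indicator {0<..<pi/2} t"]] by simp
  qed
  finally have "(\<lambda>k. LBINT t:{0<..<pi/2}. ?f k t) sums (LBINT t:{0<..<pi/2}. cos (x * cos t))"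
    unfolding set_lebesgue_integral_def .
  then have "(\<lambda>k. pi / 2 * ((-1) ^ k / (fact k)\<^sup>2 * (x / 2) ^ (2 * k))) sums (LBINT t:{0<..<pi/2}. cos (x * cos t))"
    unfolding fk .
  from sums_mult[OF this, of "2 / pi"]
  have "(\<lambda>k. (-1) ^ k / (fact k)\<^sup>2 * (x / 2) ^ (2 * k)) sums (2 / pi * (LBINT t:{0<..<pi/2}. cos (x * cos t)))"
    by (simp only: mult.assoc[symmetric] times_divide_eq_left times_divide_eq_right) simp
  then show ?thesis unfolding bessel_J0_def by (rule sums_unique[symmetric])
qed

lemma bessel_J0_measurable [measurable]: "bessel_J0 \<in> borel_measurable borel"
  unfolding bessel_J0_def by measurable

text \<open>Averages of the corresponding bounds for the cosine. The linear bound holds globally and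
  suffices against the simple pole of \<open>1 / (1 - exp (- x))\<close>.\<close>

lemma bessel_J0_bounds: "\<bar>bessel_J0 x\<bar> \<le> 1" "\<bar>1 - bessel_J0 x\<bar> \<le> \<bar>x\<bar>"
proof -
  have i: "set_integrable lborel {0<..<pi/2} (\<lambda>t. cos (x * cos t))"
    "set_integrable lborel {0<..<pi/2} (\<lambda>t. c)" for c :: real
    by (intro set_integrable_half_pi continuous_intros)+
  have c: "(LBINT t:{0<..<pi/2}. c) = c * (pi / 2)" for c :: real by (simp add: set_lebesgue_integral_def)
  have "(LBINT t:{0<..<pi/2}. cos (x * cos t)) \<le> 1 * (pi / 2)" "- 1 * (pi / 2) \<le> (LBINT t:{0<..<pi/2}. cos (x * cos t))"
    unfolding c[symmetric] by (intro set_integral_mono i; simp)+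
  then show "\<bar>bessel_J0 x\<bar> \<le> 1" unfolding bessel_J0_integral by (simp add: field_simps abs_le_iff)
  have k: "1 - \<bar>x\<bar> \<le> cos y" if "\<bar>y\<bar> \<le> \<bar>x\<bar>" for y
  proof -
    have "cos y = 1 - 2 * (sin (y / 2))\<^sup>2" using cos_double_sin[of "y / 2"] by simp
    moreover have "(sin (y / 2))\<^sup>2 \<le> \<bar>sin (y / 2)\<bar> * 1"
      unfolding power2_eq_square by (metis abs_ge_zero abs_mult_self_eq abs_sin_le_one mult_left_mono)
    moreover have "\<bar>sin (y / 2)\<bar> \<le> \<bar>y / 2\<bar>" by (rule abs_sin_x_le_abs_x)
    ultimately show ?thesis using that by simp
  qed
  have "(1 - \<bar>x\<bar>) * (pi / 2) \<le> (LBINT t:{0<..<pi/2}. cos (x * cos t))"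
    unfolding c[symmetric] by (intro set_integral_mono i k) (simp add: abs_mult mult_left_le)
  then have "1 - bessel_J0 x \<le> \<bar>x\<bar>" unfolding bessel_J0_integral by (simp add: field_simps)
  moreover have "bessel_J0 x \<le> 1" using \<open>\<bar>bessel_J0 x\<bar> \<le> 1\<close> by simp
  ultimately show "\<bar>1 - bessel_J0 x\<bar> \<le> \<bar>x\<bar>" by simp
qed

lemma laplace_cos:
  fixes k b :: real
  assumes k: "k > 0"
  shows "set_integrable lborel {0<..} (\<lambda>x. exp (- (k * x)) * cos (b * x))"
    and "(LBINT x:{0<..}. exp (- (k * x)) * cos (b * x)) = k / (k\<^sup>2 + b\<^sup>2)"
proof -
  let ?f = "\<lambda>x::real. exp (- (k * x)) * cos (b * x)"
  let ?F = "\<lambda>x. exp (- (k * x)) * (b * sin (b * x) - k * cos (b * x)) / (k\<^sup>2 + b\<^sup>2)"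
  have kb: "k\<^sup>2 + b\<^sup>2 > 0" using k by (intro add_pos_nonneg) auto
  have ei: "einterval 0 \<infinity> = {0<..}" by (auto simp: einterval_def zero_ereal_def)
  have i0: "set_integrable lborel {0<..} (\<lambda>x. exp (- (x * k)))" by (rule integrable_I0i_exp_mscale[OF k])
  show i: "set_integrable lborel {0<..} ?f"
    by (rule set_integrable_bound[OF i0]) 
       (auto simp: abs_mult mult.commute[of k] mult_left_le set_borel_measurable_def)
  have D: "(?F has_vector_derivative ?f x) (at x)" for x
    unfolding has_real_derivative_iff_has_vector_derivative[symmetric]
    using kb by (auto intro!: derivative_eq_intros simp: divide_simps; simp add: power2_eq_square algebra_simps)
  have lim: "((\<lambda>x. ?F x) \<longlongrightarrow> 0) at_top"
  proof (rule Lim_null_comparison)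
    show "\<forall>\<^sub>F x in at_top. norm (?F x) \<le> exp (- (k * x)) * ((\<bar>b\<bar> + k) / (k\<^sup>2 + b\<^sup>2))"
    proof (intro always_eventually allI)
      fix x
      have "\<bar>b * sin (b * x) - k * cos (b * x)\<bar> \<le> \<bar>b * sin (b * x)\<bar> + \<bar>k * cos (b * x)\<bar>" by (rule abs_triangle_ineq4)
      also have "\<dots> \<le> \<bar>b\<bar> + k" using k by (intro add_mono) (auto simp: abs_mult mult_left_le)
      finally show "norm (?F x) \<le> exp (- (k * x)) * ((\<bar>b\<bar> + k) / (k\<^sup>2 + b\<^sup>2))"
        using kb by (simp add: abs_mult divide_right_mono mult_left_mono)
    qed
    show "((\<lambda>x. exp (- (k * x)) * ((\<bar>b\<bar> + k) / (k\<^sup>2 + b\<^sup>2))) \<longlongrightarrow> 0) at_top"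
    proof (rule tendsto_mult_left_zero)
      show "((\<lambda>x. exp (- (k * x))) \<longlongrightarrow> 0) at_top" using k by real_asymp
    qed
  qed
  have "(LBINT x=0..\<infinity>. ?f x) = 0 - ?F 0"
  proof (rule interval_integral_FTC_integrable)
    show "((?F \<circ> real_of_ereal) \<longlongrightarrow> ?F 0) (at_right 0)"
      unfolding zero_ereal_def ereal_tendsto_simps using kb
      by (intro tendsto_eq_intros) auto
    show "((?F \<circ> real_of_ereal) \<longlongrightarrow> 0) (at_left \<infinity>)"
      unfolding ereal_tendsto_simps by (rule lim)
  qed (use D i in \<open>auto simp: ei\<close>)
  then show "(LBINT x:{0<..}. ?f x) = k / (k\<^sup>2 + b\<^sup>2)"
    by (simp add: interval_lebesgue_integral_0_infty)
qed

text \<open>The antiderivative is \<open>arctan (k / s * tan t) / s\<close> with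
  \<open>s = sqrt (k^2 + c^2)\<close>. It has a limit where the tangent diverges, so the fundamental
  theorem is used in its improper form.\<close>

lemma inverse_cos_square_integral:
  fixes k c :: real
  assumes k: "k > 0"
  shows "(LBINT t:{0<..<pi/2}. k / (k\<^sup>2 + (c * cos t)\<^sup>2)) = pi / 2 / sqrt (k\<^sup>2 + c\<^sup>2)"
proof -
  define s where "s = sqrt (k\<^sup>2 + c\<^sup>2)"
  have kc: "k\<^sup>2 + c\<^sup>2 > 0" using k by (intro add_pos_nonneg) auto
  have s: "s > 0" "s\<^sup>2 = k\<^sup>2 + c\<^sup>2" using kc by (auto simp: s_def)
  let ?f = "\<lambda>t. k / (k\<^sup>2 + (c * cos t)\<^sup>2)"
  let ?F = "\<lambda>t. 1 / s * arctan (k / s * tan t)"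
  have "(LBINT t=0..ereal (pi/2). ?f t) = 1 / s * (pi / 2) - 0"
  proof (rule interval_integral_FTC_nonneg)
    show "0 < ereal (pi / 2)" by simp
    fix t assume "0 < ereal t" "ereal t < ereal (pi / 2)"
    then have t: "0 < t" "t < pi / 2" by auto
    have ct: "cos t > 0" using t by (intro cos_gt_zero) auto
    have "(?F has_real_derivative 1 / s * (k / s * inverse ((cos t)\<^sup>2) / (1 + (k / s * tan t)\<^sup>2))) (at t)"
      using ct by (auto intro!: derivative_eq_intros simp: divide_simps)
    moreover have "1 / s * (k / s * inverse ((cos t)\<^sup>2) / (1 + (k / s * tan t)\<^sup>2)) = ?f t"
    proof -
      have e: "1 + (k / s * tan t)\<^sup>2 = (s\<^sup>2 * (cos t)\<^sup>2 + k\<^sup>2 * (sin t)\<^sup>2) / (s\<^sup>2 * (cos t)\<^sup>2)"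
        using s(1) ct by (simp add: tan_def power_mult_distrib power_divide add_divide_distrib)
      have e2: "s\<^sup>2 * (cos t)\<^sup>2 + k\<^sup>2 * (sin t)\<^sup>2 = k\<^sup>2 + (c * cos t)\<^sup>2"
      proof -
        have "s\<^sup>2 * (cos t)\<^sup>2 + k\<^sup>2 * (sin t)\<^sup>2 = k\<^sup>2 * ((sin t)\<^sup>2 + (cos t)\<^sup>2) + (c * cos t)\<^sup>2"
          unfolding s(2) by (simp only: power_mult_distrib distrib_left distrib_right add_ac)
        then show ?thesis by simp
      qed
      have p: "k\<^sup>2 + (c * cos t)\<^sup>2 > 0" using k by (intro add_pos_nonneg) auto
      show ?thesis unfolding e e2 using s(1) ct p by (simp add: divide_simps) (simp add: power2_eq_square)
    qed
    ultimately show "(?F has_real_derivative ?f t) (at t)" by simp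
    have p: "k\<^sup>2 + (c * cos t)\<^sup>2 \<noteq> 0" using k by (intro less_imp_neq[THEN not_sym] add_pos_nonneg) auto
    show "isCont ?f t" using p by (intro continuous_intros) auto
  next
    show "AE x in lborel. 0 < ereal x \<longrightarrow> ereal x < ereal (pi / 2) \<longrightarrow> 0 \<le> ?f x"
      using k by (intro AE_I2) (auto intro!: divide_nonneg_nonneg)
    show "((?F \<circ> real_of_ereal) \<longlongrightarrow> 0) (at_right 0)"
      unfolding zero_ereal_def ereal_tendsto_simps
      by (rule tendsto_eq_intros | simp)+
    show "((?F \<circ> real_of_ereal) \<longlongrightarrow> 1 / s * (pi / 2)) (at_left (ereal (pi / 2)))"
      unfolding ereal_tendsto_simps
    proof (intro tendsto_mult_left filterlim_compose[OF tendsto_arctan_at_top])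
      show "filterlim (\<lambda>t. k / s * tan t) at_top (at_left (pi / 2))"
        by (rule filterlim_tendsto_pos_mult_at_top[OF tendsto_const]) (use k s in \<open>auto intro: filterlim_tan_at_left\<close>)
    qed
  qed
  then have "(LBINT t=0..ereal (pi/2). ?f t) = pi / 2 / s" by simp
  moreover have "(LBINT t=0..ereal (pi/2). ?f t) = (LBINT t:{0<..<pi/2}. ?f t)"
    by (simp add: interval_lebesgue_integral_def einterval_0_half_pi)
  ultimately show ?thesis by (simp add: s_def)
qed

text \<open>Fubini applied to Bessel's integral reduces the transform to that of the cosine,
  averaged over the angle.\<close>

lemma laplace_bessel_J0:
  fixes k c :: real
  assumes k: "k > 0"
  shows "set_integrable lborel {0<..} (\<lambda>x. exp (- (k * x)) * bessel_J0 (c * x))"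
    and "(LBINT x:{0<..}. exp (- (k * x)) * bessel_J0 (c * x)) = 1 / sqrt (k\<^sup>2 + c\<^sup>2)"
proof -
  have i0: "set_integrable lborel {0<..} (\<lambda>x. exp (- (x * k)))" by (rule integrable_I0i_exp_mscale[OF k])
  show "set_integrable lborel {0<..} (\<lambda>x. exp (- (k * x)) * bessel_J0 (c * x))"
    by (rule set_integrable_bound[OF i0])
       (auto simp: abs_mult mult.commute[of k] mult_left_le bessel_J0_bounds set_borel_measurable_def)
  let ?f = "\<lambda>(x, t). (indicator {0<..} x * exp (- (k * x))) * (indicator {0<..<pi/2} t * cos (c * x * cos t))"
  have ind: "integrable lborel (\<lambda>t. indicator {0<..<pi/2} t :: real)"
    by (auto intro!: integrable_real_indicator)
  have i1: "integrable lborel (\<lambda>x. indicator {0<..} x * exp (- (k * x)))"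
    using i0 by (simp add: set_integrable_def mult.commute[of k])
  have P: "integrable (lborel \<Otimes>\<^sub>M lborel) ?f"
    by (rule Bochner_Integration.integrable_bound[OF integrable_pair_mult[OF i1 ind]])
       (auto simp: case_prod_unfold abs_mult split: split_indicator)
  have "(LBINT x:{0<..}. exp (- (k * x)) * bessel_J0 (c * x))
     = (LBINT x. 2 / pi * (LBINT t. ?f (x, t)))"
    unfolding set_lebesgue_integral_def bessel_J0_integral
    by (intro Bochner_Integration.integral_cong) auto
  also have "\<dots> = 2 / pi * (LBINT x. LBINT t. ?f (x, t))" by (rule integral_mult_right_zero)
  also have "(LBINT x. LBINT t. ?f (x, t)) = (LBINT t. LBINT x. ?f (x, t))"
    using lborel_pair.Fubini_integral[OF P] by simp
  also have "\<dots> = (LBINT t:{0<..<pi/2}. k / (k\<^sup>2 + (c * cos t)\<^sup>2))"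
    unfolding set_lebesgue_integral_def
  proof (intro Bochner_Integration.integral_cong refl)
    fix t
    have "(LBINT x. ?f (x, t)) = (LBINT x. indicator {0<..<pi/2} t * (indicator {0<..} x *\<^sub>R (exp (- (k * x)) * cos (c * cos t * x))))"
      by (intro Bochner_Integration.integral_cong) (auto simp: mult_ac)
    also have "\<dots> = indicator {0<..<pi/2} t * (LBINT x:{0<..}. exp (- (k * x)) * cos (c * cos t * x))"
      unfolding set_lebesgue_integral_def by (rule integral_mult_right_zero)
    finally show "(LBINT x. ?f (x, t)) = indicator {0<..<pi/2} t *\<^sub>R (k / (k\<^sup>2 + (c * cos t)\<^sup>2))"
      by (simp add: laplace_cos(2)[OF k])
  qed
  also have "\<dots> = pi / 2 / sqrt (k\<^sup>2 + c\<^sup>2)" by (rule inverse_cos_square_integral[OF k])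
  finally show "(LBINT x:{0<..}. exp (- (k * x)) * bessel_J0 (c * x)) = 1 / sqrt (k\<^sup>2 + c\<^sup>2)" by simp
qed

subsection \<open>The averaged digamma function\<close>

text \<open>The innermost integral of \<open>psi_gen\<close> with
  \<open>c = (a - 1) * v / u\<close>. At \<open>c = 0\<close> it is Gauss's integral for the digamma
  function at 1.\<close>

definition bessel_psi :: "real \<Rightarrow> real" where
  "bessel_psi c = (LBINT x:{0<..}. exp (- x) * (1 / x - bessel_J0 (c * x) / (1 - exp (- x))))"

text \<open>The poles of \<open>1 / x\<close> and \<open>1 / (1 - exp (- x))\<close> at 0 differ by
  at most 1; replacing the Bessel function by 1 costs the two terms with \<open>c\<close>.\<close>

lemma bessel_psi_kernel_bound:
  fixes c x :: real
  assumes c: "c \<ge> 0" and x: "x > 0"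
  shows "\<bar>1 / x - bessel_J0 (c * x) / (1 - exp (- x))\<bar> \<le> 1 + c + c * x"
proof -
  define D where "D = 1 - exp (- x)"
  have D: "D > 0" using x by (simp add: D_def)
  have "D \<le> x" using exp_ge_add_one_self[of "- x"] unfolding D_def by linarith
  have "exp (- x) * (1 + x) \<le> exp (- x) * exp x" using exp_ge_add_one_self[of x] by (intro mult_left_mono) auto
  then have "exp (- x) * (1 + x) \<le> 1" by (simp flip: exp_add)
  then have a: "1 / D \<le> 1 + 1 / x" using D x by (simp add: D_def field_simps)
  have b: "1 / x \<le> 1 / D" using \<open>D \<le> x\<close> D by (simp add: frac_le)
  have "\<bar>1 - bessel_J0 (c * x)\<bar> / D = \<bar>1 - bessel_J0 (c * x)\<bar> * (1 / D)" by simp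
  also have "\<dots> \<le> (c * x) * (1 + 1 / x)"
    using bessel_J0_bounds(2)[of "c * x"] a c x D by (intro mult_mono) auto
  also have "\<dots> = c * x + c" using x by (simp add: field_simps)
  finally have d: "\<bar>(1 - bessel_J0 (c * x)) / D\<bar> \<le> c * x + c" using D by (simp add: abs_divide)
  have "1 / x - bessel_J0 (c * x) / D = (1 / x - 1 / D) + (1 - bessel_J0 (c * x)) / D"
    by (simp add: diff_divide_distrib)
  then show ?thesis using a b d unfolding D_def[symmetric] by linarith
qed

lemma integrable_bessel_psi:
  assumes c: "c \<ge> 0"
  shows "set_integrable lborel {0<..} (\<lambda>x. exp (- x) * (1 / x - bessel_J0 (c * x) / (1 - exp (- x))))"
proof -
  have 0: "integrable lborel (\<lambda>x. indicator {0<..} x *\<^sub>R (exp (- x) * (1 + c + c * x)))"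
  proof -
    have "integrable lborel (\<lambda>x. (1 + c) * (x ^ 0 * exp (- x) * indicator {0<..} x) + c * (x ^ 1 * exp (- x) * indicator {0<..} x :: real))"
      using has_bochner_integral_I0i_power_exp_m[of 0] has_bochner_integral_I0i_power_exp_m[of 1]
      by (intro Bochner_Integration.integrable_add integrable_mult_right) (simp_all only: has_bochner_integral_iff)
    then show ?thesis by (simp add: algebra_simps)
  qed
  show ?thesis unfolding set_integrable_def
  proof (rule Bochner_Integration.integrable_bound[OF 0])
    show "AE x in lborel. norm (indicator {0<..} x *\<^sub>R (exp (- x) * (1 / x - bessel_J0 (c * x) / (1 - exp (- x)))))
         \<le> norm (indicator {0<..} x *\<^sub>R (exp (- x) * (1 + c + c * x)))"
    proof (intro AE_I2)
      fix x :: real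
      show "norm (indicator {0<..} x *\<^sub>R (exp (- x) * (1 / x - bessel_J0 (c * x) / (1 - exp (- x)))))
         \<le> norm (indicator {0<..} x *\<^sub>R (exp (- x) * (1 + c + c * x)))"
      proof (cases "x > 0")
        case True
        then have "\<bar>1 / x - bessel_J0 (c * x) / (1 - exp (- x))\<bar> \<le> \<bar>1 + c + c * x\<bar>"
          using bessel_psi_kernel_bound[OF c True] by linarith
        then show ?thesis using True by (simp add: abs_mult)
      qed simp
    qed
  qed measurable
qed

section \<open>The inner integral as a limit of sums and as a theta integral\<close>

text \<open>An instance of \<open>frullani_log\<close> for \<open>exp (- exp q)\<close>, which falls
  from 1 to 0; multiplying \<open>x\<close> by \<open>b\<close> shifts \<open>q\<close> by
  \<open>ln b\<close>.\<close>

lemma exp_Frullani: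
  assumes "b \<ge> (1::real)"
  shows "set_integrable lborel {0<..} (\<lambda>x. (exp (- x) - exp (- (b * x))) / x)"
    and "(LBINT x:{0<..}. (exp (- x) - exp (- (b * x))) / x) = ln b"
proof -
  define T where "T q = exp (- exp q)" for q :: real
  have "integrable lborel (\<lambda>q. T q - 1 * indicator {..<0} q)"
  proof (rule Bochner_Integration.integrable_bound[OF integrable_exp_abs[of 1]])
    show "AE q in lborel. norm (T q - 1 * indicator {..<0} q) \<le> norm (exp (- 1 * \<bar>q\<bar>))"
    proof (rule AE_I2)
      fix q :: real
      show "norm (T q - 1 * indicator {..<0} q) \<le> norm (exp (- 1 * \<bar>q\<bar>))"
      proof (cases "q < 0")
        case True
        have "1 - exp q \<le> T q" "T q \<le> 1" using exp_ge_add_one_self[of "- exp q"] by (auto simp: T_def)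
        then have "\<bar>T q - 1\<bar> \<le> exp q" by simp
        then show ?thesis using True by simp
      next
        case False
        have "q \<le> exp q" using exp_ge_add_one_self[of q] by linarith
        then show ?thesis using False by (simp add: T_def)
      qed
    qed
    show "(\<lambda>q. T q - 1 * indicator {..<0} q) \<in> borel_measurable lborel" unfolding T_def by measurable
  qed simp
  from frullani_log[OF this, of 0 "ln b"]
  have F: "has_bochner_integral lborel (\<lambda>q. T (0 + q) - T (ln b + q)) (1 * (ln b - 0))" .
  let ?f = "\<lambda>x. (exp (- x) - exp (- (b * x))) / x"
  have m: "set_borel_measurable borel {0<..} ?f" unfolding set_borel_measurable_def by measurable
  have e: "exp q *\<^sub>R ?f (exp q) = T (0 + q) - T (ln b + q)" for q
    using assms by (simp add: T_def exp_add)
  show "set_integrable lborel {0<..} ?f" "(LBINT x:{0<..}. ?f x) = ln b"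
    using F unfolding set_integrable_exp_subst[OF m] set_integral_exp_subst[OF m] e by (auto simp: has_bochner_integral_iff)
qed

text \<open>The factor \<open>1 - exp (- N * x)\<close> divided by \<open>1 - exp (- x)\<close> is a
  finite geometric sum, so with it inserted the integral splits into \<open>N\<close> Laplace
  transforms and one Frullani integral. Dominated convergence removes the factor.\<close>

lemma bessel_psi_limit:
  assumes c: "c \<ge> 0"
  shows "(\<lambda>N. ln (real N + 1) - (\<Sum>k<N. 1 / sqrt ((real (Suc k))\<^sup>2 + c\<^sup>2))) \<longlonglongrightarrow> bessel_psi c"
proof -
  define g where "g x = exp (- x) * (1 / x - bessel_J0 (c * x) / (1 - exp (- x)))" for x
  have gm[measurable]: "g \<in> borel_measurable borel" unfolding g_def by measurable
  have gi: "integrable lborel (\<lambda>x. indicator {0<..} x *\<^sub>R g x)"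
    using integrable_bessel_psi[OF c] by (simp add: g_def set_integrable_def)
  have S: "(LBINT x:{0<..}. (1 - exp (- (real N * x))) * g x)
     = ln (real N + 1) - (\<Sum>k<N. 1 / sqrt ((real (Suc k))\<^sup>2 + c\<^sup>2))" for N
  proof -
    have e: "(1 - exp (- (real N * x))) * g x = (exp (- x) - exp (- ((real N + 1) * x))) / x
        - (\<Sum>k<N. exp (- (real (Suc k) * x)) * bessel_J0 (c * x))" if "x > 0" for x
    proof -
      define z where "z = exp (- x)"
      have z: "0 < z" "z < 1" using that by (auto simp: z_def)
      have zp: "exp (- (real n * x)) = z ^ n" for n
        by (simp add: z_def flip: exp_of_nat_mult)
      have "(\<Sum>k<N. exp (- (real (Suc k) * x)) * bessel_J0 (c * x)) = (\<Sum>k<N. z ^ k) * (z * bessel_J0 (c * x))"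
        unfolding zp sum_distrib_right by (intro sum.cong) auto
      also have "(\<Sum>k<N. z ^ k) = (1 - z ^ N) / (1 - z)" using z by (simp add: sum_gp_strict)
      finally have s: "(\<Sum>k<N. exp (- (real (Suc k) * x)) * bessel_J0 (c * x)) = (1 - z ^ N) / (1 - z) * (z * bessel_J0 (c * x))" .
      have t: "exp (- ((real N + 1) * x)) = z * z ^ N" using zp[of "Suc N"] by (simp add: add.commute)
      show ?thesis unfolding s unfolding t zp g_def z_def[symmetric]
        using z that by (simp add: field_simps)
    qed
    have i1: "set_integrable lborel {0<..} (\<lambda>x. (exp (- x) - exp (- ((real N + 1) * x))) / x)"
      by (rule exp_Frullani) simp
    have i2: "set_integrable lborel {0<..} (\<lambda>x. exp (- (real (Suc k) * x)) * bessel_J0 (c * x))" for k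
      by (rule laplace_bessel_J0) simp
    have "(LBINT x:{0<..}. (1 - exp (- (real N * x))) * g x)
       = (LBINT x:{0<..}. (exp (- x) - exp (- ((real N + 1) * x))) / x
        - (\<Sum>k<N. exp (- (real (Suc k) * x)) * bessel_J0 (c * x)))"
      by (rule set_lebesgue_integral_cong) (auto simp: e)
    also have "\<dots> = (LBINT x:{0<..}. (exp (- x) - exp (- ((real N + 1) * x))) / x)
        - (LBINT x:{0<..}. (\<Sum>k<N. exp (- (real (Suc k) * x)) * bessel_J0 (c * x)))"
    proof (rule set_integral_diff(2)[OF i1])
      show "set_integrable lborel {0<..} (\<lambda>x. \<Sum>k<N. exp (- (real (Suc k) * x)) * bessel_J0 (c * x))"
        using i2 unfolding set_integrable_def scaleR_sum_right by (intro Bochner_Integration.integrable_sum) auto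
    qed
    also have "(LBINT x:{0<..}. (\<Sum>k<N. exp (- (real (Suc k) * x)) * bessel_J0 (c * x)))
       = (\<Sum>k<N. LBINT x:{0<..}. exp (- (real (Suc k) * x)) * bessel_J0 (c * x))"
      using i2 unfolding set_lebesgue_integral_def set_integrable_def scaleR_sum_right
      by (intro Bochner_Integration.integral_sum) auto
    also have "\<dots> = (\<Sum>k<N. 1 / sqrt ((real (Suc k))\<^sup>2 + c\<^sup>2))"
      by (intro sum.cong laplace_bessel_J0(2)) auto
    also have "(LBINT x:{0<..}. (exp (- x) - exp (- ((real N + 1) * x))) / x) = ln (real N + 1)"
      by (rule exp_Frullani) simp
    finally show ?thesis .
  qed
  have "(\<lambda>N. LBINT x. indicator {0<..} x *\<^sub>R ((1 - exp (- (real N * x))) * g x)) \<longlonglongrightarrow> (LBINT x. indicator {0<..} x *\<^sub>R g x)"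
  proof (rule integral_dominated_convergence[where w = "\<lambda>x. norm (indicator {0<..} x *\<^sub>R g x)"])
    show "AE x in lborel. (\<lambda>N. indicator {0<..} x *\<^sub>R ((1 - exp (- (real N * x))) * g x)) \<longlonglongrightarrow> indicator {0<..} x *\<^sub>R g x"
    proof (intro AE_I2)
      fix x :: real
      show "(\<lambda>N. indicator {0<..} x *\<^sub>R ((1 - exp (- (real N * x))) * g x)) \<longlonglongrightarrow> indicator {0<..} x *\<^sub>R g x"
      proof (cases "x > 0")
        case True
        then have "(\<lambda>N. exp (- (real N * x))) \<longlonglongrightarrow> 0" by real_asymp
        then have "(\<lambda>N. indicator {0<..} x *\<^sub>R ((1 - exp (- (real N * x))) * g x)) \<longlonglongrightarrow> indicator {0<..} x *\<^sub>R ((1 - 0) * g x)"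
          by (intro tendsto_intros)
        then show ?thesis by simp
      qed simp
    qed
    show "AE x in lborel. norm (indicator {0<..} x *\<^sub>R ((1 - exp (- (real N * x))) * g x)) \<le> norm (indicator {0<..} x *\<^sub>R g x)" for N
      by (intro AE_I2) (auto simp: abs_mult intro!: mult_left_le_one_le split: split_indicator)
  qed (use gi in auto)
  then show ?thesis using S by (simp add: set_lebesgue_integral_def bessel_psi_def g_def)
qed

text \<open>The counterpart, averaged over a unit cell, of a term
  \<open>1 / sqrt (n^2 + c^2)\<close>: the antiderivative of the averaged function is
  \<open>arsinh\<close> of the quotient by \<open>c\<close>.\<close>

lemma arsinh_gauss_integral:
  fixes a c :: real
  assumes c: "c > 0" and a: "a \<ge> 0"
  defines "G \<equiv> (\<lambda>q. LBINT t:{0..1}. exp (q / 2) * exp (- pi * ((a + t)\<^sup>2 + c\<^sup>2) * exp q))"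
  shows "has_bochner_integral lborel G (arsinh ((a + 1) / c) - arsinh (a / c))"
proof -
  define f where "f p = indicator {0..1} (fst p) * (exp (snd p / 2) * exp (- pi * ((a + fst p)\<^sup>2 + c\<^sup>2) * exp (snd p)))" for p :: "real \<times> real"
  have fm[measurable]: "f \<in> borel_measurable (lborel \<Otimes>\<^sub>M lborel)" unfolding f_def by measurable
  have pos: "(a + t)\<^sup>2 + c\<^sup>2 > 0" for t using c by (intro add_nonneg_pos) auto
  have q: "has_bochner_integral lborel (\<lambda>q. f (t, q)) (indicator {0..1} t * (1 / sqrt ((a + t)\<^sup>2 + c\<^sup>2)))" for t
  proof -
    have "has_bochner_integral lborel (\<lambda>q. exp (q / 2) * exp (- pi * (sqrt ((a + t)\<^sup>2 + c\<^sup>2))\<^sup>2 * exp q)) (1 / sqrt ((a + t)\<^sup>2 + c\<^sup>2))"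
      using pos[of t] by (intro exp_gauss_integral) simp
    then have "has_bochner_integral lborel (\<lambda>q. exp (q / 2) * exp (- pi * ((a + t)\<^sup>2 + c\<^sup>2) * exp q)) (1 / sqrt ((a + t)\<^sup>2 + c\<^sup>2))"
      using pos[of t] by simp
    then show ?thesis unfolding f_def fst_conv snd_conv by (rule has_bochner_integral_mult_right)
  qed
  have cont: "continuous_on {0..1} (\<lambda>t. 1 / sqrt ((a + t)\<^sup>2 + c\<^sup>2))"
    using pos by (intro continuous_intros) (metis less_irrefl real_sqrt_eq_0_iff)
  have P: "integrable (lborel \<Otimes>\<^sub>M lborel) f"
  proof (rule lborel_pair.Fubini_integrable[OF fm])
    have "norm (f p) = f p" for p by (simp add: f_def)
    then have "(LBINT q. norm (f (t, q))) = indicator {0..1} t * (1 / sqrt ((a + t)\<^sup>2 + c\<^sup>2))" for t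
      using q[of t] by (simp add: has_bochner_integral_iff)
    then show "integrable lborel (\<lambda>t. LBINT q. norm (f (t, q)))"
      using borel_integrable_atLeastAtMost'[OF cont] by (simp add: set_integrable_def)
    show "AE t in lborel. integrable lborel (\<lambda>q. f (t, q))" using q by (simp add: has_bochner_integral_iff)
  qed
  have G: "G = (\<lambda>q. LBINT t. f (t, q))"
    by (simp only: G_def set_lebesgue_integral_def f_def fst_conv snd_conv real_scaleR_def)
  have "integrable lborel G"
    using lborel_pair.integrable_fst'[OF lborel_pair.integrable_product_swap[OF P]] by (simp add: case_prod_unfold G)
  moreover have "integral\<^sup>L lborel G = (LBINT t. LBINT q. f (t, q))"
    unfolding G using P by (intro lborel_pair.Fubini_integral) (simp add: case_prod_unfold)
  moreover have "\<dots> = (LBINT t. indicator {0..1} t *\<^sub>R (1 / sqrt ((a + t)\<^sup>2 + c\<^sup>2)))"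
    using q by (simp add: has_bochner_integral_iff)
  moreover have "\<dots> = arsinh ((a + 1) / c) - arsinh ((a + 0) / c)"
  proof (rule integral_FTC_atLeastAtMost)
    fix t :: real
    have "((\<lambda>t. arsinh ((a + t) / c)) has_real_derivative 1 / sqrt (((a + t) / c)\<^sup>2 + 1) * (1 / c)) (at t within {0..1})"
      by (rule DERIV_chain2[OF arsinh_real_has_field_derivative]) (use c in \<open>auto intro!: derivative_eq_intros\<close>)
    moreover have "1 / sqrt (((a + t) / c)\<^sup>2 + 1) * (1 / c) = 1 / sqrt ((a + t)\<^sup>2 + c\<^sup>2)"
    proof -
      have "((a + t) / c)\<^sup>2 + 1 = ((a + t)\<^sup>2 + c\<^sup>2) / c\<^sup>2" using c by (simp add: power_divide field_simps)
      then show ?thesis using c by (simp add: real_sqrt_divide)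
    qed
    ultimately show "((\<lambda>t. arsinh ((a + t) / c)) has_vector_derivative 1 / sqrt ((a + t)\<^sup>2 + c\<^sup>2)) (at t within {0..1})"
      by (simp add: has_real_derivative_iff_has_vector_derivative)
  qed (use cont in auto)
  ultimately show ?thesis by (simp add: has_bochner_integral_iff)
qed

text \<open>Integral against sum: \<open>e k\<close> is a Gaussian averaged over
  \<open>[k, k + 1]\<close> minus its value at the right end, hence nonnegative. On the side of
  values the \<open>arsinh\<close> terms telescope, and \<open>ln (N + 1) - arsinh (N / c)\<close>
  tends to \<open>ln (c / 2)\<close>. On the side of integrands the cells add up to a full Gaussian
  integral, which is the term subtracted in \<open>phi\<close>.\<close>

lemma bessel_psi_theta:
  assumes c: "c > 0"
  shows "has_bochner_integral lborel (\<lambda>q. - (exp (q / 4) * phi q * exp (- pi * c\<^sup>2 * exp q))) (bessel_psi c - ln (c / 2))"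
proof -
  define I where "I k q = (LBINT t:{0..1}. exp (q / 2) * exp (- pi * ((real k + t)\<^sup>2 + c\<^sup>2) * exp q))" for k q
  define e where "e k q = I k q - exp (q / 2) * exp (- pi * ((real (Suc k))\<^sup>2 + c\<^sup>2) * exp q)" for k q
  have pos: "(real (Suc k))\<^sup>2 + c\<^sup>2 > 0" for k using c by (intro add_nonneg_pos) auto
  have eI: "has_bochner_integral lborel (e k) (arsinh ((real k + 1) / c) - arsinh (real k / c) - 1 / sqrt ((real (Suc k))\<^sup>2 + c\<^sup>2))" for k
  proof -
    have "has_bochner_integral lborel (\<lambda>q. exp (q / 2) * exp (- pi * (sqrt ((real (Suc k))\<^sup>2 + c\<^sup>2))\<^sup>2 * exp q)) (1 / sqrt ((real (Suc k))\<^sup>2 + c\<^sup>2))"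
      using pos[of k] by (intro exp_gauss_integral) simp
    then have "has_bochner_integral lborel (\<lambda>q. exp (q / 2) * exp (- pi * ((real (Suc k))\<^sup>2 + c\<^sup>2) * exp q)) (1 / sqrt ((real (Suc k))\<^sup>2 + c\<^sup>2))"
      using pos[of k] by simp
    then show ?thesis unfolding e_def I_def
      by (intro has_bochner_integral_diff arsinh_gauss_integral c) auto
  qed
  have si: "set_integrable lborel {0..1} (\<lambda>t. exp (q / 2) * exp (- pi * ((real k + t)\<^sup>2 + c\<^sup>2) * exp q))" for k q
    by (intro borel_integrable_atLeastAtMost' continuous_intros)
  have e0: "0 \<le> e k q" for k q
  proof -
    have "(LBINT t:{0..1::real}. exp (q / 2) * exp (- pi * ((real (Suc k))\<^sup>2 + c\<^sup>2) * exp q)) \<le> I k q"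
      unfolding I_def
      by (intro set_integral_mono si borel_integrable_atLeastAtMost' continuous_intros)
         (auto intro!: mult_left_mono mult_right_mono power_mono)
    moreover have "(LBINT t:{0..1::real}. C) = C" for C :: real by (simp add: set_lebesgue_integral_def)
    ultimately show ?thesis unfolding e_def by simp
  qed
  have esum: "(\<lambda>k. e k q) sums (- (exp (q / 4) * phi q * exp (- pi * c\<^sup>2 * exp q)))" for q
  proof -
    let ?g = "\<lambda>x::real. exp (- (pi * exp q) * x\<^sup>2)"
    define J where "J k = (LBINT t:{0..1}. ?g (real k + t))" for k
    have pe: "pi * exp q > 0" by simp
    have cst: "set_integrable lborel {0..1::real} (\<lambda>t. C)" "(LBINT t:{0..1::real}. C) = C" for C :: real
      by (intro borel_integrable_atLeastAtMost' continuous_intros) (simp add: set_lebesgue_integral_def)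
    have "J k \<le> (LBINT t:{0..1::real}. exp (- (pi * exp q * (real k)\<^sup>2)))" for k
      unfolding J_def by (intro set_integral_mono cst borel_integrable_atLeastAtMost' continuous_intros)
        (auto simp: mult_ac intro!: mult_left_mono power_mono)
    then have Jle: "J k \<le> exp (- (pi * exp q * (real k)\<^sup>2))" for k unfolding cst .
    have J0: "0 \<le> J k" for k unfolding J_def set_lebesgue_integral_def by (intro integral_nonneg_AE AE_I2) simp
    have "summable J"
      by (rule summable_comparison_test[OF _ summable_exp_square[OF pe]]) (use Jle J0 in auto)
    moreover have "suminf J = 1 / (2 * exp (q / 2))"
    proof -
      have "2 * suminf J = (LBINT x. ?g x)"
        unfolding J_def by (rule integral_even_tiling[OF gaussian_integrable(1)[OF pe], symmetric]) simp
      moreover have "complex_of_real (LBINT x. ?g x) = of_real (sqrt (pi / (pi * exp q)))"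
        using gaussian_fourier[OF pe, of 0] by (simp del: of_real_exp)
      then have "(LBINT x. ?g x) = sqrt (pi / (pi * exp q))" by (simp only: of_real_eq_iff)
      moreover have "sqrt (pi / (pi * exp q)) = 1 / exp (q / 2)"
      proof (rule real_sqrt_unique)
        show "(1 / exp (q / 2))\<^sup>2 = pi / (pi * exp q)" by (simp add: power_divide flip: exp_of_nat_mult)
      qed simp
      ultimately show ?thesis by simp
    qed
    ultimately have Js: "J sums (1 / (2 * exp (q / 2)))" by (simp add: sums_iff)
    let ?E = "exp (q / 2) * exp (- pi * c\<^sup>2 * exp q)"
    have "I k q = ?E * J k" for k
    proof -
      have "I k q = (LBINT t:{0..1}. ?E * ?g (real k + t))"
        unfolding I_def by (intro set_lebesgue_integral_cong) (auto simp: algebra_simps simp flip: exp_add)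
      then show ?thesis unfolding J_def by simp
    qed
    then have ek: "e k q = ?E * (J k - exp (- (pi * (real (Suc k))\<^sup>2 * exp q)))" for k
      unfolding e_def by (simp add: algebra_simps flip: exp_add)
    have "(\<lambda>k. ?E * (J k - exp (- (pi * (real (Suc k))\<^sup>2 * exp q)))) sums (?E * (1 / (2 * exp (q / 2)) - om (exp q)))"
      by (intro sums_mult sums_diff Js om_sums) simp
    also have "?E * (1 / (2 * exp (q / 2)) - om (exp q)) = - (exp (q / 4) * phi q * exp (- pi * c\<^sup>2 * exp q))"
    proof -
      have "exp (q / 2) * (1 / (2 * exp (q / 2)) - om (exp q)) = 1 / 2 - chi q" by (simp add: chi_def right_diff_distrib)
      also have "\<dots> = - (exp (q / 4) * phi q)" by (simp add: chi_phi)
      finally have h: "exp (q / 2) * (1 / (2 * exp (q / 2)) - om (exp q)) = - (exp (q / 4) * phi q)" .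
      have "?E * (1 / (2 * exp (q / 2)) - om (exp q)) = exp (q / 2) * (1 / (2 * exp (q / 2)) - om (exp q)) * exp (- pi * c\<^sup>2 * exp q)"
        by (simp only: mult_ac)
      then show ?thesis unfolding h by simp
    qed
    finally show ?thesis unfolding ek .
  qed
  define X where "X k = arsinh ((real k + 1) / c) - arsinh (real k / c) - 1 / sqrt ((real (Suc k))\<^sup>2 + c\<^sup>2)" for k
  have "X sums (bessel_psi c - ln (c / 2))"
    unfolding sums_def
  proof -
    have tel: "(\<Sum>k<N. X k) = (ln (real N + 1) - (\<Sum>k<N. 1 / sqrt ((real (Suc k))\<^sup>2 + c\<^sup>2))) - (ln (real N + 1) - arsinh (real N / c))" for N
      by (induction N) (auto simp: X_def add.commute)
    have "(\<lambda>N. ln (real N + 1) - arsinh (real N / c)) \<longlonglongrightarrow> ln (c / 2)"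
    proof -
      have "(\<lambda>N. ln (real N + 1) - arsinh (real N / c)) \<longlonglongrightarrow> - ln (inverse c + inverse \<bar>c\<bar>)"
        unfolding arsinh_real_def using c by real_asymp
      moreover have "inverse c + inverse \<bar>c\<bar> = 2 / c" using c by (simp add: divide_inverse)
      ultimately show ?thesis using c by (simp add: ln_div)
    qed
    then show "(\<lambda>N. \<Sum>k<N. X k) \<longlonglongrightarrow> bessel_psi c - ln (c / 2)"
      unfolding tel using c by (intro tendsto_diff bessel_psi_limit) auto
  qed
  moreover have XI: "integral\<^sup>L lborel (e k) = X k" "integrable lborel (e k)" for k
    using eI[of k] by (simp_all add: has_bochner_integral_iff X_def)
  have ne: "norm (e k q) = e k q" for k q using e0[of k q] by simp
  have A: "AE q in lborel. summable (\<lambda>k. norm (e k q))" unfolding ne using esum by (simp add: sums_iff)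
  have B: "summable (\<lambda>k. LBINT q. norm (e k q))" unfolding ne using XI \<open>X sums _\<close> by (simp add: sums_iff)
  have "(\<lambda>k. integral\<^sup>L lborel (e k)) sums (LBINT q. (\<Sum>k. e k q))" by (rule sums_integral[OF XI(2) A B])
  moreover have "integrable lborel (\<lambda>q. (\<Sum>k. e k q))" by (rule integrable_suminf[OF XI(2) A B])
  moreover have "(\<Sum>k. e k q) = - (exp (q / 4) * phi q * exp (- pi * c\<^sup>2 * exp q))" for q
    using esum by (simp add: sums_iff)
  ultimately show ?thesis using XI(1) \<open>X sums _\<close> by (simp add: has_bochner_integral_iff) (metis sums_unique2)
qed

definition bessel_rest :: "real \<Rightarrow> real" where
  "bessel_rest c = (LBINT q. om (exp (- q)) * exp (- pi * c\<^sup>2 * exp q))"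

text \<open>Evenness of \<open>phi\<close> replaces \<open>om (exp q)\<close> by
  \<open>om (exp (- q))\<close>; in this form \<open>1 / (2 * c)\<close> splits off and the
  remaining integrand is nonnegative. The upper bound is the sign of \<open>phi\<close> once
  more.\<close>

lemma
  assumes c: "c > 0"
  shows integrable_bessel_rest: "integrable lborel (\<lambda>q. om (exp (- q)) * exp (- pi * c\<^sup>2 * exp q))"
    and bessel_psi_eq: "bessel_psi c = ln (c / 2) + 1 / (2 * c) - bessel_rest c"
    and bessel_rest_bounds: "0 \<le> bessel_rest c" "bessel_rest c \<le> 1 / (2 * c)"
proof -
  let ?g = "exp (- pi * c\<^sup>2 * exp q)"
  have e: "om (exp (- q)) * exp (- pi * c\<^sup>2 * exp q) = (1 / 2) * (exp (q / 2) * exp (- pi * c\<^sup>2 * exp q)) - (- (exp (q / 4) * phi q * exp (- pi * c\<^sup>2 * exp q)))" for q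
  proof -
    have "exp (q / 4) * phi q = exp (q / 4) * phi (- q)" by (simp add: phi_even)
    also have "\<dots> = om (exp (- q)) - exp (q / 2) / 2"
      unfolding phi_def by (simp add: right_diff_distrib mult.assoc[symmetric] flip: exp_add)
    finally have "om (exp (- q)) = exp (q / 4) * phi q + exp (q / 2) / 2" by simp
    then show ?thesis by (simp only:) (simp add: algebra_simps)
  qed
  have H: "has_bochner_integral lborel (\<lambda>q. om (exp (- q)) * exp (- pi * c\<^sup>2 * exp q)) ((1 / 2) * (1 / c) - (bessel_psi c - ln (c / 2)))"
    unfolding e by (intro has_bochner_integral_diff has_bochner_integral_mult_right exp_gauss_integral bessel_psi_theta c)
  then show "integrable lborel (\<lambda>q. om (exp (- q)) * exp (- pi * c\<^sup>2 * exp q))" by (simp add: has_bochner_integral_iff)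
  from H have R: "bessel_rest c = (1 / 2) * (1 / c) - (bessel_psi c - ln (c / 2))"
    unfolding bessel_rest_def by (simp add: has_bochner_integral_iff)
  then show "bessel_psi c = ln (c / 2) + 1 / (2 * c) - bessel_rest c" by simp
  show "0 \<le> bessel_rest c" unfolding bessel_rest_def
    by (intro integral_nonneg_AE AE_I2 mult_nonneg_nonneg om_nonneg) auto
  have "bessel_psi c - ln (c / 2) = (LBINT q. - (exp (q / 4) * phi q * exp (- pi * c\<^sup>2 * exp q)))"
    using bessel_psi_theta[OF c] by (simp add: has_bochner_integral_iff)
  also have "\<dots> \<ge> 0"
  proof (intro integral_nonneg_AE AE_I2)
    show "0 \<le> - (exp (q / 4) * phi q * exp (- pi * c\<^sup>2 * exp q))" for q
      using phi_bounds(1)[of q] by (simp add: mult_nonneg_nonpos mult_nonpos_nonneg)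
  qed
  finally show "bessel_rest c \<le> 1 / (2 * c)" using R by simp
qed

subsection \<open>Koshliakov's sum\<close>

text \<open>The regularised integral of \<open>chi\<close>, as evaluated in
  \<open>chi_cut_integral\<close>.\<close>

definition theta_const :: real where "theta_const = (euler_mascheroni - ln (4 * pi)) / 2"

text \<open>The sum of \<open>bessel_rest\<close> over the positive multiples of \<open>y\<close>,
  in closed form up to the self-convolution.\<close>

definition koshliakov :: "real \<Rightarrow> real" where
  "koshliakov y = phi_conv (2 * ln y) / sqrt y + (theta_const - ln y / 2) / y"

text \<open>The product of the two theta values is a multiple of
  \<open>phi (- q) * phi (z + q)\<close>, which integrates to the convolution, plus a multiple of
  \<open>chi (z + q) + chi (- q) - 1 / 2\<close>. Each \<open>chi\<close> gives
  \<open>theta_const\<close> once its step is removed; the steps and the constant combine to the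
  difference of two half-lines, of signed length \<open>- z\<close>.\<close>

lemma om_product_integral:
  "has_bochner_integral lborel (\<lambda>q. om (exp (- q)) * om (exp (z + q)))
     (exp (- z / 4) * phi_conv z + exp (- z / 2) * (theta_const - z / 4))"
proof -
  define c where "c q = chi q - indicator {..<0} q / 2" for q
  have cI: "has_bochner_integral lborel c theta_const"
    using integrable_chi_cut chi_cut_integral by (simp add: c_def[abs_def] has_bochner_integral_iff theta_const_def)
  have c1: "has_bochner_integral lborel (\<lambda>q. c (z + 1 * q)) theta_const"
    using has_bochner_integral_lborel_affine[OF cI, of 1 z] by simp
  have c2: "has_bochner_integral lborel (\<lambda>q. c (0 + (-1) * q)) theta_const"
    using has_bochner_integral_lborel_affine[OF cI, of "-1" 0] by simp
  define h where "h q = (if q < - z then 1 else 0) - (if q < 0 then 1 else 0 :: real)" for q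
  have h: "has_bochner_integral lborel h (- z)" unfolding h_def[abs_def] by (rule half_line_difference)
  have "has_bochner_integral lborel (\<lambda>q. phi (0 + 1 * q) * phi (z - (0 + 1 * q))) (phi_conv z)"
    using integrable_phi_mult[of z] by (simp add: has_bochner_integral_iff phi_conv_def)
  then have "has_bochner_integral lborel (\<lambda>r. phi r * phi (z - r)) (phi_conv z)" by simp
  then have "has_bochner_integral lborel (\<lambda>q. phi (0 + (-1) * q) * phi (z - (0 + (-1) * q))) (phi_conv z /\<^sub>R \<bar>-1\<bar>)"
    by (rule has_bochner_integral_lborel_affine) simp
  then have p: "has_bochner_integral lborel (\<lambda>q. phi (- q) * phi (z + q)) (phi_conv z)" by simp
  have H: "has_bochner_integral lborel (\<lambda>q. exp (- z / 4) * (phi (- q) * phi (z + q)) + (exp (- z / 2) / 2) * ((c (z + 1 * q) + c (0 + (-1) * q)) + (1 / 2) * h q))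
     (exp (- z / 4) * phi_conv z + (exp (- z / 2) / 2) * ((theta_const + theta_const) + (1 / 2) * (- z)))"
    by (intro has_bochner_integral_add has_bochner_integral_mult_right p c1 c2 h)
  \<comment> \<open>At \<open>q = 0\<close> the step of the reflected term and the one inside
    \<open>h\<close> both miss the point, so the constant 1/2 is not produced there; the single
    point is a null set.\<close>
  have e: "om (exp (- q)) * om (exp (z + q)) = exp (- z / 4) * (phi (- q) * phi (z + q)) + (exp (- z / 2) / 2) * ((c (z + 1 * q) + c (0 + (-1) * q)) + (1 / 2) * h q)"
    if "q \<noteq> 0" for q
  proof -
    have i: "(c (z + 1 * q) + c (0 + (-1) * q)) + (1 / 2) * h q = chi (z + q) + chi (- q) - 1 / 2"
      using that by (auto simp: c_def h_def split: split_indicator)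
    define A B where "A = om (exp (- q))" and "B = om (exp (z + q))"
    define a b where "a = exp (q / 4)" and "b = exp (z / 4)"
    have ab: "a > 0" "b > 0" by (auto simp: a_def b_def)
    have half: "exp (x / 2) = (exp (x / 4))\<^sup>2" for x :: real by (simp flip: exp_of_nat_mult)
    have neg: "exp (- x / t) = 1 / exp (x / t)" for x t :: real by (simp add: exp_minus inverse_eq_divide)
    have add: "exp ((z + q) / t) = exp (z / t) * exp (q / t)" for t by (simp add: add_divide_distrib exp_add)
    have E: "exp (- q / 4) = 1 / a" "exp (q / 4) = a" "exp ((z + q) / 4) = b * a" "exp (- (z + q) / 4) = 1 / (b * a)"
      "exp (- q / 2) = 1 / a\<^sup>2" "exp ((z + q) / 2) = b\<^sup>2 * a\<^sup>2" "exp (- z / 4) = 1 / b" "exp (- z / 2) = 1 / b\<^sup>2"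
      unfolding neg half add a_def b_def power_mult_distrib by (simp_all add: power_divide)
    have ph: "phi (- q) = (1 / a) * A - a / 2" "phi (z + q) = (b * a) * B - 1 / (b * a) / 2"
      "chi (z + q) = b\<^sup>2 * a\<^sup>2 * B" "chi (- q) = 1 / a\<^sup>2 * A"
      unfolding phi_def chi_def E A_def[symmetric] B_def[symmetric] by (simp_all add: a_def)
    show ?thesis unfolding i ph E A_def[symmetric] B_def[symmetric]
      using ab by (simp add: field_simps power2_eq_square)
  qed
  have "AE q in lborel. exp (- z / 4) * (phi (- q) * phi (z + q)) + (exp (- z / 2) / 2) * ((c (z + 1 * q) + c (0 + (-1) * q)) + (1 / 2) * h q) = om (exp (- q)) * om (exp (z + q))"
    using AE_lborel_singleton[of 0] by eventually_elim (rule e[symmetric])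
  moreover have [measurable]: "c \<in> borel_measurable borel" "h \<in> borel_measurable borel"
    unfolding c_def[abs_def] h_def[abs_def] by measurable
  ultimately have "has_bochner_integral lborel (\<lambda>q. om (exp (- q)) * om (exp (z + q)))
     (exp (- z / 4) * phi_conv z + (exp (- z / 2) / 2) * ((theta_const + theta_const) + (1 / 2) * (- z)))"
    using H by (subst (asm) has_bochner_integral_cong_AE) auto
  then show ?thesis by (simp add: field_simps)
qed

text \<open>The Gaussian factors of \<open>bessel_rest\<close> at the multiples of \<open>y\<close>
  add up to \<open>om (exp (z + q))\<close> with \<open>exp z = y^2\<close>; all terms are
  nonnegative, so the sum itself dominates its partial sums.\<close>

lemma koshliakov_sums:
  assumes y: "y > 0"
  shows "(\<lambda>m. bessel_rest (real (Suc m) * y)) sums koshliakov y"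
proof -
  define z where "z = 2 * ln y"
  have ez: "exp z = y\<^sup>2" "exp (- z / 4) = 1 / sqrt y" "exp (- z / 2) = 1 / y"
  proof -
    show "exp z = y\<^sup>2" using exp_of_nat_mult[of 2 "ln y"] y by (simp add: z_def)
    have "exp (- z / 4) = exp (- ln (sqrt y))" using y by (simp add: z_def ln_sqrt)
    also have "\<dots> = 1 / sqrt y" using y by (simp add: exp_minus inverse_eq_divide)
    finally show "exp (- z / 4) = 1 / sqrt y" .
    show "exp (- z / 2) = 1 / y" using y by (simp add: z_def exp_minus inverse_eq_divide)
  qed
  define f where "f m q = om (exp (- q)) * exp (- pi * (real (Suc m) * y)\<^sup>2 * exp q)" for m q
  define F where "F q = om (exp (- q)) * om (exp (z + q))" for q
  have FI: "has_bochner_integral lborel F (koshliakov y)"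
  proof -
    have "exp (- z / 4) * phi_conv z + exp (- z / 2) * (theta_const - z / 4) = koshliakov y"
      unfolding ez koshliakov_def by (simp add: z_def)
    then show ?thesis using om_product_integral[of z] by (simp only: F_def[abs_def])
  qed
  have fs: "(\<lambda>m. f m q) sums F q" for q
  proof -
    have "(\<lambda>m. om (exp (- q)) * exp (- (pi * (real (Suc m))\<^sup>2 * exp (z + q)))) sums F q"
      unfolding F_def by (intro sums_mult om_sums) simp
    then show ?thesis unfolding f_def exp_add ez by (simp add: power_mult_distrib mult_ac)
  qed
  have f0: "0 \<le> f m q" for m q unfolding f_def by (intro mult_nonneg_nonneg om_nonneg) auto
  have fi: "integrable lborel (f m)" for m
    unfolding f_def using y by (intro integrable_bessel_rest) simp
  have [measurable]: "f m \<in> borel_measurable borel" for m unfolding f_def by measurable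
  have Fi: "integrable lborel F" using FI by (simp add: has_bochner_integral_iff)
  have "(\<lambda>N. LBINT q. (\<Sum>m<N. f m q)) \<longlonglongrightarrow> integral\<^sup>L lborel F"
  proof (rule integral_dominated_convergence[where w = F])
    show "AE q in lborel. (\<lambda>N. \<Sum>m<N. f m q) \<longlonglongrightarrow> F q" using fs by (simp add: sums_def)
    show "AE q in lborel. norm (\<Sum>m<N. f m q) \<le> F q" for N
    proof (rule AE_I2)
      fix q
      have "(\<Sum>m<N. f m q) \<le> F q"
        using sum_le_suminf[of "\<lambda>m. f m q" "{..<N}"] fs[of q] f0 by (simp add: sums_iff)
      then show "norm (\<Sum>m<N. f m q) \<le> F q" using f0 by (simp add: sum_nonneg)
    qed
  qed (use Fi in auto)
  moreover have "(LBINT q. (\<Sum>m<N. f m q)) = (\<Sum>m<N. bessel_rest (real (Suc m) * y))" for N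
    using fi by (subst Bochner_Integration.integral_sum) (simp_all add: bessel_rest_def f_def[abs_def])
  ultimately show ?thesis using FI by (simp add: sums_def has_bochner_integral_iff)
qed

subsection \<open>The mixing measure\<close>

text \<open>The two exponents leave room around the functions to be averaged: \<open>1\<close>, \<open>ln r\<close>, \<open>1 / r\<close>,
  \<open>(ln r) / r\<close> and the powers of \<open>r\<close> with exponent of real part \<open>- 1 / 2\<close>.\<close>

definition growth :: "real \<Rightarrow> real" where
  "growth r = r powr (1 / 2) + r powr (- 3 / 2)"

lemma growth_nonneg: "0 \<le> growth r" by (simp add: growth_def)

lemma powr_le_growth:
  assumes "r > 0" "- 3 / 2 \<le> a" "a \<le> 1 / 2" shows "r powr a \<le> growth r"
proof (cases "r \<ge> 1")
  case True
  then have "r powr a \<le> r powr (1 / 2)" using assms by (intro powr_mono) auto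
  then show ?thesis by (simp add: growth_def add_increasing2)
next
  case False
  then have "r powr a \<le> r powr (- 3 / 2)" using assms by (intro powr_mono') auto
  then show ?thesis by (simp add: growth_def add_increasing)
qed

lemma abs_ln_le_powr:
  assumes "r > (0::real)" shows "\<bar>ln r\<bar> \<le> 2 * (r powr (1 / 2) + r powr (- 1 / 2))"
proof -
  have 1: "ln x \<le> 2 * x powr (1 / 2)" if "x > 0" for x :: real
  proof -
    have "ln (x powr (1 / 2)) \<le> x powr (1 / 2) - 1" using that by (intro ln_le_minus_one) simp
    then show ?thesis using that by (simp add: ln_powr)
  qed
  have "- ln r \<le> 2 * r powr (- 1 / 2)" 
  proof -
    have "(1 / r) powr (1 / 2) = r powr (- 1 / 2)"
      using assms powr_minus_divide[of r "1/2"] by (simp add: powr_divide)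
    moreover have "ln (1 / r) = - ln r" using assms by (simp add: ln_div)
    ultimately show ?thesis using 1[of "1 / r"] assms by simp
  qed
  moreover have "\<bar>l\<bar> \<le> 2 * (a + b)" if "- l \<le> 2 * b" "0 \<le> a" "0 \<le> b" "l \<le> 2 * a" for l a b :: real
    using that unfolding distrib_left by linarith
  ultimately show ?thesis using 1[OF assms] by (meson powr_ge_zero)
qed

lemma growth_scale:
  assumes "a > 0" "r > 0" shows "growth (a * r) \<le> growth a * growth r"
proof -
  have "growth (a * r) = a powr (1/2) * r powr (1/2) + a powr (-3/2) * r powr (-3/2)"
    using assms by (simp add: growth_def powr_mult)
  also have "\<dots> \<le> growth a * growth r" by (simp add: growth_def algebra_simps)
  finally show ?thesis .
qed

section \<open>Functions that can be averaged\<close>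

text \<open>The bound is asked for on the positive axis only, where \<open>v / u\<close> lies on the
  support of the kernel.\<close>

definition admissible :: "(real \<Rightarrow> complex) \<Rightarrow> bool" where
  "admissible f \<longleftrightarrow> f \<in> borel_measurable borel \<and> (\<exists>K. \<forall>r>0. norm (f r) \<le> K * growth r)"

lemma admissible_measurable [measurable_dest]: "admissible f \<Longrightarrow> f \<in> borel_measurable borel"
  by (simp add: admissible_def)

lemma admissible_bound:
  assumes "admissible f" obtains K where "K \<ge> 0" "\<And>r. r > 0 \<Longrightarrow> norm (f r) \<le> K * growth r"
proof -
  obtain K where K: "\<And>r. r > 0 \<Longrightarrow> norm (f r) \<le> K * growth r" using assms by (auto simp: admissible_def)
  have "norm (f r) \<le> \<bar>K\<bar> * growth r" if "r > 0" for r
    using K[OF that] growth_nonneg[of r] by (meson abs_ge_self mult_right_mono order_trans)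
  then show ?thesis using that[of "\<bar>K\<bar>"] by simp
qed

lemma admissibleI:
  assumes "f \<in> borel_measurable borel" "\<And>r. r > 0 \<Longrightarrow> norm (f r) \<le> K * growth r"
  shows "admissible f" using assms by (auto simp: admissible_def)

lemma admissible_add:
  assumes "admissible f" "admissible g" shows "admissible (\<lambda>r. f r + g r)"
proof -
  obtain K where K: "K \<ge> 0" "\<And>r. r > 0 \<Longrightarrow> norm (f r) \<le> K * growth r" using admissible_bound[OF assms(1)] by blast
  obtain L where L: "L \<ge> 0" "\<And>r. r > 0 \<Longrightarrow> norm (g r) \<le> L * growth r" using admissible_bound[OF assms(2)] by blast
  show ?thesis
  proof (rule admissibleI[where K = "K + L"])
    show "norm (f r + g r) \<le> (K + L) * growth r" if "r > 0" for r
      unfolding distrib_right using K(2)[OF that] L(2)[OF that] by (rule norm_triangle_mono)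
    show "(\<lambda>r. f r + g r) \<in> borel_measurable borel" using assms by measurable
  qed
qed

lemma admissible_cmult:
  assumes "admissible f" shows "admissible (\<lambda>r. c * f r)"
proof -
  obtain K where K: "K \<ge> 0" "\<And>r. r > 0 \<Longrightarrow> norm (f r) \<le> K * growth r" using admissible_bound[OF assms(1)] by blast
  show ?thesis
  proof (rule admissibleI[where K = "norm c * K"])
    show "norm (c * f r) \<le> (norm c * K) * growth r" if "r > 0" for r
      unfolding norm_mult mult.assoc using K(2)[OF that] by (rule mult_left_mono) simp
    show "(\<lambda>r. c * f r) \<in> borel_measurable borel" using assms by measurable
  qed
qed

lemma admissible_scale:
  assumes "admissible f" "a > 0" shows "admissible (\<lambda>r. f (a * r))"
proof -
  obtain K where K: "K \<ge> 0" "\<And>r. r > 0 \<Longrightarrow> norm (f r) \<le> K * growth r" using admissible_bound[OF assms(1)] by blast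
  have "norm (f (a * r)) \<le> (K * growth a) * growth r" if "r > 0" for r
    using K(2)[of "a * r"] that assms(2) mult_left_mono[OF growth_scale[OF assms(2) that] K(1)]
    by (simp add: mult.assoc)
  moreover have "(\<lambda>r. f (a * r)) \<in> borel_measurable borel"
    by (rule measurable_compose[OF _ admissible_measurable[OF assms(1)]]) measurable
  ultimately show ?thesis by (rule admissibleI[rotated])
qed

lemma admissible_of_real_powr:
  assumes "- 3 / 2 \<le> a" "a \<le> 1 / 2" shows "admissible (\<lambda>r. of_real (r powr a))"
  using powr_le_growth[OF _ assms] by (intro admissibleI[where K = 1]) auto

lemma admissible_const: "admissible (\<lambda>r. c)"
  using admissible_cmult[OF admissible_of_real_powr[of 0], of c] powr_le_growth[of _ 0]
  by (intro admissibleI[where K = "norm c"]) (auto simp: mult_le_cancel_left1)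

lemma admissible_ln: "admissible (\<lambda>r. of_real (ln r))"
proof (rule admissibleI[where K = 4])
  fix r :: real assume "r > 0"
  then show "norm (complex_of_real (ln r)) \<le> 4 * growth r"
    using abs_ln_le_powr[of r] powr_le_growth[of r "1/2"] powr_le_growth[of r "-1/2"] by simp
qed measurable

lemma admissible_ln_over: "admissible (\<lambda>r. of_real (ln r / r))"
proof (rule admissibleI[where K = 4])
  fix r :: real assume r: "r > 0"
  have "\<bar>ln r\<bar> / r \<le> 2 * (r powr (1 / 2) + r powr (- 1 / 2)) / r"
    using abs_ln_le_powr[OF r] r by (intro divide_right_mono) auto
  also have "\<dots> = 2 * (r powr (1 / 2 - 1) + r powr (- 1 / 2 - 1))"
    unfolding powr_diff using r by (simp add: add_divide_distrib)
  also have "\<dots> \<le> 4 * growth r"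
    using powr_le_growth[OF r, of "1/2 - 1"] powr_le_growth[OF r, of "-1/2 - 1"] by simp
  finally show "norm (complex_of_real (ln r / r)) \<le> 4 * growth r" using r by (simp add: norm_divide)
qed measurable

section \<open>The kernel in \<open>v\<close> and \<open>u\<close> and its majorant\<close>

definition sinhc :: "complex \<Rightarrow> real \<Rightarrow> complex" where
  "sinhc w u = (if w = 0 then of_real u else sinh (w * of_real u) / w)"

lemma norm_sinh_le: "norm (sinh z) \<le> norm z * exp (norm z)" for z :: complex
proof -
  have "norm (sinh z - sinh 0) \<le> exp (norm z) * norm (z - 0)"
  proof (rule field_differentiable_bound[where S = "cball 0 (norm z)" and f' = cosh])
    fix x :: complex assume x: "x \<in> cball 0 (norm z)"
    show "(sinh has_field_derivative cosh x) (at x within cball 0 (norm z))"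
      by (auto intro!: derivative_eq_intros)
    have "norm (cosh x) \<le> (norm (exp x) + norm (exp (- x))) / 2"
      unfolding cosh_field_def using norm_triangle_ineq[of "exp x" "exp (- x)"] by (simp add: norm_divide)
    also have "\<dots> \<le> (exp (norm z) + exp (norm z)) / 2"
      using norm_exp[of x] norm_exp[of "- x"] x
      by (intro divide_right_mono add_mono) (auto intro: order_trans)
    finally show "norm (cosh x) \<le> exp (norm z)" by simp
  qed auto
  then show ?thesis by (simp add: mult.commute)
qed

lemma sinhc_bound:
  assumes "u \<ge> 0" "norm w \<le> W" shows "norm (sinhc w u) \<le> u * exp (W * u)"
proof (cases "w = 0")
  case True
  have "0 \<le> W" using assms norm_ge_zero order_trans by blast
  then have "u * 1 \<le> u * exp (W * u)" using assms by (intro mult_left_mono) auto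
  then show ?thesis using True assms by (simp add: sinhc_def)
next
  case False
  have "norm (sinhc w u) = norm (sinh (w * of_real u)) / norm w" using False by (simp add: sinhc_def norm_divide)
  also have "\<dots> \<le> norm (w * of_real u) * exp (norm (w * of_real u)) / norm w"
    by (intro divide_right_mono norm_sinh_le) auto
  also have "\<dots> = u * exp (norm w * u)" using False assms by (simp add: norm_mult)
  also have "\<dots> \<le> u * exp (W * u)" using assms by (intro mult_left_mono) (auto intro: mult_right_mono)
  finally show ?thesis .
qed

lemma sinhc_measurable [measurable]: "sinhc w \<in> borel_measurable borel"
proof (cases "w = 0")
  case False
  then have "continuous_on UNIV (sinhc w)" unfolding sinhc_def sinh_field_def by (auto intro!: continuous_intros)
  then show ?thesis by (rule borel_measurable_continuous_onI)
qed (simp add: sinhc_def[abs_def])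

lemma sinhc_tendsto: "((\<lambda>w. sinhc (a * w) u) \<longlongrightarrow> of_real u) (at 0)" if "a \<noteq> 0"
proof -
  have "((\<lambda>w. sinh (w * of_real u)) has_field_derivative cosh (0 * of_real u) * of_real u) (at 0)"
    by (auto intro!: derivative_eq_intros)
  then have "((\<lambda>w. sinh (w * of_real u) / w) \<longlongrightarrow> complex_of_real u) (at 0)"
    by (simp add: has_field_derivative_iff)
  moreover have "filterlim (\<lambda>w. a * w) (at 0) (at 0)"
    unfolding filterlim_at
  proof
    show "\<forall>\<^sub>F w in at 0. a * w \<in> UNIV \<and> a * w \<noteq> 0" using that by (simp add: eventually_at_filter)
    show "((\<lambda>w. a * w) \<longlongrightarrow> 0) (at 0)" by (auto intro!: tendsto_eq_intros)
  qed
  ultimately have "((\<lambda>w. sinh (a * w * of_real u) / (a * w)) \<longlongrightarrow> complex_of_real u) (at 0)"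
    by (rule filterlim_compose)
  moreover have "\<forall>\<^sub>F w in at 0. sinh (a * w * of_real u) / (a * w) = sinhc (a * w) u"
    using that by (auto simp: sinhc_def eventually_at_filter)
  ultimately show ?thesis by (rule Lim_transform_eventually)
qed

text \<open>Completing the square gives \<open>W * x - x^2 \<le> (W + 1)^2 / 4 - x\<close>, and a
  Gamma integral dominates.\<close>

lemma gauss_power_integrable:
  assumes a: "a > (-1::real)"
  shows "integrable lborel (\<lambda>x. indicator {0<..} x * (x powr a * exp (W * x - x\<^sup>2)))"
proof -
  have m: "set_borel_measurable borel {0<..} (\<lambda>x. x powr a * exp (W * x - x\<^sup>2))"
    unfolding set_borel_measurable_def by measurable
  have "integrable lborel (\<lambda>q. exp q *\<^sub>R (exp q powr a * exp (W * exp q - (exp q)\<^sup>2)))"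
  proof (rule Bochner_Integration.integrable_bound)
    show "integrable lborel (\<lambda>q. exp ((W + 1)\<^sup>2 / 4) * exp ((a + 1) * q - exp q))"
      using Gamma_integral_exp_real[of "a + 1"] a by (intro integrable_mult_right) (simp add: has_bochner_integral_iff)
    show "AE q in lborel. norm (exp q *\<^sub>R (exp q powr a * exp (W * exp q - (exp q)\<^sup>2))) \<le> norm (exp ((W + 1)\<^sup>2 / 4) * exp ((a + 1) * q - exp q))"
    proof (rule AE_I2)
      fix q :: real
      have "0 \<le> (exp q - (W + 1) / 2)\<^sup>2" by simp
      then have "W * exp q - (exp q)\<^sup>2 \<le> (W + 1)\<^sup>2 / 4 - exp q"
        by (simp add: power2_eq_square algebra_simps add_divide_distrib diff_divide_distrib)
      then have "exp ((a + 1) * q) * exp (W * exp q - (exp q)\<^sup>2) \<le> exp ((a + 1) * q) * exp ((W + 1)\<^sup>2 / 4 - exp q)"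
        by (intro mult_left_mono) auto
      moreover have "exp q *\<^sub>R (exp q powr a * exp (W * exp q - (exp q)\<^sup>2)) = exp ((a + 1) * q) * exp (W * exp q - (exp q)\<^sup>2)"
        by (simp add: powr_def distrib_right exp_add)
      moreover have "exp ((W + 1)\<^sup>2 / 4) * exp ((a + 1) * q - exp q) = exp ((a + 1) * q) * exp ((W + 1)\<^sup>2 / 4 - exp q)"
        by (simp flip: exp_add)
      ultimately show "norm (exp q *\<^sub>R (exp q powr a * exp (W * exp q - (exp q)\<^sup>2))) \<le> norm (exp ((W + 1)\<^sup>2 / 4) * exp ((a + 1) * q - exp q))"
        by (simp only: real_norm_def abs_mult abs_exp_cancel)
    qed
  qed measurable
  then show ?thesis using set_integrable_exp_subst[OF m] by (simp add: set_integrable_def)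
qed

text \<open>The pair is \<open>(v, u)\<close>, and \<open>sinhc (\<i> * w) v\<close> is \<open>sin (w v) / w\<close>, extended to \<open>w = 0\<close>:
  the factor \<open>1 / w\<^sup>2\<close> of \<open>psi_gen\<close> is absorbed, so that the value at \<open>w = 0\<close> is the limit.\<close>

definition mix_kernel :: "complex \<Rightarrow> real \<times> real \<Rightarrow> complex" where
  "mix_kernel w p = (indicator {0<..} (fst p) * indicator {0<..} (snd p) * (4 / sqrt pi * exp (- ((snd p)\<^sup>2 + (fst p)\<^sup>2)) / snd p)) *\<^sub>R
     (sinhc (\<i> * w) (fst p) * sinhc w (snd p))"

text \<open>The two factors \<open>sinhc\<close> contribute \<open>v * u\<close> and exponentials,
  and the division by \<open>u\<close> in the kernel cancels one power: hence the exponents 1 and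
  0.\<close>

definition mix_kernel_bound :: "real \<Rightarrow> real \<times> real \<Rightarrow> real" where
  "mix_kernel_bound W p = 4 / sqrt pi * ((indicator {0<..} (fst p) * (fst p powr 1 * exp (W * fst p - (fst p)\<^sup>2))) *
     (indicator {0<..} (snd p) * (snd p powr 0 * exp (W * snd p - (snd p)\<^sup>2))))"

lemma mix_kernel_measurable [measurable]: "mix_kernel w \<in> borel_measurable (borel \<Otimes>\<^sub>M borel)"
  unfolding mix_kernel_def[abs_def] by measurable

lemma norm_mix_kernel_le:
  assumes "norm w \<le> W" shows "norm (mix_kernel w p) \<le> mix_kernel_bound W p"
proof (cases "fst p > 0 \<and> snd p > 0")
  case True
  define v u where "v = fst p" and "u = snd p"
  have vu: "v > 0" "u > 0" using True by (auto simp: v_def u_def)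
  have ind: "indicator {0<..} v = (1 :: real)" "indicator {0<..} u = (1 :: real)" using vu by simp_all
  have c0: "0 \<le> 4 / sqrt pi * exp (- (u\<^sup>2 + v\<^sup>2)) / u" using vu by simp
  have "norm (mix_kernel w p) = (4 / sqrt pi * exp (- (u\<^sup>2 + v\<^sup>2)) / u) * (norm (sinhc (\<i> * w) v) * norm (sinhc w u))"
    unfolding mix_kernel_def v_def[symmetric] u_def[symmetric] ind mult_1 norm_scaleR norm_mult abs_of_nonneg[OF c0] ..
  also have "\<dots> \<le> (4 / sqrt pi * exp (- (u\<^sup>2 + v\<^sup>2)) / u) * ((v * exp (W * v)) * (u * exp (W * u)))"
    using vu assms c0 by (intro mult_left_mono mult_mono sinhc_bound) (simp_all add: norm_mult)
  also have "\<dots> = mix_kernel_bound W p"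
  proof -
    have e: "exp (- (u\<^sup>2 + v\<^sup>2)) = exp (- u\<^sup>2) * exp (- v\<^sup>2)" "exp (W * x - x\<^sup>2) = exp (W * x) * exp (- x\<^sup>2)" for x
      by (simp_all flip: exp_add)
    show ?thesis unfolding mix_kernel_bound_def v_def[symmetric] u_def[symmetric] ind mult_1 e
      using vu by simp
  qed
  finally show ?thesis .
qed (auto simp: mix_kernel_def mix_kernel_bound_def)

text \<open>Multiplied by the majorant, the two powers in \<open>growth\<close> give exponents 3/2
  and -1/2 in one variable against -1/2 and 3/2 in the other, all above -1, and the integral splits
  into products.\<close>

lemma integrable_mix_kernel_bound_growth: "integrable (lborel \<Otimes>\<^sub>M lborel) (\<lambda>p. mix_kernel_bound W p * growth (fst p / snd p))"
proof -
  let ?g = "\<lambda>a x. indicator {0<..} x * (x powr a * exp (W * x - x\<^sup>2)) :: real"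
  have "integrable (lborel \<Otimes>\<^sub>M lborel) (\<lambda>p. 4 / sqrt pi * (?g (3/2) (fst p) * ?g (-1/2) (snd p) + ?g (-1/2) (fst p) * ?g (3/2) (snd p)))"
    by (intro integrable_mult_right Bochner_Integration.integrable_add integrable_pair_mult gauss_power_integrable) auto
  moreover have "4 / sqrt pi * (?g (3/2) (fst p) * ?g (-1/2) (snd p) + ?g (-1/2) (fst p) * ?g (3/2) (snd p)) = mix_kernel_bound W p * growth (fst p / snd p)" for p
  proof (cases "fst p > 0 \<and> snd p > 0")
    case True
    define v u where "v = fst p" and "u = snd p"
    have vu: "v > 0" "u > 0" using True by (auto simp: v_def u_def)
    have 1: "growth (v / u) = v powr (1/2) * u powr (-1/2) + v powr (-3/2) * u powr (3/2)"
    proof -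
      have "u powr (- 1 / 2) = 1 / u powr (1 / 2)" using powr_minus_divide[of u "1/2"] by simp
      moreover have "u powr (- 3 / 2) = 1 / u powr (3 / 2)" using powr_minus_divide[of u "3/2"] by simp
      ultimately show ?thesis using vu unfolding growth_def by (simp only: powr_divide less_imp_le) simp
    qed
    have 2: "v powr (3/2) = v powr 1 * v powr (1/2)" "v powr (-1/2) = v powr 1 * v powr (-3/2)"
      by (simp_all only: powr_add[symmetric]) simp_all
    have ind: "indicator {0<..} v = (1 :: real)" "indicator {0<..} u = (1 :: real)" "u powr 0 = 1" using vu by simp_all
    show ?thesis unfolding mix_kernel_bound_def v_def[symmetric] u_def[symmetric] 1 2 ind
      by (simp only: mult_1 distrib_left distrib_right mult_ac)
  qed (auto simp: mix_kernel_bound_def)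
  ultimately show ?thesis by simp
qed

section \<open>The average and its limit theorems\<close>

text \<open>The weight is complex and not normalised; its total mass is
  \<open>CC (\<i> * w)\<close>, by \<open>CC_iw\<close>.\<close>

definition mix :: "complex \<Rightarrow> (real \<Rightarrow> complex) \<Rightarrow> complex" where
  "mix w f = (LINT p|(lborel \<Otimes>\<^sub>M lborel). mix_kernel w p * f (fst p / snd p))"

lemma mix_kernel_eq_0: "\<not> (fst p > 0 \<and> snd p > 0) \<Longrightarrow> mix_kernel w p = 0"
  by (auto simp: mix_kernel_def)

lemma norm_mix_kernel_mult_le:
  assumes "norm w \<le> W" "\<And>r. r > 0 \<Longrightarrow> norm (f r) \<le> K * growth r"
  shows "norm (mix_kernel w p * f (fst p / snd p)) \<le> K * (mix_kernel_bound W p * growth (fst p / snd p))"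
proof (cases "fst p > 0 \<and> snd p > 0")
  case True
  then have r: "fst p / snd p > 0" by simp
  have "norm (mix_kernel w p * f (fst p / snd p)) \<le> mix_kernel_bound W p * (K * growth (fst p / snd p))"
    unfolding norm_mult using norm_mix_kernel_le[OF assms(1)] assms(2)[OF r]
    using order_trans[OF norm_ge_zero norm_mix_kernel_le[OF assms(1)]] by (intro mult_mono) auto
  then show ?thesis by (simp add: mult_ac)
next
  case False
  then show ?thesis by (auto simp: mix_kernel_eq_0 mix_kernel_bound_def)
qed

lemma mix_kernel_comp_measurable:
  assumes "f \<in> borel_measurable borel"
  shows "(\<lambda>p. mix_kernel w p * f (fst p / snd p)) \<in> borel_measurable (lborel \<Otimes>\<^sub>M lborel)"
  using assms by measurable

lemma integrable_mix:
  assumes "admissible f"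
  shows "integrable (lborel \<Otimes>\<^sub>M lborel) (\<lambda>p. mix_kernel w p * f (fst p / snd p))"
proof -
  obtain K where K: "K \<ge> 0" "\<And>r. r > 0 \<Longrightarrow> norm (f r) \<le> K * growth r" using admissible_bound[OF assms] by blast
  show ?thesis
  proof (rule Bochner_Integration.integrable_bound[OF integrable_mult_right[OF integrable_mix_kernel_bound_growth[of "norm w"], of K]])
    show "AE p in (lborel \<Otimes>\<^sub>M lborel). norm (mix_kernel w p * f (fst p / snd p)) \<le> norm (K * (mix_kernel_bound (norm w) p * growth (fst p / snd p)))"
    proof (rule AE_I2)
      fix p
      show "norm (mix_kernel w p * f (fst p / snd p)) \<le> norm (K * (mix_kernel_bound (norm w) p * growth (fst p / snd p)))"
        using norm_mix_kernel_mult_le[of w "norm w" f K p] K by simp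
    qed
    show "(\<lambda>p. mix_kernel w p * f (fst p / snd p)) \<in> borel_measurable (lborel \<Otimes>\<^sub>M lborel)"
      using admissible_measurable[OF assms] by (rule mix_kernel_comp_measurable)
  qed
qed

lemma mix_cong: "(\<And>r. r > 0 \<Longrightarrow> f r = g r) \<Longrightarrow> mix w f = mix w g"
  unfolding mix_def
proof (rule Bochner_Integration.integral_cong[OF refl])
  fix p assume "\<And>r. r > 0 \<Longrightarrow> f r = g r"
  then show "mix_kernel w p * f (fst p / snd p) = mix_kernel w p * g (fst p / snd p)"
    by (cases "fst p > 0 \<and> snd p > 0") (auto simp: mix_kernel_eq_0)
qed

lemma mix_add: "admissible f \<Longrightarrow> admissible g \<Longrightarrow> mix w (\<lambda>r. f r + g r) = mix w f + mix w g"
  unfolding mix_def by (simp add: distrib_left integrable_mix)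

lemma mix_cmult: "mix w (\<lambda>r. c * f r) = c * mix w f"
  unfolding mix_def by (simp add: mult.left_commute)

text \<open>Identifies the limiting values at \<open>w = 0\<close> through which
  \<open>psi_gen\<close> and \<open>BB\<close> are defined there. A convergent sequence of
  parameters is bounded, so one majorant serves all of them.\<close>

lemma mix_tendsto_0:
  assumes f: "admissible f" shows "((\<lambda>w. mix w f) \<longlongrightarrow> mix 0 f) (at 0)"
  unfolding tendsto_at_iff_sequentially
proof (intro allI impI)
  fix X :: "nat \<Rightarrow> complex" assume X: "\<forall>i. X i \<in> UNIV - {0}" "X \<longlonglongrightarrow> 0"
  obtain W where W: "norm (X n) \<le> W" for n
    using convergent_imp_Bseq[OF convergentI[OF X(2)]] by (auto simp: Bseq_def)
  obtain K where K: "K \<ge> 0" "\<And>r. r > 0 \<Longrightarrow> norm (f r) \<le> K * growth r" using admissible_bound[OF f] by blast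
  have hat: "filterlim X (at 0) sequentially" using X by (auto simp: filterlim_at intro!: always_eventually)
  have "(\<lambda>n. LINT p|(lborel \<Otimes>\<^sub>M lborel). mix_kernel (X n) p * f (fst p / snd p)) \<longlonglongrightarrow> (LINT p|(lborel \<Otimes>\<^sub>M lborel). mix_kernel 0 p * f (fst p / snd p))"
  proof (rule integral_dominated_convergence[where w = "\<lambda>p. K * (mix_kernel_bound W p * growth (fst p / snd p))"])
    show "AE p in (lborel \<Otimes>\<^sub>M lborel). (\<lambda>n. mix_kernel (X n) p * f (fst p / snd p)) \<longlonglongrightarrow> mix_kernel 0 p * f (fst p / snd p)"
    proof (rule AE_I2)
      fix p :: "real \<times> real"
      have "(\<lambda>n. sinhc (\<i> * X n) (fst p)) \<longlonglongrightarrow> of_real (fst p)" "(\<lambda>n. sinhc (1 * X n) (snd p)) \<longlonglongrightarrow> of_real (snd p)"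
        by (rule filterlim_compose[OF sinhc_tendsto hat]; simp)+
      then have "(\<lambda>n. mix_kernel (X n) p) \<longlonglongrightarrow> (indicator {0<..} (fst p) * indicator {0<..} (snd p) * (4 / sqrt pi * exp (- ((snd p)\<^sup>2 + (fst p)\<^sup>2)) / snd p)) *\<^sub>R (of_real (fst p) * of_real (snd p))"
        unfolding mix_kernel_def by (intro tendsto_intros) auto
      then have "(\<lambda>n. mix_kernel (X n) p) \<longlonglongrightarrow> mix_kernel 0 p" by (simp add: mix_kernel_def[of 0] sinhc_def)
      then show "(\<lambda>n. mix_kernel (X n) p * f (fst p / snd p)) \<longlonglongrightarrow> mix_kernel 0 p * f (fst p / snd p)" by (rule tendsto_mult_right)
    qed
    show "AE p in (lborel \<Otimes>\<^sub>M lborel). norm (mix_kernel (X n) p * f (fst p / snd p)) \<le> K * (mix_kernel_bound W p * growth (fst p / snd p))" for n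
      using norm_mix_kernel_mult_le[OF W K(2)] by (intro AE_I2) auto
    show "integrable (lborel \<Otimes>\<^sub>M lborel) (\<lambda>p. K * (mix_kernel_bound W p * growth (fst p / snd p)))"
      by (intro integrable_mult_right integrable_mix_kernel_bound_growth)
  qed (intro mix_kernel_comp_measurable admissible_measurable[OF f])+
  then show "((\<lambda>w. mix w f) \<circ> X) \<longlonglongrightarrow> mix 0 f" by (simp add: mix_def o_def)
qed

text \<open>The kernel is complex, but the terms are nonnegative: all partial sums lie below the
  admissible sum \<open>F\<close>, and dominated convergence applies.\<close>

lemma mix_sums:
  assumes f: "\<And>m. f m \<in> borel_measurable borel" and F: "admissible (\<lambda>r. of_real (F r))"
    and f0: "\<And>m r. r > 0 \<Longrightarrow> 0 \<le> f m r" and s: "\<And>r. r > 0 \<Longrightarrow> (\<lambda>m. f m r) sums (F r :: real)"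
  shows "(\<lambda>m. mix w (\<lambda>r. of_real (f m r))) sums mix w (\<lambda>r. of_real (F r))"
proof -
  have part: "0 \<le> (\<Sum>m<N. f m r)" "(\<Sum>m<N. f m r) \<le> F r" if "r > 0" for N r
    using sum_le_suminf[of "\<lambda>m. f m r" "{..<N}"] s[OF that] f0[OF that] by (auto simp: sums_iff intro: sum_nonneg)
  have single: "f m r \<le> F r" if "r > 0" for m r
    using part(2)[OF that, of "Suc m"] part(1)[OF that, of m] by simp
  obtain K where K: "K \<ge> 0" "\<And>r. r > 0 \<Longrightarrow> norm (complex_of_real (F r)) \<le> K * growth r" using admissible_bound[OF F] by blast
  have ad: "admissible (\<lambda>r. complex_of_real (f m r))" for m
  proof (rule admissibleI[where K = K])
    show "norm (complex_of_real (f m r)) \<le> K * growth r" if "r > 0" for r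
      using K(2)[OF that] single[OF that, of m] f0[OF that, of m] by simp
  qed (use f in measurable)
  have "(\<lambda>N. LINT p|(lborel \<Otimes>\<^sub>M lborel). mix_kernel w p * of_real (\<Sum>m<N. f m (fst p / snd p))) \<longlonglongrightarrow> (LINT p|(lborel \<Otimes>\<^sub>M lborel). mix_kernel w p * of_real (F (fst p / snd p)))"
  proof (rule integral_dominated_convergence[where w = "\<lambda>p. K * (mix_kernel_bound (norm w) p * growth (fst p / snd p))"])
    show "AE p in (lborel \<Otimes>\<^sub>M lborel). (\<lambda>N. mix_kernel w p * of_real (\<Sum>m<N. f m (fst p / snd p))) \<longlonglongrightarrow> mix_kernel w p * of_real (F (fst p / snd p))"
    proof (rule AE_I2)
      fix p :: "real \<times> real"
      show "(\<lambda>N. mix_kernel w p * of_real (\<Sum>m<N. f m (fst p / snd p))) \<longlonglongrightarrow> mix_kernel w p * of_real (F (fst p / snd p))"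
      proof (cases "fst p > 0 \<and> snd p > 0")
        case True
        then show ?thesis using s[of "fst p / snd p"] unfolding sums_def by (intro tendsto_mult_left tendsto_of_real) auto
      qed (auto simp: mix_kernel_eq_0)
    qed
    show "AE p in (lborel \<Otimes>\<^sub>M lborel). norm (mix_kernel w p * of_real (\<Sum>m<N. f m (fst p / snd p))) \<le> K * (mix_kernel_bound (norm w) p * growth (fst p / snd p))" for N
    proof (rule AE_I2)
      fix p :: "real \<times> real"
      have "norm (complex_of_real (\<Sum>m<N. f m r)) \<le> K * growth r" if "r > 0" for r
        using K(2)[OF that] part[OF that, of N] by (simp del: of_real_sum)
      then show "norm (mix_kernel w p * of_real (\<Sum>m<N. f m (fst p / snd p))) \<le> K * (mix_kernel_bound (norm w) p * growth (fst p / snd p))"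
        using norm_mix_kernel_mult_le[of w "norm w" "\<lambda>r. of_real (\<Sum>m<N. f m r)" K p] by simp
    qed
    show "integrable (lborel \<Otimes>\<^sub>M lborel) (\<lambda>p. K * (mix_kernel_bound (norm w) p * growth (fst p / snd p)))"
      by (intro integrable_mult_right integrable_mix_kernel_bound_growth)
    show "(\<lambda>p. mix_kernel w p * of_real (F (fst p / snd p))) \<in> borel_measurable (lborel \<Otimes>\<^sub>M lborel)"
      using admissible_measurable[OF F] by (rule mix_kernel_comp_measurable)
    show "(\<lambda>p. mix_kernel w p * of_real (\<Sum>m<N. f m (fst p / snd p))) \<in> borel_measurable (lborel \<Otimes>\<^sub>M lborel)" for N
      using f by (intro mix_kernel_comp_measurable[of "\<lambda>r. of_real (\<Sum>m<N. f m r)"]) measurable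
  qed
  moreover have "(LINT p|(lborel \<Otimes>\<^sub>M lborel). mix_kernel w p * of_real (\<Sum>m<N. f m (fst p / snd p))) = (\<Sum>m<N. mix w (\<lambda>r. of_real (f m r)))" for N
    unfolding mix_def of_real_sum sum_distrib_left
    by (rule Bochner_Integration.integral_sum) (rule integrable_mix[OF ad])
  ultimately show ?thesis by (simp add: sums_def mix_def)
qed

section \<open>The generalized digamma function as an average\<close>

lemma bessel_psi_measurable [measurable]: "bessel_psi \<in> borel_measurable borel"
proof -
  have "(\<lambda>c. LINT x|lborel. indicator {0<..} x *\<^sub>R (exp (- x) * (1 / x - bessel_J0 (c * x) / (1 - exp (- x))))) \<in> borel_measurable borel"
    using lborel.borel_measurable_lebesgue_integral[of "\<lambda>c x. indicator {0<..} x *\<^sub>R (exp (- x) * (1 / x - bessel_J0 (c * x) / (1 - exp (- x))))" borel]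
    by measurable
  then show ?thesis unfolding bessel_psi_def[abs_def] set_lebesgue_integral_def .
qed

lemma bessel_rest_measurable [measurable]: "bessel_rest \<in> borel_measurable borel"
  unfolding bessel_rest_def[abs_def]
  using lborel.borel_measurable_lebesgue_integral[of "\<lambda>c q. om (exp (- q)) * exp (- pi * c\<^sup>2 * exp q)" borel]
  by measurable

lemma admissible_inverse: "admissible (\<lambda>r. of_real (1 / r))"
proof (rule admissibleI[where K = 1])
  fix r :: real assume r: "r > 0"
  then have "1 / r = r powr (- 1)" by (simp add: powr_minus_divide)
  then show "norm (complex_of_real (1 / r)) \<le> 1 * growth r" using powr_le_growth[OF r, of "-1"] r by (simp add: norm_divide)
qed measurable

lemma admissible_bessel_rest: "admissible (\<lambda>r. of_real (bessel_rest r))"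
proof (rule admissibleI[where K = 1])
  fix r :: real assume r: "r > 0"
  have "bessel_rest r \<le> 1 / (2 * r)" "0 \<le> bessel_rest r" by (rule bessel_rest_bounds[OF r])+
  moreover have "1 / (2 * r) \<le> 1 / r" using r by (intro divide_left_mono) auto
  moreover have "1 / r = r powr (- 1)" using r by (simp add: powr_minus_divide)
  ultimately show "norm (complex_of_real (bessel_rest r)) \<le> 1 * growth r" using powr_le_growth[OF r, of "-1"] by simp
qed measurable

lemma bessel_psi_scaled:
  assumes "x > 0" "r > 0"
  shows "complex_of_real (bessel_psi (x * r)) =
    (of_real (ln x - ln 2) * 1 + of_real (ln r)) + (of_real (1 / (2 * x)) * of_real (1 / r) + (- 1) * of_real (bessel_rest (x * r)))"
proof -
  have "bessel_psi (x * r) = ln (x * r / 2) + 1 / (2 * (x * r)) - bessel_rest (x * r)"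
    using assms by (intro bessel_psi_eq) simp
  also have "ln (x * r / 2) = ln x - ln 2 + ln r" using assms by (simp add: ln_mult ln_div)
  finally show ?thesis by simp
qed

lemma admissible_bessel_psi:
  assumes x: "x > 0" shows "admissible (\<lambda>r. of_real (bessel_psi (x * r)))"
proof -
  have "admissible (\<lambda>r. (of_real (ln x - ln 2) * 1 + of_real (ln r)) + (of_real (1 / (2 * x)) * of_real (1 / r) + (- 1) * of_real (bessel_rest (x * r))))" (is "admissible ?g")
    by (intro admissible_add admissible_cmult admissible_const admissible_ln admissible_inverse
        admissible_scale[OF admissible_bessel_rest x])
  then obtain K where "K \<ge> 0" "\<And>r. r > 0 \<Longrightarrow> norm (?g r) \<le> K * growth r" using admissible_bound by blast
  then show ?thesis by (intro admissibleI[where K = K]) (simp_all only: bessel_psi_scaled[OF x], measurable)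
qed

lemma mix_iterated:
  assumes "admissible f"
  shows "mix w f = (LBINT v. LBINT u. mix_kernel w (v, u) * f (v / u))"
  using lborel_pair.integral_fst'[OF integrable_mix[OF assms, of w]] by (simp add: mix_def)

text \<open>For nonzero \<open>w\<close> the innermost integral is \<open>bessel_psi\<close>, and
  the product of sine and hyperbolic sine is \<open>w^2\<close> times two factors
  \<open>sinhc\<close>, which cancels the prefactor; admissibility identifies the iterated integral
  with the one over pairs. At \<open>w = 0\<close> both sides are limits.\<close>

lemma psi_gen_eq_mix:
  assumes x: "x > 0"
  shows "psi_gen w (x + 1) = mix w (\<lambda>r. of_real (bessel_psi (x * r)))"
proof -
  let ?f = "\<lambda>w. 4 / (w\<^sup>2 * of_real (sqrt pi)) *
     (LINT v:{0<..}|lborel. (LINT u:{0<..}|lborel. (LINT xa:{0<..}|lborel.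
        of_real (exp (- (u\<^sup>2 + v\<^sup>2 + xa)) / u) * sin (w * of_real v) * sinh (w * of_real u) *
        of_real (1 / xa - bessel_J0 ((x + 1 - 1) * (v * xa / u)) / (1 - exp (- xa))))))"
  have ne: "?f w = mix w (\<lambda>r. of_real (bessel_psi (x * r)))" if w: "w \<noteq> 0" for w
  proof -
    have inner: "(LINT xa:{0<..}|lborel.
        of_real (exp (- (u\<^sup>2 + v\<^sup>2 + xa)) / u) * sin (w * of_real v) * sinh (w * of_real u) *
        of_real (1 / xa - bessel_J0 ((x + 1 - 1) * (v * xa / u)) / (1 - exp (- xa))))
      = of_real (exp (- (u\<^sup>2 + v\<^sup>2)) / u) * sin (w * of_real v) * sinh (w * of_real u) * of_real (bessel_psi (x * (v / u)))" for u v
    proof -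
      let ?c = "of_real (exp (- (u\<^sup>2 + v\<^sup>2)) / u) * sin (w * of_real v) * sinh (w * of_real u) :: complex"
      have "(LINT xa:{0<..}|lborel.
        of_real (exp (- (u\<^sup>2 + v\<^sup>2 + xa)) / u) * sin (w * of_real v) * sinh (w * of_real u) *
        of_real (1 / xa - bessel_J0 ((x + 1 - 1) * (v * xa / u)) / (1 - exp (- xa))))
       = (LINT xa|lborel. ?c * of_real (indicator {0<..} xa *\<^sub>R (exp (- xa) * (1 / xa - bessel_J0 (x * (v / u) * xa) / (1 - exp (- xa))))))"
        unfolding set_lebesgue_integral_def
      proof (intro Bochner_Integration.integral_cong refl)
        fix xa :: real
        have 1: "exp (- (u\<^sup>2 + v\<^sup>2 + xa)) = exp (- (u\<^sup>2 + v\<^sup>2)) * exp (- xa)" by (simp flip: exp_add)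
        have 2: "(x + 1 - 1) * (v * xa / u) = x * (v / u) * xa" by simp
        show "indicator {0<..} xa *\<^sub>R (of_real (exp (- (u\<^sup>2 + v\<^sup>2 + xa)) / u) * sin (w * of_real v) * sinh (w * of_real u) *
            complex_of_real (1 / xa - bessel_J0 ((x + 1 - 1) * (v * xa / u)) / (1 - exp (- xa))))
          = ?c * of_real (indicator {0<..} xa *\<^sub>R (exp (- xa) * (1 / xa - bessel_J0 (x * (v / u) * xa) / (1 - exp (- xa)))))"
          unfolding 1 2 real_scaleR_def unfolding scaleR_conv_of_real of_real_mult of_real_divide
          by (simp only: times_divide_eq_left times_divide_eq_right mult_ac)
      qed
      also have "\<dots> = ?c * of_real (bessel_psi (x * (v / u)))"
        unfolding integral_mult_right_zero integral_complex_of_real bessel_psi_def set_lebesgue_integral_def ..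
      finally show ?thesis .
    qed
    have ss: "sin (w * of_real v) * sinh (w * of_real u) = w\<^sup>2 * (sinhc (\<i> * w) v * sinhc w u)" for u v
    proof -
      have "sinh (\<i> * w * of_real v) = \<i> * sin (w * of_real v)"
        by (simp add: sinh_field_def sin_exp_eq mult.assoc diff_divide_distrib)
      then have "sinhc (\<i> * w) v = sin (w * of_real v) / w" using w by (simp add: sinhc_def)
      then show ?thesis using w by (simp add: sinhc_def power2_eq_square)
    qed
    have "?f w = (LBINT v. LBINT u. 4 / (w\<^sup>2 * of_real (sqrt pi)) * (indicator {0<..} v *\<^sub>R (indicator {0<..} u *\<^sub>R
        (of_real (exp (- (u\<^sup>2 + v\<^sup>2)) / u) * sin (w * of_real v) * sinh (w * of_real u) * of_real (bessel_psi (x * (v / u)))))))"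
      unfolding inner unfolding set_lebesgue_integral_def integral_scaleR_right integral_mult_right_zero ..
    also have "\<dots> = (LBINT v. LBINT u. mix_kernel w (v, u) * of_real (bessel_psi (x * (v / u))))"
    proof (intro Bochner_Integration.integral_cong refl)
      fix v u :: real
      have "4 / (w\<^sup>2 * of_real (sqrt pi)) * (indicator {0<..} v *\<^sub>R (indicator {0<..} u *\<^sub>R
          (of_real (exp (- (u\<^sup>2 + v\<^sup>2)) / u) * sin (w * of_real v) * sinh (w * of_real u) * of_real (bessel_psi (x * (v / u))))))
        = (of_real (indicator {0<..} v * indicator {0<..} u * (4 / sqrt pi * exp (- (u\<^sup>2 + v\<^sup>2)) / u)) / w\<^sup>2 * (sin (w * of_real v) * sinh (w * of_real u))) * of_real (bessel_psi (x * (v / u)))"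
        by (simp add: scaleR_conv_of_real mult_ac)
      also have "\<dots> = mix_kernel w (v, u) * of_real (bessel_psi (x * (v / u)))"
        unfolding ss mix_kernel_def using w by (simp add: scaleR_conv_of_real)
      finally show "4 / (w\<^sup>2 * of_real (sqrt pi)) * (indicator {0<..} v *\<^sub>R (indicator {0<..} u *\<^sub>R
          (of_real (exp (- (u\<^sup>2 + v\<^sup>2)) / u) * sin (w * of_real v) * sinh (w * of_real u) * of_real (bessel_psi (x * (v / u))))))
         = mix_kernel w (v, u) * of_real (bessel_psi (x * (v / u)))" .
    qed
    also have "\<dots> = mix w (\<lambda>r. of_real (bessel_psi (x * r)))"
      by (rule mix_iterated[OF admissible_bessel_psi[OF x], symmetric])
    finally show ?thesis .
  qed
  show ?thesis
  proof (cases "w = 0")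
    case False
    then show ?thesis using ne[OF False] by (simp add: psi_gen_def limit_at_0_def)
  next
    case True
    have "\<forall>\<^sub>F w in at 0. mix w (\<lambda>r. of_real (bessel_psi (x * r))) = ?f w"
      using ne by (auto simp: eventually_at_filter)
    with mix_tendsto_0[OF admissible_bessel_psi[OF x]]
    have "(?f \<longlongrightarrow> mix 0 (\<lambda>r. of_real (bessel_psi (x * r)))) (at 0)"
      by (rule Lim_transform_eventually)
    then have "Lim (at 0) ?f = mix 0 (\<lambda>r. of_real (bessel_psi (x * r)))" by (intro tendsto_Lim) auto
    then show ?thesis using True by (simp only: psi_gen_def limit_at_0_def simp_thms if_True)
  qed
qed

lemma psi_gen_expansion:
  assumes x: "x > 0"
  shows "psi_gen w (x + 1) = of_real (ln x - ln 2) * mix w (\<lambda>r. 1) + mix w (\<lambda>r. of_real (ln r))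
    + of_real (1 / (2 * x)) * mix w (\<lambda>r. of_real (1 / r)) - mix w (\<lambda>r. of_real (bessel_rest (x * r)))"
proof -
  have A: "admissible (\<lambda>r. of_real (ln x - ln 2) * 1)" and B: "admissible (\<lambda>r. of_real (ln r))"
    and C: "admissible (\<lambda>r. of_real (1 / (2 * x)) * of_real (1 / r))" and D: "admissible (\<lambda>r. (- 1) * of_real (bessel_rest (x * r)))"
    by (intro admissible_cmult admissible_const admissible_ln admissible_inverse admissible_scale[OF admissible_bessel_rest x])+
  have "psi_gen w (x + 1) = mix w (\<lambda>r. (of_real (ln x - ln 2) * 1 + of_real (ln r)) + (of_real (1 / (2 * x)) * of_real (1 / r) + (- 1) * of_real (bessel_rest (x * r))))"
    unfolding psi_gen_eq_mix[OF x] by (rule mix_cong) (rule bessel_psi_scaled[OF x])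
  also have "\<dots> = (mix w (\<lambda>r. of_real (ln x - ln 2) * 1) + mix w (\<lambda>r. of_real (ln r))) + (mix w (\<lambda>r. of_real (1 / (2 * x)) * of_real (1 / r)) + mix w (\<lambda>r. (- 1) * of_real (bessel_rest (x * r))))"
    unfolding mix_add[OF admissible_add[OF A B] admissible_add[OF C D]] mix_add[OF A B] mix_add[OF C D] ..
  finally show ?thesis unfolding mix_cmult by simp
qed

subsection \<open>Confluent hypergeometric series\<close>

text \<open>The Chu-Vandermonde identity. Pascal's rule splits the sum for \<open>n + 1\<close> into
  the sum for \<open>n\<close> and a multiple of the same sum with \<open>a\<close> and
  \<open>c\<close> raised by 1.\<close>

lemma alternating_pochhammer_sum:
  fixes a c :: "'a::field_char_0"
  assumes "\<And>k. c + of_nat k \<noteq> 0"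
  shows "(\<Sum>k\<le>n. of_nat (n choose k) * (-1) ^ k * (pochhammer a k / pochhammer c k)) = pochhammer (c - a) n / pochhammer c n"
  using assms
proof (induction n arbitrary: a c)
  case (Suc n)
  let ?t = "\<lambda>a c k. (-1) ^ k * (pochhammer a k / pochhammer c k) :: 'a"
  have c0: "c \<noteq> 0" using Suc.prems[of 0] by simp
  have c1: "c + 1 + of_nat k \<noteq> 0" for k using Suc.prems[of "Suc k"] by (simp add: add_ac)
  have pc: "pochhammer c k \<noteq> 0" for k
    using Suc.prems by (simp add: pochhammer_prod)
  have pc1: "pochhammer (c + 1) k \<noteq> 0" for k
    using pc[of "Suc k"] by (simp add: pochhammer_rec)
  have "(\<Sum>k\<le>Suc n. of_nat (Suc n choose k) * ?t a c k)
     = ?t a c 0 + (\<Sum>k\<le>n. (of_nat (n choose k) + of_nat (n choose Suc k)) * ?t a c (Suc k))"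
    by (subst sum.atMost_Suc_shift) simp
  also have "\<dots> = (?t a c 0 + (\<Sum>k\<le>n. of_nat (n choose Suc k) * ?t a c (Suc k))) + (\<Sum>k\<le>n. of_nat (n choose k) * ?t a c (Suc k))"
    by (simp only: distrib_right sum.distrib add_ac)
  also have "?t a c 0 + (\<Sum>k\<le>n. of_nat (n choose Suc k) * ?t a c (Suc k)) = (\<Sum>k\<le>Suc n. of_nat (n choose k) * ?t a c k)"
    by (subst sum.atMost_Suc_shift) simp
  also have "\<dots> = (\<Sum>k\<le>n. of_nat (n choose k) * ?t a c k)" by simp
  also have "(\<Sum>k\<le>n. of_nat (n choose k) * ?t a c k) = pochhammer (c - a) n / pochhammer c n"
    using Suc.IH[OF Suc.prems] by (simp add: mult.assoc)
  also have "(\<Sum>k\<le>n. of_nat (n choose k) * ?t a c (Suc k)) = - (a / c) * (\<Sum>k\<le>n. of_nat (n choose k) * ?t (a + 1) (c + 1) k)"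
    unfolding sum_distrib_left by (intro sum.cong refl) (simp add: pochhammer_rec)
  also have "(\<Sum>k\<le>n. of_nat (n choose k) * ?t (a + 1) (c + 1) k) = pochhammer (c - a) n / pochhammer (c + 1) n"
    using Suc.IH[of "c + 1" "a + 1", OF c1] by (simp add: mult.assoc)
  also have "pochhammer (c - a) n / pochhammer c n + - (a / c) * (pochhammer (c - a) n / pochhammer (c + 1) n)
      = pochhammer (c - a) (Suc n) / pochhammer c (Suc n)"
  proof -
    have e: "pochhammer c n * (c + of_nat n) = c * pochhammer (c + 1) n"
      using pochhammer_rec[of c n] pochhammer_rec'[of c n] by (simp add: mult.commute)
    have cn: "c + of_nat n \<noteq> 0" by (rule Suc.prems)
    have "pochhammer (c - a) n / pochhammer c n = pochhammer (c - a) n * (c + of_nat n) / (c * pochhammer (c + 1) n)"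
      unfolding e[symmetric] using pc cn by simp
    moreover have "- (a / c) * (pochhammer (c - a) n / pochhammer (c + 1) n) = - a * pochhammer (c - a) n / (c * pochhammer (c + 1) n)" by simp
    ultimately have "pochhammer (c - a) n / pochhammer c n + - (a / c) * (pochhammer (c - a) n / pochhammer (c + 1) n)
      = (pochhammer (c - a) n * (c + of_nat n) + - a * pochhammer (c - a) n) / (c * pochhammer (c + 1) n)"
      by (simp only: add_divide_distrib)
    also have "\<dots> = pochhammer (c - a) (Suc n) / pochhammer c (Suc n)"
      by (simp add: pochhammer_rec'[of "c - a"] pochhammer_rec[of c] algebra_simps)
    finally show ?thesis .
  qed
  finally show ?case by (simp add: mult.assoc)
qed simp

lemma has_field_derivative_pochhammer:
  fixes a :: complex
  assumes "\<And>k. a + of_nat k \<noteq> 0"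
  shows "((\<lambda>a. pochhammer a n) has_field_derivative pochhammer a n * (\<Sum>j<n. 1 / (a + of_nat j))) (at a)"
proof (induction n)
  case (Suc n)
  have "((\<lambda>a. (a + of_nat n) * pochhammer a n) has_field_derivative
     pochhammer a n + (a + of_nat n) * (pochhammer a n * (\<Sum>j<n. 1 / (a + of_nat j)))) (at a)"
    by (rule derivative_eq_intros Suc.IH refl | simp)+
  moreover have "pochhammer a n + (a + of_nat n) * (pochhammer a n * (\<Sum>j<n. 1 / (a + of_nat j)))
     = pochhammer a (Suc n) * (\<Sum>j<Suc n. 1 / (a + of_nat j))"
    using assms[of n] by (simp add: pochhammer_rec' field_simps)
  ultimately show ?case by (simp add: pochhammer_rec')
qed simp

lemma three_halves_nonzero: "(3 / 2 :: complex) + of_nat k \<noteq> 0"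
proof
  assume "(3 / 2 :: complex) + of_nat k = 0"
  then have "Re ((3 / 2 :: complex) + of_nat k) = 0" by simp
  then show False by simp
qed

lemma fact_odd: "(fact (2 * k + 1) :: complex) = 4 ^ k * fact k * pochhammer (3 / 2) k"
proof (induction k)
  case (Suc k)
  have "(fact (2 * Suc k + 1) :: complex) = of_nat (2 * k + 3) * (of_nat (2 * k + 2) * fact (2 * k + 1))"
    by (simp add: fact_reduce algebra_simps)
  also have "\<dots> = 4 ^ Suc k * fact (Suc k) * pochhammer (3 / 2) (Suc k)"
    unfolding Suc.IH by (simp add: pochhammer_rec' field_simps)
  finally show ?case .
qed simp

text \<open>The derivative of the Chu-Vandermonde identity in \<open>a\<close>, taken at 1/2 with
  \<open>c = 3/2\<close>. Logarithmic derivatives of Pochhammer symbols are sums of reciprocals, and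
  since \<open>c - a = 1\<close> the right-hand side produces harmonic numbers.\<close>

lemma alternating_harm_sum:
  "(\<Sum>k\<le>n. of_nat (n choose k) * (-1) ^ k * (pochhammer (1/2) k / pochhammer (3/2) k * (\<Sum>j<k. 1 / (1/2 + of_nat j))))
     = - (fact n / pochhammer (3/2 :: complex) n * harm n)"
proof -
  have h: "(1 / 2 :: complex) + of_nat k \<noteq> 0" for k
  proof
    assume "(1 / 2 :: complex) + of_nat k = 0"
    then have "Re ((1 / 2 :: complex) + of_nat k) = 0" by simp
    then show False by simp
  qed
  have o: "(1 :: complex) + of_nat k \<noteq> 0" for k by (metis of_nat_Suc of_nat_neq_0)
  let ?L = "\<lambda>a::complex. \<Sum>k\<le>n. of_nat (n choose k) * (-1) ^ k * (pochhammer a k / pochhammer (3/2) k)"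
  have "(?L has_field_derivative (\<Sum>k\<le>n. of_nat (n choose k) * (-1) ^ k * (pochhammer (1/2) k * (\<Sum>j<k. 1 / (1/2 + of_nat j)) / pochhammer (3/2) k))) (at (1/2))"
    by (intro DERIV_sum DERIV_cmult DERIV_cdivide has_field_derivative_pochhammer h)
  moreover have "(?L has_field_derivative (pochhammer (3/2 - 1/2) n * (\<Sum>j<n. 1 / (3/2 - 1/2 + of_nat j))) * (0 - 1) / pochhammer (3/2) n) (at (1/2))"
  proof -
    have "((\<lambda>a. pochhammer (3/2 - a) n) has_field_derivative (pochhammer (3/2 - 1/2) n * (\<Sum>j<n. 1 / (3/2 - 1/2 + of_nat j))) * (0 - 1)) (at (1/2 :: complex))"
      by (rule DERIV_chain2[where f = "\<lambda>x. pochhammer x n"]) (use o in \<open>auto intro!: has_field_derivative_pochhammer derivative_eq_intros\<close>)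
    then show ?thesis unfolding alternating_pochhammer_sum[OF three_halves_nonzero] by (rule DERIV_cdivide)
  qed
  ultimately have "(\<Sum>k\<le>n. of_nat (n choose k) * (-1) ^ k * (pochhammer (1/2) k * (\<Sum>j<k. 1 / (1/2 + of_nat j)) / pochhammer (3/2) k))
     = (pochhammer (3/2 - 1/2) n * (\<Sum>j<n. 1 / (3/2 - 1/2 + of_nat j))) * (0 - 1) / pochhammer (3/2 :: complex) n"
    by (rule DERIV_unique)
  also have "\<dots> = - (fact n / pochhammer (3/2) n * harm n)"
  proof -
    have "(\<Sum>j<n. 1 / (1 + of_nat j :: complex)) = harm n"
      unfolding harm_def by (intro sum.reindex_bij_witness[of _ "\<lambda>i. i - 1" Suc]) (auto simp: inverse_eq_divide add_ac)
    then show ?thesis by (simp add: pochhammer_fact)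
  qed
  finally show ?thesis by simp
qed

text \<open>Cauchy product with the exponential series: for exponential generating functions,
  multiplication by \<open>exp (- z)\<close> is the alternating binomial transform of the
  coefficients.\<close>

lemma binomial_transform_sums:
  fixes A B :: "nat \<Rightarrow> complex"
  assumes A: "summable (\<lambda>k. norm (A k * (z ^ k / fact k)))"
    and B: "\<And>n. (\<Sum>k\<le>n. of_nat (n choose k) * (-1) ^ k * A k) = B n"
  shows "(\<lambda>n. B n * ((- z) ^ n / fact n)) sums (exp (- z) * (\<Sum>k. A k * (z ^ k / fact k)))"
proof -
  have e: "summable (\<lambda>n. norm ((- z) ^ n /\<^sub>R fact n))" by (rule summable_norm_exp)
  have "(\<lambda>n. \<Sum>i\<le>n. (A i * (z ^ i / fact i)) * ((- z) ^ (n - i) /\<^sub>R fact (n - i))) sums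
     ((\<Sum>k. A k * (z ^ k / fact k)) * (\<Sum>n. (- z) ^ n /\<^sub>R fact n))"
    by (rule Cauchy_product_sums[OF A e])
  also have "(\<lambda>n. \<Sum>i\<le>n. (A i * (z ^ i / fact i)) * ((- z) ^ (n - i) /\<^sub>R fact (n - i))) = (\<lambda>n. B n * ((- z) ^ n / fact n))"
  proof
    fix n
    have "(A i * (z ^ i / fact i)) * ((- z) ^ (n - i) /\<^sub>R fact (n - i)) = (of_nat (n choose i) * (-1) ^ i * A i) * ((- z) ^ n / fact n)" if "i \<le> n" for i
    proof -
      have b: "of_nat (n choose i) = fact n / (fact i * fact (n - i) :: complex)" using that by (rule binomial_fact)
      have "(- z) ^ n = (- z) ^ i * (- z) ^ (n - i)" using that by (simp flip: power_add)
      also have "(- z) ^ i = (-1) ^ i * z ^ i" by (rule power_minus)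
      finally have p: "(-1) ^ i * (- z) ^ n = z ^ i * (- z) ^ (n - i)"
        by (simp add: mult.assoc[symmetric] power_mult_distrib[symmetric])
      have "(of_nat (n choose i) * (-1) ^ i * A i) * ((- z) ^ n / fact n) = A i * ((-1) ^ i * (- z) ^ n) / (fact i * fact (n - i))"
        unfolding b by (simp add: field_simps)
      also have "\<dots> = (A i * (z ^ i / fact i)) * ((- z) ^ (n - i) /\<^sub>R fact (n - i))"
        unfolding p by (simp add: scaleR_conv_of_real field_simps)
      finally show ?thesis by simp
    qed
    then have "(\<Sum>i\<le>n. (A i * (z ^ i / fact i)) * ((- z) ^ (n - i) /\<^sub>R fact (n - i))) = (\<Sum>i\<le>n. of_nat (n choose i) * (-1) ^ i * A i) * ((- z) ^ n / fact n)"
      unfolding sum_distrib_right by (intro sum.cong) auto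
    then show "(\<Sum>i\<le>n. (A i * (z ^ i / fact i)) * ((- z) ^ (n - i) /\<^sub>R fact (n - i))) = B n * ((- z) ^ n / fact n)"
      unfolding B .
  qed
  also have "(\<Sum>n. (- z) ^ n /\<^sub>R fact n) = exp (- z)" by (simp add: exp_def)
  finally show ?thesis by (simp add: mult.commute)
qed

lemma norm_pochhammer_ratio_le:
  "norm (pochhammer a k / pochhammer (3/2 :: complex) k) \<le> (norm a + 1) ^ k"
proof (induction k)
  case (Suc k)
  have "norm (a + of_nat k) \<le> norm a + real k" using norm_triangle_ineq[of a "of_nat k"] by simp
  also have "\<dots> \<le> (norm a + 1) * (3 / 2 + real k)"
  proof -
    have "(norm a + 1) * (3 / 2 + real k) = 3 / 2 * norm a + norm a * real k + 3 / 2 + real k"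
      by (simp add: algebra_simps)
    moreover have "0 \<le> norm a * real k" "0 \<le> norm a" by simp_all
    ultimately show ?thesis by linarith
  qed
  finally have "norm (a + of_nat k) / (3 / 2 + real k) \<le> norm a + 1" by (simp add: divide_simps)
  moreover have "norm ((3 / 2 :: complex) + of_nat k) = 3 / 2 + real k"
  proof -
    have "(3 / 2 :: complex) + of_nat k = of_real (3 / 2 + real k)" by simp
    then show ?thesis by (simp only: norm_of_real)
  qed
  ultimately have "norm ((a + of_nat k) / (3 / 2 + of_nat k)) \<le> norm a + 1" by (simp add: norm_divide)
  then have "norm ((a + of_nat k) / (3 / 2 + of_nat k)) * norm (pochhammer a k / pochhammer (3/2) k) \<le> (norm a + 1) * (norm a + 1) ^ k"
    using Suc.IH by (intro mult_mono) auto
  then show ?case by (simp add: pochhammer_rec' norm_mult norm_divide)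
qed simp

lemma summable_hyp1F1:
  "summable (\<lambda>k. norm (pochhammer a k / pochhammer (3/2 :: complex) k * (z ^ k / fact k)))"
proof (rule summable_comparison_test)
  show "summable (\<lambda>k. ((norm a + 1) * norm z) ^ k /\<^sub>R fact k)" by (rule summable_exp_generic)
  show "\<exists>N. \<forall>n\<ge>N. norm (norm (pochhammer a n / pochhammer (3/2 :: complex) n * (z ^ n / fact n))) \<le> ((norm a + 1) * norm z) ^ n /\<^sub>R fact n"
  proof (intro exI allI impI)
    fix n
    have "norm (pochhammer a n / pochhammer (3/2 :: complex) n) * norm (z ^ n / fact n) \<le> (norm a + 1) ^ n * (norm z ^ n / fact n)"
      by (intro mult_mono norm_pochhammer_ratio_le) (auto simp: norm_divide norm_power)
    also have "\<dots> = ((norm a + 1) * norm z) ^ n /\<^sub>R fact n"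
      by (simp add: power_mult_distrib divide_inverse mult_ac)
    finally show "norm (norm (pochhammer a n / pochhammer (3/2 :: complex) n * (z ^ n / fact n))) \<le> ((norm a + 1) * norm z) ^ n /\<^sub>R fact n"
      unfolding norm_mult[of "pochhammer a n / _"] by (simp only: real_norm_def abs_mult abs_norm_cancel)
  qed
qed

text \<open>The coefficients of the product of the series with \<open>exp (- z)\<close> are
  alternating binomial sums, evaluated by Chu-Vandermonde.\<close>

theorem kummer_transformation:
  "hyp1F1 (3/2 - a) (3/2) (- z) = exp (- z) * hyp1F1 a (3/2) z"
  using binomial_transform_sums[OF summable_hyp1F1[of a z] alternating_pochhammer_sum[OF three_halves_nonzero]]
  unfolding hyp1F1_def by (rule sums_unique[symmetric])

definition hyp1F1_one :: "complex \<Rightarrow> complex" where "hyp1F1_one z = hyp1F1 1 (3/2) z"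

text \<open>The series in the definition of \<open>BB\<close>, because
  \<open>Digamma (n + 1) + euler_mascheroni\<close> is the harmonic number
  \<open>harm n\<close>.\<close>

definition hyp1F1_harm :: "complex \<Rightarrow> complex" where
  "hyp1F1_harm z = (\<Sum>n. z ^ n / pochhammer (3/2) n * harm n)"

lemma hyp1F1_one_sums: "(\<lambda>n. z ^ n / pochhammer (3/2) n) sums hyp1F1_one z"
proof -
  have "summable (\<lambda>k. pochhammer 1 k / pochhammer (3/2 :: complex) k * (z ^ k / fact k))"
    by (rule summable_norm_cancel[OF summable_hyp1F1])
  then have "(\<lambda>k. pochhammer 1 k / pochhammer (3/2 :: complex) k * (z ^ k / fact k)) sums hyp1F1_one z"
    unfolding hyp1F1_one_def hyp1F1_def by (rule summable_sums)
  then show ?thesis by (simp add: pochhammer_fact[symmetric])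
qed

lemma hyp1F1_half: "hyp1F1 (1/2) (3/2) z = exp z * hyp1F1_one (- z)"
  using kummer_transformation[of 1 "- z"] by (simp add: hyp1F1_one_def)

text \<open>The derivative of the hypergeometric series in its first parameter at 1/2, which is what
  the logarithmic moment with weight \<open>1 / u\<close> produces. The binomial transform rewrites
  it with harmonic numbers at the opposite argument.\<close>

lemma harm_transform:
  shows "summable (\<lambda>k. norm (pochhammer (1/2) k / pochhammer (3/2 :: complex) k * (\<Sum>j<k. 1 / (1/2 + of_nat j)) * (z ^ k / fact k)))" (is ?S)
    and "(\<Sum>k. pochhammer (1/2) k / pochhammer (3/2 :: complex) k * (\<Sum>j<k. 1 / (1/2 + of_nat j)) * (z ^ k / fact k)) = - exp z * hyp1F1_harm (- z)" (is ?T)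
proof -
  let ?A = "\<lambda>k. pochhammer (1/2) k / pochhammer (3/2 :: complex) k * (\<Sum>j<k. 1 / (1/2 + of_nat j))"
  show S: ?S
  proof (rule summable_comparison_test)
    show "summable (\<lambda>k. (2 * (norm (1/2 :: complex) + 1) * norm z * 2) ^ k /\<^sub>R fact k)" by (rule summable_exp_generic)
    show "\<exists>N. \<forall>n\<ge>N. norm (norm (?A n * (z ^ n / fact n))) \<le> (2 * (norm (1/2 :: complex) + 1) * norm z * 2) ^ n /\<^sub>R fact n"
    proof (intro exI allI impI)
      fix n
      have "norm (\<Sum>j<n. 1 / (1/2 + of_nat j :: complex)) \<le> (\<Sum>j<n. 2)"
      proof (rule sum_norm_le)
        fix j
        have "(1/2 + of_nat j :: complex) = of_real (1/2 + real j)" by simp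
        then have "norm (1/2 + of_nat j :: complex) = 1/2 + real j" by (simp only: norm_of_real)
        then show "norm (1 / (1/2 + of_nat j :: complex)) \<le> 2" by (simp add: norm_divide divide_simps)
      qed
      also have "\<dots> = real (2 * n)" by simp
      \<comment> \<open>The linear growth of the sum of reciprocals is absorbed into the base of the
        exponential majorant.\<close>
      also have "\<dots> \<le> 2 ^ n * 2 ^ n"
      proof -
        have "n < 2 ^ n" by (rule less_exp)
        then have "2 * n \<le> 2 ^ n * 2 ^ n"
        proof (cases n)
          case (Suc m)
          then have "(2 :: nat) \<le> 2 ^ n" by simp
          then show ?thesis using \<open>n < 2 ^ n\<close> by (intro mult_le_mono) auto
        qed simp
        then have "real (2 * n) \<le> real (2 ^ n * 2 ^ n)" by (rule of_nat_mono)
        then show ?thesis by simp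
      qed
      finally have 1: "norm (\<Sum>j<n. 1 / (1/2 + of_nat j :: complex)) \<le> 2 ^ n * 2 ^ n" .
      have "norm (?A n * (z ^ n / fact n)) = norm (pochhammer (1/2) n / pochhammer (3/2 :: complex) n) * norm (\<Sum>j<n. 1 / (1/2 + of_nat j :: complex)) * (norm z ^ n / fact n)"
        by (simp only: norm_mult norm_divide norm_power norm_fact)
      also have "\<dots> \<le> (norm (1/2 :: complex) + 1) ^ n * (2 ^ n * 2 ^ n) * (norm z ^ n / fact n)"
        by (intro mult_mono norm_pochhammer_ratio_le 1) auto
      also have "\<dots> = (2 * (norm (1/2 :: complex) + 1) * norm z * 2) ^ n /\<^sub>R fact n"
      proof -
        have "c ^ n * (2 ^ n * 2 ^ n) * (y ^ n / fact n) = (2 * c * y * 2) ^ n /\<^sub>R fact n" for c y :: real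
          by (simp only: power_mult_distrib divide_inverse mult_ac real_scaleR_def)
        then show ?thesis .
      qed
      finally show "norm (norm (?A n * (z ^ n / fact n))) \<le> (2 * (norm (1/2 :: complex) + 1) * norm z * 2) ^ n /\<^sub>R fact n"
        by (simp only: real_norm_def abs_norm_cancel)
    qed
  qed
  have "(\<lambda>n. - (fact n / pochhammer (3/2) n * harm n) * ((- z) ^ n / fact n)) sums (exp (- z) * (\<Sum>k. ?A k * (z ^ k / fact k)))"
    by (rule binomial_transform_sums[OF S alternating_harm_sum])
  then have "(\<lambda>n. - ((- z) ^ n / pochhammer (3/2) n * harm n)) sums (exp (- z) * (\<Sum>k. ?A k * (z ^ k / fact k)))"
    by (simp add: field_simps)
  then have "(\<lambda>n. (- z) ^ n / pochhammer (3/2) n * harm n) sums - (exp (- z) * (\<Sum>k. ?A k * (z ^ k / fact k)))"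
    using sums_minus by fastforce
  then have "hyp1F1_harm (- z) = - (exp (- z) * (\<Sum>k. ?A k * (z ^ k / fact k)))"
    unfolding hyp1F1_harm_def by (rule sums_unique[symmetric])
  then show ?T by (simp add: exp_minus)
qed

lemma summable_hyp1F1_harm: "summable (\<lambda>n. z ^ n / pochhammer (3/2 :: complex) n * harm n)"
proof -
  let ?A = "\<lambda>k. pochhammer (1/2) k / pochhammer (3/2 :: complex) k * (\<Sum>j<k. 1 / (1/2 + of_nat j))"
  have "(\<lambda>n. - (fact n / pochhammer (3/2) n * harm n) * ((- (- z)) ^ n / fact n)) sums (exp (- (- z)) * (\<Sum>k. ?A k * ((- z) ^ k / fact k)))"
    by (rule binomial_transform_sums[OF harm_transform(1) alternating_harm_sum])
  then have "summable (\<lambda>n. - (z ^ n / pochhammer (3/2 :: complex) n * harm n))"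
    by (simp add: sums_iff field_simps)
  then show ?thesis by (simp only: summable_minus_iff)
qed

subsection \<open>Gaussian moments of the hyperbolic sine\<close>

definition sinh_gauss_integrable :: "complex \<Rightarrow> (real \<Rightarrow> complex) \<Rightarrow> bool" where
  "sinh_gauss_integrable w g \<longleftrightarrow> set_integrable lborel {0<..} (\<lambda>u. of_real (exp (- u\<^sup>2)) * sinhc w u * g u)"

definition sinh_gauss :: "complex \<Rightarrow> (real \<Rightarrow> complex) \<Rightarrow> complex" where
  "sinh_gauss w g = (LBINT u:{0<..}. of_real (exp (- u\<^sup>2)) * sinhc w u * g u)"

text \<open>Even powers of \<open>w\<close> only: in this form the series also holds at
  \<open>w = 0\<close>, where the term with \<open>k = 0\<close> survives alone.\<close>

lemma sinhc_sums: "(\<lambda>k. (w * w) ^ k * of_real (u ^ (2 * k + 1)) / fact (2 * k + 1)) sums sinhc w u"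
proof (cases "w = 0")
  case True
  have "(\<lambda>k. (0 :: complex) ^ k * (of_real (u ^ (2 * k + 1)) / fact (2 * k + 1))) sums (of_real (u ^ (2 * 0 + 1)) / fact (2 * 0 + 1))"
    using powser_sums_zero[of "\<lambda>k. complex_of_real (u ^ (2 * k + 1)) / fact (2 * k + 1)"] by (simp add: mult.commute)
  then show ?thesis using True by (simp add: sinhc_def)
next
  case False
  have "(\<lambda>n. if even n then 0 else (w * of_real u) ^ n /\<^sub>R fact n) sums sinh (w * of_real u)" by (rule sinh_converges)
  then have "(\<lambda>k. (w * of_real u) ^ (2 * k + 1) /\<^sub>R fact (2 * k + 1)) sums sinh (w * of_real u)"
    using sums_mono_reindex[of "\<lambda>k. 2 * k + 1" "\<lambda>n. if even n then 0 else (w * of_real u) ^ n /\<^sub>R fact n" "sinh (w * of_real u)"]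
    by (force simp: strict_mono_def elim: oddE)
  then have "(\<lambda>k. (w * of_real u) ^ (2 * k + 1) /\<^sub>R fact (2 * k + 1) / w) sums (sinh (w * of_real u) / w)"
    by (rule sums_divide)
  moreover have "(w * of_real u) ^ (2 * k + 1) /\<^sub>R fact (2 * k + 1) / w = (w * w) ^ k * of_real (u ^ (2 * k + 1)) / fact (2 * k + 1)" for k
  proof -
    have "(w * of_real u) ^ (2 * k + 1) = w * ((w * w) ^ k * of_real (u ^ (2 * k + 1)))"
      by (simp add: power_mult_distrib power_mult power2_eq_square)
    then show ?thesis using False by (simp only:) (simp add: scaleR_conv_of_real divide_inverse del: fact_Suc)
  qed
  ultimately show ?thesis using False by (simp add: sinhc_def)
qed

text \<open>The partial sums are majorised by the series at the real argument \<open>norm w\<close>,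
  whose terms are nonnegative and whose sum is already bounded.\<close>

lemma sinhc_partial_sum_bound:
  fixes w :: complex
  assumes u: "u \<ge> 0"
  shows "norm (\<Sum>k<N. (w * w) ^ k * of_real (u ^ (2 * k + 1)) / fact (2 * k + 1)) \<le> u * exp (norm w * u)"
proof -
  define t where "t k = (norm w * norm w) ^ k * u ^ (2 * k + 1) / fact (2 * k + 1)" for k
  have t0: "0 \<le> t k" for k using u by (simp add: t_def)
  have "(\<lambda>k. complex_of_real (t k)) sums sinhc (of_real (norm w)) u"
    using sinhc_sums[of "of_real (norm w)" u] by (simp add: t_def)
  then have "(\<lambda>k. Re (complex_of_real (t k))) sums Re (sinhc (of_real (norm w)) u)" by (rule sums_Re)
  then have ts: "t sums Re (sinhc (of_real (norm w)) u)" by simp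
  have "norm (\<Sum>k<N. (w * w) ^ k * of_real (u ^ (2 * k + 1)) / fact (2 * k + 1)) \<le> (\<Sum>k<N. t k)"
    by (rule sum_norm_le) (use u in \<open>simp add: t_def norm_divide norm_mult norm_power del: fact_Suc\<close>)
  also have "\<dots> \<le> Re (sinhc (of_real (norm w)) u)"
    using sum_le_suminf[of t "{..<N}"] ts t0 by (simp add: sums_iff)
  also have "\<dots> \<le> norm (sinhc (of_real (norm w)) u)" by (rule complex_Re_le_cmod)
  also have "\<dots> \<le> u * exp (norm w * u)" by (rule sinhc_bound) (use u in auto)
  finally show ?thesis .
qed

text \<open>Termwise integration, with one majorant for all partial sums of \<open>sinhc\<close>. It
  reduces each integral against \<open>g\<close> to the odd Gaussian moments \<open>M k\<close> of
  \<open>g\<close>.\<close>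

lemma sinh_gauss_series:
  assumes g[measurable]: "g \<in> borel_measurable borel"
    and dom: "integrable lborel (\<lambda>u. indicator {0<..} u * (exp (norm w * u - u\<^sup>2) * u * norm (g u)))"
    and M: "\<And>k. (LBINT u:{0<..}. of_real (exp (- u\<^sup>2) * u ^ (2 * k + 1)) * g u) = M k"
  shows "sinh_gauss_integrable w g" and "(\<lambda>k. (w * w) ^ k / fact (2 * k + 1) * M k) sums sinh_gauss w g"
proof -
  define s where "s N u = indicator {0<..} u *\<^sub>R (of_real (exp (- u\<^sup>2)) * (\<Sum>k<N. (w * w) ^ k * of_real (u ^ (2 * k + 1)) / fact (2 * k + 1)) * g u)" for N and u :: real
  define f where "f u = indicator {0<..} u *\<^sub>R (of_real (exp (- u\<^sup>2)) * sinhc w u * g u)" for u :: real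
  define D where "D u = indicator {0<..} u * (exp (norm w * u - u\<^sup>2) * u * norm (g u))" for u :: real
  have Di: "integrable lborel D" using dom by (simp add: D_def[abs_def])
  have bd: "norm (indicator {0<..} u *\<^sub>R (of_real (exp (- u\<^sup>2)) * c * g u)) \<le> D u" if "u > 0 \<Longrightarrow> norm c \<le> u * exp (norm w * u)" for u :: real and c :: complex
  proof (cases "u > 0")
    case True
    have "norm (indicator {0<..} u *\<^sub>R (of_real (exp (- u\<^sup>2)) * c * g u)) = exp (- u\<^sup>2) * norm c * norm (g u)"
      using True by (simp add: norm_mult)
    also have "\<dots> \<le> exp (- u\<^sup>2) * (u * exp (norm w * u)) * norm (g u)"
      using that[OF True] True by (intro mult_mono) auto
    also have "\<dots> = D u"
    proof -
      have "exp (norm w * u - u\<^sup>2) = exp (norm w * u) * exp (- u\<^sup>2)" by (simp flip: exp_add)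
      then show ?thesis using True by (simp add: D_def)
    qed
    finally show ?thesis .
  qed (simp add: D_def)
  have [measurable]: "s N \<in> borel_measurable borel" "f \<in> borel_measurable borel" for N
    unfolding s_def f_def by measurable
  have fb: "norm (f u) \<le> D u" for u unfolding f_def by (rule bd) (rule sinhc_bound; simp)
  have sb: "norm (s N u) \<le> D u" for N u unfolding s_def by (rule bd) (rule sinhc_partial_sum_bound; simp)
  have fi: "integrable lborel f"
    by (rule Bochner_Integration.integrable_bound[OF Di]) (use fb in \<open>auto intro!: AE_I2 order_trans[OF fb abs_ge_self]\<close>)
  then show "sinh_gauss_integrable w g" by (simp add: sinh_gauss_integrable_def set_integrable_def f_def[abs_def])
  have lim: "(\<lambda>N. s N u) \<longlonglongrightarrow> f u" for u
    unfolding s_def f_def using sinhc_sums[of w u] unfolding sums_def by (intro tendsto_intros) auto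
  have L: "(\<lambda>N. LBINT u. s N u) \<longlonglongrightarrow> (LBINT u. f u)"
    by (rule integral_dominated_convergence[where w = D]) (use Di sb lim in auto)
  define t where "t k u = indicator {0<..} u *\<^sub>R (of_real (exp (- u\<^sup>2) * u ^ (2 * k + 1)) * g u)" for k and u :: real
  have ti: "integrable lborel (\<lambda>u. (w * w) ^ k / fact (2 * k + 1) * t k u)" for k
  proof -
    have i: "integrable lborel (s N)" for N
      by (rule Bochner_Integration.integrable_bound[OF Di]) (use sb in \<open>auto intro!: AE_I2 order_trans[OF sb abs_ge_self]\<close>)
    have "integrable lborel (\<lambda>u. s (Suc k) u - s k u)" by (intro Bochner_Integration.integrable_diff i)
    moreover have "s (Suc k) u - s k u = (w * w) ^ k / fact (2 * k + 1) * t k u" for u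
      by (simp add: s_def t_def scaleR_conv_of_real algebra_simps del: fact_Suc power_Suc mult_Suc_right)
    ultimately show ?thesis by simp
  qed
  have "s N u = (\<Sum>k<N. (w * w) ^ k / fact (2 * k + 1) * t k u)" for N u
    by (simp add: s_def t_def scaleR_conv_of_real sum_distrib_left sum_distrib_right mult_ac)
  then have A: "(LBINT u. s N u) = (\<Sum>k<N. LBINT u. (w * w) ^ k / fact (2 * k + 1) * t k u)" for N
    using ti by (simp add: Bochner_Integration.integral_sum)
  have B: "(LBINT u. (w * w) ^ k / fact (2 * k + 1) * t k u) = (w * w) ^ k / fact (2 * k + 1) * M k" for k
    unfolding integral_mult_right_zero using M[of k] by (simp add: t_def set_lebesgue_integral_def)
  have "(LBINT u. f u) = sinh_gauss w g" by (simp add: sinh_gauss_def set_lebesgue_integral_def f_def)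
  then show "(\<lambda>k. (w * w) ^ k / fact (2 * k + 1) * M k) sums sinh_gauss w g"
    using L unfolding A B sums_def by (simp only:)
qed

text \<open>The substitution \<open>u = exp q\<close> followed by a dilation of \<open>q\<close> by
  2 gives the factor 1/2; the exponent \<open>2 * a - 2\<close> is chosen so that the odd power of
  \<open>u\<close> leads to the argument \<open>a + k\<close>.\<close>

lemma Gamma_moment:
  assumes "Re a > 0"
  shows "(LBINT u:{0<..}. of_real (exp (- u\<^sup>2) * u ^ (2 * k + 1)) * (of_real u powr (2 * a - 2))) = Gamma (a + of_nat k) / 2"
proof -
  let ?f = "\<lambda>u::real. of_real (exp (- u\<^sup>2) * u ^ (2 * k + 1)) * (complex_of_real u powr (2 * a - 2))"
  have m: "set_borel_measurable borel {0<..} ?f"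
    by (rule set_measurable_continuous_on) (auto intro!: continuous_intros)
  have "has_bochner_integral lborel (\<lambda>q. exp ((a + of_nat k) * of_real (0 + 2 * q)) * of_real (exp (- exp (0 + 2 * q)))) (Gamma (a + of_nat k) /\<^sub>R \<bar>2\<bar>)"
    by (rule has_bochner_integral_lborel_affine[OF Gamma_integral_exp]) (use assms in auto)
  moreover have "exp ((a + of_nat k) * of_real (0 + 2 * q)) * of_real (exp (- exp (0 + 2 * q))) = exp q *\<^sub>R ?f (exp q)" for q
  proof -
    have 1: "(exp q)\<^sup>2 = exp (2 * q)" by (simp flip: exp_of_nat_mult)
    have 2: "complex_of_real (exp q) powr (2 * a - 2) = exp ((2 * a - 2) * of_real q)"
      by (simp add: powr_def Ln_of_real flip: exp_of_real)
    have 3: "exp q ^ (2 * k + 1) = exp (real (2 * k + 1) * q)" by (rule exp_of_nat_mult[symmetric])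
    have 4: "exp ((a + of_nat k) * of_real (2 * q)) = exp (of_real q) * exp (of_real (real (2 * k + 1) * q)) * exp ((2 * a - 2) * complex_of_real q)"
      unfolding exp_add[symmetric] by (simp add: algebra_simps)
    show ?thesis unfolding 1 2 3 scaleR_conv_of_real of_real_mult add_0 4[simplified] using 4
      by (simp add: exp_of_real[symmetric] del: exp_of_real)
  qed
  ultimately have "has_bochner_integral lborel (\<lambda>q. exp q *\<^sub>R ?f (exp q)) (Gamma (a + of_nat k) / 2)"
    by (simp add: scaleR_conv_of_real)
  then show ?thesis unfolding set_integral_exp_subst[OF m] by (simp only: has_bochner_integral_iff)
qed

text \<open>The factor 1/4 is one half from the dilation and one half from \<open>ln u\<close> being
  half the logarithm of the square.\<close>

lemma log_Gamma_moment:
  assumes "s > 0"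
  shows "(LBINT u:{0<..}. complex_of_real (exp (- u\<^sup>2) * u ^ (2 * k + 1)) * of_real (ln u * u powr (2 * s - 2))) = of_real (Gamma (s + real k) * Digamma (s + real k) / 4)"
proof -
  let ?f = "\<lambda>u::real. exp (- u\<^sup>2) * u ^ (2 * k + 1) * (ln u * u powr (2 * s - 2))"
  have m: "set_borel_measurable borel {0<..} ?f" unfolding set_borel_measurable_def by measurable
  have "has_bochner_integral lborel (\<lambda>q. (0 + 2 * q) * exp ((s + real k) * (0 + 2 * q) - exp (0 + 2 * q))) ((Gamma (s + real k) * Digamma (s + real k)) /\<^sub>R \<bar>2\<bar>)"
    by (rule has_bochner_integral_lborel_affine[OF log_Gamma_integral]) (use assms in auto)
  then have "has_bochner_integral lborel (\<lambda>q. 1 / 2 * ((0 + 2 * q) * exp ((s + real k) * (0 + 2 * q) - exp (0 + 2 * q)))) (1 / 2 * ((Gamma (s + real k) * Digamma (s + real k)) /\<^sub>R \<bar>2\<bar>))"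
    by (rule has_bochner_integral_mult_right)
  moreover have "1 / 2 * ((0 + 2 * q) * exp ((s + real k) * (0 + 2 * q) - exp (0 + 2 * q))) = exp q *\<^sub>R ?f (exp q)" for q
  proof -
    have 1: "(exp q)\<^sup>2 = exp (2 * q)" by (simp flip: exp_of_nat_mult)
    have 2: "exp q powr (2 * s - 2) = exp ((2 * s - 2) * q)" by (simp add: powr_def)
    have 3: "exp q ^ (2 * k + 1) = exp (real (2 * k + 1) * q)" by (rule exp_of_nat_mult[symmetric])
    have 4: "exp ((s + real k) * (2 * q) - exp (2 * q)) = exp q * (exp (- exp (2 * q)) * exp (real (2 * k + 1) * q) * exp ((2 * s - 2) * q))"
      unfolding exp_add[symmetric] by (simp add: algebra_simps)
    show ?thesis unfolding 1 2 3 add_0 4 by simp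
  qed
  moreover have "1 / 2 * ((Gamma (s + real k) * Digamma (s + real k)) /\<^sub>R \<bar>2\<bar>) = Gamma (s + real k) * Digamma (s + real k) / 4" by simp
  ultimately have "has_bochner_integral lborel (\<lambda>q. exp q *\<^sub>R ?f (exp q)) (Gamma (s + real k) * Digamma (s + real k) / 4)"
    by (simp only:)
  then have "(LBINT u:{0<..}. ?f u) = Gamma (s + real k) * Digamma (s + real k) / 4"
    unfolding set_integral_exp_subst[OF m] by (simp only: has_bochner_integral_iff)
  then have "complex_of_real (LBINT u:{0<..}. ?f u) = of_real (Gamma (s + real k) * Digamma (s + real k) / 4)" by (simp only:)
  then show ?thesis unfolding set_lebesgue_integral_def integral_complex_of_real[symmetric]
    by (simp only: scaleR_conv_of_real of_real_mult real_scaleR_def of_real_eq_id id_apply)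
qed

lemma fact_odd_ratio: "(w * w) ^ k / fact (2 * k + 1) = (w\<^sup>2 / 4) ^ k / (fact k * pochhammer (3/2 :: complex) k)"
  unfolding fact_odd by (simp add: power_divide power2_eq_square)

lemma measurable_powr_complex [measurable]: "(\<lambda>u. complex_of_real u powr s) \<in> borel_measurable borel"
  unfolding powr_def by measurable

text \<open>The quotient of the Gamma values is a Pochhammer symbol, and the odd factorial is
  \<open>4 ^ k * fact k * pochhammer (3/2) k\<close>; the moment series is thereby a confluent
  series at \<open>w^2 / 4\<close>.\<close>

lemma sinh_gauss_powr:
  assumes a: "Re a > 0"
  shows "sinh_gauss_integrable w (\<lambda>u. of_real u powr (2 * a - 2))"
    and "sinh_gauss w (\<lambda>u. of_real u powr (2 * a - 2)) = Gamma a / 2 * hyp1F1 a (3/2) (w\<^sup>2 / 4)"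
proof -
  have n: "norm (complex_of_real u powr (2 * a - 2)) = u powr (2 * Re a - 2)" if "u > 0" for u
    using that by (simp add: norm_powr_real_powr)
  have "integrable lborel (\<lambda>u. indicator {0<..} u * (u powr (2 * Re a - 1) * exp (norm w * u - u\<^sup>2)))"
    by (rule gauss_power_integrable) (use a in simp)
  moreover have "indicator {0<..} u * (u powr (2 * Re a - 1) * exp (norm w * u - u\<^sup>2)) = indicator {0<..} u * (exp (norm w * u - u\<^sup>2) * u * norm (complex_of_real u powr (2 * a - 2)))" for u
  proof (cases "u > 0")
    case True
    have "u powr (2 * Re a - 1) = u powr 1 * u powr (2 * Re a - 2)" unfolding powr_add[symmetric] by simp
    then show ?thesis using True n[OF True] by simp
  qed simp
  ultimately have dom: "integrable lborel (\<lambda>u. indicator {0<..} u * (exp (norm w * u - u\<^sup>2) * u * norm (complex_of_real u powr (2 * a - 2))))" by simp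
  note H = sinh_gauss_series[OF _ dom Gamma_moment[OF a]]
  show "sinh_gauss_integrable w (\<lambda>u. of_real u powr (2 * a - 2))" by (rule H) measurable
  have s: "(\<lambda>k. (w * w) ^ k / fact (2 * k + 1) * (Gamma (a + of_nat k) / 2)) sums sinh_gauss w (\<lambda>u. of_real u powr (2 * a - 2))"
    by (rule H) measurable
  have a0: "a \<notin> \<int>\<^sub>\<le>\<^sub>0" using a by (auto elim!: nonpos_Ints_cases)
  have e: "(w * w) ^ k / fact (2 * k + 1) * (Gamma (a + of_nat k) / 2) = Gamma a / 2 * (pochhammer a k / pochhammer (3/2) k * ((w\<^sup>2 / 4) ^ k / fact k))" for k
  proof -
    have "Gamma (a + of_nat k) = Gamma a * pochhammer a k"
      using pochhammer_Gamma[OF a0, of k] a0 by (simp add: Gamma_eq_zero_iff)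
    then show ?thesis unfolding fact_odd_ratio by (simp add: mult_ac)
  qed
  have "(\<lambda>k. Gamma a / 2 * (pochhammer a k / pochhammer (3/2) k * ((w\<^sup>2 / 4) ^ k / fact k))) sums (Gamma a / 2 * hyp1F1 a (3/2) (w\<^sup>2 / 4))"
    unfolding hyp1F1_def by (intro sums_mult summable_sums summable_norm_cancel[OF summable_hyp1F1])
  then show "sinh_gauss w (\<lambda>u. of_real u powr (2 * a - 2)) = Gamma a / 2 * hyp1F1 a (3/2) (w\<^sup>2 / 4)"
    using s unfolding e by (rule sums_unique2[rotated])
qed

text \<open>The logarithm is absorbed into powers shifted by 1/2 to either side, both still
  integrable at 0. The series is evaluated below at \<open>s = 1\<close> and
  \<open>s = 1/2\<close>.\<close>

lemma sinh_gauss_ln_series: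
  assumes s: "s \<ge> 1/2"
  shows "sinh_gauss_integrable w (\<lambda>u. of_real (ln u * u powr (2 * s - 2)))"
    and "(\<lambda>k. (w\<^sup>2 / 4) ^ k / (fact k * pochhammer (3/2) k) * of_real (Gamma (s + real k) * Digamma (s + real k) / 4)) sums sinh_gauss w (\<lambda>u. of_real (ln u * u powr (2 * s - 2)))"
proof -
  have i: "integrable lborel (\<lambda>u. 2 * (indicator {0<..} u * (u powr (2 * s - 1 / 2) * exp (norm w * u - u\<^sup>2)) + indicator {0<..} u * (u powr (2 * s - 3 / 2) * exp (norm w * u - u\<^sup>2))))"
    by (intro integrable_mult_right Bochner_Integration.integrable_add gauss_power_integrable) (use s in auto)
  have dom: "integrable lborel (\<lambda>u. indicator {0<..} u * (exp (norm w * u - u\<^sup>2) * u * norm (complex_of_real (ln u * u powr (2 * s - 2)))))"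
  proof (rule Bochner_Integration.integrable_bound[OF i])
    show "AE u in lborel. norm (indicator {0<..} u * (exp (norm w * u - u\<^sup>2) * u * norm (complex_of_real (ln u * u powr (2 * s - 2)))))
      \<le> norm (2 * (indicator {0<..} u * (u powr (2 * s - 1 / 2) * exp (norm w * u - u\<^sup>2)) + indicator {0<..} u * (u powr (2 * s - 3 / 2) * exp (norm w * u - u\<^sup>2))))"
    proof (rule AE_I2)
      fix u :: real
      show "norm (indicator {0<..} u * (exp (norm w * u - u\<^sup>2) * u * norm (complex_of_real (ln u * u powr (2 * s - 2)))))
      \<le> norm (2 * (indicator {0<..} u * (u powr (2 * s - 1 / 2) * exp (norm w * u - u\<^sup>2)) + indicator {0<..} u * (u powr (2 * s - 3 / 2) * exp (norm w * u - u\<^sup>2))))"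
      proof (cases "u > 0")
        case True
        define E where "E = exp (norm w * u - u\<^sup>2)"
        have E: "E > 0" by (simp add: E_def)
        have p1: "u powr (2 * s - 1 / 2) = u powr (1 / 2) * (u powr 1 * u powr (2 * s - 2))"
          and p2: "u powr (2 * s - 3 / 2) = u powr (- 1 / 2) * (u powr 1 * u powr (2 * s - 2))"
          unfolding powr_add[symmetric] by simp_all
        have "\<bar>ln u\<bar> * (E * (u powr 1 * u powr (2 * s - 2))) \<le> (2 * (u powr (1 / 2) + u powr (- 1 / 2))) * (E * (u powr 1 * u powr (2 * s - 2)))"
          by (intro mult_right_mono abs_ln_le_powr[OF True]) (use E in auto)
        also have "\<dots> = 2 * (u powr (2 * s - 1 / 2) * E + u powr (2 * s - 3 / 2) * E)"
          unfolding p1 p2 by (simp only: distrib_left distrib_right mult_ac)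
        finally have le: "\<bar>ln u\<bar> * (E * (u powr 1 * u powr (2 * s - 2))) \<le> 2 * (u powr (2 * s - 1 / 2) * E + u powr (2 * s - 3 / 2) * E)" .
        have "norm (indicator {0<..} u * (E * u * norm (complex_of_real (ln u * u powr (2 * s - 2))))) = \<bar>ln u\<bar> * (E * (u powr 1 * u powr (2 * s - 2)))"
          using True E by (simp add: abs_mult norm_mult)
        also note le
        also have "2 * (u powr (2 * s - 1 / 2) * E + u powr (2 * s - 3 / 2) * E) = norm (2 * (indicator {0<..} u * (u powr (2 * s - 1 / 2) * E) + indicator {0<..} u * (u powr (2 * s - 3 / 2) * E)))"
          using True E by (simp add: abs_of_nonneg)
        finally show ?thesis unfolding E_def .
      qed simp
    qed
  qed measurable
  have s0: "s > 0" using s by simp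
  note H = sinh_gauss_series[OF _ dom log_Gamma_moment[OF s0]]
  show "sinh_gauss_integrable w (\<lambda>u. of_real (ln u * u powr (2 * s - 2)))" by (rule H) measurable
  have "(\<lambda>k. (w * w) ^ k / fact (2 * k + 1) * of_real (Gamma (s + real k) * Digamma (s + real k) / 4)) sums sinh_gauss w (\<lambda>u. of_real (ln u * u powr (2 * s - 2)))"
    by (rule H) measurable
  then show "(\<lambda>k. (w\<^sup>2 / 4) ^ k / (fact k * pochhammer (3/2) k) * of_real (Gamma (s + real k) * Digamma (s + real k) / 4)) sums sinh_gauss w (\<lambda>u. of_real (ln u * u powr (2 * s - 2)))"
    unfolding fact_odd_ratio .
qed

subsection \<open>The functions C and B\<close>

lemma sinh_gauss_one: "sinh_gauss_integrable w (\<lambda>u. 1)" "sinh_gauss w (\<lambda>u. 1) = hyp1F1_one (w\<^sup>2 / 4) / 2"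
proof -
  have e: "indicator {0<..} u *\<^sub>R (complex_of_real (exp (- u\<^sup>2)) * sinhc w u * 1) = indicator {0<..} u *\<^sub>R (complex_of_real (exp (- u\<^sup>2)) * sinhc w u * of_real u powr (2 * 1 - 2))" for u :: real
    by (simp add: indicator_def)
  show "sinh_gauss_integrable w (\<lambda>u. 1)" using sinh_gauss_powr(1)[of 1 w] unfolding sinh_gauss_integrable_def set_integrable_def e by simp
  show "sinh_gauss w (\<lambda>u. 1) = hyp1F1_one (w\<^sup>2 / 4) / 2"
    using sinh_gauss_powr(2)[of 1 w] unfolding sinh_gauss_def set_lebesgue_integral_def e hyp1F1_one_def by simp
qed

lemma sinh_gauss_inverse: "sinh_gauss_integrable w (\<lambda>u. of_real (1 / u))" "sinh_gauss w (\<lambda>u. of_real (1 / u)) = of_real (sqrt pi) / 2 * (exp (w\<^sup>2 / 4) * hyp1F1_one (- (w\<^sup>2 / 4)))"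
proof -
  have e: "indicator {0<..} u *\<^sub>R (complex_of_real (exp (- u\<^sup>2)) * sinhc w u * of_real (1 / u)) = indicator {0<..} u *\<^sub>R (complex_of_real (exp (- u\<^sup>2)) * sinhc w u * of_real u powr (2 * (1/2) - 2))" for u :: real
  proof (cases "u > 0")
    case True
    have "complex_of_real u powr (2 * (1/2) - 2) = inverse (of_real u)" using True by (simp add: powr_minus)
    then show ?thesis by (simp add: inverse_eq_divide)
  qed simp
  show "sinh_gauss_integrable w (\<lambda>u. of_real (1 / u))" using sinh_gauss_powr(1)[of "1/2" w] unfolding sinh_gauss_integrable_def set_integrable_def e by simp
  show "sinh_gauss w (\<lambda>u. of_real (1 / u)) = of_real (sqrt pi) / 2 * (exp (w\<^sup>2 / 4) * hyp1F1_one (- (w\<^sup>2 / 4)))"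
    using sinh_gauss_powr(2)[of "1/2" w] unfolding sinh_gauss_def set_lebesgue_integral_def e hyp1F1_half
    by (simp add: Gamma_one_half_complex)
qed

lemma sinh_gauss_ln:
  "sinh_gauss_integrable w (\<lambda>u. of_real (ln u))"
  "sinh_gauss w (\<lambda>u. of_real (ln u)) = (hyp1F1_harm (w\<^sup>2 / 4) - euler_mascheroni * hyp1F1_one (w\<^sup>2 / 4)) / 4"
proof -
  let ?z = "w\<^sup>2 / 4"
  have e: "indicator {0<..} u *\<^sub>R (complex_of_real (exp (- u\<^sup>2)) * sinhc w u * of_real (ln u)) = indicator {0<..} u *\<^sub>R (complex_of_real (exp (- u\<^sup>2)) * sinhc w u * of_real (ln u * u powr (2 * 1 - 2)))" for u :: real
    by (simp add: indicator_def)
  show "sinh_gauss_integrable w (\<lambda>u. of_real (ln u))" using sinh_gauss_ln_series(1)[of 1 w] unfolding sinh_gauss_integrable_def set_integrable_def e by simp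
  have "(\<lambda>k. ?z ^ k / (fact k * pochhammer (3/2) k) * of_real (Gamma (1 + real k) * Digamma (1 + real k) / 4)) sums sinh_gauss w (\<lambda>u. of_real (ln u * u powr (2 * 1 - 2)))"
    by (rule sinh_gauss_ln_series) simp
  moreover have "?z ^ k / (fact k * pochhammer (3/2) k) * of_real (Gamma (1 + real k) * Digamma (1 + real k) / 4) = (?z ^ k / pochhammer (3/2) k * harm k - euler_mascheroni * (?z ^ k / pochhammer (3/2) k)) / 4" for k
  proof -
    have "Gamma (1 + real k) = fact k" using Gamma_fact[of k, where 'a = real] by simp
    moreover have "Digamma (1 + real k) = harm k - euler_mascheroni"
      using Digamma_of_nat[of k, where 'a = real] by simp
    ultimately have G: "complex_of_real (Gamma (1 + real k) * Digamma (1 + real k) / 4) = fact k * (harm k - euler_mascheroni) / 4"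
      by (simp add: of_real_harm)
    have alg: "Z / (F * p) * (F * (h - g) / 4) = (Z / p * h - g * (Z / p)) / 4" if "F \<noteq> 0" for Z F p h g :: complex
      using that by (simp add: algebra_simps diff_divide_distrib)
    show ?thesis unfolding G by (rule alg) simp
  qed
  ultimately have "(\<lambda>k. (?z ^ k / pochhammer (3/2) k * harm k - euler_mascheroni * (?z ^ k / pochhammer (3/2) k)) / 4) sums sinh_gauss w (\<lambda>u. of_real (ln u * u powr (2 * 1 - 2)))" by (simp only:)
  moreover have "(\<lambda>k. (?z ^ k / pochhammer (3/2) k * harm k - euler_mascheroni * (?z ^ k / pochhammer (3/2) k)) / 4) sums ((hyp1F1_harm ?z - euler_mascheroni * hyp1F1_one ?z) / 4)"
    unfolding hyp1F1_harm_def by (intro sums_divide sums_diff sums_mult hyp1F1_one_sums summable_sums summable_hyp1F1_harm)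
  ultimately have "sinh_gauss w (\<lambda>u. of_real (ln u * u powr (2 * 1 - 2))) = (hyp1F1_harm ?z - euler_mascheroni * hyp1F1_one ?z) / 4" by (rule sums_unique2)
  then show "sinh_gauss w (\<lambda>u. of_real (ln u)) = (hyp1F1_harm ?z - euler_mascheroni * hyp1F1_one ?z) / 4"
    unfolding sinh_gauss_def set_lebesgue_integral_def e .
qed

text \<open>The case \<open>s = 1/2\<close>: digamma values at half-integers are sums of reciprocals
  \<open>1 / (1/2 + j)\<close> minus the constant \<open>euler_mascheroni + 2 * ln 2\<close>, and
  \<open>harm_transform\<close> sums the former.\<close>

lemma sinh_gauss_ln_over:
  "sinh_gauss_integrable w (\<lambda>u. of_real (ln u / u))"
  "sinh_gauss w (\<lambda>u. of_real (ln u / u)) = of_real (sqrt pi) / 4 * exp (w\<^sup>2 / 4) * (- (euler_mascheroni + of_real (2 * ln 2)) * hyp1F1_one (- (w\<^sup>2 / 4)) - hyp1F1_harm (- (w\<^sup>2 / 4)))"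
proof -
  let ?z = "w\<^sup>2 / 4"
  have e: "indicator {0<..} u *\<^sub>R (complex_of_real (exp (- u\<^sup>2)) * sinhc w u * of_real (ln u / u)) = indicator {0<..} u *\<^sub>R (complex_of_real (exp (- u\<^sup>2)) * sinhc w u * of_real (ln u * u powr (2 * (1/2) - 2)))" for u :: real
  proof (cases "u > 0")
    case True
    have "u powr (2 * (1/2) - 2) = 1 / u" using True powr_minus_divide[of u 1] by simp
    then show ?thesis by simp
  qed simp
  show "sinh_gauss_integrable w (\<lambda>u. of_real (ln u / u))" using sinh_gauss_ln_series(1)[of "1/2" w] unfolding sinh_gauss_integrable_def set_integrable_def e by simp
  define D where "D k = (\<Sum>j<k. 1 / (1/2 + of_nat j :: complex))" for k
  define c where "c = euler_mascheroni + complex_of_real (2 * ln 2)"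
  let ?p = "\<lambda>k. pochhammer (1/2) k / pochhammer (3/2 :: complex) k"
  have "(\<lambda>k. ?z ^ k / (fact k * pochhammer (3/2) k) * of_real (Gamma (1/2 + real k) * Digamma (1/2 + real k) / 4)) sums sinh_gauss w (\<lambda>u. of_real (ln u * u powr (2 * (1/2) - 2)))"
    by (rule sinh_gauss_ln_series) simp
  moreover have "?z ^ k / (fact k * pochhammer (3/2) k) * of_real (Gamma (1/2 + real k) * Digamma (1/2 + real k) / 4) = of_real (sqrt pi) / 4 * (?p k * D k * (?z ^ k / fact k) - c * (?p k * (?z ^ k / fact k)))" for k
  proof -
    have h: "(1/2 :: complex) \<notin> \<int>\<^sub>\<le>\<^sub>0"
    proof
      assume "(1/2 :: complex) \<in> \<int>\<^sub>\<le>\<^sub>0"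
      then obtain n where "(1/2 :: complex) = - of_nat n" by (auto elim!: nonpos_Ints_cases')
      then have "Re (1/2 :: complex) = Re (- of_nat n)" by (simp only:)
      then show False using of_nat_0_le_iff[of n, where 'a = real] by simp
    qed
    have "complex_of_real (Gamma (1/2 + real k)) = Gamma (1/2 + of_nat k)"
      by (simp add: Gamma_complex_of_real[symmetric])
    also have "\<dots> = of_real (sqrt pi) * pochhammer (1/2) k"
      using pochhammer_Gamma[OF h, of k] by (simp add: Gamma_one_half_complex field_simps)
    finally have G: "complex_of_real (Gamma (1/2 + real k)) = of_real (sqrt pi) * pochhammer (1/2) k" .
    have "Digamma (1/2 + real k) = (\<Sum>j<k. 2 / (of_nat (2 * j) + 1)) - euler_mascheroni - of_real (2 * ln 2)"
      using Digamma_half_integer[of k, where 'a = real] by (simp add: add.commute)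
    then have "complex_of_real (Digamma (1/2 + real k)) = (\<Sum>j<k. 2 / (of_nat (2 * j) + 1)) - euler_mascheroni - of_real (2 * ln 2)" by simp
    also have "(\<Sum>j<k. 2 / (of_nat (2 * j) + 1 :: complex)) = D k"
      unfolding D_def
    proof (intro sum.cong refl)
      fix j
      have "(1/2 + of_nat j :: complex) = (of_nat (2 * j) + 1) / 2" by (simp add: field_simps)
      then show "2 / (of_nat (2 * j) + 1 :: complex) = 1 / (1/2 + of_nat j)" by (simp only:) simp
    qed
    finally have Dg: "complex_of_real (Digamma (1/2 + real k)) = D k - c" by (simp add: c_def)
    have "complex_of_real (Gamma (1/2 + real k) * Digamma (1/2 + real k) / 4) = of_real (sqrt pi) * pochhammer (1/2) k * (D k - c) / 4"
      unfolding of_real_mult of_real_divide G Dg by simp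
    then show ?thesis by (simp only:) (simp add: algebra_simps diff_divide_distrib)
  qed
  ultimately have 1: "(\<lambda>k. of_real (sqrt pi) / 4 * (?p k * D k * (?z ^ k / fact k) - c * (?p k * (?z ^ k / fact k)))) sums sinh_gauss w (\<lambda>u. of_real (ln u * u powr (2 * (1/2) - 2)))" by (simp only:)
  have d: "(\<lambda>k. ?p k * D k * (?z ^ k / fact k)) sums (- exp ?z * hyp1F1_harm (- ?z))"
    unfolding D_def harm_transform(2)[symmetric] by (intro summable_sums summable_norm_cancel[OF harm_transform(1)])
  have h: "(\<lambda>k. ?p k * (?z ^ k / fact k)) sums (exp ?z * hyp1F1_one (- ?z))"
    unfolding hyp1F1_half[symmetric] hyp1F1_def by (intro summable_sums summable_norm_cancel[OF summable_hyp1F1])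
  have "(\<lambda>k. of_real (sqrt pi) / 4 * (?p k * D k * (?z ^ k / fact k) - c * (?p k * (?z ^ k / fact k)))) sums (of_real (sqrt pi) / 4 * (- exp ?z * hyp1F1_harm (- ?z) - c * (exp ?z * hyp1F1_one (- ?z))))"
    by (intro sums_mult sums_diff d h)
  from sums_unique2[OF 1 this]
  have "sinh_gauss w (\<lambda>u. of_real (ln u * u powr (2 * (1/2) - 2))) = of_real (sqrt pi) / 4 * (- exp ?z * hyp1F1_harm (- ?z) - c * (exp ?z * hyp1F1_one (- ?z)))" .
  also have "\<dots> = of_real (sqrt pi) / 4 * exp ?z * (- c * hyp1F1_one (- ?z) - hyp1F1_harm (- ?z))" by (simp add: algebra_simps)
  finally show "sinh_gauss w (\<lambda>u. of_real (ln u / u)) = of_real (sqrt pi) / 4 * exp ?z * (- (euler_mascheroni + of_real (2 * ln 2)) * hyp1F1_one (- ?z) - hyp1F1_harm (- ?z))"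
    unfolding sinh_gauss_def set_lebesgue_integral_def e c_def .
qed

text \<open>Fubini for a sum of two products, the shape taken by \<open>ln (v / u)\<close>. The
  factor \<open>1 / u\<close> of the kernel is attached to the functions of
  \<open>u\<close>.\<close>

lemma mix_product2:
  assumes f: "admissible f" and e: "\<And>v u. v > 0 \<Longrightarrow> u > 0 \<Longrightarrow> f (v / u) = f1 v * f2 u + g1 v * g2 u"
    and i: "sinh_gauss_integrable w (\<lambda>u. f2 u * of_real (1 / u))" "sinh_gauss_integrable w (\<lambda>u. g2 u * of_real (1 / u))" "sinh_gauss_integrable (\<i> * w) f1" "sinh_gauss_integrable (\<i> * w) g1"
  shows "mix w f = 4 / of_real (sqrt pi) * (sinh_gauss (\<i> * w) f1 * sinh_gauss w (\<lambda>u. f2 u * of_real (1 / u)) + sinh_gauss (\<i> * w) g1 * sinh_gauss w (\<lambda>u. g2 u * of_real (1 / u)))"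
proof -
  define F G where "F = sinh_gauss w (\<lambda>u. f2 u * of_real (1 / u))" and "G = sinh_gauss w (\<lambda>u. g2 u * of_real (1 / u))"
  let ?h = "\<lambda>w g u. indicator {0<..} u *\<^sub>R (complex_of_real (exp (- u\<^sup>2)) * sinhc w u * g u)"
  have "mix w f = (LBINT v. LBINT u. mix_kernel w (v, u) * f (v / u))" by (rule mix_iterated[OF f])
  also have "\<dots> = (LBINT v. 4 / of_real (sqrt pi) * (?h (\<i> * w) f1 v * F + ?h (\<i> * w) g1 v * G))"
  proof (rule Bochner_Integration.integral_cong[OF refl])
    fix v :: real
    have "(LBINT u. mix_kernel w (v, u) * f (v / u)) = (LBINT u. 4 / of_real (sqrt pi) * (?h (\<i> * w) f1 v * ?h w (\<lambda>u. f2 u * of_real (1 / u)) u + ?h (\<i> * w) g1 v * ?h w (\<lambda>u. g2 u * of_real (1 / u)) u))"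
    proof (rule Bochner_Integration.integral_cong[OF refl])
      fix u :: real
      show "mix_kernel w (v, u) * f (v / u) = 4 / of_real (sqrt pi) * (?h (\<i> * w) f1 v * ?h w (\<lambda>u. f2 u * of_real (1 / u)) u + ?h (\<i> * w) g1 v * ?h w (\<lambda>u. g2 u * of_real (1 / u)) u)"
      proof (cases "v > 0 \<and> u > 0")
        case True
        have "exp (- (u\<^sup>2 + v\<^sup>2)) = exp (- u\<^sup>2) * exp (- v\<^sup>2)" by (simp flip: exp_add)
        then have k: "mix_kernel w (v, u) = 4 / of_real (sqrt pi) * (of_real (exp (- v\<^sup>2)) * sinhc (\<i> * w) v) * (of_real (exp (- u\<^sup>2)) * sinhc w u * of_real (1 / u))"
          using True by (simp add: mix_kernel_def scaleR_conv_of_real)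
        show ?thesis unfolding k using True e[of v u] by (simp add: algebra_simps add_divide_distrib)
      next
        case False
        then show ?thesis by (auto simp: mix_kernel_eq_0)
      qed
    qed
    also have "\<dots> = 4 / of_real (sqrt pi) * (LBINT u. ?h (\<i> * w) f1 v * ?h w (\<lambda>u. f2 u * of_real (1 / u)) u + ?h (\<i> * w) g1 v * ?h w (\<lambda>u. g2 u * of_real (1 / u)) u)"
      by (rule integral_mult_right_zero)
    also have "(LBINT u. ?h (\<i> * w) f1 v * ?h w (\<lambda>u. f2 u * of_real (1 / u)) u + ?h (\<i> * w) g1 v * ?h w (\<lambda>u. g2 u * of_real (1 / u)) u)
       = (LBINT u. ?h (\<i> * w) f1 v * ?h w (\<lambda>u. f2 u * of_real (1 / u)) u) + (LBINT u. ?h (\<i> * w) g1 v * ?h w (\<lambda>u. g2 u * of_real (1 / u)) u)"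
      using i unfolding sinh_gauss_integrable_def set_integrable_def by (intro Bochner_Integration.integral_add integrable_mult_right)
    also have "\<dots> = ?h (\<i> * w) f1 v * F + ?h (\<i> * w) g1 v * G"
      unfolding integral_mult_right_zero F_def G_def sinh_gauss_def set_lebesgue_integral_def ..
    finally show "(LBINT u. mix_kernel w (v, u) * f (v / u)) = 4 / of_real (sqrt pi) * (?h (\<i> * w) f1 v * F + ?h (\<i> * w) g1 v * G)" .
  qed
  also have "\<dots> = 4 / of_real (sqrt pi) * (LBINT v. ?h (\<i> * w) f1 v * F + ?h (\<i> * w) g1 v * G)" by (rule integral_mult_right_zero)
  also have "(LBINT v. ?h (\<i> * w) f1 v * F + ?h (\<i> * w) g1 v * G) = (LBINT v. ?h (\<i> * w) f1 v * F) + (LBINT v. ?h (\<i> * w) g1 v * G)"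
    using i unfolding sinh_gauss_integrable_def set_integrable_def by (intro Bochner_Integration.integral_add integrable_mult_left)
  also have "\<dots> = sinh_gauss (\<i> * w) f1 * F + sinh_gauss (\<i> * w) g1 * G"
    unfolding integral_mult_left_zero sinh_gauss_def set_lebesgue_integral_def ..
  finally show ?thesis unfolding F_def G_def .
qed

lemma sinh_gauss_cmult: "sinh_gauss w (\<lambda>u. c * g u) = c * sinh_gauss w g"
  unfolding sinh_gauss_def by (simp add: mult.left_commute)

lemma sinh_gauss_integrable_zero: "sinh_gauss_integrable w (\<lambda>u. 0)" by (simp add: sinh_gauss_integrable_def set_integrable_def)

lemma sinh_gauss_zero: "sinh_gauss w (\<lambda>u. 0) = 0" by (simp add: sinh_gauss_def set_lebesgue_integral_def)

lemma mix_product: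
  assumes f: "admissible f" and e: "\<And>v u. v > 0 \<Longrightarrow> u > 0 \<Longrightarrow> f (v / u) = f1 v * f2 u"
    and i: "sinh_gauss_integrable w (\<lambda>u. f2 u * of_real (1 / u))" "sinh_gauss_integrable (\<i> * w) f1"
  shows "mix w f = 4 / of_real (sqrt pi) * (sinh_gauss (\<i> * w) f1 * sinh_gauss w (\<lambda>u. f2 u * of_real (1 / u)))"
proof -
  have "mix w f = 4 / of_real (sqrt pi) * (sinh_gauss (\<i> * w) f1 * sinh_gauss w (\<lambda>u. f2 u * of_real (1 / u)) + sinh_gauss (\<i> * w) (\<lambda>_. 0) * sinh_gauss w (\<lambda>u. 0 * of_real (1 / u)))"
    by (rule mix_product2[OF f]) (use e i sinh_gauss_integrable_zero in auto)
  then show ?thesis by (simp add: sinh_gauss_zero)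
qed

lemma sq_iw: "(\<i> * w)\<^sup>2 / 4 = - (w\<^sup>2 / 4)" by (simp add: power_mult_distrib)

lemma mix_1: "mix w (\<lambda>r. 1) = exp (w\<^sup>2 / 4) * (hyp1F1_one (- (w\<^sup>2 / 4)))\<^sup>2"
proof -
  have "mix w (\<lambda>r. 1) = 4 / of_real (sqrt pi) * (sinh_gauss (\<i> * w) (\<lambda>v. 1) * sinh_gauss w (\<lambda>u. 1 * of_real (1 / u)))"
    by (rule mix_product[OF admissible_const]) (use sinh_gauss_inverse(1)[of w] sinh_gauss_one(1) in auto)
  then show ?thesis unfolding mult_1 sinh_gauss_inverse(2) sinh_gauss_one(2) sq_iw by (simp add: power2_eq_square)
qed

lemma mix_inverse: "mix w (\<lambda>r. of_real (1 / r)) = exp (- (w\<^sup>2 / 4)) * (hyp1F1_one (w\<^sup>2 / 4))\<^sup>2"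
proof -
  have u: "indicator {0<..} u *\<^sub>R (complex_of_real (exp (- u\<^sup>2)) * sinhc w u * (of_real u * of_real (1 / u))) = indicator {0<..} u *\<^sub>R (complex_of_real (exp (- u\<^sup>2)) * sinhc w u * 1)" for u :: real
    by (simp add: indicator_def)
  have "sinh_gauss_integrable w (\<lambda>u. of_real u * of_real (1 / u))" using sinh_gauss_one(1)[of w] unfolding sinh_gauss_integrable_def set_integrable_def u .
  then have "mix w (\<lambda>r. of_real (1 / r)) = 4 / of_real (sqrt pi) * (sinh_gauss (\<i> * w) (\<lambda>v. of_real (1 / v)) * sinh_gauss w (\<lambda>u. of_real u * of_real (1 / u)))"
    by (intro mix_product[OF admissible_inverse]) (use sinh_gauss_inverse(1) in auto)
  moreover have "sinh_gauss w (\<lambda>u. of_real u * of_real (1 / u)) = hyp1F1_one (w\<^sup>2 / 4) / 2"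
    using sinh_gauss_one(2)[of w] unfolding sinh_gauss_def set_lebesgue_integral_def u .
  ultimately show ?thesis unfolding sinh_gauss_inverse(2) sq_iw minus_minus by (simp only:) (simp add: power2_eq_square)
qed

text \<open>The logarithms of \<open>v\<close> and \<open>u\<close> enter with opposite signs, so
  Euler's constant cancels; the harmonic parts add up, and of the \<open>2 * ln 2\<close> from the
  half-integer digamma values one \<open>ln 2\<close> times the total mass remains.\<close>

lemma mix_ln: "mix w (\<lambda>r. of_real (ln r)) - of_real (ln 2) * mix w (\<lambda>r. 1) = exp (w\<^sup>2 / 4) * hyp1F1_one (- (w\<^sup>2 / 4)) * hyp1F1_harm (- (w\<^sup>2 / 4))"
proof -
  have t: "(\<lambda>u. - complex_of_real (ln u) * of_real (1 / u)) = (\<lambda>u. (- 1) * of_real (ln u / u))" by (simp add: fun_eq_iff)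
  have "sinh_gauss_integrable w (\<lambda>u. (- 1) * of_real (ln u / u))"
    using sinh_gauss_ln_over(1)[of w] unfolding sinh_gauss_integrable_def
    by (subst mult.left_commute) (rule set_integrable_mult_right)
  then have A: "mix w (\<lambda>r. of_real (ln r)) = 4 / of_real (sqrt pi) * (sinh_gauss (\<i> * w) (\<lambda>v. of_real (ln v)) * sinh_gauss w (\<lambda>u. 1 * of_real (1 / u)) + sinh_gauss (\<i> * w) (\<lambda>v. 1) * sinh_gauss w (\<lambda>u. - of_real (ln u) * of_real (1 / u)))"
    by (intro mix_product2[OF admissible_ln]) (use sinh_gauss_inverse(1)[of w] sinh_gauss_one(1) sinh_gauss_ln(1) t in \<open>auto simp: ln_div\<close>)
  have B: "sinh_gauss w (\<lambda>u. - of_real (ln u) * of_real (1 / u)) = - sinh_gauss w (\<lambda>u. of_real (ln u / u))"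
    unfolding t sinh_gauss_cmult by simp
  have alg: "4 / S * ((Q - g * P) / 4 * (S / 2 * (E * P)) + P / 2 * - (S / 4 * E * (- (g + 2 * l) * P - Q))) - l * (E * P\<^sup>2) = E * P * Q"
    if "S \<noteq> 0" for S Q g P E l :: complex
    using that by (simp add: field_simps power2_eq_square)
  show ?thesis
    unfolding A B unfolding sinh_gauss_ln_over(2) sinh_gauss_ln(2) sinh_gauss_one(2) mult_1 sinh_gauss_inverse(2) sq_iw mix_1 of_real_mult of_real_numeral
    by (rule alg) simp
qed

lemma mix_ln_over: "mix w (\<lambda>r. of_real (ln r / r)) = - (exp (- (w\<^sup>2 / 4)) * hyp1F1_one (w\<^sup>2 / 4) * hyp1F1_harm (w\<^sup>2 / 4)) - of_real (ln 2) * mix w (\<lambda>r. of_real (1 / r))"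
proof -
  have u1: "indicator {0<..} u *\<^sub>R (complex_of_real (exp (- u\<^sup>2)) * sinhc w u * (of_real u * of_real (1 / u))) = indicator {0<..} u *\<^sub>R (complex_of_real (exp (- u\<^sup>2)) * sinhc w u * 1)" for u :: real
    by (simp add: indicator_def)
  have u2: "indicator {0<..} u *\<^sub>R (complex_of_real (exp (- u\<^sup>2)) * sinhc w u * (of_real (- (ln u * u)) * of_real (1 / u))) = (- 1) * (indicator {0<..} u *\<^sub>R (complex_of_real (exp (- u\<^sup>2)) * sinhc w u * of_real (ln u)))" for u :: real
    by (simp add: indicator_def)
  have 1: "sinh_gauss_integrable w (\<lambda>u. of_real u * of_real (1 / u))" using sinh_gauss_one(1)[of w] unfolding sinh_gauss_integrable_def set_integrable_def u1 .
  have 2: "sinh_gauss_integrable w (\<lambda>u. of_real (- (ln u * u)) * of_real (1 / u))" using sinh_gauss_ln(1)[of w] unfolding sinh_gauss_integrable_def set_integrable_def u2 by (rule integrable_mult_right)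
  have A: "mix w (\<lambda>r. of_real (ln r / r)) = 4 / of_real (sqrt pi) * (sinh_gauss (\<i> * w) (\<lambda>v. of_real (ln v / v)) * sinh_gauss w (\<lambda>u. of_real u * of_real (1 / u)) + sinh_gauss (\<i> * w) (\<lambda>v. of_real (1 / v)) * sinh_gauss w (\<lambda>u. of_real (- (ln u * u)) * of_real (1 / u)))"
  proof (rule mix_product2[OF admissible_ln_over _ 1 2 sinh_gauss_ln_over(1) sinh_gauss_inverse(1)])
    fix v u :: real assume vu: "v > 0" "u > 0"
    have "ln (v / u) / (v / u) = ln v / v * u + 1 / v * (- (ln u * u))"
      using vu by (simp add: ln_div field_simps)
    then show "complex_of_real (ln (v / u) / (v / u)) = of_real (ln v / v) * of_real u + of_real (1 / v) * of_real (- (ln u * u))"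
      by (simp only: of_real_add of_real_mult)
  qed
  have B1: "sinh_gauss w (\<lambda>u. of_real u * of_real (1 / u)) = hyp1F1_one (w\<^sup>2 / 4) / 2"
    using sinh_gauss_one(2)[of w] unfolding sinh_gauss_def set_lebesgue_integral_def u1 .
  have B2: "sinh_gauss w (\<lambda>u. of_real (- (ln u * u)) * of_real (1 / u)) = - ((hyp1F1_harm (w\<^sup>2 / 4) - euler_mascheroni * hyp1F1_one (w\<^sup>2 / 4)) / 4)"
    using sinh_gauss_ln(2)[of w] unfolding sinh_gauss_def set_lebesgue_integral_def u2 integral_mult_right_zero by simp
  have alg: "4 / S * (S / 4 * E * (- (g + 2 * l) * P - Q) * (P / 2) + S / 2 * (E * P) * - ((Q - g * P) / 4)) = - (E * P * Q) - l * (E * P\<^sup>2)"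
    if "S \<noteq> 0" for S Q g P E l :: complex
    using that by (simp add: field_simps power2_eq_square)
  show ?thesis
    unfolding A B1 B2 unfolding sinh_gauss_ln_over(2) sinh_gauss_inverse(2) sq_iw minus_minus mix_inverse of_real_mult of_real_numeral
    by (rule alg) simp
qed

section \<open>The error function and the closed forms of \<open>CC\<close> and
  \<open>BB\<close>\<close>

text \<open>A first-order differential equation, from the two-term recursion of the reciprocal
  Pochhammer symbols. Multiplication by \<open>2 * z\<close> makes it meaningful at 0 as
  well.\<close>

lemma hyp1F1_one_derivative:
  "\<exists>D. (hyp1F1_one has_field_derivative D) (at z) \<and> 2 * z * D = 1 - hyp1F1_one z + 2 * z * hyp1F1_one z"
proof -
  define p where "p n = 1 / pochhammer (3/2 :: complex) n" for n
  have PPp: "hyp1F1_one = (\<lambda>z. \<Sum>n. p n * z ^ n)"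
    using hyp1F1_one_sums by (auto simp: fun_eq_iff p_def sums_iff field_simps)
  have s: "summable (\<lambda>n. p n * y ^ n)" for y
    using hyp1F1_one_sums[of y] by (simp add: p_def sums_iff field_simps)
  have D: "(hyp1F1_one has_field_derivative (\<Sum>n. diffs p n * z ^ n)) (at z)"
    unfolding PPp by (rule termdiffs_strong_converges_everywhere[OF s])
  have sd: "summable (\<lambda>n. diffs p n * z ^ n)" by (rule termdiff_converges_all[OF s])
  have r: "(2 * of_nat n + 3) * p (Suc n) = 2 * p n" for n
  proof -
    have 1: "pochhammer (3/2 :: complex) (Suc n) = (3/2 + of_nat n) * pochhammer (3/2) n" by (simp add: pochhammer_rec')
    have 2: "(2 * of_nat n + 3 :: complex) = 2 * (3/2 + of_nat n)" by simp
    have "2 * t * (1 / (t * P)) = 2 * (1 / P)" if "t \<noteq> 0" for t P :: complex using that by simp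
    then show ?thesis unfolding p_def 1 2 using three_halves_nonzero by blast
  qed
  have "(\<lambda>n. 2 * z * (diffs p n * z ^ n) + p (Suc n) * z ^ Suc n - 2 * z * (p n * z ^ n)) sums (2 * z * (\<Sum>n. diffs p n * z ^ n) + (hyp1F1_one z - 1) - 2 * z * hyp1F1_one z)"
  proof (intro sums_diff sums_add sums_mult)
    show "(\<lambda>n. diffs p n * z ^ n) sums (\<Sum>n. diffs p n * z ^ n)" using sd by (rule summable_sums)
    show "(\<lambda>n. p n * z ^ n) sums hyp1F1_one z" unfolding PPp using s by (rule summable_sums)
    then show "(\<lambda>n. p (Suc n) * z ^ Suc n) sums (hyp1F1_one z - 1)"
      by (subst sums_Suc_iff) (simp add: p_def)
  qed
  moreover have "2 * z * (diffs p n * z ^ n) + p (Suc n) * z ^ Suc n - 2 * z * (p n * z ^ n) = 0" for n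
  proof -
    have "2 * z * (diffs p n * z ^ n) + p (Suc n) * z ^ Suc n = ((2 * of_nat n + 3) * p (Suc n)) * z ^ Suc n"
      by (simp add: diffs_def algebra_simps)
    then show ?thesis unfolding r by simp
  qed
  ultimately have "(\<lambda>n. 0 :: complex) sums (2 * z * (\<Sum>n. diffs p n * z ^ n) + (hyp1F1_one z - 1) - 2 * z * hyp1F1_one z)" by (simp only:)
  then have "2 * z * (\<Sum>n. diffs p n * z ^ n) + (hyp1F1_one z - 1) - 2 * z * hyp1F1_one z = 0"
    by (rule sums_unique2[OF _ sums_zero])
  then have "2 * z * (\<Sum>n. diffs p n * z ^ n) = 1 - hyp1F1_one z + 2 * z * hyp1F1_one z" by (simp add: algebra_simps)
  then show ?thesis using D by blast
qed

text \<open>The bracketed expression vanishes at 0, and the differential equation of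
  \<open>hyp1F1_one\<close> shows that it is an antiderivative of the Gaussian on the whole
  plane.\<close>

lemma erf_eq: "erf w = 2 / of_real (sqrt pi) * (w * exp (- w\<^sup>2) * hyp1F1_one (w\<^sup>2))"
proof -
  let ?G = "\<lambda>z. z * exp (- z\<^sup>2) * hyp1F1_one (z\<^sup>2)"
  have D: "(?G has_field_derivative exp (- (z\<^sup>2))) (at z within UNIV)" for z
  proof -
    obtain D where D: "(hyp1F1_one has_field_derivative D) (at (z\<^sup>2))" "2 * z\<^sup>2 * D = 1 - hyp1F1_one (z\<^sup>2) + 2 * z\<^sup>2 * hyp1F1_one (z\<^sup>2)"
      using hyp1F1_one_derivative by blast
    have c: "((\<lambda>z. hyp1F1_one (z\<^sup>2)) has_field_derivative D * (2 * z)) (at z)"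
      by (rule DERIV_chain2[where f = hyp1F1_one and g = "\<lambda>z. z\<^sup>2", OF D(1)]) (auto intro!: derivative_eq_intros)
    have "(?G has_field_derivative (exp (- z\<^sup>2) + z * (exp (- z\<^sup>2) * (- (2 * z)))) * hyp1F1_one (z\<^sup>2) + z * exp (- z\<^sup>2) * (D * (2 * z))) (at z)"
      by (rule derivative_eq_intros c refl | simp)+
    moreover have "(exp (- z\<^sup>2) + z * (exp (- z\<^sup>2) * (- (2 * z)))) * hyp1F1_one (z\<^sup>2) + z * exp (- z\<^sup>2) * (D * (2 * z)) = exp (- z\<^sup>2) * (hyp1F1_one (z\<^sup>2) - 2 * z\<^sup>2 * hyp1F1_one (z\<^sup>2) + 2 * z\<^sup>2 * D)"
      by (simp add: algebra_simps power2_eq_square)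
    moreover have "\<dots> = exp (- z\<^sup>2)" unfolding D(2) by simp
    ultimately show ?thesis by simp
  qed
  have "((\<lambda>z. exp (- (z\<^sup>2))) has_contour_integral (?G (pathfinish (linepath 0 w)) - ?G (pathstart (linepath 0 w)))) (linepath 0 w)"
    by (rule contour_integral_primitive[where S = UNIV, OF D valid_path_linepath]) auto
  then have "contour_integral (linepath 0 w) (\<lambda>z. exp (- (z\<^sup>2))) = ?G w" by (intro contour_integral_unique) simp
  then show ?thesis by (simp add: erf_def)
qed

lemma erf_half: "of_real (sqrt pi) * erf (w / 2) = w * exp (- (w\<^sup>2 / 4)) * hyp1F1_one (w\<^sup>2 / 4)"
proof -
  have "erf (w / 2) = 2 / of_real (sqrt pi) * (w / 2 * exp (- (w\<^sup>2 / 4)) * hyp1F1_one (w\<^sup>2 / 4))"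
    using erf_eq[of "w / 2"] by (simp add: power_divide)
  then show ?thesis by simp
qed

lemma limit_at_0_eqI:
  assumes "\<And>w. w \<noteq> 0 \<Longrightarrow> f w = g w" "(g \<longlongrightarrow> g 0) (at 0)"
  shows "limit_at_0 f w = g w"
proof (cases "w = 0")
  case True
  have "\<forall>\<^sub>F w in at 0. g w = f w" using assms(1) by (auto simp: eventually_at_filter)
  with assms(2) have "(f \<longlongrightarrow> g 0) (at 0)" by (rule Lim_transform_eventually)
  then have "Lim (at 0) f = g 0" by (intro tendsto_Lim) auto
  then show ?thesis using True by (simp add: limit_at_0_def)
qed (simp add: limit_at_0_def assms)

lemma isCont_hyp1F1_one_sq: "isCont (\<lambda>w. hyp1F1_one (w\<^sup>2 / 4)) w"
proof -
  obtain D where "(hyp1F1_one has_field_derivative D) (at (w\<^sup>2 / 4))" using hyp1F1_one_derivative by blast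
  then have "isCont hyp1F1_one (w\<^sup>2 / 4)" by (rule DERIV_isCont)
  moreover have "isCont (\<lambda>w. w\<^sup>2 / 4) w" by (intro continuous_intros) auto
  ultimately show ?thesis by (rule isCont_o2[rotated])
qed

lemma CC_eq: "CC w = exp (- (w\<^sup>2 / 4)) * (hyp1F1_one (w\<^sup>2 / 4))\<^sup>2"
  unfolding CC_def
proof (rule limit_at_0_eqI)
  fix w :: complex assume w: "w \<noteq> 0"
  have "of_real pi / w\<^sup>2 * exp (w\<^sup>2 / 4) * (erf (w / 2))\<^sup>2 = exp (w\<^sup>2 / 4) * ((of_real (sqrt pi) * erf (w / 2)) / w)\<^sup>2"
    by (simp add: power_mult_distrib power_divide flip: of_real_power)
  also have "\<dots> = exp (w\<^sup>2 / 4) * (exp (- (w\<^sup>2 / 4)) * hyp1F1_one (w\<^sup>2 / 4))\<^sup>2" unfolding erf_half using w by simp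
  also have "\<dots> = exp (- (w\<^sup>2 / 4)) * (hyp1F1_one (w\<^sup>2 / 4))\<^sup>2"
  proof -
    have "exp (w\<^sup>2 / 4) * exp (- (w\<^sup>2 / 4)) = 1" by (simp flip: exp_add)
    then show ?thesis by (simp add: power2_eq_square mult.assoc mult.left_commute)
  qed
  finally show "of_real pi / w\<^sup>2 * exp (w\<^sup>2 / 4) * (erf (w / 2))\<^sup>2 = exp (- (w\<^sup>2 / 4)) * (hyp1F1_one (w\<^sup>2 / 4))\<^sup>2" .
next
  have "isCont (\<lambda>w. exp (- (w\<^sup>2 / 4)) * (hyp1F1_one (w\<^sup>2 / 4))\<^sup>2) 0"
    by (intro continuous_intros isCont_hyp1F1_one_sq) auto
  then show "((\<lambda>w. exp (- (w\<^sup>2 / 4)) * (hyp1F1_one (w\<^sup>2 / 4))\<^sup>2) \<longlongrightarrow> exp (- (0\<^sup>2 / 4)) * (hyp1F1_one (0\<^sup>2 / 4))\<^sup>2) (at 0)"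
    by (simp add: isCont_def)
qed

lemma CC_iw: "CC (\<i> * w) = mix w (\<lambda>r. 1)"
  by (simp add: CC_eq mix_1 sq_iw)

lemma CC_mix: "CC w = mix w (\<lambda>r. of_real (1 / r))"
  unfolding CC_eq mix_inverse ..

text \<open>Presents the closed form of \<open>BB\<close> as an average, so that its continuity at
  \<open>w = 0\<close> follows from \<open>mix_tendsto_0\<close>.\<close>

lemma BB_aux: "mix (\<i> * w) (\<lambda>r. of_real (ln r) - of_real (ln 2)) = exp (- (w\<^sup>2 / 4)) * hyp1F1_one (w\<^sup>2 / 4) * hyp1F1_harm (w\<^sup>2 / 4)"
proof -
  have "mix (\<i> * w) (\<lambda>r. of_real (ln r) - of_real (ln 2)) = mix (\<i> * w) (\<lambda>r. of_real (ln r) + (- of_real (ln 2)) * 1)" by simp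
  also have "\<dots> = mix (\<i> * w) (\<lambda>r. of_real (ln r)) + (- of_real (ln 2)) * mix (\<i> * w) (\<lambda>r. 1)"
    by (subst mix_add) (intro admissible_ln admissible_cmult admissible_const, intro admissible_cmult admissible_const, simp only: mix_cmult)
  finally show ?thesis using mix_ln[of "\<i> * w"] by (simp add: sq_iw)
qed

lemma BB_eq: "BB w = exp (- (w\<^sup>2 / 4)) * hyp1F1_one (w\<^sup>2 / 4) * hyp1F1_harm (w\<^sup>2 / 4)"
  unfolding BB_def
proof (rule limit_at_0_eqI)
  fix w :: complex assume w: "w \<noteq> 0"
  have "(\<Sum>n. (w\<^sup>2 / 4) ^ n / pochhammer (3/2) n * (Digamma (of_nat (n + 1)) + euler_mascheroni)) = hyp1F1_harm (w\<^sup>2 / 4)"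
    unfolding hyp1F1_harm_def
  proof (rule suminf_cong)
    fix n
    have "Digamma (of_nat (n + 1) :: complex) = harm n - euler_mascheroni" using Digamma_of_nat[of n, where 'a = complex] by simp
    then show "(w\<^sup>2 / 4) ^ n / pochhammer (3/2) n * (Digamma (of_nat (n + 1)) + euler_mascheroni) = (w\<^sup>2 / 4) ^ n / pochhammer (3/2) n * harm n"
      by (simp only:) simp
  qed
  moreover have "of_real (sqrt pi) / w * erf (w / 2) = (of_real (sqrt pi) * erf (w / 2)) / w" by simp
  moreover have "\<dots> = exp (- (w\<^sup>2 / 4)) * hyp1F1_one (w\<^sup>2 / 4)" unfolding erf_half using w by simp
  ultimately show "of_real (sqrt pi) / w * erf (w / 2) * (\<Sum>n. (w\<^sup>2 / 4) ^ n / pochhammer (3/2) n * (Digamma (of_nat (n + 1)) + euler_mascheroni))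
     = exp (- (w\<^sup>2 / 4)) * hyp1F1_one (w\<^sup>2 / 4) * hyp1F1_harm (w\<^sup>2 / 4)" by (simp only:)
next
  let ?f = "\<lambda>r. of_real (ln r) - of_real (ln 2) :: complex"
  have ad: "admissible ?f"
    using admissible_add[OF admissible_ln admissible_const[of "- of_real (ln 2)"]] by simp
  have "filterlim (\<lambda>w. \<i> * w) (at 0) (at 0)"
    unfolding filterlim_at
  proof
    show "\<forall>\<^sub>F w in at 0. \<i> * w \<in> UNIV \<and> \<i> * w \<noteq> 0" by (simp add: eventually_at_filter)
    show "((\<lambda>w. \<i> * w) \<longlongrightarrow> 0) (at 0)" by (auto intro!: tendsto_eq_intros)
  qed
  from filterlim_compose[OF mix_tendsto_0[OF ad] this]
  have "((\<lambda>w. mix (\<i> * w) ?f) \<longlongrightarrow> mix (\<i> * 0) ?f) (at 0)" by simp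
  then show "((\<lambda>w. exp (- (w\<^sup>2 / 4)) * hyp1F1_one (w\<^sup>2 / 4) * hyp1F1_harm (w\<^sup>2 / 4)) \<longlongrightarrow> exp (- (0\<^sup>2 / 4)) * hyp1F1_one (0\<^sup>2 / 4) * hyp1F1_harm (0\<^sup>2 / 4)) (at 0)"
    unfolding BB_aux .
qed

lemma BB_iw: "BB (\<i> * w) = mix w (\<lambda>r. of_real (ln r)) - of_real (ln 2) * mix w (\<lambda>r. 1)"
  by (simp add: BB_eq mix_ln sq_iw)

lemma BB_mix: "BB w = - mix w (\<lambda>r. of_real (ln r / r)) - of_real (ln 2) * CC w"
  unfolding BB_eq mix_ln_over CC_mix by simp

section \<open>The series of \<open>lam\<close>\<close>

text \<open>The terms subtracted in \<open>lam\<close> are the averages of the elementary part of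
  \<open>bessel_psi\<close>: \<open>CC (\<i> * w)\<close> belongs to the logarithm of
  \<open>x\<close>, \<open>BB (\<i> * w)\<close> to the constant and \<open>CC w\<close> to the
  reciprocal. Only the remainder survives.\<close>

lemma lam_eq:
  assumes x: "x > 0" shows "lam w x = - mix w (\<lambda>r. of_real (bessel_rest (x * r)))"
  unfolding lam_def psi_gen_expansion[OF x] CC_iw BB_iw CC_mix[of w] by (simp add: algebra_simps)

text \<open>The part of \<open>koshliakov\<close> that is left when its elementary terms are set
  apart.\<close>

definition phi_corr :: "real \<Rightarrow> real" where "phi_corr y = phi_conv (2 * ln y) / sqrt y"

lemma phi_conv_measurable [measurable]: "phi_conv \<in> borel_measurable borel"
  using continuous_phi_conv by (rule borel_measurable_continuous_onI)

lemma admissible_phi_corr: "admissible (\<lambda>r. of_real (phi_corr r))"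
proof (rule admissibleI[where K = "(LBINT r. \<bar>phi r\<bar>) / 2"])
  fix r :: real assume r: "r > 0"
  have "\<bar>phi_corr r\<bar> = \<bar>phi_conv (2 * ln r)\<bar> * r powr (- 1 / 2)"
    using r powr_minus_divide[of r "1/2"] by (simp add: phi_corr_def powr_half_sqrt)
  also have "\<dots> \<le> (LBINT r. \<bar>phi r\<bar>) / 2 * growth r"
    using phi_conv_bounds(2)[of "2 * ln r"] powr_le_growth[OF r, of "- 1 / 2"]
    by (intro mult_mono) (auto intro: order_trans[OF abs_ge_zero])
  finally show "norm (complex_of_real (phi_corr r)) \<le> (LBINT r. \<bar>phi r\<bar>) / 2 * growth r" by simp
qed (unfold phi_corr_def, measurable)

text \<open>The sum of \<open>lam\<close> is minus the average of \<open>koshliakov (a * r)\<close>,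
  whose elementary terms are multiples of \<open>1 / r\<close> and \<open>ln r / r\<close>. Their
  averages are expressed by \<open>CC\<close> and \<open>BB\<close> and cancel against the two terms
  in front of the series.\<close>

theorem lam_sums:
  assumes a: "a > 0"
  shows "summable (\<lambda>m. lam w (real (Suc m) * a))"
    and "of_real ((euler_mascheroni - ln (2 * pi * a)) / (2 * a)) * CC w + 1 / (2 * of_real a) * BB w + (\<Sum>m. lam w (real (Suc m) * a))
      = - mix w (\<lambda>r. of_real (phi_corr (a * r)))"
proof -
  let ?k = "\<lambda>r. of_real (phi_corr (a * r)) + (of_real ((theta_const - ln a / 2) / a) * of_real (1 / r) + of_real (- 1 / (2 * a)) * of_real (ln r / r)) :: complex"
  have A: "admissible (\<lambda>r. of_real (phi_corr (a * r)))" by (rule admissible_scale[OF admissible_phi_corr a])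
  have B: "admissible (\<lambda>r. of_real ((theta_const - ln a / 2) / a) * of_real (1 / r))" by (intro admissible_cmult admissible_inverse)
  have C: "admissible (\<lambda>r. of_real (- 1 / (2 * a)) * of_real (ln r / r))" by (intro admissible_cmult admissible_ln_over)
  have kk: "complex_of_real (koshliakov (a * r)) = ?k r" if "r > 0" for r
  proof -
    have "koshliakov (a * r) = phi_corr (a * r) + ((theta_const - ln a / 2) / a * (1 / r) + (- 1 / (2 * a)) * (ln r / r))"
    proof -
      have 1: "koshliakov (a * r) = phi_corr (a * r) + (theta_const - ln (a * r) / 2) / (a * r)"
        by (simp add: koshliakov_def phi_corr_def)
      have "ln (a * r) = ln a + ln r" using a that by (simp add: ln_mult)
      then have "(theta_const - ln (a * r) / 2) / (a * r) = (theta_const - ln a / 2) / a * (1 / r) + (- 1 / (2 * a)) * (ln r / r)"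
        using a that by (simp add: field_simps)
      then show ?thesis using 1 by simp
    qed
    then show ?thesis by (simp only: of_real_add of_real_mult)
  qed
  have adk: "admissible ?k" by (intro admissible_add A B C)
  have km[measurable]: "koshliakov \<in> borel_measurable borel" unfolding koshliakov_def[abs_def] by measurable
  have ad: "admissible (\<lambda>r. of_real (koshliakov (a * r)))"
  proof -
    obtain K where "K \<ge> 0" "\<And>r. r > 0 \<Longrightarrow> norm (?k r) \<le> K * growth r" using admissible_bound[OF adk] by blast
    moreover have "(\<lambda>r. complex_of_real (koshliakov (a * r))) \<in> borel_measurable borel" using km by measurable
    ultimately show ?thesis by (intro admissibleI[where K = K]) (simp_all only: kk)
  qed
  have "(\<lambda>m. mix w (\<lambda>r. of_real (bessel_rest (real (Suc m) * a * r)))) sums mix w (\<lambda>r. of_real (koshliakov (a * r)))"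
  proof (rule mix_sums[OF _ ad])
    show "0 \<le> bessel_rest (real (Suc m) * a * r)" if "r > 0" for m r
      using that a by (intro bessel_rest_bounds) (auto intro!: mult_pos_pos)
    show "(\<lambda>m. bessel_rest (real (Suc m) * a * r)) sums koshliakov (a * r)" if "r > 0" for r
      using koshliakov_sums[of "a * r"] that a by (simp add: mult.assoc)
  qed measurable
  from sums_minus[OF this] have S: "(\<lambda>m. lam w (real (Suc m) * a)) sums - mix w (\<lambda>r. of_real (koshliakov (a * r)))"
    using a by (simp add: lam_eq mult_pos_pos)
  show "summable (\<lambda>m. lam w (real (Suc m) * a))" using S by (rule sums_summable)
  have "mix w (\<lambda>r. of_real (koshliakov (a * r))) = mix w ?k" by (rule mix_cong) (rule kk)
  also have "\<dots> = mix w (\<lambda>r. of_real (phi_corr (a * r))) + (of_real ((theta_const - ln a / 2) / a) * CC w + of_real (- 1 / (2 * a)) * mix w (\<lambda>r. of_real (ln r / r)))"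
    unfolding mix_add[OF A admissible_add[OF B C]] mix_add[OF B C] mix_cmult CC_mix ..
  also have "mix w (\<lambda>r. of_real (ln r / r)) = - BB w - of_real (ln 2) * CC w"
    unfolding BB_mix by simp
  finally have M: "mix w (\<lambda>r. of_real (koshliakov (a * r))) = mix w (\<lambda>r. of_real (phi_corr (a * r))) + (of_real ((theta_const - ln a / 2) / a) * CC w + of_real (- 1 / (2 * a)) * (- BB w - of_real (ln 2) * CC w))" .
  \<comment> \<open>\<open>theta_const\<close> contains the logarithm of \<open>4 * pi\<close>; the
    \<open>ln 2\<close> that turns it into that of \<open>2 * pi\<close> comes from
    \<open>BB_mix\<close>.\<close>
  have "ln (2 * pi * a) = ln 2 + ln pi + ln a" "ln (4 * pi) = 2 * ln 2 + ln pi"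
    using a ln_realpow[of 2 2] by (simp_all add: ln_mult)
  then have c: "(euler_mascheroni - ln (2 * pi * a)) / (2 * a) = (theta_const - ln a / 2) / a + ln 2 / (2 * a)"
    using a by (simp add: theta_const_def field_simps)
  have "(\<Sum>m. lam w (real (Suc m) * a)) = - mix w (\<lambda>r. of_real (koshliakov (a * r)))" using S by (rule sums_unique[symmetric])
  then show "of_real ((euler_mascheroni - ln (2 * pi * a)) / (2 * a)) * CC w + 1 / (2 * of_real a) * BB w + (\<Sum>m. lam w (real (Suc m) * a))
      = - mix w (\<lambda>r. of_real (phi_corr (a * r)))"
    unfolding M c using a by (simp add: algebra_simps)
qed

subsection \<open>The Riemann zeta function through the theta function\<close>

text \<open>Riemann's splitting: the Mellin integral of \<open>om\<close> over \<open>x > 1\<close>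
  only, which converges for every \<open>s\<close>.\<close>

definition theta_laplace :: "complex \<Rightarrow> complex" where
  "theta_laplace s = (LBINT q:{0<..}. of_real (om (exp q)) * exp (s * of_real q / 2))"

lemma integrable_om_exp:
  "integrable lborel (\<lambda>q. indicator {0<..} q * (om (exp q) * exp (a * q)))"
proof -
  have i: "integrable lborel (\<lambda>q::real. 2 * exp ((\<bar>a\<bar> + 1) * q - exp q))"
    using Gamma_integral_exp_real[of "\<bar>a\<bar> + 1"] by (intro integrable_mult_right) (simp add: has_bochner_integral_iff)
  show ?thesis
  proof (rule Bochner_Integration.integrable_bound[OF i], measurable, intro AE_I2)
    fix q :: real
    show "norm (indicator {0<..} q * (om (exp q) * exp (a * q))) \<le> norm (2 * exp ((\<bar>a\<bar> + 1) * q - exp q))"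
    proof (cases "q > 0")
      case True
      have "om (exp q) \<le> 2 * exp (- (pi * exp q))" using True by (intro om_le_exp) simp
      moreover have "exp q \<le> pi * exp q" using pi_gt3 mult_right_mono[of 1 pi "exp q"] by simp
      ultimately have 1: "om (exp q) \<le> 2 * exp (- exp q)" by (smt (verit) exp_le_cancel_iff)
      have "a * q \<le> (\<bar>a\<bar> + 1) * q" using True by (intro mult_right_mono) auto
      then have 2: "exp (a * q) \<le> exp ((\<bar>a\<bar> + 1) * q)" by simp
      have "om (exp q) * exp (a * q) \<le> (2 * exp (- exp q)) * exp ((\<bar>a\<bar> + 1) * q)"
        by (rule mult_mono[OF 1 2]) auto
      also have "\<dots> = 2 * exp ((\<bar>a\<bar> + 1) * q - exp q)" by (simp add: exp_diff exp_minus field_simps)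
      finally show ?thesis using True om_nonneg[of "exp q"] by simp
    qed simp
  qed
qed

lemma theta_laplace_integrable:
  "set_integrable lborel {0<..} (\<lambda>q. complex_of_real (om (exp q)) * exp (s * of_real q / 2))"
  unfolding set_integrable_def
proof (rule Bochner_Integration.integrable_bound[OF integrable_om_exp[of "Re s / 2"]])
  show "AE q in lborel. norm (indicator {0<..} q *\<^sub>R (of_real (om (exp q)) * exp (s * of_real q / 2)))
      \<le> norm (indicator {0<..} q * (om (exp q) * exp (Re s / 2 * q)))"
    by (intro AE_I2) (auto simp: norm_mult split: split_indicator)
qed measurable

lemma exp_partial_sum_le:
  fixes x :: real assumes "x \<ge> 0" shows "(\<Sum>k<n. x ^ k / fact k) \<le> exp x"
proof -
  have "(\<lambda>k. x ^ k / fact k) sums exp x" using exp_converges[of x] by (simp add: divide_inverse mult.commute)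
  then show ?thesis using assms sum_le_suminf[of "\<lambda>k. x ^ k / fact k" "{..<n}"] by (simp add: sums_iff)
qed

text \<open>Termwise integration of the exponential series gives a power series in \<open>s\<close>
  that converges everywhere; the integrand at the modulus of \<open>s\<close> dominates the sums of
  absolute values.\<close>

lemma holomorphic_theta_laplace: "theta_laplace holomorphic_on A"
proof -
  define m where "m n = (LBINT q. indicator {0<..} q *\<^sub>R (complex_of_real (om (exp q)) * ((of_real q / 2) ^ n / fact n)))" for n
  have S: "(\<lambda>n. m n * s ^ n) sums theta_laplace s" for s
  proof -
    define f where "f n q = indicator {0<..} q *\<^sub>R (complex_of_real (om (exp q)) * ((s * of_real q / 2) ^ n / fact n))" for n q
    define G where "G q = indicator {0<..} q * (om (exp q) * exp (norm s / 2 * q))" for q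
    have G: "integrable lborel G" unfolding G_def by (rule integrable_om_exp)
    have [measurable]: "f n \<in> borel_measurable borel" for n unfolding f_def by measurable
    have nf: "norm (f n q) = indicator {0<..} q * (om (exp q) * ((norm s / 2 * q) ^ n / fact n))" for n q
      by (auto simp: f_def norm_mult norm_divide norm_power om_nonneg power_mult_distrib field_simps split: split_indicator)
    have ps: "(\<Sum>k<n. norm (f k q)) \<le> G q" for n q
    proof (cases "q > 0")
      case True
      have "(\<Sum>k<n. norm (f k q)) = om (exp q) * (\<Sum>k<n. (norm s / 2 * q) ^ k / fact k)"
        unfolding nf sum_distrib_left using True by simp
      also have "\<dots> \<le> om (exp q) * exp (norm s / 2 * q)"
        using True by (intro mult_left_mono exp_partial_sum_le om_nonneg) auto
      finally show ?thesis using True by (simp add: G_def)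
    qed (simp add: nf G_def)
    have i: "integrable lborel (f n)" for n
    proof (rule Bochner_Integration.integrable_bound[OF G])
      have "norm (f n q) \<le> G q" for q
        using ps[where n = "Suc n" and q = q] sum_nonneg[of "{..<n}" "\<lambda>k. norm (f k q)"] by simp
      then show "AE q in lborel. norm (f n q) \<le> norm (G q)" by (intro AE_I2) (metis norm_ge_zero abs_of_nonneg order_trans real_norm_def)
    qed measurable
    have "(\<lambda>n. integral\<^sup>L lborel (f n)) sums (LBINT q. (\<Sum>n. f n q))"
    proof (rule sums_integral[OF i])
      show "AE q in lborel. summable (\<lambda>n. norm (f n q))"
        by (intro AE_I2 summableI_nonneg_bounded[where x = "G _"]) (use ps in auto)
      show "summable (\<lambda>n. LBINT q. norm (f n q))"
      proof (rule summableI_nonneg_bounded[where x = "integral\<^sup>L lborel G"])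
        show "0 \<le> (LBINT q. norm (f n q))" for n by simp
        have "(\<Sum>k<n. (LBINT q. norm (f k q))) = (LBINT q. (\<Sum>k<n. norm (f k q)))" for n
          by (rule Bochner_Integration.integral_sum[symmetric]) (intro integrable_norm i)
        also have "(LBINT q. (\<Sum>k<n. norm (f k q))) \<le> integral\<^sup>L lborel G" for n
          by (intro integral_mono Bochner_Integration.integrable_sum integrable_norm i G ps)
        finally show "(\<Sum>k<n. (LBINT q. norm (f k q))) \<le> integral\<^sup>L lborel G" for n .
      qed
    qed
    moreover have "integral\<^sup>L lborel (f n) = m n * s ^ n" for n
    proof -
      have "f n = (\<lambda>q. indicator {0<..} q *\<^sub>R (complex_of_real (om (exp q)) * ((of_real q / 2) ^ n / fact n)) * s ^ n)"
        by (simp add: f_def power_mult_distrib power_divide fun_eq_iff)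
      then show ?thesis unfolding m_def by (simp only: integral_mult_left_zero)
    qed
    moreover have "(\<Sum>n. f n q) = indicator {0<..} q *\<^sub>R (complex_of_real (om (exp q)) * exp (s * of_real q / 2))" for q
    proof -
      have "x ^ n /\<^sub>R fact n = x ^ n / fact n" for x :: complex and n
        by (simp add: scaleR_conv_of_real divide_inverse mult.commute)
      then have "(\<lambda>n. (s * of_real q / 2) ^ n / fact n) sums exp (s * of_real q / 2)"
        using exp_converges[of "s * of_real q / 2"] by (simp only:)
      then have "(\<lambda>n. f n q) sums (indicator {0<..} q *\<^sub>R (complex_of_real (om (exp q)) * exp (s * of_real q / 2)))"
        unfolding f_def by (intro sums_scaleR_right sums_mult)
      then show ?thesis by (rule sums_unique[symmetric])
    qed
    ultimately show ?thesis unfolding theta_laplace_def set_lebesgue_integral_def by simp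
  qed
  have "theta_laplace = (\<lambda>s. \<Sum>n. m n * s ^ n)" using S by (simp add: sums_iff fun_eq_iff)
  moreover have "((\<lambda>s. \<Sum>n. m n * s ^ n) has_field_derivative (\<Sum>n. diffs m n * s ^ n)) (at s)" for s
    by (rule termdiffs_strong_converges_everywhere) (use S in \<open>simp add: sums_iff\<close>)
  ultimately show ?thesis
    unfolding holomorphic_on_def by (metis field_differentiable_def field_differentiable_at_within)
qed

lemma exponential_integral:
  assumes a: "Re a > 0"
  shows "set_integrable lborel {0<..} (\<lambda>q. exp (- (a * of_real q)))"
    and "(LBINT q:{0<..}. exp (- (a * of_real q))) = 1 / a"
proof -
  have a0: "a \<noteq> 0" using a by auto
  have "set_integrable lborel {0<..} (\<lambda>q::real. exp (- (q * Re a)))"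
    by (rule integrable_I0i_exp_mscale[OF a])
  then show i: "set_integrable lborel {0<..} (\<lambda>q. exp (- (a * of_real q)))"
    unfolding set_integrable_def
    by (rule Bochner_Integration.integrable_bound) (auto intro!: AE_I2 simp: mult.commute split: split_indicator)
  have ei: "einterval 0 \<infinity> = {0<..}" by (auto simp: einterval_def)
  have "(LBINT q=0..\<infinity>. exp (- (a * of_real q))) = 0 - (- 1 / a)"
  proof (rule interval_integral_FTC_integrable[where F = "\<lambda>q. - exp (- (a * of_real q)) / a"])
    show "((\<lambda>q. - exp (- (a * of_real q)) / a) has_vector_derivative exp (- (a * of_real x))) (at x)" for x :: real
    proof -
      have "((\<lambda>z. - exp (- (a * z)) / a) has_field_derivative exp (- (a * of_real x))) (at (of_real x))"
        using a0 by (auto intro!: derivative_eq_intros)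
      then show ?thesis by (rule has_vector_derivative_real_field)
    qed
    show "(((\<lambda>q. - exp (- (a * of_real q)) / a) \<circ> real_of_ereal) \<longlongrightarrow> - 1 / a) (at_right 0)"
      unfolding zero_ereal_def ereal_tendsto_simps using a0 by (intro tendsto_eq_intros) auto
    show "(((\<lambda>q. - exp (- (a * of_real q)) / a) \<circ> real_of_ereal) \<longlongrightarrow> 0) (at_left \<infinity>)"
      unfolding ereal_tendsto_simps
    proof (rule tendsto_norm_zero_cancel)
      have "((\<lambda>q. exp (- (Re a * q)) / norm a) \<longlongrightarrow> 0) at_top" using a a0 by real_asymp
      then show "((\<lambda>q. norm (- exp (- (a * of_real q)) / a)) \<longlongrightarrow> 0) at_top" by (simp add: norm_divide)
    qed
  qed (use i in \<open>auto simp: ei\<close>)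
  then show "(LBINT q:{0<..}. exp (- (a * of_real q))) = 1 / a"
    by (simp add: interval_lebesgue_integral_0_infty)
qed

lemma om_exp_minus: "om (exp (- q)) = exp (q / 2) * om (exp q) + exp (q / 2) / 2 - 1 / 2"
proof -
  have "1 + 2 * om (1 / exp q) = sqrt (exp q) * (1 + 2 * om (exp q))" by (rule om_functional_equation) simp
  moreover have "1 / exp q = exp (- q)" by (simp add: exp_minus divide_inverse)
  moreover have "sqrt (exp q) = exp (q / 2)" by (rule real_sqrt_unique) (simp_all flip: exp_double)
  ultimately show ?thesis by (simp add: algebra_simps)
qed

lemma integral_split_at_zero:
  fixes f :: "real \<Rightarrow> complex"
  assumes [measurable]: "f \<in> borel_measurable borel"
    and p: "set_integrable lborel {0<..} f" and n: "set_integrable lborel {0<..} (\<lambda>q. f (- q))"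
  shows "integrable lborel f" "integral\<^sup>L lborel f = (LBINT q:{0<..}. f q) + (LBINT q:{0<..}. f (- q))"
proof -
  have n': "integrable lborel (\<lambda>q. indicator {0<..} (0 + (-1) * q) *\<^sub>R f (- (0 + (-1) * q)))"
    using n unfolding set_integrable_def by (intro lborel_integrable_real_affine) auto
  have "(LBINT q:{0<..}. f (- q)) = (LBINT q. indicator {0<..} (0 + (-1) * q) *\<^sub>R f (- (0 + (-1) * q)))"
    unfolding set_lebesgue_integral_def by (subst lborel_integral_real_affine[of "-1" _ 0]) auto
  then have e: "(LBINT q:{0<..}. f (- q)) = (LBINT q. indicator {..<0} q *\<^sub>R f q)"
    by (simp add: indicator_def)
  have n'': "integrable lborel (\<lambda>q. indicator {..<0} q *\<^sub>R f q)" using n' by (simp add: indicator_def)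
  have ae: "AE q in lborel. indicator {0<..} q *\<^sub>R f q + indicator {..<0} q *\<^sub>R f q = f q"
    using AE_lborel_singleton[of 0] by eventually_elim (auto split: split_indicator)
  have s: "integrable lborel (\<lambda>q. indicator {0<..} q *\<^sub>R f q + indicator {..<0} q *\<^sub>R f q)"
    using p n'' unfolding set_integrable_def by (rule Bochner_Integration.integrable_add)
  show "integrable lborel f" using s by (rule integrable_cong_AE_imp) (use ae in auto)
  have "integral\<^sup>L lborel f = (LBINT q. indicator {0<..} q *\<^sub>R f q + indicator {..<0} q *\<^sub>R f q)"
    by (rule integral_cong_AE) (use ae in auto)
  also have "\<dots> = (LBINT q:{0<..}. f q) + (LBINT q:{0<..}. f (- q))"
    unfolding e unfolding set_lebesgue_integral_def using p n'' unfolding set_integrable_def by (rule Bochner_Integration.integral_add)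
  finally show "integral\<^sup>L lborel f = (LBINT q:{0<..}. f q) + (LBINT q:{0<..}. f (- q))" .
qed

text \<open>The half-line of negative \<open>q\<close> is reflected and the functional equation
  applied: it yields the integral at \<open>1 - s\<close>, and two exponentials whose integrals are
  the pole terms.\<close>

lemma mellin_om:
  assumes s: "Re s > 1"
  shows "integrable lborel (\<lambda>q. complex_of_real (om (exp q)) * exp (s * of_real q / 2))"
    and "(LBINT q. of_real (om (exp q)) * exp (s * of_real q / 2)) = theta_laplace s + theta_laplace (1 - s) - 1 / s - 1 / (1 - s)"
proof -
  let ?f = "\<lambda>q. complex_of_real (om (exp q)) * exp (s * of_real q / 2)"
  let ?a = "\<lambda>q. complex_of_real (om (exp q)) * exp ((1 - s) * of_real q / 2)"
  let ?b = "\<lambda>q::real. 1 / 2 * exp (- ((s - 1) / 2 * of_real q)) - 1 / 2 * exp (- (s / 2 * of_real q))"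
  have e: "?f (- q) = ?a q + ?b q" for q
  proof -
    have "complex_of_real (om (exp (- q))) = exp (of_real q / 2) * of_real (om (exp q)) + exp (of_real q / 2) / 2 - 1 / 2"
      unfolding om_exp_minus by (simp flip: exp_of_real)
    moreover have "exp ((1 - s) * of_real q / 2) = exp (of_real q / 2) * exp (- (s / 2 * of_real q))"
      by (simp add: algebra_simps diff_divide_distrib flip: exp_add)
    moreover have "exp (- ((s - 1) / 2 * of_real q)) = exp (of_real q / 2) * exp (- (s / 2 * of_real q))"
      by (simp add: algebra_simps diff_divide_distrib flip: exp_add)
    moreover have "exp (s * of_real (- q) / 2) = exp (- (s / 2 * of_real q))" by simp
    ultimately show ?thesis by (simp only:) (simp add: algebra_simps)
  qed
  have b1: "set_integrable lborel {0<..} (\<lambda>q. 1 / 2 * exp (- ((s - 1) / 2 * of_real q)))"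
    and b2: "set_integrable lborel {0<..} (\<lambda>q. 1 / 2 * exp (- (s / 2 * of_real q)))"
    using s by (intro set_integrable_mult_right exponential_integral(1); simp)+
  have b: "set_integrable lborel {0<..} ?b" by (rule set_integral_diff(1)[OF b1 b2])
  have "(LBINT q:{0<..}. ?b q) = (LBINT q:{0<..}. 1 / 2 * exp (- ((s - 1) / 2 * of_real q))) - (LBINT q:{0<..}. 1 / 2 * exp (- (s / 2 * of_real q)))"
    by (rule set_integral_diff(2)[OF b1 b2])
  also have "\<dots> = 1 / (s - 1) - 1 / s"
  proof -
    have r: "Re ((s - 1) / 2) > 0" "Re (s / 2) > 0" using s by auto
    have "1 / 2 * (1 / (x / 2)) = 1 / x" for x :: complex by simp
    then show ?thesis unfolding set_integral_mult_right exponential_integral(2)[OF r(1)] exponential_integral(2)[OF r(2)] by (simp only:)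
  qed
  finally have bi: "(LBINT q:{0<..}. ?b q) = - 1 / s - 1 / (1 - s)"
    using minus_divide_right[of 1 "1 - s"] by simp
  have n: "set_integrable lborel {0<..} (\<lambda>q. ?f (- q))"
    unfolding e by (rule set_integral_add(1)[OF theta_laplace_integrable b])
  have ni: "(LBINT q:{0<..}. ?f (- q)) = theta_laplace (1 - s) + (- 1 / s - 1 / (1 - s))"
    unfolding e set_integral_add(2)[OF theta_laplace_integrable b] bi theta_laplace_def ..
  have m: "?f \<in> borel_measurable borel" by measurable
  show "integrable lborel ?f" by (rule integral_split_at_zero(1)[OF m theta_laplace_integrable n])
  show "integral\<^sup>L lborel ?f = theta_laplace s + theta_laplace (1 - s) - 1 / s - 1 / (1 - s)"
    unfolding integral_split_at_zero(2)[OF m theta_laplace_integrable n] ni theta_laplace_def by simp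
qed

text \<open>Each Gaussian of the theta series integrates to the Gamma factor times one Dirichlet
  term. The same evaluation at the real point \<open>Re s\<close> gives the integrals of the
  absolute values, whose summability permits the exchange.\<close>

lemma completed_zeta_series:
  assumes s: "Re s > 1"
  shows "(\<lambda>n. Gamma (s / 2) * (of_real pi powr (- s / 2) * (1 / of_nat (Suc n) powr s))) sums
    (theta_laplace s + theta_laplace (1 - s) - 1 / s - 1 / (1 - s))"
proof -
  define c where "c n = ln (pi * (real (Suc n))\<^sup>2)" for n
  have ec: "exp (c n) = pi * (real (Suc n))\<^sup>2" for n by (simp add: c_def)
  define f where "f n q = complex_of_real (exp (- (pi * (real (Suc n))\<^sup>2 * exp q))) * exp (s * of_real q / 2)" for n q
  have g: "has_bochner_integral lborel (\<lambda>q. complex_of_real (exp (- (pi * (real (Suc n))\<^sup>2 * exp q))) * exp (z * of_real q / 2))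
      (Gamma (z / 2) * exp (- (z / 2 * of_real (c n))))" if "Re z > 1" for n z
  proof -
    have "has_bochner_integral lborel (\<lambda>q. exp (z / 2 * of_real (c n + 1 * q)) * of_real (exp (- exp (c n + 1 * q)))) (Gamma (z / 2) /\<^sub>R \<bar>1\<bar>)"
      by (rule has_bochner_integral_lborel_affine[OF Gamma_integral_exp]) (use that in auto)
    then have "has_bochner_integral lborel (\<lambda>q. exp (- (z / 2 * of_real (c n))) * (exp (z / 2 * of_real (c n + 1 * q)) * of_real (exp (- exp (c n + 1 * q))))) (exp (- (z / 2 * of_real (c n))) * Gamma (z / 2))"
      by (intro has_bochner_integral_mult_right) simp
    moreover have "exp (- (z / 2 * of_real (c n))) * (exp (z / 2 * of_real (c n + 1 * q)) * of_real (exp (- exp (c n + 1 * q))))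
        = complex_of_real (exp (- (pi * (real (Suc n))\<^sup>2 * exp q))) * exp (z * of_real q / 2)" for q
    proof -
      have "exp (z / 2 * of_real (c n + 1 * q)) = exp (z / 2 * of_real (c n)) * exp (z * of_real q / 2)"
        by (simp add: ring_distribs flip: exp_add)
      moreover have "exp (- (z / 2 * of_real (c n))) * exp (z / 2 * of_real (c n)) = 1" by (simp flip: exp_add)
      moreover have "exp (c n + 1 * q) = pi * (real (Suc n))\<^sup>2 * exp q" by (simp only: exp_add ec mult_1)
      ultimately show ?thesis by (simp only: mult.assoc[symmetric]) simp
    qed
    ultimately show ?thesis by (simp only: mult.commute[of _ "Gamma (z / 2)"])
  qed
  have pw: "exp (- (z / 2 * of_real (c n))) = of_real pi powr (- z / 2) * (1 / of_nat (Suc n) powr z)" for n and z :: complex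
  proof -
    have n: "(of_nat (Suc n) :: complex) \<noteq> 0" by (simp del: of_nat_Suc)
    have L: "Ln (of_nat (Suc n) :: complex) = of_real (ln (real (Suc n)))"
      using Ln_of_real[of "real (Suc n)"] by simp
    have "c n = ln pi + 2 * ln (real (Suc n))"
      unfolding c_def by (simp add: ln_mult ln_realpow del: of_nat_Suc)
    then have "- (z / 2 * of_real (c n)) = - z / 2 * of_real (ln pi) - z * of_real (ln (real (Suc n)))"
      by (simp add: algebra_simps)
    then have 1: "exp (- (z / 2 * of_real (c n))) = exp (- z / 2 * of_real (ln pi)) * (1 / exp (z * of_real (ln (real (Suc n)))))"
      by (simp only: exp_diff) simp
    have 2: "Ln (complex_of_real pi) = of_real (ln pi)" by (rule Ln_of_real) simp
    have 3: "complex_of_real pi powr (- z / 2) = exp (- z / 2 * of_real (ln pi))" by (simp add: powr_def 2)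
    have 4: "of_nat (Suc n) powr z = exp (z * of_real (ln (real (Suc n))))" unfolding powr_def L using n by (simp only: if_False)
    show ?thesis unfolding 1 3 4 ..
  qed
  have i: "integrable lborel (f n)" for n using g[OF s, of n] unfolding f_def[abs_def] by (simp only: has_bochner_integral_iff)
  have nf: "norm (f n q) = exp (- (pi * (real (Suc n))\<^sup>2 * exp q)) * exp (Re s / 2 * q)" for n q
    by (simp add: f_def norm_mult)
  have sum: "(\<lambda>n. f n q) sums (of_real (om (exp q)) * exp (s * of_real q / 2))" for q
    unfolding f_def by (intro sums_mult2 sums_of_real om_sums) simp
  have "(\<lambda>n. integral\<^sup>L lborel (f n)) sums (LBINT q. (\<Sum>n. f n q))"
  proof (rule sums_integral[OF i])
    show "AE q in lborel. summable (\<lambda>n. norm (f n q))"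
      unfolding nf by (intro AE_I2 summable_mult2 sums_summable[OF om_sums]) simp
    have "(LBINT q. norm (f n q)) = norm (of_real pi powr (- of_real (Re s) / 2) * Gamma (of_real (Re s) / 2) :: complex) * (1 / real (Suc n) powr Re s)" for n
    proof -
      have "complex_of_real (LBINT q. norm (f n q)) = (LBINT q. complex_of_real (norm (f n q)))"
        by (rule integral_complex_of_real[symmetric])
      also have "\<dots> = Gamma (of_real (Re s) / 2) * exp (- (of_real (Re s) / 2 * of_real (c n)))"
      proof -
        have "complex_of_real (norm (f n q)) = complex_of_real (exp (- (pi * (real (Suc n))\<^sup>2 * exp q))) * exp (of_real (Re s) * of_real q / 2)" for q
          unfolding nf by (simp flip: exp_of_real)
        then show ?thesis using g[of "of_real (Re s)" n] s by (simp only: Re_complex_of_real has_bochner_integral_integral_eq)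
      qed
      also have "\<dots> = (of_real pi powr (- of_real (Re s) / 2) * Gamma (of_real (Re s) / 2)) * (1 / of_nat (Suc n) powr of_real (Re s))"
        unfolding pw by (simp only: mult_ac)
      finally have "norm (complex_of_real (LBINT q. norm (f n q))) = norm (of_real pi powr (- of_real (Re s) / 2) * Gamma (of_real (Re s) / 2) :: complex) * norm (1 / of_nat (Suc n) powr of_real (Re s) :: complex)"
        by (simp only: norm_mult)
      moreover have "norm (1 / of_nat (Suc n) powr of_real (Re s) :: complex) = 1 / real (Suc n) powr Re s"
        using norm_powr_real_powr[of "of_nat (Suc n)" "of_real (Re s)"] by (simp add: norm_divide del: of_nat_Suc)
      moreover have "0 \<le> (LBINT q. norm (f n q))" by simp
      ultimately show ?thesis by simp
    qed
    moreover have "summable (\<lambda>n. 1 / real (Suc n) powr Re s)"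
      using s summable_Suc_iff[of "\<lambda>n. 1 / real n powr Re s"] summable_real_powr_iff[of "- Re s"] by (simp add: powr_minus divide_inverse)
    ultimately show "summable (\<lambda>n. LBINT q. norm (f n q))" by (simp only: summable_mult)
  qed
  moreover have "integral\<^sup>L lborel (f n) = Gamma (s / 2) * (of_real pi powr (- s / 2) * (1 / of_nat (Suc n) powr s))" for n
    using g[OF s, of n] unfolding f_def[abs_def] pw by (rule has_bochner_integral_integral_eq)
  ultimately show ?thesis unfolding sums_unique[OF sum, symmetric] mellin_om(2)[OF s] by (simp only:)
qed

text \<open>The sum of the completed series is explicit and meaningful away from 0 and 1. Dividing
  by the Gamma factor, through the entire function \<open>rGamma\<close>, leaves 1 as the only
  singular point.\<close>

lemma zeta_continuation:
  obtains f where "f holomorphic_on - {1}" "\<And>s. Re s > 1 \<Longrightarrow> (\<lambda>n. 1 / of_nat (Suc n) powr s) sums f s" "f 1 = 0"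
    "\<And>s. s \<noteq> 1 \<Longrightarrow> s / 2 \<notin> \<int>\<^sub>\<le>\<^sub>0 \<Longrightarrow> of_real pi powr (- s / 2) * Gamma (s / 2) * f s = theta_laplace s + theta_laplace (1 - s) - 1 / s - 1 / (1 - s)"
proof
  \<comment> \<open>\<open>rGamma (s / 2) / s\<close> is written as \<open>rGamma (s / 2 + 1) / 2\<close>, which is regular at \<open>s = 0\<close>.\<close>
  define h where "h s = of_real pi powr (s / 2) * (rGamma (s / 2) * (theta_laplace s + theta_laplace (1 - s) - 1 / (1 - s)) - rGamma (s / 2 + 1) / 2)" for s
  define f where "f s = (if s = 1 then 0 else h s)" for s
  have "(theta_laplace \<circ> (\<lambda>s. 1 - s)) holomorphic_on - {1}"
    by (intro holomorphic_on_compose holomorphic_theta_laplace holomorphic_intros)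
  then have 1: "(\<lambda>s. theta_laplace (1 - s)) holomorphic_on - {1}" by (simp add: o_def)
  have 2: "(\<lambda>s. of_real pi powr (s / 2)) holomorphic_on - {1}"
  proof -
    have "(\<lambda>s. complex_of_real pi powr (s / 2)) = (\<lambda>s. exp (s / 2 * Ln (of_real pi)))" by (simp add: powr_def fun_eq_iff)
    then show ?thesis by (simp only:) (intro holomorphic_intros; simp)
  qed
  have "h holomorphic_on - {1}" unfolding h_def
    by (intro holomorphic_intros 1 2 holomorphic_theta_laplace) auto
  then show "f holomorphic_on - {1}" by (rule holomorphic_transform) (simp add: f_def)
  show "f 1 = 0" by (simp add: f_def)
  show eq: "of_real pi powr (- s / 2) * Gamma (s / 2) * f s = theta_laplace s + theta_laplace (1 - s) - 1 / s - 1 / (1 - s)"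
    if s: "s \<noteq> 1" "s / 2 \<notin> \<int>\<^sub>\<le>\<^sub>0" for s
  proof -
    have s0: "s \<noteq> 0" using s by auto
    have a: "of_real pi powr (- s / 2) * of_real pi powr (s / 2) = (1 :: complex)" by (simp flip: powr_add)
    have b: "Gamma (s / 2) * rGamma (s / 2) = 1" using s Gamma_eq_zero_iff[of "s / 2"] by (simp add: rGamma_inverse_Gamma)
    have c: "rGamma (s / 2 + 1) / 2 = rGamma (s / 2) * (1 / s)" using rGamma_plus1[of "s / 2"] s0 by (simp add: field_simps)
    have "of_real pi powr (- s / 2) * Gamma (s / 2) * f s = (of_real pi powr (- s / 2) * of_real pi powr (s / 2)) *
        ((Gamma (s / 2) * rGamma (s / 2)) * (theta_laplace s + theta_laplace (1 - s) - 1 / (1 - s) - 1 / s))"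
      unfolding f_def h_def c using s by (simp add: algebra_simps)
    then show ?thesis unfolding a b by simp
  qed
  show "(\<lambda>n. 1 / of_nat (Suc n) powr s) sums f s" if s: "Re s > 1" for s
  proof -
    have s1: "s \<noteq> 1" and s2: "s / 2 \<notin> \<int>\<^sub>\<le>\<^sub>0" using s by (auto elim!: nonpos_Ints_cases simp: complex_eq_iff)
    define K where "K = of_real pi powr (- s / 2) * Gamma (s / 2)"
    have K: "K \<noteq> 0" unfolding K_def using s2 Gamma_eq_zero_iff[of "s / 2"] by simp
    have "(\<lambda>n. K * (1 / of_nat (Suc n) powr s)) sums (K * f s)"
      using completed_zeta_series[OF s] unfolding eq[OF s1 s2, symmetric] K_def by (simp only: mult_ac)
    then show ?thesis using sums_mult_iff[OF K] by blast
  qed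
qed

text \<open>The definite description is justified by the identity theorem: the half-plane of
  convergence is open and nonempty in the connected punctured plane, and the value at 1 is
  prescribed.\<close>

lemma zeta_properties:
  "zeta holomorphic_on - {1}" (is ?A)
  "s \<noteq> 1 \<Longrightarrow> s / 2 \<notin> \<int>\<^sub>\<le>\<^sub>0 \<Longrightarrow> of_real pi powr (- s / 2) * Gamma (s / 2) * zeta s = theta_laplace s + theta_laplace (1 - s) - 1 / s - 1 / (1 - s)" (is "PROP ?B")
proof -
  obtain f where f: "f holomorphic_on - {1}" "\<And>s. Re s > 1 \<Longrightarrow> (\<lambda>n. 1 / of_nat (Suc n) powr s) sums f s" "f 1 = 0"
    "\<And>s. s \<noteq> 1 \<Longrightarrow> s / 2 \<notin> \<int>\<^sub>\<le>\<^sub>0 \<Longrightarrow> of_real pi powr (- s / 2) * Gamma (s / 2) * f s = theta_laplace s + theta_laplace (1 - s) - 1 / s - 1 / (1 - s)"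
    by (rule zeta_continuation) (rule that)
  have "zeta = f" unfolding zeta_def
  proof (rule the_equality)
    show "f holomorphic_on - {1} \<and> (\<forall>s. 1 < Re s \<longrightarrow> (\<lambda>n. 1 / of_nat (Suc n) powr s) sums f s) \<and> f 1 = 0" using f by simp
  next
    fix g assume g: "g holomorphic_on - {1} \<and> (\<forall>s. 1 < Re s \<longrightarrow> (\<lambda>n. 1 / of_nat (Suc n) powr s) sums g s) \<and> g 1 = 0"
    have "g z = f z" if "z \<noteq> 1" for z
    proof (rule analytic_continuation_open[where s = "{s. Re s > 1}" and s' = "- {1}" and f = g and g = f])
      show "open {s. Re s > 1}" by (rule open_halfspace_Re_gt)
      have "(2 :: complex) \<in> {s. Re s > 1}" by simp
      then show "{s. Re s > 1} \<noteq> {}" by blast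
      show "connected (- {1 :: complex})" by (rule connected_punctured_universe) simp
      show "g z = f z" if "z \<in> {s. Re s > 1}" for z using that g f(2) sums_unique2 by blast
    qed (use that g f(1) in auto)
    then show "g = f" using g f(3) by (metis ext)
  qed
  then show ?A "PROP ?B" using f by auto
qed

section \<open>The critical line\<close>

lemma half_notin_nonpos_Ints: "Re s > 0 \<Longrightarrow> s / 2 \<notin> \<int>\<^sub>\<le>\<^sub>0"
  by (auto elim!: nonpos_Ints_cases simp: complex_eq_iff)

text \<open>For \<open>s = 1/2 + 2 * \<i> * k\<close> the factor \<open>exp (s * q / 2)\<close> is
  \<open>exp (q / 4)\<close> times the Fourier kernel, and the subtracted term of \<open>phi\<close>
  integrates to a pole term. The positive half-line gives the part at \<open>s\<close>; the negative
  one, reflected by evenness, that at \<open>1 - s\<close>.\<close>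

lemma theta_laplace_critical:
  fixes k :: real
  defines "s \<equiv> 1 / 2 + 2 * \<i> * of_real k"
  shows "theta_laplace s + theta_laplace (1 - s) - 1 / s - 1 / (1 - s) = of_real (phi_hat k)"
proof -
  let ?g = "\<lambda>q. complex_of_real (phi q) * iexp (k * q)"
  have e: "complex_of_real (phi q) * iexp (j * q) = complex_of_real (om (exp q)) * exp (z * of_real q / 2) - 1 / 2 * exp (- ((1 - z) / 2 * of_real q))"
    if z: "z = 1 / 2 + 2 * \<i> * of_real j" for j q z
  proof -
    have "complex_of_real (phi q) = of_real (om (exp q)) * exp (of_real q / 4) - exp (- of_real q / 4) / 2"
      unfolding phi_def by (simp add: mult.commute flip: exp_of_real)
    moreover have "exp (z * of_real q / 2) = exp (of_real q / 4) * iexp (j * q)"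
      unfolding z by (simp add: algebra_simps add_divide_distrib flip: exp_add)
    moreover have "exp (- ((1 - z) / 2 * of_real q)) = exp (- of_real q / 4) * iexp (j * q)"
      unfolding z by (simp add: algebra_simps add_divide_distrib diff_divide_distrib flip: exp_add)
    ultimately show ?thesis by (simp only:) (simp add: algebra_simps)
  qed
  have main: "set_integrable lborel {0<..} (\<lambda>q. complex_of_real (phi q) * iexp (j * q))"
      "(LBINT q:{0<..}. complex_of_real (phi q) * iexp (j * q)) = theta_laplace z - 1 / (1 - z)"
    if z: "z = 1 / 2 + 2 * \<i> * of_real j" for j z
  proof -
    have r: "Re ((1 - z) / 2) > 0" by (simp add: z)
    have b: "set_integrable lborel {0<..} (\<lambda>q. 1 / 2 * exp (- ((1 - z) / 2 * of_real q)))"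
      by (intro set_integrable_mult_right exponential_integral(1) r)
    show "set_integrable lborel {0<..} (\<lambda>q. complex_of_real (phi q) * iexp (j * q))"
      unfolding e[OF z] by (rule set_integral_diff(1)[OF theta_laplace_integrable b])
    have "(LBINT q:{0<..}. complex_of_real (phi q) * iexp (j * q)) = theta_laplace z - (LBINT q:{0<..}. 1 / 2 * exp (- ((1 - z) / 2 * of_real q)))"
      unfolding e[OF z] set_integral_diff(2)[OF theta_laplace_integrable b] theta_laplace_def ..
    also have "(LBINT q:{0<..}. 1 / 2 * exp (- ((1 - z) / 2 * of_real q))) = 1 / 2 * (1 / ((1 - z) / 2))"
      unfolding set_integral_mult_right exponential_integral(2)[OF r] ..
    finally show "(LBINT q:{0<..}. complex_of_real (phi q) * iexp (j * q)) = theta_laplace z - 1 / (1 - z)" by simp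
  qed
  have sk: "s = 1 / 2 + 2 * \<i> * of_real k" "1 - s = 1 / 2 + 2 * \<i> * of_real (- k)" by (simp_all add: s_def)
  have n: "?g (- q) = complex_of_real (phi q) * iexp ((- k) * q)" for q by (simp add: phi_even)
  have gm: "?g \<in> borel_measurable borel" by measurable
  have "of_real (phi_hat k) = integral\<^sup>L lborel ?g" by (rule phi_hat_eq[symmetric])
  also have "\<dots> = (LBINT q:{0<..}. ?g q) + (LBINT q:{0<..}. ?g (- q))"
    by (rule integral_split_at_zero(2)[OF gm main(1)[OF sk(1)]]) (unfold n, rule main(1)[OF sk(2)])
  also have "\<dots> = (theta_laplace s - 1 / (1 - s)) + (theta_laplace (1 - s) - 1 / (1 - (1 - s)))"
    unfolding n main(2)[OF sk(1)] main(2)[OF sk(2)] ..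
  finally show ?thesis by simp
qed

text \<open>Here \<open>s = 1/2 + \<i> * t / 2\<close> is different from 1 and has positive real
  part, so the product defining \<open>xi\<close> is analytic there and filling in singularities
  changes nothing. The polynomial factor \<open>s * (s - 1) / 2\<close> is
  \<open>- (1 + t^2) / 8\<close>.\<close>

lemma Xi_eq:
  fixes t :: real
  shows "Xi (of_real t / 2) = - of_real ((1 + t\<^sup>2) / 8 * phi_hat (t / 4))"
proof -
  define s where "s = 1 / 2 + \<i> * (of_real t / 2)"
  have s1: "s \<noteq> 1" by (simp add: s_def complex_eq_iff)
  have s0: "Re s > 0" by (simp add: s_def)
  have s2: "s / 2 \<notin> \<int>\<^sub>\<le>\<^sub>0" by (rule half_notin_nonpos_Ints[OF s0])
  let ?F = "\<lambda>s. 1/2 * s * (s - 1) * of_real pi powr (- s / 2) * Gamma (s / 2) * zeta s"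
  have an: "?F analytic_on {s}"
  proof -
    have U: "open ({z. Re z > 0} - {1})" by (intro open_Diff open_halfspace_Re_gt) auto
    have "(\<lambda>s. complex_of_real pi powr (- s / 2)) = (\<lambda>s. exp (- s / 2 * Ln (of_real pi)))" by (simp add: powr_def fun_eq_iff)
    then have p: "(\<lambda>s. complex_of_real pi powr (- s / 2)) holomorphic_on ({z. Re z > 0} - {1})"
      by (simp only:) (intro holomorphic_intros; simp)
    have "?F holomorphic_on ({z. Re z > 0} - {1})"
      by (intro holomorphic_intros p holomorphic_on_subset[OF zeta_properties(1)]) (auto dest: half_notin_nonpos_Ints)
    then have "?F analytic_on ({z. Re z > 0} - {1})" using U by (simp add: analytic_on_open)
    then show ?thesis by (rule analytic_on_subset) (use s0 s1 in auto)
  qed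
  have "Xi (of_real t / 2) = ?F s"
    unfolding Xi_def xi_def s_def[symmetric] by (rule remove_sings_at_analytic[OF an])
  also have "\<dots> = 1/2 * s * (s - 1) * (of_real pi powr (- s / 2) * Gamma (s / 2) * zeta s)" by (simp only: mult.assoc)
  also have "of_real pi powr (- s / 2) * Gamma (s / 2) * zeta s = of_real (phi_hat (t / 4))"
    unfolding zeta_properties(2)[OF s1 s2] using theta_laplace_critical[of "t / 4"] by (simp add: s_def)
  also have "1/2 * s * (s - 1) = - of_real ((1 + t\<^sup>2) / 8)"
    by (simp add: s_def complex_eq_iff power2_eq_square algebra_simps)
  finally show ?thesis by simp
qed

subsection \<open>The integral representation\<close>

text \<open>For positive \<open>c\<close> and \<open>r\<close> this is \<open>c\<close> to the power
  \<open>\<i> * t / 2\<close> times \<open>r\<close> to the power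
  \<open>(- 1 + \<i> * t) / 2\<close>. In this form the modulus is visibly independent of
  \<open>t\<close>.\<close>

definition osc :: "real \<Rightarrow> real \<Rightarrow> real \<Rightarrow> complex" where
  "osc c t r = exp (\<i> * of_real (t / 2 * ln (c * r))) * of_real (r powr (- 1 / 2))"

definition mixed :: "complex \<Rightarrow> real \<Rightarrow> real \<Rightarrow> complex" where
  "mixed w c t = of_real ((phi_hat (t / 4))\<^sup>2) * mix w (osc c t)"

lemma norm_osc: "norm (osc c t r) = r powr (- 1 / 2)"
  by (simp add: osc_def norm_mult)

lemma osc_measurable [measurable]: "(\<lambda>x. osc c (snd x) (fst (fst x) / snd (fst x))) \<in> borel_measurable ((lborel \<Otimes>\<^sub>M lborel) \<Otimes>\<^sub>M lborel)"
  unfolding osc_def by measurable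

lemma integrable_phi_hat_quarter: "integrable lborel (\<lambda>t. (phi_hat (t / 4))\<^sup>2)"
  using lborel_integrable_real_affine[OF integrable_phi_hat_square, of "1 / 4" 0] by simp

text \<open>Inversion after the substitution \<open>t = - 4 * k\<close>; evenness of
  \<open>phi_hat\<close> absorbs the sign.\<close>

lemma phi_conv_inversion_quarter:
  "(LBINT t. complex_of_real ((phi_hat (t / 4))\<^sup>2) * exp (\<i> * of_real (t / 2 * z))) = of_real (8 * pi * phi_conv (2 * z))"
proof -
  let ?f = "\<lambda>t. complex_of_real ((phi_hat (t / 4))\<^sup>2) * exp (\<i> * of_real (t / 2 * z))"
  have "?f (0 + (- 4) * k) = complex_of_real ((phi_hat k)\<^sup>2) * iexp (- (k * (2 * z)))" for k
    by (simp add: phi_hat_even mult_ac)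
  then have "(LBINT k. ?f (0 + (- 4) * k)) = of_real (2 * pi * phi_conv (2 * z))"
    by (simp only: phi_conv_inversion)
  moreover have "integral\<^sup>L lborel ?f = \<bar>- 4\<bar> *\<^sub>R (LBINT k. ?f (0 + (- 4) * k))"
    by (rule lborel_integral_real_affine) simp
  ultimately show ?thesis by (simp add: scaleR_conv_of_real)
qed

text \<open>Fubini between the pair \<open>(v, u)\<close> and \<open>t\<close>. Fourier inversion
  evaluates the integral over \<open>t\<close> for each pair, and \<open>sqrt c\<close> compensates
  for the square root of \<open>c * r\<close> in \<open>phi_corr\<close>.\<close>

lemma mixed_integral:
  assumes c: "c > 0"
  shows "integrable lborel (mixed w c)"
    and "integral\<^sup>L lborel (mixed w c) = of_real (8 * pi * sqrt c) * mix w (\<lambda>r. of_real (phi_corr (c * r)))"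
proof -
  let ?L = "lborel \<Otimes>\<^sub>M lborel :: (real \<times> real) measure"
  interpret P: pair_sigma_finite ?L "lborel :: real measure"
    unfolding pair_sigma_finite_def by (metis lborel_prod lborel.sigma_finite_measure_axioms)
  define Q where "Q t = (phi_hat (t / 4))\<^sup>2" for t
  have Qi: "integrable lborel Q" unfolding Q_def by (rule integrable_phi_hat_quarter)
  then have [measurable]: "Q \<in> borel_measurable borel" by (simp add: borel_measurable_integrable)
  define h where "h p = mix_kernel w p * of_real ((fst p / snd p) powr (- 1 / 2))" for p
  have hi: "integrable ?L h" unfolding h_def by (intro integrable_mix admissible_of_real_powr) auto
  define F where "F p t = of_real (Q t) * (mix_kernel w p * osc c t (fst p / snd p))" for p t
  have Fm: "(\<lambda>(p, t). F p t) \<in> borel_measurable (?L \<Otimes>\<^sub>M lborel)"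
    unfolding F_def case_prod_unfold by measurable
  \<comment> \<open>The modulus of the oscillating factor does not depend on \<open>t\<close>, so
    the majorant is a product of integrable functions of the two variables.\<close>
  have nF: "norm (F p t) = norm (h p) * Q t" for p t
    by (simp add: F_def h_def norm_mult norm_osc Q_def norm_power)
  have FI: "integrable (?L \<Otimes>\<^sub>M lborel) (\<lambda>(p, t). F p t)"
  proof (rule P.Fubini_integrable[OF Fm])
    show "integrable ?L (\<lambda>p. LBINT t. norm ((\<lambda>(p, t). F p t) (p, t)))"
      unfolding prod.case nF integral_mult_right_zero by (intro integrable_mult_left integrable_norm hi)
    show "AE p in ?L. integrable lborel (\<lambda>t. (\<lambda>(p, t). F p t) (p, t))"
    proof (rule AE_I2)
      fix p
      have m: "(\<lambda>t. F p t) \<in> borel_measurable lborel" unfolding F_def osc_def by measurable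
      have i: "integrable lborel (\<lambda>t. norm (h p) * Q t)" using Qi by (rule integrable_mult_right)
      have "integrable lborel (\<lambda>t. F p t)"
        by (rule Bochner_Integration.integrable_bound[OF i m]) (auto simp: nF Q_def)
      then show "integrable lborel (\<lambda>t. (\<lambda>(p, t). F p t) (p, t))" by simp
    qed
  qed
  have mx: "mixed w c = (\<lambda>t. LINT p|?L. F p t)"
    by (rule ext) (simp only: mixed_def F_def mix_def Q_def integral_mult_right_zero)
  show "integrable lborel (mixed w c)" unfolding mx by (rule P.integrable_snd[OF FI])
  have inner: "(LBINT t. F p t) = mix_kernel w p * (of_real (8 * pi * sqrt c) * of_real (phi_corr (c * (fst p / snd p))))" for p
  proof (cases "fst p > 0 \<and> snd p > 0")
    case True
    define r where "r = fst p / snd p"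
    have r: "r > 0" using True by (simp add: r_def)
    have "(LBINT t. F p t) = (LBINT t. (mix_kernel w p * of_real (r powr (- 1 / 2))) * (complex_of_real ((phi_hat (t / 4))\<^sup>2) * exp (\<i> * of_real (t / 2 * ln (c * r)))))"
      unfolding F_def osc_def Q_def r_def by (simp only: mult_ac)
    also have "\<dots> = mix_kernel w p * of_real (r powr (- 1 / 2)) * of_real (8 * pi * phi_conv (2 * ln (c * r)))"
      unfolding integral_mult_right_zero phi_conv_inversion_quarter ..
    also have "r powr (- 1 / 2) = sqrt c / sqrt (c * r)"
      using c r powr_minus_divide[of r "1/2"] by (simp add: real_sqrt_mult powr_half_sqrt)
    finally show ?thesis unfolding r_def phi_corr_def by simp
  qed (simp add: F_def mix_kernel_eq_0)
  have "integral\<^sup>L lborel (mixed w c) = (LINT p|?L. (LBINT t. F p t))"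
    unfolding mx by (rule P.Fubini_integral[OF FI])
  also have "\<dots> = mix w (\<lambda>r. of_real (8 * pi * sqrt c) * of_real (phi_corr (c * r)))"
    unfolding inner mix_def ..
  also have "\<dots> = of_real (8 * pi * sqrt c) * mix w (\<lambda>r. of_real (phi_corr (c * r)))" by (rule mix_cmult)
  finally show "integral\<^sup>L lborel (mixed w c) = of_real (8 * pi * sqrt c) * mix w (\<lambda>r. of_real (phi_corr (c * r)))" .
qed

text \<open>A power of \<open>v / u\<close> splits into a moment in \<open>v\<close> with parameter
  \<open>a\<close> and one in \<open>u\<close> with parameter \<open>b\<close>. As
  \<open>b = 3/2 - a\<close> and the arguments are opposite, Kummer's transformation turns the
  second confluent value into \<open>exp (w^2 / 4)\<close> times the first, which explains the
  square.\<close>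

lemma mix_osc:
  fixes t :: real
  assumes c: "c > 0"
  defines "a \<equiv> (3 + \<i> * of_real t) / 4" and "b \<equiv> (3 - \<i> * of_real t) / 4"
  shows "of_real (sqrt pi) * mix w (osc c t) = of_real c powr (\<i> * of_real t / 2) *
    (Gamma a * Gamma b * exp (w\<^sup>2 / 4) * (hyp1F1 a (3/2) (- (w\<^sup>2) / 4))\<^sup>2)"
proof -
  define z where "z = (- 1 + \<i> * of_real t) / 2"
  have za: "2 * a - 2 = z" "2 * b - 2 = - 1 - z" by (simp_all add: z_def a_def b_def field_simps)
  have Re_pos: "Re a > 0" "Re b > 0" by (simp_all add: a_def b_def)
  have rz: "osc c t r = of_real c powr (\<i> * of_real t / 2) * of_real r powr z" if "r > 0" for r
  proof -
    have "osc c t r = exp (\<i> * of_real (t / 2 * (ln c + ln r))) * exp (of_real (- 1 / 2 * ln r))"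
    proof -
      have "complex_of_real (r powr (- 1 / 2)) = exp (of_real (- 1 / 2 * ln r))"
        unfolding exp_of_real using that by (simp add: powr_def)
      moreover have "ln (c * r) = ln c + ln r" using c that by (simp add: ln_mult)
      ultimately show ?thesis unfolding osc_def by (simp only:)
    qed
    also have "\<dots> = exp (\<i> * of_real t / 2 * of_real (ln c)) * exp (z * of_real (ln r))"
    proof -
      have "\<i> * of_real (t / 2 * (ln c + ln r)) + of_real (- 1 / 2 * ln r) = \<i> * of_real t / 2 * of_real (ln c) + z * of_real (ln r)"
        by (simp add: z_def field_simps)
      then show ?thesis by (simp only: exp_add[symmetric])
    qed
    finally show ?thesis using c that by (simp add: powr_def Ln_of_real)
  qed
  have f1: "admissible (\<lambda>r. complex_of_real r powr z)"
  proof (rule admissibleI[where K = 1])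
    show "norm (complex_of_real r powr z) \<le> 1 * growth r" if "r > 0" for r
      using that powr_le_growth[of r "- 1 / 2"] by (simp add: norm_powr_real_powr z_def)
  qed measurable
  have Z: "mix w (\<lambda>r. of_real r powr z) = 4 / of_real (sqrt pi) * (sinh_gauss (\<i> * w) (\<lambda>v. of_real v powr z) * sinh_gauss w (\<lambda>u. of_real u powr (- z) * of_real (1 / u)))"
    and I: "sinh_gauss w (\<lambda>u. of_real u powr (- z) * of_real (1 / u)) = sinh_gauss w (\<lambda>u. of_real u powr (- 1 - z))"
  proof -
    have e: "indicator {0<..} u *\<^sub>R (of_real (exp (- u\<^sup>2)) * sinhc w u * (of_real u powr (- z) * of_real (1 / u)))
        = indicator {0<..} u *\<^sub>R (of_real (exp (- u\<^sup>2)) * sinhc w u * of_real u powr (- 1 - z))" for u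
    proof (cases "u > 0")
      case True
      then have "complex_of_real u powr (- 1 - z) = of_real u powr (- z) * of_real (1 / u)"
      proof -
        have "- 1 - z = - z - 1" by simp
        then show ?thesis using True powr_diff[of "complex_of_real u" "- z" 1] by (simp only:) simp
      qed
      then show ?thesis by simp
    qed simp
    show "sinh_gauss w (\<lambda>u. of_real u powr (- z) * of_real (1 / u)) = sinh_gauss w (\<lambda>u. of_real u powr (- 1 - z))"
      unfolding sinh_gauss_def set_lebesgue_integral_def e ..
    have "sinh_gauss_integrable w (\<lambda>u. of_real u powr (- 1 - z))" using sinh_gauss_powr(1)[OF Re_pos(2)] unfolding za .
    then have i: "sinh_gauss_integrable w (\<lambda>u. of_real u powr (- z) * of_real (1 / u))"
      unfolding sinh_gauss_integrable_def set_integrable_def e .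
    show "mix w (\<lambda>r. of_real r powr z) = 4 / of_real (sqrt pi) * (sinh_gauss (\<i> * w) (\<lambda>v. of_real v powr z) * sinh_gauss w (\<lambda>u. of_real u powr (- z) * of_real (1 / u)))"
    proof (rule mix_product[OF f1 _ i])
      show "sinh_gauss_integrable (\<i> * w) (\<lambda>v. of_real v powr z)" using sinh_gauss_powr(1)[OF Re_pos(1)] unfolding za .
      fix v u :: real assume vu: "v > 0" "u > 0"
      then show "of_real (v / u) powr z = of_real v powr z * of_real u powr (- z)"
        by (simp add: powr_def Ln_of_real ln_div algebra_simps flip: exp_add of_real_divide)
    qed
  qed
  have G1: "sinh_gauss (\<i> * w) (\<lambda>v. of_real v powr z) = Gamma a / 2 * hyp1F1 a (3/2) (- (w\<^sup>2) / 4)"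
    using sinh_gauss_powr(2)[OF Re_pos(1), of "\<i> * w"] unfolding za by (simp add: power_mult_distrib)
  have "b = 3 / 2 - a" by (simp add: a_def b_def field_simps)
  then have "hyp1F1 b (3/2) (w\<^sup>2 / 4) = exp (w\<^sup>2 / 4) * hyp1F1 a (3/2) (- (w\<^sup>2) / 4)"
    using kummer_transformation[of a "- (w\<^sup>2) / 4"] by simp
  then have G2: "sinh_gauss w (\<lambda>u. of_real u powr (- 1 - z)) = Gamma b / 2 * (exp (w\<^sup>2 / 4) * hyp1F1 a (3/2) (- (w\<^sup>2) / 4))"
    using sinh_gauss_powr(2)[OF Re_pos(2), of w] unfolding za by simp
  have "mix w (osc c t) = of_real c powr (\<i> * of_real t / 2) * mix w (\<lambda>r. of_real r powr z)"
    unfolding mix_cmult[symmetric] by (rule mix_cong) (rule rz)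
  then show ?thesis unfolding Z I G1 G2 by (simp add: power2_eq_square)
qed

text \<open>Passing to \<open>\<i> * w\<close> reverses the sign of the hypergeometric argument.
  Kummer's transformation restores it at the price of exchanging the two conjugate parameters, that
  is of replacing \<open>t\<close> by \<open>- t\<close>, and inverting \<alpha> does the same to
  the oscillating power.\<close>

lemma mixed_swap:
  assumes "\<alpha> > 0" "\<beta> > 0" "\<alpha> * \<beta> = 1"
  shows "mixed (\<i> * w) \<beta> t = mixed w \<alpha> (- t)"
proof -
  have b: "\<beta> = 1 / \<alpha>" using assms by (simp add: field_simps)
  have ln: "ln \<beta> = - ln \<alpha>" unfolding b using assms by (simp add: ln_div)
  have p: "complex_of_real \<beta> powr (\<i> * of_real t / 2) = of_real \<alpha> powr (\<i> * of_real (- t) / 2)"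
    using assms by (simp add: powr_def Ln_of_real ln)
  define a where "a = (3 + \<i> * of_real t) / 4"
  define a' where "a' = (3 - \<i> * of_real t) / 4"
  have aa: "a = 3 / 2 - a'" by (simp add: a_def a'_def field_simps)
  have "hyp1F1 a (3/2) (w\<^sup>2 / 4) = exp (w\<^sup>2 / 4) * hyp1F1 a' (3/2) (- (w\<^sup>2 / 4))"
    unfolding aa using kummer_transformation[of a' "- (w\<^sup>2 / 4)"] by simp
  then have k: "exp (- (w\<^sup>2 / 4)) * (hyp1F1 a (3/2) (w\<^sup>2 / 4))\<^sup>2 = exp (w\<^sup>2 / 4) * (hyp1F1 a' (3/2) (- (w\<^sup>2 / 4)))\<^sup>2"
    by (simp add: power2_eq_square exp_minus)
  have m1: "of_real (sqrt pi) * mix (\<i> * w) (osc \<beta> t) = of_real \<beta> powr (\<i> * of_real t / 2) *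
      (Gamma a * Gamma a' * (exp (- (w\<^sup>2 / 4)) * (hyp1F1 a (3/2) (w\<^sup>2 / 4))\<^sup>2))"
    using mix_osc[OF assms(2), of "\<i> * w" t] by (simp add: a_def a'_def power_mult_distrib)
  have m2: "of_real (sqrt pi) * mix w (osc \<alpha> (- t)) = of_real \<alpha> powr (\<i> * of_real (- t) / 2) *
      (Gamma a * Gamma a' * (exp (w\<^sup>2 / 4) * (hyp1F1 a' (3/2) (- (w\<^sup>2 / 4)))\<^sup>2))"
    using mix_osc[OF assms(1), of w "- t"] by (simp add: a_def a'_def mult_ac)
  have "of_real (sqrt pi) * mix (\<i> * w) (osc \<beta> t) = of_real (sqrt pi) * mix w (osc \<alpha> (- t))"
    unfolding m1 m2 k p ..
  then have "mix (\<i> * w) (osc \<beta> t) = mix w (osc \<alpha> (- t))" by simp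
  then show ?thesis by (simp add: mixed_def phi_hat_even)
qed

text \<open>With \<open>z = (- 1 + \<i> * t) / 4\<close> the recursion of Gamma gives
  \<open>Gamma a = z * Gamma z\<close>, and the square of the modulus of \<open>z\<close> is
  \<open>(1 + t^2) / 16\<close>. The square of the factor \<open>(1 + t^2) / 8\<close> in
  \<open>Xi_eq\<close>, divided by \<open>1 + t^2\<close>, leaves just this factor and 1/4.\<close>

lemma Gamma_Xi_weight:
  fixes t :: real
  defines "a \<equiv> (3 + \<i> * of_real t) / 4" and "b \<equiv> (3 - \<i> * of_real t) / 4"
  shows "of_real ((cmod (Gamma ((- 1 + \<i> * of_real t) / 4)))\<^sup>2) * ((Xi (of_real t / 2))\<^sup>2 / of_real (1 + t\<^sup>2))
    = Gamma a * Gamma b * of_real ((phi_hat (t / 4))\<^sup>2) / 4"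
proof -
  define z where "z = (- 1 + \<i> * of_real t) / 4"
  have "z \<notin> \<int>\<^sub>\<le>\<^sub>0"
  proof
    assume "z \<in> \<int>\<^sub>\<le>\<^sub>0"
    then obtain n where "z = of_int n" by (elim nonpos_Ints_cases)
    then have "Re z = of_int n" by simp
    then have "of_int (4 * n) = (of_int (- 1) :: real)" by (simp add: z_def)
    then have "4 * n = - 1" by (simp only: of_int_eq_iff)
    then show False by presburger
  qed
  then have "Gamma (z + 1) = z * Gamma z" by (rule Gamma_plus1)
  moreover have za: "z + 1 = a" by (simp add: z_def a_def field_simps)
  ultimately have "cmod (Gamma a) = cmod z * cmod (Gamma z)" by (simp add: norm_mult)
  moreover have "(cmod z)\<^sup>2 = (1 + t\<^sup>2) / 16"
    unfolding cmod_power2 by (simp add: z_def power2_eq_square field_simps)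
  ultimately have "(cmod (Gamma a))\<^sup>2 = (1 + t\<^sup>2) / 16 * (cmod (Gamma z))\<^sup>2" by (simp add: power_mult_distrib)
  moreover have "of_real ((cmod (Gamma a))\<^sup>2) = Gamma a * Gamma b"
  proof -
    have "b = cnj a" by (simp add: a_def b_def)
    then have "Gamma b = cnj (Gamma a)" by (simp add: cnj_Gamma)
    then show ?thesis by (simp only: complex_norm_square)
  qed
  ultimately have G: "Gamma a * Gamma b = of_real ((1 + t\<^sup>2) / 16 * (cmod (Gamma z))\<^sup>2)" by (simp only:)
  have t: "1 + t\<^sup>2 \<noteq> 0" using zero_le_power2[of t] by linarith
  have e: "n * (((1 + t\<^sup>2) / 8 * p)\<^sup>2 / (1 + t\<^sup>2)) = (1 + t\<^sup>2) / 16 * n * p\<^sup>2 / 4" for n p :: real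
    using t by (simp add: field_simps power2_eq_square)
  have c: "complex_of_real n * ((- complex_of_real x)\<^sup>2 / of_real y) = of_real (n * (x\<^sup>2 / y))" for n x y
    by simp
  have d: "complex_of_real x * of_real y / 4 = of_real (x * y / 4)" for x y by simp
  show ?thesis unfolding G Xi_eq z_def[symmetric] c d e ..
qed

text \<open>Infinite sums and integrals have default values when they do not converge; the
  summability and integrability clauses ensure that those in the identity are genuine.\<close>

theorem theorem1p3:
  fixes w :: complex and \<alpha> \<beta> :: real
  assumes "\<alpha> > 0" and "\<beta> > 0" and "\<alpha> * \<beta> = 1"
  defines "integrand \<equiv> (\<lambda>t::real.
     of_real ((cmod (Gamma ((- 1 + \<i> * of_real t) / 4)))\<^sup>2)
     * ((Xi (of_real t / 2))\<^sup>2 / of_real (1 + t\<^sup>2))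
     * (of_real \<alpha> powr (\<i> * of_real t / 2)
          * (hyp1F1 ((3 + \<i> * of_real t) / 4) (3/2) (- (w\<^sup>2) / 4))\<^sup>2
      + of_real \<alpha> powr (- (\<i> * of_real t / 2))
          * (hyp1F1 ((3 - \<i> * of_real t) / 4) (3/2) (- (w\<^sup>2) / 4))\<^sup>2))"
  shows "summable (\<lambda>m. lam w (real (Suc m) * \<alpha>)) \<and>
    summable (\<lambda>m. lam (\<i> * w) (real (Suc m) * \<beta>)) \<and>
    set_integrable lborel {0<..} integrand \<and>
    of_real (sqrt \<alpha>) *
      (of_real ((euler_mascheroni - ln (2 * pi * \<alpha>)) / (2 * \<alpha>)) * CC w
       + 1 / (2 * of_real \<alpha>) * BB w
       + (\<Sum>m. lam w (real (Suc m) * \<alpha>)))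
    = of_real (sqrt \<beta>) *
      (of_real ((euler_mascheroni - ln (2 * pi * \<beta>)) / (2 * \<beta>)) * CC (\<i> * w)
       + 1 / (2 * of_real \<beta>) * BB (\<i> * w)
       + (\<Sum>m. lam (\<i> * w) (real (Suc m) * \<beta>))) \<and>
    of_real (sqrt \<beta>) *
      (of_real ((euler_mascheroni - ln (2 * pi * \<beta>)) / (2 * \<beta>)) * CC (\<i> * w)
       + 1 / (2 * of_real \<beta>) * BB (\<i> * w)
       + (\<Sum>m. lam (\<i> * w) (real (Suc m) * \<beta>)))
    = - (exp (w\<^sup>2 / 4) / (2 * of_real pi powr (3/2))) * (LINT t:{0<..}|lborel. integrand t)"
proof -
  \<comment> \<open>The ratio between the integrand and \<open>mixed\<close>: 1/4 from
    \<open>Gamma_Xi_weight\<close>, the other two factors from \<open>mix_osc\<close>.\<close>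
  define E where "E = of_real (sqrt pi) * exp (- (w\<^sup>2 / 4)) / (4 :: complex)"
  have expE: "exp (w\<^sup>2 / 4) * exp (- (w\<^sup>2 / 4)) = 1" by (simp flip: exp_add)
  have piece: "of_real ((cmod (Gamma ((- 1 + \<i> * of_real t) / 4)))\<^sup>2) * ((Xi (of_real t / 2))\<^sup>2 / of_real (1 + t\<^sup>2))
      * (of_real \<alpha> powr (\<i> * of_real t / 2) * (hyp1F1 ((3 + \<i> * of_real t) / 4) (3/2) (- (w\<^sup>2) / 4))\<^sup>2) = E * mixed w \<alpha> t" for t :: real
  proof -
    define X where "X = of_real \<alpha> powr (\<i> * of_real t / 2) * (hyp1F1 ((3 + \<i> * of_real t) / 4) (3/2) (- (w\<^sup>2) / 4))\<^sup>2"
    define GG where "GG = Gamma ((3 + \<i> * of_real t) / 4) * Gamma ((3 - \<i> * of_real t) / 4)"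
    define Q where "Q = complex_of_real ((phi_hat (t / 4))\<^sup>2)"
    have m: "of_real (sqrt pi) * mix w (osc \<alpha> t) = exp (w\<^sup>2 / 4) * (GG * X)"
      unfolding mix_osc[OF assms(1)] X_def GG_def by (simp only: mult_ac)
    have "E * mixed w \<alpha> t = Q / 4 * exp (- (w\<^sup>2 / 4)) * (of_real (sqrt pi) * mix w (osc \<alpha> t))"
      unfolding E_def mixed_def Q_def by simp
    also have "\<dots> = (exp (w\<^sup>2 / 4) * exp (- (w\<^sup>2 / 4))) * (GG * Q / 4 * X)"
      unfolding m by (simp only: mult_ac times_divide_eq_left times_divide_eq_right)
    also have "\<dots> = GG * Q / 4 * X" unfolding expE by simp
    finally show ?thesis unfolding Gamma_Xi_weight X_def GG_def Q_def ..
  qed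
  have Xi_even: "(Xi (of_real (- t) / 2))\<^sup>2 = (Xi (of_real t / 2))\<^sup>2" for t :: real
    unfolding Xi_eq minus_divide_left[symmetric] phi_hat_even by simp
  have Gam: "cmod (Gamma ((- 1 + \<i> * of_real (- t)) / 4)) = cmod (Gamma ((- 1 + \<i> * of_real t) / 4))" for t :: real
  proof -
    have "(- 1 + \<i> * of_real (- t)) / 4 = cnj ((- 1 + \<i> * of_real t) / 4)" by simp
    then show ?thesis by (simp only: cnj_Gamma[symmetric] complex_mod_cnj)
  qed
  \<comment> \<open>The two summands are one function at \<open>t\<close> and at \<open>- t\<close>,
    since the Gamma and \<open>Xi\<close> weights are even; the integral over the half-line is
    therefore one over the whole line.\<close>
  have integrand: "integrand t = E * mixed w \<alpha> t + E * mixed w \<alpha> (- t)" for t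
    unfolding integrand_def piece[symmetric] Gam Xi_even by (simp add: ring_distribs)
  note J = mixed_integral[OF assms(1), of w]
  have p: "set_integrable lborel {0<..} (\<lambda>t. E * mixed w \<alpha> t)"
    unfolding set_integrable_def using J(1) by (intro integrable_mult_indicator integrable_mult_right) auto
  have Jn: "integrable lborel (\<lambda>t. mixed w \<alpha> (- t))"
    using lborel_integrable_real_affine[OF J(1), of "- 1" 0] by simp
  have n: "set_integrable lborel {0<..} (\<lambda>t. E * mixed w \<alpha> (- t))"
    unfolding set_integrable_def using Jn by (intro integrable_mult_indicator integrable_mult_right) auto
  have set_int: "set_integrable lborel {0<..} integrand"
    unfolding integrand[abs_def] by (rule set_integral_add(1)[OF p n])
  have Jm: "(\<lambda>t. E * mixed w \<alpha> t) \<in> borel_measurable borel"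
    using borel_measurable_integrable[OF J(1)] by simp
  have "(LBINT t:{0<..}. integrand t) = (LBINT t. E * mixed w \<alpha> t)"
    unfolding integrand set_integral_add(2)[OF p n] by (rule integral_split_at_zero(2)[OF Jm p n, symmetric])
  also have "\<dots> = E * integral\<^sup>L lborel (mixed w \<alpha>)" by simp
  finally have int: "(LBINT t:{0<..}. integrand t) = E * integral\<^sup>L lborel (mixed w \<alpha>)" .
  have pw: "complex_of_real pi powr (3 / 2) = of_real (pi * sqrt pi)"
  proof -
    have "complex_of_real pi powr (3 / 2) = complex_of_real pi powr of_real (3 / 2)" by simp
    also have "\<dots> = of_real (pi powr (3 / 2))" by (rule powr_of_real) auto
    also have "pi powr (3 / 2) = pi powr 1 * pi powr (1 / 2)" using powr_add[of pi 1 "1 / 2"] by simp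
    also have "\<dots> = pi * sqrt pi" by (simp add: powr_half_sqrt)
    finally show ?thesis .
  qed
  have "exp (w\<^sup>2 / 4) / (2 * of_real pi powr (3/2)) * (E * integral\<^sup>L lborel (mixed w \<alpha>))
      = (exp (w\<^sup>2 / 4) * exp (- (w\<^sup>2 / 4))) * integral\<^sup>L lborel (mixed w \<alpha>) / (8 * of_real pi)"
    unfolding pw E_def by (simp add: field_simps del: real_sqrt_eq_1_iff)
  then have rhs: "- (exp (w\<^sup>2 / 4) / (2 * of_real pi powr (3/2))) * (LBINT t:{0<..}. integrand t) = - (integral\<^sup>L lborel (mixed w \<alpha>) / (8 * of_real pi))"
    unfolding int expE by simp
  \<comment> \<open>Stated for arbitrary parameters so that it serves both
    \<open>(w, \<alpha>)\<close> and \<open>(\<i> * w, \<beta>)\<close>; the two integrals then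
    agree by reflecting \<open>t\<close>.\<close>
  have bracket: "of_real (sqrt c) * - mix v (\<lambda>r. of_real (phi_corr (c * r))) = - (integral\<^sup>L lborel (mixed v c) / (8 * of_real pi))" if "c > 0" for v c
    unfolding mixed_integral(2)[OF that] by simp
  have "integral\<^sup>L lborel (mixed (\<i> * w) \<beta>) = (LBINT t. mixed w \<alpha> (0 + (- 1) * t))"
  proof -
    have "mixed (\<i> * w) \<beta> = (\<lambda>t. mixed w \<alpha> (0 + (- 1) * t))"
      using mixed_swap[OF assms(1-3)] by (simp add: fun_eq_iff)
    then show ?thesis by (simp only:)
  qed
  also have "\<dots> = integral\<^sup>L lborel (mixed w \<alpha>)"
    using lborel_integral_real_affine[of "- 1" "mixed w \<alpha>" 0] by simp
  finally have swap: "integral\<^sup>L lborel (mixed (\<i> * w) \<beta>) = integral\<^sup>L lborel (mixed w \<alpha>)" .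
  show ?thesis
    unfolding lam_sums(2)[OF assms(1)] lam_sums(2)[OF assms(2)] bracket[OF assms(1)] bracket[OF assms(2)] swap rhs
    using lam_sums(1)[OF assms(1)] lam_sums(1)[OF assms(2)] set_int by blast
qed

end
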